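(* Let $\phi(s)=\sum_{n\ge1}a(n)\lambda_n^{-s}$ be a Dirichlet series belonging to the class $\mathcal A$ with parameter $r>0$ and dual series $\psi(s)=\sum_{n\ge1}b(n)\mu_n^{-s}$ (see context). Suppose that $b(n)=\overline{a(n)}$ and $\lambda_n=\mu_n$ for all $n$. Let $\sigma_a$ denote the abscissa of absolute convergence of $\phi$. If one of the following conditions holds: 1. $\sigma_a<\min\{1,r\}+\frac12\max\{1,r\}$ and, for some integer $k\ge0$, the diagonal Epstein zeta function $\mathcal Z_{2^{k+1}}(s;a;\lambda)$ associated with $\phi$ has infinitely many zeros on its critical line $\mathrm{Re}(s)=2^kr$; 2. $\sigma_a<\min\{1,r\}+\frac12\max\{1,r\}$ and, for some integer $k\ge0$, $$\mathcal Z_{2^{k+1}}(2^kr+it;a;\lambda)=o\left(|t|^{2^k-\frac12}\right),\qquad|t|\to\infty;$$ then $\phi(s)$ has infinitely many zeros on the critical line $\mathrm{Re}(s)=\frac r2$.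
   Context: Hecke pair with parameter $r>0$: $(\lambda_n)_{n\ge1}$, $(\mu_n)_{n\ge1}$ are sequences of positive numbers strictly increasing to $\infty$; $(a(n))_{n\ge1}$, $(b(n))_{n\ge1}$ are complex sequences, not identically zero; $\phi(s)=\sum_{n\ge1}a(n)\lambda_n^{-s}$ and $\psi(s)=\sum_{n\ge1}b(n)\mu_n^{-s}$ have finite abscissas of absolute convergence $\sigma_a$, $\sigma_b$; and there is a meromorphic function $\chi$ on $\mathbb C$ such that (1) $\chi(s)=\Gamma(s)\phi(s)$ for $\mathrm{Re}(s)>\sigma_a$ and $\chi(s)=\Gamma(r-s)\psi(r-s)$ for $\mathrm{Re}(s)<r-\sigma_b$; (2) $\lim_{|\mathrm{Im}(s)|\to\infty}\chi(s)=0$ uniformly in every strip $\sigma_1\le\mathrm{Re}(s)\le\sigma_2$; (3) the singularities of $\chi$ are at most poles and are confined to some compact set. Class $\mathcal A$: $\phi$ belongs to $\mathcal A$ (with parameter $r$ and dual series $\psi$) if $(\phi,\psi)$ is a Hecke pair with parameter $r$; $\phi$ and $\psi$ have analytic continuations to $\mathbb C$, analytic except for possible simple poles at $s=r$ with residues $\rho$ and $\rho^\star$ respectively; and the coefficients are extended to $n=0$ by $a(0):=-\phi(0)$, $b(0):=-\psi(0)$. Also $\lambda_0=\mu_0=0$. Dyadic diagonal Epstein zeta function: for an integer $N\ge1$ and $\mathrm{Re}(s)>N\sigma_a$, $$\mathcal Z_N(s;a;\lambda)=\sum_{\substack{n_1,\dots,n_N\ge0\\(n_1,\dots,n_N)\ne0}}\frac{a(n_1)\cdots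 a(n_N)}{(\lambda_{n_1}+\dots+\lambda_{n_N})^s}.$$ It has a meromorphic continuation to $\mathbb C$ with at most a simple pole at $s=Nr$; in the claim $\mathcal Z_{2^{k+1}}$ denotes the continuation with $N=2^{k+1}$. *)

theory Defs
  imports
    "HOL-Complex_Analysis.Complex_Analysis"
    "HOL-Library.Landau_Symbols"
begin

text \<open>
  Coefficient and exponent sequences are total functions on \<^typ>\<open>nat\<close>. The Dirichlet series only
  use the indices \<open>n \<ge> 1\<close>; the values at \<open>0\<close> are the extended coefficient \<open>a(0)\<close> and
  \<open>\<lambda>\<^sub>0 = 0\<close>.
\<close>

definition dirichlet_term :: "(nat \<Rightarrow> complex) \<Rightarrow> (nat \<Rightarrow> real) \<Rightarrow> complex \<Rightarrow> nat \<Rightarrow> complex" where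
  "dirichlet_term a l s n = a n * complex_of_real (l n) powr (- s)"

definition dirichlet_series :: "(nat \<Rightarrow> complex) \<Rightarrow> (nat \<Rightarrow> real) \<Rightarrow> complex \<Rightarrow> complex" where
  "dirichlet_series a l s = (\<Sum>n. dirichlet_term a l s (Suc n))"

definition abs_conv_abscissa :: "(nat \<Rightarrow> complex) \<Rightarrow> (nat \<Rightarrow> real) \<Rightarrow> ereal" where
  "abs_conv_abscissa a l =
     Inf {ereal \<sigma> |\<sigma>. summable (\<lambda>n. norm (dirichlet_term a l (complex_of_real \<sigma>) (Suc n)))}"

definition hecke_exponents :: "(nat \<Rightarrow> real) \<Rightarrow> bool" where
  "hecke_exponents l \<longleftrightarrow>
     (\<forall>n\<ge>1. 0 < l n) \<and> strict_mono_on {1..} l \<and> filterlim l at_top sequentially"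

text \<open>
  The function \<open>X\<close> is normalised by \<^const>\<open>nicely_meromorphic_on\<close>, that is, removable singularities
  are removed. As the library's \<^const>\<open>Gamma\<close> takes the value \<open>0\<close> at its poles, the identities for
  \<open>X\<close> are stated off these poles.
\<close>

definition hecke_pair ::
  "real \<Rightarrow> (nat \<Rightarrow> complex) \<Rightarrow> (nat \<Rightarrow> real) \<Rightarrow> (nat \<Rightarrow> complex) \<Rightarrow> (nat \<Rightarrow> real) \<Rightarrow> bool" where
  "hecke_pair r a l b m \<longleftrightarrow>
     r > 0 \<and>
     hecke_exponents l \<and> hecke_exponents m \<and>
     (\<exists>n\<ge>1. a n \<noteq> 0) \<and> (\<exists>n\<ge>1. b n \<noteq> 0) \<and>
     \<bar>abs_conv_abscissa a l\<bar> \<noteq> \<infinity> \<and> \<bar>abs_conv_abscissa b m\<bar> \<noteq> \<infinity> \<and>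
     (\<exists>X. X nicely_meromorphic_on UNIV \<and>
        (\<forall>s. ereal (Re s) > abs_conv_abscissa a l \<longrightarrow> s \<notin> \<int>\<^sub>\<le>\<^sub>0 \<longrightarrow>
           X s = Gamma s * dirichlet_series a l s) \<and>
        (\<forall>s. ereal (Re s) < ereal r - abs_conv_abscissa b m \<longrightarrow> of_real r - s \<notin> \<int>\<^sub>\<le>\<^sub>0 \<longrightarrow>
           X s = Gamma (of_real r - s) * dirichlet_series b m (of_real r - s)) \<and>
        (\<forall>\<sigma>\<^sub>1 \<sigma>\<^sub>2. uniform_limit {\<sigma>\<^sub>1..\<sigma>\<^sub>2} (\<lambda>t \<sigma>. X (Complex \<sigma> t)) (\<lambda>_. 0) at_infinity) \<and>
        (\<exists>K. compact K \<and> X analytic_on (- K)))"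

definition continuation_simple_pole ::
  "real \<Rightarrow> (nat \<Rightarrow> complex) \<Rightarrow> (nat \<Rightarrow> real) \<Rightarrow> (complex \<Rightarrow> complex) \<Rightarrow> bool" where
  "continuation_simple_pole r a l \<Phi> \<longleftrightarrow>
     \<Phi> nicely_meromorphic_on UNIV \<and>
     \<Phi> analytic_on (- {of_real r}) \<and>
     (is_pole \<Phi> (of_real r) \<longrightarrow> zorder \<Phi> (of_real r) = -1) \<and>
     (\<forall>s. ereal (Re s) > abs_conv_abscissa a l \<longrightarrow> \<Phi> s = dirichlet_series a l s)"

text \<open>
  Here \<open>\<Phi>\<close> and \<open>\<Psi>\<close> are the continuations to the whole plane of the Dirichlet series with
  coefficients \<open>a\<close> and \<open>b\<close>.
\<close>

definition class_A ::
  "real \<Rightarrow> (nat \<Rightarrow> complex) \<Rightarrow> (nat \<Rightarrow> real) \<Rightarrow> (nat \<Rightarrow> complex) \<Rightarrow> (nat \<Rightarrow> real) \<Rightarrow>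
   (complex \<Rightarrow> complex) \<Rightarrow> (complex \<Rightarrow> complex) \<Rightarrow> bool" where
  "class_A r a l b m \<Phi> \<Psi> \<longleftrightarrow>
     hecke_pair r a l b m \<and>
     continuation_simple_pole r a l \<Phi> \<and> continuation_simple_pole r b m \<Psi> \<and>
     a 0 = - \<Phi> 0 \<and> b 0 = - \<Psi> 0 \<and> l 0 = 0 \<and> m 0 = 0"

text \<open>The series is indexed by the \<open>N\<close>-tuples of naturals that are not identically zero.\<close>

definition epstein_series ::
  "nat \<Rightarrow> (nat \<Rightarrow> complex) \<Rightarrow> (nat \<Rightarrow> real) \<Rightarrow> complex \<Rightarrow> complex" where
  "epstein_series N a l s =
     (\<Sum>\<^sub>\<infinity>n \<in> {n \<in> {..<N} \<rightarrow>\<^sub>E UNIV. \<exists>i<N. n i \<noteq> 0}.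
        (\<Prod>i<N. a (n i)) / complex_of_real (\<Sum>i<N. l (n i)) powr s)"

text \<open>
  The meromorphic continuation of the series above. The description is unique by the identity
  theorem whenever the abscissa is not \<open>\<infinity>\<close>, because \<^const>\<open>nicely_meromorphic_on\<close> also fixes the
  values at poles and removable singularities.
\<close>

definition epstein_zeta ::
  "nat \<Rightarrow> (nat \<Rightarrow> complex) \<Rightarrow> (nat \<Rightarrow> real) \<Rightarrow> complex \<Rightarrow> complex" where
  "epstein_zeta N a l =
     (THE Z. Z nicely_meromorphic_on UNIV \<and>
        (\<forall>s. ereal (Re s) > ereal (real N) * abs_conv_abscissa a l \<longrightarrow> Z s = epstein_series N a l s))"

end

theory Submission
  imports Defs "HOL-Probability.Probability" "HOL-Real_Asymp.Real_Asymp"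
begin

text \<open>
  Put \<open>\<theta> u = (\<Sum>n. a n * exp (- l n * exp u))\<close>. The functional equation is equivalent to
  \<open>\<theta> (- u) = exp (r * u) * cnj (\<theta> u)\<close>, a relation inherited by powers of \<open>\<theta>\<close>; the Mellin transform of
  \<open>\<theta> ^ N\<close> is \<open>Gamma\<close> times the diagonal Epstein zeta function, and it is real on the critical line.
  Squaring \<open>\<theta>\<close> convolves critical values: up to an error of order
  \<open>t powr (2 ^ k * c - 1/2) * exp (- pi * t / 2)\<close>, with \<open>max sa r < c < r + 1/2\<close>, the
  critical value of the square at height \<open>t\<close> is the integral of the critical values at heights \<open>y\<close> and
  \<open>t - y\<close>.

  Suppose that \<open>\<Phi>\<close> has only finitely many zeros on \<open>Re s = r / 2\<close>. Then its real critical function has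
  constant sign for large heights, so the integral has no cancellation there and is at least
  of order \<open>t powr r * exp (- pi * t / 2)\<close>, by a mean value argument for \<open>\<Phi>\<close>. By the choice of \<open>c\<close>
  this dominates the error, hence the critical values of the square are eventually positive and the
  step can be iterated. After dividing by \<open>Gamma\<close> this gives the lower bound
  \<open>\<bar>t\<bar> powr (2 ^ k - 1/2)\<close> for the Epstein zeta function on its critical line, which excludes both
  the \<open>o\<close>-estimate and infinitely many zeros.
\<close>

section \<open>Vertical growth of the Gamma function\<close>

text \<open>The decay \<open>exp (- pi * t / 2)\<close> reproduces itself: exp(-pi y/2) exp(-pi (t -
  y)/2) does not depend on y, so for 0 < y < t convolution loses nothing exponentially. On the end
  ranges, where signs are unknown, only pointwise bounds coming from a line of absolute convergence
  help; they fix the error exponent and hence the condition on \<open>sa\<close>. Convolving two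
  functions of order t^E in this normalisation gives t^(2 E + 1), so E + 1 doubles: from E = r one
  reaches 2^k r + 2^k - 1, and division by Gamma, of exponent 2^k r - 1/2, leaves 2^k - 1/2. The
  first squaring is the difficult one: finitely many zeros yield a sign but no pointwise lower bound
  for \<Phi>, so a mean value of \<Phi> at heights y and t - y must be bounded below, by comparison
  with a line on which the leading term of the series dominates. Two further points: constant terms
  force the subtraction of main terms, whose cross terms give a correction in the convolution
  formula; and \<open>sa\<close> \<ge> 0, which the treatment of theta uses, is extracted from the
  functional equation.\<close>

lemma half_strip_bounded:
  fixes G :: "complex \<Rightarrow> complex" and a b C K M :: real
  assumes ana: "G analytic_on {s. a \<le> Re s \<and> Re s \<le> b \<and> 1 \<le> Im s}"
    and growth: "\<And>s. a \<le> Re s \<Longrightarrow> Re s \<le> b \<Longrightarrow> 1 \<le> Im s \<Longrightarrow> norm (G s) \<le> C * exp (K * Im s)"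
    and sides: "\<And>s. Re s = a \<or> Re s = b \<Longrightarrow> 1 \<le> Im s \<Longrightarrow> norm (G s) \<le> M"
  shows "\<exists>B. \<forall>s. a \<le> Re s \<longrightarrow> Re s \<le> b \<longrightarrow> 1 \<le> Im s \<longrightarrow> norm (G s) \<le> B"
proof -
  define L where "L = max \<bar>a\<bar> \<bar>b\<bar>"
  \<comment> \<open>The entry \<open>C * exp K\<close> bounds the bottom edge Im s = 1, where only
    \<open>growth\<close> is available; \<open>sides\<close> covers the vertical edges.\<close>
  define M0 where "M0 = max 1 (max M (C * exp K))"
  have M0: "M0 \<ge> 1" "M0 \<ge> M" "M0 \<ge> C * exp K" by (auto simp: M0_def)
  have norm_exp: "norm (exp (of_real \<epsilon> * s\<^sup>2)) = exp (\<epsilon> * ((Re s)\<^sup>2 - (Im s)\<^sup>2))" for \<epsilon> s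
    by (simp add: Re_power2)
  have Re_le: "(Re s)\<^sup>2 \<le> L\<^sup>2" if "a \<le> Re s" "Re s \<le> b" for s
    using that unfolding L_def by (intro power2_le_iff_abs_le[THEN iffD2]) auto
  \<comment> \<open>Phragmen-Lindelof argument: the damping exp(\<epsilon> s^2) has modulus
    exp(\<epsilon> (\<sigma>^2 - t^2)), which beats exp(K t) on the top edge of a tall rectangle and
    is at most exp(\<epsilon> L^2) elsewhere. The maximum modulus principle gives the bound inside,
    and \<epsilon> then tends to 0.\<close>
  have key: "norm (G s) * exp (\<epsilon> * ((Re s)\<^sup>2 - (Im s)\<^sup>2)) \<le> M0 * exp (\<epsilon> * L\<^sup>2)"
    if s: "a \<le> Re s" "Re s \<le> b" "1 \<le> Im s" and \<epsilon>: "\<epsilon> > 0" for s \<epsilon>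
  proof -
    have "eventually (\<lambda>T. C * exp (K * T - \<epsilon> * T\<^sup>2) \<le> 1) at_top"
    proof -
      have "((\<lambda>T. C * exp (K * T - \<epsilon> * T\<^sup>2)) \<longlongrightarrow> 0) at_top"
        using \<epsilon> by real_asymp
      from order_tendstoD(2)[OF this, of 1] show ?thesis
        by (auto elim: eventually_mono)
    qed
    then obtain T where T: "T > Im s" "C * exp (K * T - \<epsilon> * T\<^sup>2) \<le> 1"
      using eventually_conj[OF _ eventually_gt_at_top[of "Im s"]] eventually_happens'[of at_top]
      by (metis (mono_tags, lifting) eventually_elim2 eventually_gt_at_top trivial_limit_at_top_linorder eventually_happens)
    define S where "S = cbox (Complex a 1) (Complex b T)"
    have S: "S = {s. a \<le> Re s \<and> Re s \<le> b \<and> 1 \<le> Im s \<and> Im s \<le> T}"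
      by (auto simp: S_def in_cbox_complex_iff)
    have "(\<lambda>s. G s * exp (of_real \<epsilon> * s\<^sup>2)) analytic_on S"
      by (intro analytic_intros analytic_on_subset[OF ana]) (auto simp: S)
    then have hol: "(\<lambda>s. G s * exp (of_real \<epsilon> * s\<^sup>2)) holomorphic_on S"
      by (rule analytic_imp_holomorphic)
    have "norm (G s * exp (of_real \<epsilon> * s\<^sup>2)) \<le> M0 * exp (\<epsilon> * L\<^sup>2)"
    proof (rule maximum_modulus_frontier[where f = "\<lambda>s. G s * exp (of_real \<epsilon> * s\<^sup>2)" and S = S])
      show "(\<lambda>s. G s * exp (of_real \<epsilon> * s\<^sup>2)) holomorphic_on interior S"
        using hol interior_subset holomorphic_on_subset by blast
      show "continuous_on (closure S) (\<lambda>s. G s * exp (of_real \<epsilon> * s\<^sup>2))"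
        using holomorphic_on_imp_continuous_on[OF hol] by (simp add: S_def)
      show "bounded S" by (simp add: S_def)
      show "s \<in> S" using s T by (simp add: S)
      fix z assume "z \<in> frontier S"
      then have z: "z \<in> S" "Re z = a \<or> Re z = b \<or> Im z = 1 \<or> Im z = T"
        by (auto simp: S_def frontier_def in_cbox_complex_iff in_box_complex_iff)
      have zz: "a \<le> Re z" "Re z \<le> b" "1 \<le> Im z" using z by (auto simp: S)
      have R2: "(Re z)\<^sup>2 \<le> L\<^sup>2" using Re_le zz by auto
      show "norm (G z * exp (of_real \<epsilon> * z\<^sup>2)) \<le> M0 * exp (\<epsilon> * L\<^sup>2)"
      proof (cases "Im z = T")
        case True
        have "norm (G z * exp (of_real \<epsilon> * z\<^sup>2)) \<le> C * exp (K * T) * exp (\<epsilon> * ((Re z)\<^sup>2 - (Im z)\<^sup>2))"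
          unfolding norm_mult norm_exp using growth[OF zz] True by (intro mult_right_mono) auto
        also have "\<dots> = C * exp (K * T - \<epsilon> * T\<^sup>2) * exp (\<epsilon> * (Re z)\<^sup>2)"
          by (simp add: True algebra_simps exp_diff exp_minus exp_add)
        also have "\<dots> \<le> M0 * exp (\<epsilon> * L\<^sup>2)"
          using T R2 M0 \<epsilon> by (intro mult_mono) auto
        finally show ?thesis .
      next
        case False
        then have "norm (G z) \<le> M0"
          using z(2) sides[of z] growth[OF zz] M0 zz by fastforce
        moreover have "\<epsilon> * ((Re z)\<^sup>2 - (Im z)\<^sup>2) \<le> \<epsilon> * L\<^sup>2"
          using R2 \<epsilon> by (intro mult_left_mono) (auto intro: order_trans[of _ "(Re z)\<^sup>2"])
        ultimately show ?thesis
          unfolding norm_mult norm_exp using M0 by (intro mult_mono) auto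
      qed
    qed
    then show ?thesis by (simp only: norm_mult norm_exp)
  qed
  have "norm (G s) \<le> M0" if s: "a \<le> Re s" "Re s \<le> b" "1 \<le> Im s" for s
  proof (rule tendsto_le[of "at_right (0::real)"])
    show "((\<lambda>\<epsilon>. M0 * exp (\<epsilon> * L\<^sup>2)) \<longlongrightarrow> M0) (at_right 0)"
      by (rule tendsto_eq_intros refl | simp)+
    show "((\<lambda>\<epsilon>. norm (G s) * exp (\<epsilon> * ((Re s)\<^sup>2 - (Im s)\<^sup>2))) \<longlongrightarrow> norm (G s)) (at_right 0)"
      by (rule tendsto_eq_intros refl | simp)+
    show "eventually (\<lambda>\<epsilon>. norm (G s) * exp (\<epsilon> * ((Re s)\<^sup>2 - (Im s)\<^sup>2)) \<le> M0 * exp (\<epsilon> * L\<^sup>2)) (at_right 0)"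
      using key[OF s] by (intro eventually_mono[OF eventually_at_right_less[of 0]]) auto
  qed simp
  then show ?thesis by blast
qed

text \<open>Stirling's main factor in the upper half plane, rotated by -i: writing Ln s = Ln(-i s) +
  i pi/2 splits s^(s - 1/2) into this factor and one of modulus exp(-pi t/2). Since Re(-i s) = Im s
  is positive, no branch cut is met.\<close>

lemma norm_stirling_factor:
  fixes s :: complex
  assumes s: "0 < Re s" "1 \<le> Im s"
  shows "norm (exp ((s - 1/2) * Ln (- \<i> * s))) = exp ((Re s - 1/2) * ln (norm s) + Im s * arctan (Re s / Im s))"
proof -
  have nz: "- \<i> * s \<noteq> 0" using s by auto
  have "Re (Ln (- \<i> * s)) = ln (norm s)" using nz by (simp add: norm_mult)
  moreover have "Im (Ln (- \<i> * s)) = - arctan (Re s / Im s)"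
    using arg_conv_arctan[of "- \<i> * s"] s Arg_eq_Im_Ln[OF nz] by (simp add: arctan_minus)
  ultimately show ?thesis by (simp add: algebra_simps)
qed

text \<open>The angular part t arctan(\<sigma>/t) lies between 0 and \<sigma> \<le> 3/2, and t \<le>
  |s| \<le> 5/2 t in this strip; hence the constants exp(3/2) and 5/2.\<close>

lemma norm_stirling_factor_bounds:
  fixes s :: complex
  assumes s: "1/2 \<le> Re s" "Re s \<le> 3/2" "1 \<le> Im s"
  shows "Im s powr (Re s - 1/2) \<le> norm (exp ((s - 1/2) * Ln (- \<i> * s)))"
    and "norm (exp ((s - 1/2) * Ln (- \<i> * s))) \<le> 5 / 2 * exp (3 / 2) * Im s powr (Re s - 1/2)"
proof -
  have t: "0 < Im s" "0 < Re s" using s by auto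
  have n: "Im s \<le> norm s" "norm s \<le> 5 / 2 * Im s"
    using abs_Im_le_cmod[of s] cmod_le[of s] s by auto
  have a0: "0 \<le> arctan (Re s / Im s)" using t by simp
  have a1: "Im s * arctan (Re s / Im s) \<le> 3 / 2"
  proof -
    have "arctan (Re s / Im s) \<le> Re s / Im s" using t by (intro arctan_le_self) auto
    then have "Im s * arctan (Re s / Im s) \<le> Im s * (Re s / Im s)" using t by (intro mult_left_mono) auto
    then show ?thesis using t s by simp
  qed
  have eq: "norm (exp ((s - 1/2) * Ln (- \<i> * s))) = norm s powr (Re s - 1/2) * exp (Im s * arctan (Re s / Im s))"
    using norm_stirling_factor[of s] t s by (auto simp: powr_def exp_add)
  have "Im s powr (Re s - 1/2) * 1 \<le> norm s powr (Re s - 1/2) * exp (Im s * arctan (Re s / Im s))"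
    using n t s a0 by (intro mult_mono powr_mono2) auto
  then show "Im s powr (Re s - 1/2) \<le> norm (exp ((s - 1/2) * Ln (- \<i> * s)))" unfolding eq by simp
  have "norm s powr (Re s - 1/2) \<le> (5 / 2 * Im s) powr (Re s - 1/2)"
    using n t s by (intro powr_mono2) auto
  also have "\<dots> = (5 / 2) powr (Re s - 1/2) * Im s powr (Re s - 1/2)"
    by (rule powr_mult)
  also have "\<dots> \<le> 5 / 2 * Im s powr (Re s - 1/2)"
    using powr_mono[of "Re s - 1/2" 1 "5/2"] s by (intro mult_right_mono) auto
  finally have "norm s powr (Re s - 1/2) * exp (Im s * arctan (Re s / Im s))
     \<le> (5 / 2 * Im s powr (Re s - 1/2)) * exp (3 / 2)"
    using a1 by (intro mult_mono) auto
  then show "norm (exp ((s - 1/2) * Ln (- \<i> * s))) \<le> 5 / 2 * exp (3 / 2) * Im s powr (Re s - 1/2)"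
    unfolding eq by (simp add: mult_ac)
qed

text \<open>At real part 1/2 the reflection formula pairs z with 1 - z = cnj z, so it yields a
  modulus, with sin(pi z) turning into cosh(pi t).\<close>

lemma norm_Gamma_half:
  fixes t :: real
  shows "(norm (Gamma (Complex (1/2) t)))\<^sup>2 = pi / cosh (pi * t)"
proof -
  let ?z = "Complex (1/2) t"
  have z: "1 - ?z = cnj ?z" by (simp add: complex_eq_iff)
  have "Gamma ?z * cnj (Gamma ?z) = of_real pi / sin (of_real pi * ?z)"
    using Gamma_reflection_complex[of ?z] by (simp add: z cnj_Gamma)
  also have "of_real pi * ?z = of_real (pi/2) + of_real (pi * t) * \<i>"
    by (simp add: complex_eq_iff)
  also have "sin \<dots> = cos (of_real (pi * t) * \<i>)"
    unfolding sin_add sin_of_real cos_of_real by simp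
  also have "\<dots> = cosh (of_real (pi * t))"
    unfolding cosh_conv_cos by (simp only: mult.commute)
  also have "\<dots> = of_real (cosh (pi * t))"
    unfolding cosh_field_def
    by (simp only: exp_of_real of_real_add of_real_divide of_real_numeral of_real_minus[symmetric])
  finally have "of_real ((norm (Gamma ?z))\<^sup>2) = (of_real (pi / cosh (pi * t)) :: complex)"
    by (simp only: complex_norm_square of_real_divide)
  then show ?thesis by (simp only: of_real_eq_iff)
qed

lemma Gamma_half_bounds:
  fixes t :: real
  assumes "t \<ge> 0"
  shows "norm (Gamma (Complex (1/2) t)) \<le> sqrt (2 * pi) * exp (- pi * t / 2)"
    and "sqrt pi * exp (- pi * t / 2) \<le> norm (Gamma (Complex (1/2) t))"
proof -
  have e: "(exp (- pi * t / 2))\<^sup>2 = 1 / exp (pi * t)"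
    by (simp add: power2_eq_square exp_minus field_simps flip: exp_add)
  have c: "exp (pi * t) / 2 \<le> cosh (pi * t)" "cosh (pi * t) \<le> exp (pi * t)"
    using assms by (auto simp: cosh_field_def field_simps)
  have "(norm (Gamma (Complex (1/2) t)))\<^sup>2 \<le> (sqrt (2 * pi) * exp (- pi * t / 2))\<^sup>2"
  proof -
    have "pi / cosh (pi * t) \<le> pi / (exp (pi * t) / 2)" using c by (intro divide_left_mono) auto
    then show ?thesis unfolding norm_Gamma_half power_mult_distrib e by (simp add: field_simps)
  qed
  then show "norm (Gamma (Complex (1/2) t)) \<le> sqrt (2 * pi) * exp (- pi * t / 2)"
    by (rule power2_le_imp_le) auto
  have "(sqrt pi * exp (- pi * t / 2))\<^sup>2 \<le> (norm (Gamma (Complex (1/2) t)))\<^sup>2"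
  proof -
    have "pi / exp (pi * t) \<le> pi / cosh (pi * t)" using c by (intro divide_left_mono) (auto intro: mult_pos_pos)
    then show ?thesis unfolding norm_Gamma_half power_mult_distrib e by (simp add: field_simps)
  qed
  then show "sqrt pi * exp (- pi * t / 2) \<le> norm (Gamma (Complex (1/2) t))"
    by (rule power2_le_imp_le) auto
qed

lemma Gamma_three_halves_bounds:
  fixes t :: real
  assumes "t \<ge> 1"
  shows "norm (Gamma (Complex (3/2) t)) \<le> 2 * t * (sqrt (2 * pi) * exp (- pi * t / 2))"
    and "t * (sqrt pi * exp (- pi * t / 2)) \<le> norm (Gamma (Complex (3/2) t))"
proof -
  let ?z = "Complex (1/2) t"
  have "?z \<notin> \<int>\<^sub>\<le>\<^sub>0" using assms by (auto elim!: nonpos_Ints_cases simp: complex_eq_iff)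
  then have "Gamma (?z + 1) = ?z * Gamma ?z" by (rule Gamma_plus1)
  moreover have "?z + 1 = Complex (3/2) t" by (simp add: complex_eq_iff)
  ultimately have G: "norm (Gamma (Complex (3/2) t)) = norm ?z * norm (Gamma ?z)" by (simp add: norm_mult)
  have n: "t \<le> norm ?z" "norm ?z \<le> 2 * t"
    using abs_Im_le_cmod[of ?z] cmod_le[of ?z] assms by auto
  show "norm (Gamma (Complex (3/2) t)) \<le> 2 * t * (sqrt (2 * pi) * exp (- pi * t / 2))"
    unfolding G using n assms Gamma_half_bounds[of t] by (intro mult_mono) auto
  show "t * (sqrt pi * exp (- pi * t / 2)) \<le> norm (Gamma (Complex (3/2) t))"
    unfolding G using n assms Gamma_half_bounds[of t] by (intro mult_mono) auto
qed

text \<open>Euler's integral gives |Gamma s| \<le> Gamma(Re s), which is continuous on a compact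
  interval. The crude bound serves as the a priori growth condition of
  \<open>half_strip_bounded\<close>.\<close>

lemma Gamma_bounded_strip:
  "\<exists>B. \<forall>s. 1/2 \<le> Re s \<longrightarrow> Re s \<le> 3/2 \<longrightarrow> norm (Gamma s) \<le> B"
proof -
  define S where "S = {1/2..3/2::real}"
  have "continuous_on S (Gamma :: real \<Rightarrow> real)"
    by (intro continuous_intros) (auto simp: S_def elim!: nonpos_Ints_cases)
  then have "compact (Gamma ` S)" by (intro compact_continuous_image) (auto simp: S_def)
  then obtain B where B: "\<And>x. x \<in> S \<Longrightarrow> norm (Gamma x) \<le> B"
    by (metis bounded_iff compact_imp_bounded imageI)
  have "norm (Gamma s) \<le> B" if "1/2 \<le> Re s" "Re s \<le> 3/2" for s :: complex
  proof -
    have "norm (Gamma s) \<le> Gamma (Re s)"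
    proof -
      have i: "((\<lambda>t. of_real t powr (s - 1) / of_real (exp t)) has_integral Gamma s) {0..}"
        using that by (intro Gamma_integral_complex) auto
      have j: "((\<lambda>t. t powr (Re s - 1) / exp t) has_integral Gamma (Re s)) {0..}"
        using that by (intro Gamma_integral_real) auto
      have "norm (integral {0..} (\<lambda>t. of_real t powr (s - 1) / of_real (exp t)))
          \<le> integral {0..} (\<lambda>t. t powr (Re s - 1) / exp t)"
        using i j by (intro integral_norm_bound_integral)
          (auto simp: has_integral_integrable norm_divide norm_powr_real_powr)
      then show ?thesis using i j by (simp add: integral_unique)
    qed
    also have "\<dots> \<le> B" using B[of "Re s"] that by (auto simp: S_def)
    finally show ?thesis .
  qed
  then show ?thesis by blast
qed

text \<open>The size is known on Re s = 1/2 by reflection and on Re s = 3/2 by the recurrence;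
  \<open>half_strip_bounded\<close>, applied to the quotient by the Stirling factor, carries it to
  the strip in between.\<close>

lemma Gamma_strip_upper:
  "\<exists>C. \<forall>s. 1/2 \<le> Re s \<longrightarrow> Re s \<le> 3/2 \<longrightarrow> 1 \<le> Im s \<longrightarrow>
     norm (Gamma s) \<le> C * (Im s powr (Re s - 1/2) * exp (- pi * Im s / 2))"
proof -
  define E where "E = (\<lambda>s::complex. exp ((s - 1/2) * Ln (- \<i> * s)))"
  define G where "G = (\<lambda>s. Gamma s * exp (- \<i> * pi * s / 2) / E s)"
  obtain B where B: "\<And>s. 1/2 \<le> Re s \<Longrightarrow> Re s \<le> 3/2 \<Longrightarrow> norm (Gamma s :: complex) \<le> B"
    using Gamma_bounded_strip by blast
  have B0: "B \<ge> 0" using B[of 1] by (auto intro: order_trans[OF norm_ge_zero])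
  have nG: "norm (G s) = norm (Gamma s) * exp (pi * Im s / 2) / norm (E s)" for s
    by (simp add: G_def norm_mult norm_divide)
  have E: "Im s powr (Re s - 1/2) \<le> norm (E s)" "norm (E s) \<le> 5 / 2 * exp (3 / 2) * Im s powr (Re s - 1/2)"
    if "1/2 \<le> Re s" "Re s \<le> 3/2" "1 \<le> Im s" for s
    using norm_stirling_factor_bounds[OF that] by (auto simp: E_def)
  have E1: "1 \<le> norm (E s)" if "1/2 \<le> Re s" "Re s \<le> 3/2" "1 \<le> Im s" for s
    using E(1)[OF that] that ge_one_powr_ge_zero[of "Im s" "Re s - 1/2"] by auto
  have "\<exists>C. \<forall>s. 1/2 \<le> Re s \<longrightarrow> Re s \<le> 3/2 \<longrightarrow> 1 \<le> Im s \<longrightarrow> norm (G s) \<le> C"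
  proof (rule half_strip_bounded)
    show "G analytic_on {s. 1/2 \<le> Re s \<and> Re s \<le> 3/2 \<and> 1 \<le> Im s}"
    proof -
      have "E analytic_on {s. 1/2 \<le> Re s \<and> Re s \<le> 3/2 \<and> 1 \<le> Im s}"
        unfolding E_def by (intro analytic_intros) (auto elim!: nonpos_Reals_cases simp: complex_eq_iff)
      then show ?thesis
        unfolding G_def
        by (intro analytic_intros analytic_Gamma) (auto elim!: nonpos_Ints_cases simp: E_def)
    qed
    show "norm (G s) \<le> B * exp (pi / 2 * Im s)" if "1/2 \<le> Re s" "Re s \<le> 3/2" "1 \<le> Im s" for s
    proof -
      have "norm (Gamma s) * exp (pi * Im s / 2) / norm (E s) \<le> B * exp (pi * Im s / 2) / 1"
        using B[of s] E1[OF that] that by (intro frac_le mult_mono mult_nonneg_nonneg) (auto simp: B0)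
      then show ?thesis by (simp add: nG)
    qed
    show "norm (G s) \<le> 2 * sqrt (2 * pi)" if "Re s = 1/2 \<or> Re s = 3/2" "1 \<le> Im s" for s
      using that(1)
    proof
      assume R: "Re s = 1/2"
      then have s: "s = Complex (1/2) (Im s)" by (simp add: complex_eq_iff)
      have "norm (Gamma s) * exp (pi * Im s / 2) \<le> sqrt (2 * pi) * exp (- pi * Im s / 2) * exp (pi * Im s / 2)"
        using Gamma_half_bounds(1)[of "Im s"] s that by (intro mult_right_mono) auto
      also have "\<dots> = sqrt (2 * pi)" by (simp add: mult.assoc flip: exp_add)
      finally have "norm (Gamma s) * exp (pi * Im s / 2) \<le> sqrt (2 * pi)" .
      then have "norm (G s) \<le> sqrt (2 * pi) / 1"
        unfolding nG using E1[of s] R that by (intro frac_le) auto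
      also have "\<dots> \<le> 2 * sqrt (2 * pi)" by simp
      finally show ?thesis .
    next
      assume R: "Re s = 3/2"
      then have s: "s = Complex (3/2) (Im s)" by (simp add: complex_eq_iff)
      have "norm (Gamma s) * exp (pi * Im s / 2) \<le> 2 * Im s * (sqrt (2 * pi) * exp (- pi * Im s / 2)) * exp (pi * Im s / 2)"
        using Gamma_three_halves_bounds(1)[of "Im s"] s that by (intro mult_right_mono) auto
      also have "\<dots> = 2 * sqrt (2 * pi) * Im s" by (simp add: mult.assoc flip: exp_add)
      finally have "norm (Gamma s) * exp (pi * Im s / 2) \<le> 2 * sqrt (2 * pi) * Im s" .
      then have "norm (G s) \<le> (2 * sqrt (2 * pi) * Im s) / Im s"
        unfolding nG using E(1)[of s] R that by (intro frac_le) auto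
      also have "\<dots> = 2 * sqrt (2 * pi)" using that by simp
      finally show ?thesis .
    qed
  qed
  then obtain C where C: "\<And>s. 1/2 \<le> Re s \<Longrightarrow> Re s \<le> 3/2 \<Longrightarrow> 1 \<le> Im s \<Longrightarrow> norm (G s) \<le> C"
    by blast
  have "norm (Gamma s) \<le> (C * (5 / 2 * exp (3 / 2))) * (Im s powr (Re s - 1/2) * exp (- pi * Im s / 2))"
    if s: "1/2 \<le> Re s" "Re s \<le> 3/2" "1 \<le> Im s" for s
  proof -
    have C0: "C \<ge> 0" using C[OF s] norm_ge_zero order_trans by blast
    have "norm (Gamma s) = norm (G s) * norm (E s) * exp (- pi * Im s / 2)"
      using E1[OF s] by (auto simp: nG mult.assoc simp flip: exp_add)
    also have "\<dots> \<le> C * (5 / 2 * exp (3 / 2) * Im s powr (Re s - 1/2)) * exp (- pi * Im s / 2)"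
      using C[OF s] E(2)[OF s] C0 by (intro mult_right_mono mult_mono) auto
    finally show ?thesis by (simp add: mult_ac)
  qed
  then show ?thesis by blast
qed

lemma norm_sin_le_exp: "norm (sin z) \<le> exp \<bar>Im z\<bar>" for z :: complex
proof -
  have "norm (exp (\<i> * z) - exp (- \<i> * z)) \<le> norm (exp (\<i> * z)) + norm (exp (- \<i> * z))"
    by (rule norm_triangle_ineq4)
  also have "\<dots> \<le> exp \<bar>Im z\<bar> + exp \<bar>Im z\<bar>"
    by (intro add_mono) auto
  finally show ?thesis by (simp add: sin_exp_eq norm_divide norm_mult)
qed

text \<open>The same interpolation for \<open>rGamma\<close>, which is entire. Its a priori growth
  comes from the reflection formula and the exponential growth of the sine.\<close>

lemma Gamma_strip_lower:
  "\<exists>C. \<forall>s. 1/2 \<le> Re s \<longrightarrow> Re s \<le> 3/2 \<longrightarrow> 1 \<le> Im s \<longrightarrow>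
     Im s powr (Re s - 1/2) * exp (- pi * Im s / 2) \<le> C * norm (Gamma s)"
proof -
  define E where "E = (\<lambda>s::complex. exp ((s - 1/2) * Ln (- \<i> * s)))"
  define G where "G = (\<lambda>s. rGamma s * exp (\<i> * pi * s / 2) * E s)"
  obtain B where B: "\<And>s. 1/2 \<le> Re s \<Longrightarrow> Re s \<le> 3/2 \<Longrightarrow> norm (Gamma s :: complex) \<le> B"
    using Gamma_bounded_strip by blast
  have B0: "B \<ge> 0" using B[of 1] by (auto intro: order_trans[OF norm_ge_zero])
  have nG: "norm (G s) = norm (rGamma s) * exp (- pi * Im s / 2) * norm (E s)" for s
    by (simp add: G_def norm_mult norm_divide)
  have E: "Im s powr (Re s - 1/2) \<le> norm (E s)" "norm (E s) \<le> 5 / 2 * exp (3 / 2) * Im s powr (Re s - 1/2)"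
    if "1/2 \<le> Re s" "Re s \<le> 3/2" "1 \<le> Im s" for s
    using norm_stirling_factor_bounds[OF that] by (auto simp: E_def)
  have nonpos: "s \<notin> \<int>\<^sub>\<le>\<^sub>0" if "1 \<le> Im s" for s
    using that by (auto elim!: nonpos_Ints_cases)
  define M where "M = 5 / 2 * exp (3 / 2) * (1 / sqrt pi)"
  have M0: "M > 0" by (simp add: M_def)
  have "\<exists>C. \<forall>s. 1/2 \<le> Re s \<longrightarrow> Re s \<le> 3/2 \<longrightarrow> 1 \<le> Im s \<longrightarrow> norm (G s) \<le> C"
  proof (rule half_strip_bounded)
    show "G analytic_on {s. 1/2 \<le> Re s \<and> Re s \<le> 3/2 \<and> 1 \<le> Im s}"
      unfolding G_def E_def
      by (intro analytic_intros analytic_rGamma)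
         (auto elim!: nonpos_Ints_cases nonpos_Reals_cases simp: complex_eq_iff)
    show "norm (G s) \<le> (B / pi * (5 / 2 * exp (3 / 2))) * exp ((pi + 2) * Im s)"
      if s: "1/2 \<le> Re s" "Re s \<le> 3/2" "1 \<le> Im s" for s
    proof -
      have s1: "1 - s \<notin> \<int>\<^sub>\<le>\<^sub>0" using s by (auto elim!: nonpos_Ints_cases simp: complex_eq_iff)
      \<comment> \<open>The point 1 - s may leave the strip, but 2 - s lies in it again, and |1 - s|
        \<ge> 1.\<close>
      have "norm (Gamma (1 - s)) \<le> B"
      proof -
        from s1 have "Gamma ((1 - s) + 1) = (1 - s) * Gamma (1 - s)" by (rule Gamma_plus1)
        then have "norm (1 - s) * norm (Gamma (1 - s)) \<le> B"
          using B[of "2 - s"] s by (simp add: norm_mult)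
        moreover have "1 \<le> norm (1 - s)" using abs_Im_le_cmod[of "1 - s"] s by auto
        then have "1 * norm (Gamma (1 - s)) \<le> norm (1 - s) * norm (Gamma (1 - s))"
          by (intro mult_right_mono) auto
        ultimately show ?thesis by simp
      qed
      moreover have "rGamma s = Gamma (1 - s) * sin (of_real pi * s) / of_real pi"
      proof -
        have "rGamma s = rGamma s * rGamma (1 - s) * Gamma (1 - s)"
          using s1 by (simp add: rGamma_inverse_Gamma Gamma_eq_zero_iff)
        then show ?thesis unfolding rGamma_reflection_complex by simp
      qed
      ultimately have "norm (rGamma s) \<le> B * exp (pi * Im s) / pi"
        using norm_sin_le_exp[of "of_real pi * s"] s B0
        by (auto simp: norm_mult norm_divide intro!: divide_right_mono mult_mono)
      moreover have "norm (E s) \<le> 5 / 2 * exp (3 / 2) * exp (2 * Im s)"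
      proof -
        have "Im s powr (Re s - 1/2) \<le> Im s powr 1" using s by (intro powr_mono) auto
        also have "\<dots> \<le> exp (2 * Im s)"
        proof -
          have "Im s \<le> exp (2 * Im s)" using s exp_ge_add_one_self[of "2 * Im s"] by linarith
          then show ?thesis using s by simp
        qed
        finally show ?thesis using E(2)[OF s] by (simp add: mult_left_mono order_trans)
      qed
      moreover have "exp (- pi * Im s / 2) \<le> 1" using s by simp
      ultimately have "norm (G s) \<le> (B * exp (pi * Im s) / pi) * 1 * (5 / 2 * exp (3 / 2) * exp (2 * Im s))"
        unfolding nG using B0 by (intro mult_mono mult_nonneg_nonneg) auto
      also have "\<dots> = (B / pi * (5 / 2 * exp (3 / 2))) * exp ((pi + 2) * Im s)"
        by (simp add: algebra_simps exp_add)
      finally show ?thesis .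
    qed
    show "norm (G s) \<le> M" if "Re s = 1/2 \<or> Re s = 3/2" "1 \<le> Im s" for s
    proof -
      have "Im s powr (Re s - 1/2) * (sqrt pi * exp (- pi * Im s / 2)) \<le> norm (Gamma s)"
        using that(1)
      proof
        assume R: "Re s = 1/2"
        then have s: "s = Complex (1/2) (Im s)" by (simp add: complex_eq_iff)
        have e: "Re s - 1/2 = 0" using R by simp
        show ?thesis unfolding e using Gamma_half_bounds(2)[of "Im s"] s that by simp
      next
        assume R: "Re s = 3/2"
        then have s: "s = Complex (3/2) (Im s)" by (simp add: complex_eq_iff)
        have e: "Re s - 1/2 = 1" using R by simp
        show ?thesis unfolding e using Gamma_three_halves_bounds(2)[of "Im s"] s that by simp
      qed
      moreover have "norm (E s) \<le> 5 / 2 * exp (3 / 2) * Im s powr (Re s - 1/2)"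
        using E(2)[of s] that by auto
      ultimately have "exp (- pi * Im s / 2) * norm (E s) \<le> M * norm (Gamma s)"
      proof -
        assume g: "Im s powr (Re s - 1/2) * (sqrt pi * exp (- pi * Im s / 2)) \<le> norm (Gamma s)"
          and e: "norm (E s) \<le> 5 / 2 * exp (3 / 2) * Im s powr (Re s - 1/2)"
        have "exp (- pi * Im s / 2) * norm (E s) \<le> exp (- pi * Im s / 2) * (5 / 2 * exp (3 / 2) * Im s powr (Re s - 1/2))"
          using e by (intro mult_left_mono) auto
        also have "\<dots> = M * (Im s powr (Re s - 1/2) * (sqrt pi * exp (- pi * Im s / 2)))"
          by (simp add: M_def)
        also have "\<dots> \<le> M * norm (Gamma s)" using g M0 by (intro mult_left_mono) auto
        finally show ?thesis .
      qed
      moreover have "Gamma s \<noteq> 0" using nonpos that by (simp add: Gamma_eq_zero_iff)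
      ultimately show ?thesis
        unfolding nG rGamma_inverse_Gamma norm_inverse by (simp add: field_simps)
    qed
  qed
  then obtain C where C: "\<And>s. 1/2 \<le> Re s \<Longrightarrow> Re s \<le> 3/2 \<Longrightarrow> 1 \<le> Im s \<Longrightarrow> norm (G s) \<le> C"
    by blast
  have "Im s powr (Re s - 1/2) * exp (- pi * Im s / 2) \<le> C * norm (Gamma s)"
    if s: "1/2 \<le> Re s" "Re s \<le> 3/2" "1 \<le> Im s" for s
  proof -
    have "Im s powr (Re s - 1/2) * exp (- pi * Im s / 2) \<le> norm (E s) * exp (- pi * Im s / 2)"
      using E(1)[OF s] by (intro mult_right_mono) auto
    also have "\<dots> = norm (G s) * norm (Gamma s)"
      using nonpos[OF s(3)] by (simp add: nG rGamma_inverse_Gamma norm_inverse Gamma_eq_zero_iff)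
    also have "\<dots> \<le> C * norm (Gamma s)" using C[OF s] by (intro mult_right_mono) auto
    finally show ?thesis .
  qed
  then show ?thesis by blast
qed

text \<open>One use of Gamma(s + 1) = s Gamma(s): in a vertical strip with Im s \<ge> 1 the factor
  |s| is comparable to Im s, which changes the exponent by exactly 1.\<close>

lemma Gamma_upper_shift:
  fixes \<alpha> \<beta> :: real
  assumes "\<exists>C. \<forall>s. \<alpha> \<le> Re s \<longrightarrow> Re s \<le> \<beta> \<longrightarrow> 1 \<le> Im s \<longrightarrow>
     norm (Gamma s) \<le> C * (Im s powr (Re s - 1/2) * exp (- pi * Im s / 2))"
  shows "\<exists>C. \<forall>s. \<alpha> + 1 \<le> Re s \<longrightarrow> Re s \<le> \<beta> + 1 \<longrightarrow> 1 \<le> Im s \<longrightarrow>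
     norm (Gamma s) \<le> C * (Im s powr (Re s - 1/2) * exp (- pi * Im s / 2))"
    and "\<exists>C. \<forall>s. \<alpha> - 1 \<le> Re s \<longrightarrow> Re s \<le> \<beta> - 1 \<longrightarrow> 1 \<le> Im s \<longrightarrow>
     norm (Gamma s) \<le> C * (Im s powr (Re s - 1/2) * exp (- pi * Im s / 2))"
proof -
  obtain C where C: "\<And>s. \<alpha> \<le> Re s \<Longrightarrow> Re s \<le> \<beta> \<Longrightarrow> 1 \<le> Im s \<Longrightarrow>
     norm (Gamma s) \<le> C * (Im s powr (Re s - 1/2) * exp (- pi * Im s / 2))" using assms by blast
  define L where "L = max \<bar>\<alpha>\<bar> \<bar>\<beta>\<bar>"
  show "\<exists>C. \<forall>s. \<alpha> + 1 \<le> Re s \<longrightarrow> Re s \<le> \<beta> + 1 \<longrightarrow> 1 \<le> Im s \<longrightarrow>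
     norm (Gamma s) \<le> C * (Im s powr (Re s - 1/2) * exp (- pi * Im s / 2))"
  proof (intro exI allI impI)
    fix s :: complex assume s: "\<alpha> + 1 \<le> Re s" "Re s \<le> \<beta> + 1" "1 \<le> Im s"
    let ?z = "s - 1"
    have "?z \<notin> \<int>\<^sub>\<le>\<^sub>0" using s by (auto elim!: nonpos_Ints_cases simp: complex_eq_iff)
    then have G: "Gamma s = ?z * Gamma ?z" using Gamma_plus1[of ?z] by simp
    have n: "norm ?z \<le> (1 + L) * Im s"
    proof -
      have "norm ?z \<le> \<bar>Re ?z\<bar> + \<bar>Im ?z\<bar>" by (rule cmod_le)
      moreover have "\<bar>Re ?z\<bar> \<le> L" using s by (auto simp: L_def)
      moreover have "L * 1 \<le> L * Im s" using s by (intro mult_left_mono) (auto simp: L_def)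
      moreover have "\<bar>Im ?z\<bar> = Im s" using s by simp
      ultimately show ?thesis by (simp add: algebra_simps)
    qed
    have "norm (Gamma s) \<le> ((1 + L) * Im s) * (C * (Im s powr (Re s - 1 - 1/2) * exp (- pi * Im s / 2)))"
      unfolding G norm_mult using C[of ?z] s by (intro mult_mono n order_trans[OF norm_ge_zero n]) auto
    also have "\<dots> = ((1 + L) * C) * ((Im s powr 1 * Im s powr (Re s - 1 - 1/2)) * exp (- pi * Im s / 2))"
      using s by (simp add: mult_ac)
    also have "Im s powr 1 * Im s powr (Re s - 1 - 1/2) = Im s powr (Re s - 1/2)"
      unfolding powr_add[symmetric] by (simp add: algebra_simps)
    finally show "norm (Gamma s) \<le> ((1 + L) * C) * (Im s powr (Re s - 1/2) * exp (- pi * Im s / 2))" .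
  qed
  show "\<exists>C. \<forall>s. \<alpha> - 1 \<le> Re s \<longrightarrow> Re s \<le> \<beta> - 1 \<longrightarrow> 1 \<le> Im s \<longrightarrow>
     norm (Gamma s) \<le> C * (Im s powr (Re s - 1/2) * exp (- pi * Im s / 2))"
  proof (intro exI allI impI)
    fix s :: complex assume s: "\<alpha> - 1 \<le> Re s" "Re s \<le> \<beta> - 1" "1 \<le> Im s"
    have "s \<notin> \<int>\<^sub>\<le>\<^sub>0" using s by (auto elim!: nonpos_Ints_cases simp: complex_eq_iff)
    then have G: "Gamma (s + 1) = s * Gamma s" by (rule Gamma_plus1)
    have "Im s * norm (Gamma s) \<le> norm s * norm (Gamma s)"
      using s abs_Im_le_cmod[of s] by (intro mult_right_mono) auto
    also have "\<dots> = norm (Gamma (s + 1))" by (simp add: G norm_mult)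
    also have "\<dots> \<le> C * (Im s powr (Re s + 1 - 1/2) * exp (- pi * Im s / 2))"
      using C[of "s + 1"] s by simp
    also have "Im s powr (Re s + 1 - 1/2) = Im s * Im s powr (Re s - 1/2)"
    proof -
      have "Im s * Im s powr (Re s - 1/2) = Im s powr 1 * Im s powr (Re s - 1/2)" using s by simp
      then show ?thesis unfolding powr_add[symmetric] by (simp add: algebra_simps)
    qed
    finally have "Im s * norm (Gamma s) \<le> Im s * (C * (Im s powr (Re s - 1/2) * exp (- pi * Im s / 2)))"
      by (simp add: mult_ac)
    then show "norm (Gamma s) \<le> C * (Im s powr (Re s - 1/2) * exp (- pi * Im s / 2))"
      using s by (subst (asm) mult_le_cancel_left_pos) auto
  qed
qed

lemma Gamma_lower_shift:
  fixes \<alpha> \<beta> :: real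
  assumes "\<exists>C. \<forall>s. \<alpha> \<le> Re s \<longrightarrow> Re s \<le> \<beta> \<longrightarrow> 1 \<le> Im s \<longrightarrow>
     Im s powr (Re s - 1/2) * exp (- pi * Im s / 2) \<le> C * norm (Gamma s)"
  shows "\<exists>C. \<forall>s. \<alpha> + 1 \<le> Re s \<longrightarrow> Re s \<le> \<beta> + 1 \<longrightarrow> 1 \<le> Im s \<longrightarrow>
     Im s powr (Re s - 1/2) * exp (- pi * Im s / 2) \<le> C * norm (Gamma s)"
    and "\<exists>C. \<forall>s. \<alpha> - 1 \<le> Re s \<longrightarrow> Re s \<le> \<beta> - 1 \<longrightarrow> 1 \<le> Im s \<longrightarrow>
     Im s powr (Re s - 1/2) * exp (- pi * Im s / 2) \<le> C * norm (Gamma s)"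
proof -
  obtain C0 where C0: "\<And>s. \<alpha> \<le> Re s \<Longrightarrow> Re s \<le> \<beta> \<Longrightarrow> 1 \<le> Im s \<Longrightarrow>
     Im s powr (Re s - 1/2) * exp (- pi * Im s / 2) \<le> C0 * norm (Gamma s)" using assms by blast
  \<comment> \<open>For an empty strip \<open>C0\<close> could be negative, and estimates multiplied
    by it need a nonnegative constant.\<close>
  define C where "C = max C0 0"
  have C: "Im s powr (Re s - 1/2) * exp (- pi * Im s / 2) \<le> C * norm (Gamma s)"
    if "\<alpha> \<le> Re s" "Re s \<le> \<beta>" "1 \<le> Im s" for s
    using C0[OF that] mult_right_mono[of C0 C "norm (Gamma s)"] by (auto simp: C_def)
  define L where "L = max \<bar>\<alpha>\<bar> \<bar>\<beta>\<bar> + 1"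
  show "\<exists>C. \<forall>s. \<alpha> + 1 \<le> Re s \<longrightarrow> Re s \<le> \<beta> + 1 \<longrightarrow> 1 \<le> Im s \<longrightarrow>
     Im s powr (Re s - 1/2) * exp (- pi * Im s / 2) \<le> C * norm (Gamma s)"
  proof (intro exI allI impI)
    fix s :: complex assume s: "\<alpha> + 1 \<le> Re s" "Re s \<le> \<beta> + 1" "1 \<le> Im s"
    let ?z = "s - 1"
    have "?z \<notin> \<int>\<^sub>\<le>\<^sub>0" using s by (auto elim!: nonpos_Ints_cases simp: complex_eq_iff)
    then have G: "Gamma s = ?z * Gamma ?z" using Gamma_plus1[of ?z] by simp
    have "Im s powr (Re s - 1/2) * exp (- pi * Im s / 2) = Im s * (Im s powr (Re s - 1 - 1/2) * exp (- pi * Im s / 2))"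
    proof -
      have "Im s * Im s powr (Re s - 1 - 1/2) = Im s powr 1 * Im s powr (Re s - 1 - 1/2)" using s by simp
      also have "\<dots> = Im s powr (Re s - 1/2)" unfolding powr_add[symmetric] by (simp add: algebra_simps)
      finally show ?thesis by (simp add: mult.assoc[symmetric])
    qed
    also have "\<dots> \<le> norm ?z * (C * norm (Gamma ?z))"
      by (rule mult_mono) (use C[of ?z] s abs_Im_le_cmod[of ?z] in auto)
    also have "\<dots> = C * norm (Gamma s)" by (simp add: G norm_mult)
    finally show "Im s powr (Re s - 1/2) * exp (- pi * Im s / 2) \<le> C * norm (Gamma s)" .
  qed
  show "\<exists>C. \<forall>s. \<alpha> - 1 \<le> Re s \<longrightarrow> Re s \<le> \<beta> - 1 \<longrightarrow> 1 \<le> Im s \<longrightarrow>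
     Im s powr (Re s - 1/2) * exp (- pi * Im s / 2) \<le> C * norm (Gamma s)"
  proof (intro exI allI impI)
    fix s :: complex assume s: "\<alpha> - 1 \<le> Re s" "Re s \<le> \<beta> - 1" "1 \<le> Im s"
    have "s \<notin> \<int>\<^sub>\<le>\<^sub>0" using s by (auto elim!: nonpos_Ints_cases simp: complex_eq_iff)
    then have G: "Gamma (s + 1) = s * Gamma s" by (rule Gamma_plus1)
    have n: "norm s \<le> (1 + L) * Im s"
    proof -
      have "norm s \<le> \<bar>Re s\<bar> + \<bar>Im s\<bar>" by (rule cmod_le)
      moreover have "\<bar>Re s\<bar> \<le> L" using s by (auto simp: L_def)
      moreover have "L * 1 \<le> L * Im s" using s by (intro mult_left_mono) (auto simp: L_def)
      moreover have "\<bar>Im s\<bar> = Im s" using s by simp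
      ultimately show ?thesis by (simp add: algebra_simps)
    qed
    have "Im s * (Im s powr (Re s - 1/2) * exp (- pi * Im s / 2)) = Im s powr (Re s + 1 - 1/2) * exp (- pi * Im s / 2)"
    proof -
      have "Im s * Im s powr (Re s - 1/2) = Im s powr 1 * Im s powr (Re s - 1/2)" using s by simp
      also have "\<dots> = Im s powr (Re s + 1 - 1/2)" unfolding powr_add[symmetric] by (simp add: algebra_simps)
      finally show ?thesis by (simp add: mult.assoc[symmetric])
    qed
    also have "\<dots> \<le> C * norm (Gamma (s + 1))" using C[of "s + 1"] s by simp
    also have "\<dots> = C * norm (Gamma s) * norm s" by (simp add: G norm_mult)
    also have "\<dots> \<le> C * norm (Gamma s) * ((1 + L) * Im s)"
      using n by (intro mult_left_mono) (auto simp: C_def)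
    finally have "Im s * (Im s powr (Re s - 1/2) * exp (- pi * Im s / 2)) \<le> Im s * ((1 + L) * C * norm (Gamma s))"
      by (simp add: mult_ac)
    then show "Im s powr (Re s - 1/2) * exp (- pi * Im s / 2) \<le> (1 + L) * C * norm (Gamma s)"
      using s by (subst (asm) mult_le_cancel_left_pos) auto
  qed
qed

lemma Gamma_upper_all:
  fixes n :: nat
  shows "\<exists>C. \<forall>s. 1/2 - real n \<le> Re s \<longrightarrow> Re s \<le> 3/2 + real n \<longrightarrow> 1 \<le> Im s \<longrightarrow>
     norm (Gamma s) \<le> C * (Im s powr (Re s - 1/2) * exp (- pi * Im s / 2))"
proof (induction n)
  case 0
  then show ?case using Gamma_strip_upper by simp
next
  case (Suc n)
  from Gamma_upper_shift[OF Suc.IH] obtain C D where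
    C: "\<And>s. 1/2 - real n + 1 \<le> Re s \<Longrightarrow> Re s \<le> 3/2 + real n + 1 \<Longrightarrow> 1 \<le> Im s \<Longrightarrow>
     norm (Gamma s) \<le> C * (Im s powr (Re s - 1/2) * exp (- pi * Im s / 2))" and
    D: "\<And>s. 1/2 - real n - 1 \<le> Re s \<Longrightarrow> Re s \<le> 3/2 + real n - 1 \<Longrightarrow> 1 \<le> Im s \<Longrightarrow>
     norm (Gamma s) \<le> D * (Im s powr (Re s - 1/2) * exp (- pi * Im s / 2))" by blast
  \<comment> \<open>At \<open>n\<close> = 0 the two shifted strips are only [3/2, 5/2] and
    [-1/2, 1/2]; the original strip closes the gap.\<close>
  obtain E where E: "\<And>s. 1/2 \<le> Re s \<Longrightarrow> Re s \<le> 3/2 \<Longrightarrow> 1 \<le> Im s \<Longrightarrow>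
     norm (Gamma s) \<le> E * (Im s powr (Re s - 1/2) * exp (- pi * Im s / 2))"
    using Gamma_strip_upper by blast
  have "norm (Gamma s) \<le> max C (max D E) * (Im s powr (Re s - 1/2) * exp (- pi * Im s / 2))"
    if s: "1/2 - real (Suc n) \<le> Re s" "Re s \<le> 3/2 + real (Suc n)" "1 \<le> Im s" for s
  proof -
    let ?x = "Im s powr (Re s - 1/2) * exp (- pi * Im s / 2)"
    have x: "?x \<ge> 0" by simp
    consider "Re s \<le> 1/2" | "1/2 \<le> Re s" "Re s \<le> 3/2" | "3/2 \<le> Re s" by linarith
    then show ?thesis
    proof cases
      case 1
      then have "norm (Gamma s) \<le> D * ?x" using D[of s] s by simp
      also have "\<dots> \<le> max C (max D E) * ?x" by (intro mult_right_mono x) auto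
      finally show ?thesis .
    next
      case 2
      then have "norm (Gamma s) \<le> E * ?x" using E[of s] s by simp
      also have "\<dots> \<le> max C (max D E) * ?x" by (intro mult_right_mono x) auto
      finally show ?thesis .
    next
      case 3
      then have "norm (Gamma s) \<le> C * ?x" using C[of s] s by simp
      also have "\<dots> \<le> max C (max D E) * ?x" by (intro mult_right_mono x) auto
      finally show ?thesis .
    qed
  qed
  then show ?case by blast
qed

lemma Gamma_lower_all:
  fixes n :: nat
  shows "\<exists>C. \<forall>s. 1/2 - real n \<le> Re s \<longrightarrow> Re s \<le> 3/2 + real n \<longrightarrow> 1 \<le> Im s \<longrightarrow>
     Im s powr (Re s - 1/2) * exp (- pi * Im s / 2) \<le> C * norm (Gamma s)"
proof (induction n)
  case 0
  then show ?case using Gamma_strip_lower by simp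
next
  case (Suc n)
  from Gamma_lower_shift[OF Suc.IH] obtain C D where
    C: "\<And>s. 1/2 - real n + 1 \<le> Re s \<Longrightarrow> Re s \<le> 3/2 + real n + 1 \<Longrightarrow> 1 \<le> Im s \<Longrightarrow>
     Im s powr (Re s - 1/2) * exp (- pi * Im s / 2) \<le> C * norm (Gamma s)" and
    D: "\<And>s. 1/2 - real n - 1 \<le> Re s \<Longrightarrow> Re s \<le> 3/2 + real n - 1 \<Longrightarrow> 1 \<le> Im s \<Longrightarrow>
     Im s powr (Re s - 1/2) * exp (- pi * Im s / 2) \<le> D * norm (Gamma s)" by blast
  obtain E where E: "\<And>s. 1/2 \<le> Re s \<Longrightarrow> Re s \<le> 3/2 \<Longrightarrow> 1 \<le> Im s \<Longrightarrow>
     Im s powr (Re s - 1/2) * exp (- pi * Im s / 2) \<le> E * norm (Gamma s)"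
    using Gamma_strip_lower by blast
  have "Im s powr (Re s - 1/2) * exp (- pi * Im s / 2) \<le> max C (max D E) * norm (Gamma s)"
    if s: "1/2 - real (Suc n) \<le> Re s" "Re s \<le> 3/2 + real (Suc n)" "1 \<le> Im s" for s
  proof -
    let ?x = "Im s powr (Re s - 1/2) * exp (- pi * Im s / 2)"
    consider "Re s \<le> 1/2" | "1/2 \<le> Re s" "Re s \<le> 3/2" | "3/2 \<le> Re s" by linarith
    then show ?thesis
    proof cases
      case 1
      then have "?x \<le> D * norm (Gamma s)" using D[of s] s by simp
      also have "\<dots> \<le> max C (max D E) * norm (Gamma s)" by (intro mult_right_mono) auto
      finally show ?thesis .
    next
      case 2
      then have "?x \<le> E * norm (Gamma s)" using E[of s] s by simp
      also have "\<dots> \<le> max C (max D E) * norm (Gamma s)" by (intro mult_right_mono) auto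
      finally show ?thesis .
    next
      case 3
      then have "?x \<le> C * norm (Gamma s)" using C[of s] s by simp
      also have "\<dots> \<le> max C (max D E) * norm (Gamma s)" by (intro mult_right_mono) auto
      finally show ?thesis .
    qed
  qed
  then show ?case by blast
qed

lemma Gamma_vertical_bounds:
  fixes \<alpha> \<beta> :: real
  obtains c C where "c > 0" "C > 0"
    "\<And>\<sigma> t. \<alpha> \<le> \<sigma> \<Longrightarrow> \<sigma> \<le> \<beta> \<Longrightarrow> 1 \<le> \<bar>t\<bar> \<Longrightarrow>
       c * (\<bar>t\<bar> powr (\<sigma> - 1/2) * exp (- pi * \<bar>t\<bar> / 2)) \<le> norm (Gamma (Complex \<sigma> t))"
    "\<And>\<sigma> t. \<alpha> \<le> \<sigma> \<Longrightarrow> \<sigma> \<le> \<beta> \<Longrightarrow> 1 \<le> \<bar>t\<bar> \<Longrightarrow>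
       norm (Gamma (Complex \<sigma> t)) \<le> C * (\<bar>t\<bar> powr (\<sigma> - 1/2) * exp (- pi * \<bar>t\<bar> / 2))"
proof -
  define n where "n = nat \<lceil>\<bar>\<alpha>\<bar> + \<bar>\<beta>\<bar> + 2\<rceil>"
  have n: "1/2 - real n \<le> \<alpha>" "\<beta> \<le> 3/2 + real n" unfolding n_def by linarith+
  obtain C where C: "\<And>s. 1/2 - real n \<le> Re s \<Longrightarrow> Re s \<le> 3/2 + real n \<Longrightarrow> 1 \<le> Im s \<Longrightarrow>
     norm (Gamma s) \<le> C * (Im s powr (Re s - 1/2) * exp (- pi * Im s / 2))" using Gamma_upper_all by blast
  obtain D where D: "\<And>s. 1/2 - real n \<le> Re s \<Longrightarrow> Re s \<le> 3/2 + real n \<Longrightarrow> 1 \<le> Im s \<Longrightarrow>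
     Im s powr (Re s - 1/2) * exp (- pi * Im s / 2) \<le> D * norm (Gamma s)" using Gamma_lower_all by blast
  have sym: "norm (Gamma (Complex \<sigma> t)) = norm (Gamma (Complex \<sigma> \<bar>t\<bar>))" for \<sigma> t
  proof (cases "t \<ge> 0")
    case False
    then have "Complex \<sigma> t = cnj (Complex \<sigma> \<bar>t\<bar>)" by (simp add: complex_cnj)
    then have "norm (Gamma (Complex \<sigma> t)) = norm (cnj (Gamma (Complex \<sigma> \<bar>t\<bar>)))"
      by (simp only: cnj_Gamma)
    then show ?thesis by simp
  qed auto
  show ?thesis
  proof (rule that[of "1 / max 1 D" "max 1 C"])
    show "1 / max 1 D > 0" "max 1 C > 0" by auto
    fix \<sigma> t :: real assume a: "\<alpha> \<le> \<sigma>" "\<sigma> \<le> \<beta>" "1 \<le> \<bar>t\<bar>"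
    let ?x = "\<bar>t\<bar> powr (\<sigma> - 1/2) * exp (- pi * \<bar>t\<bar> / 2)"
    have x: "?x \<ge> 0" by simp
    have "norm (Gamma (Complex \<sigma> \<bar>t\<bar>)) \<le> C * ?x"
      using C[of "Complex \<sigma> \<bar>t\<bar>"] a n by simp
    also have "\<dots> \<le> max 1 C * ?x" by (intro mult_right_mono x) auto
    finally show "norm (Gamma (Complex \<sigma> t)) \<le> max 1 C * ?x" by (simp only: sym[of \<sigma> t])
    have "?x \<le> D * norm (Gamma (Complex \<sigma> \<bar>t\<bar>))"
      using D[of "Complex \<sigma> \<bar>t\<bar>"] a n by simp
    also have "\<dots> \<le> max 1 D * norm (Gamma (Complex \<sigma> \<bar>t\<bar>))" by (intro mult_right_mono) auto
    finally have "?x / max 1 D \<le> norm (Gamma (Complex \<sigma> \<bar>t\<bar>))"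
      by (subst pos_divide_le_eq) (auto simp only: mult.commute less_max_iff_disj zero_less_one)
    then show "1 / max 1 D * ?x \<le> norm (Gamma (Complex \<sigma> t))"
      unfolding sym[of \<sigma> t] by simp
  qed
qed

section \<open>Fourier inversion\<close>

text \<open>The characteristic function of the standard normal law is its density up to the factor
  sqrt(2 pi); the rest is rescaling by \<epsilon>.\<close>

lemma Gaussian_Fourier:
  fixes v \<epsilon> :: real
  assumes "\<epsilon> > 0"
  shows "(LINT y|lborel. of_real (std_normal_density (\<epsilon> * y)) * iexp (y * v))
       = of_real (sqrt (2 * pi) / \<epsilon> * std_normal_density (v / \<epsilon>))"
proof -
  have "(LINT x|lborel. of_real (std_normal_density x) * iexp (v / \<epsilon> * x)) = of_real (exp (- ((v / \<epsilon>)\<^sup>2) / 2))"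
    using fun_cong[OF char_std_normal_distribution, of "v / \<epsilon>"]
    by (simp add: char_def integral_density scaleR_conv_of_real)
  also have "(LINT x|lborel. of_real (std_normal_density x) * iexp (v / \<epsilon> * x))
    = \<bar>\<epsilon>\<bar> *\<^sub>R (LINT y|lborel. of_real (std_normal_density (0 + \<epsilon> * y)) * iexp (v / \<epsilon> * (0 + \<epsilon> * y)))"
    using assms by (intro lborel_integral_real_affine) auto
  also have "(\<lambda>y. of_real (std_normal_density (0 + \<epsilon> * y)) * iexp (v / \<epsilon> * (0 + \<epsilon> * y)))
      = (\<lambda>y. of_real (std_normal_density (\<epsilon> * y)) * iexp (y * v))"
    using assms by (auto simp: fun_eq_iff mult_ac)
  finally have "\<epsilon> * (LINT y|lborel. of_real (std_normal_density (\<epsilon> * y)) * iexp (y * v)) = of_real (exp (- ((v / \<epsilon>)\<^sup>2) / 2))"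
    using assms by (simp add: scaleR_conv_of_real)
  moreover have "exp (- ((v / \<epsilon>)\<^sup>2) / 2) = sqrt (2 * pi) * std_normal_density (v / \<epsilon>)"
    by (simp add: normal_density_def)
  ultimately show ?thesis using assms by (simp add: field_simps)
qed

lemma std_normal_density_bounded: "std_normal_density x \<le> 1"
proof -
  have "1 / sqrt (2 * pi) \<le> 1" using pi_gt3 by simp
  moreover have "exp (- (x\<^sup>2 / 2)) \<le> 1" by simp
  ultimately have "1 / sqrt (2 * pi) * exp (- (x\<^sup>2 / 2)) \<le> 1 * 1" by (intro mult_mono) auto
  then show ?thesis by (simp add: normal_density_def)
qed

lemma continuous_on_std_normal_density [continuous_intros]:
  "continuous_on S f \<Longrightarrow> continuous_on S (\<lambda>x. std_normal_density (f x))"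
  unfolding normal_density_def by (intro continuous_intros) auto

text \<open>Gaussian summability: the weight \<open>\<gamma> (e n * y)\<close> makes Fubini
  applicable, and the transformed side is an average of f(x + \<open>e n\<close> v) against the
  normal density. As \<open>e n\<close> tends to 0, dominated convergence applies on one side
  because F is integrable and on the other because f is bounded and continuous.\<close>

lemma Fourier_inversion:
  fixes f :: "real \<Rightarrow> complex"
  assumes cont: "continuous_on UNIV f" and intf: "integrable lborel f" and bdd: "\<And>u. norm (f u) \<le> B"
    and F: "\<And>y. F y = (LINT u|lborel. f u * iexp (y * u))"
    and intF: "integrable lborel F"
  shows "f x = 1 / (2 * pi) * (LINT y|lborel. F y * iexp (- y * x))"
proof -
  define \<gamma> :: "real \<Rightarrow> real" where "\<gamma> = std_normal_density"
  have \<gamma>m [measurable]: "\<gamma> \<in> borel_measurable borel" by (simp add: \<gamma>_def)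
  have fm [measurable]: "f \<in> borel_measurable borel" using intf by simp
  have Fm [measurable]: "F \<in> borel_measurable borel" using intF by simp
  define e where "e = (\<lambda>n. 1 / real (Suc n))"
  have e0: "e n > 0" for n by (simp add: e_def)
  have elim: "e \<longlonglongrightarrow> 0" unfolding e_def by (rule LIMSEQ_Suc) (rule lim_1_over_n)
  have int\<gamma>: "integrable lborel (\<lambda>y. \<gamma> (e n * y))" for n
    using lborel_integrable_real_affine[of \<gamma> "e n" 0] e0[of n] integrable_std_normal_moment[of 0]
    by (simp add: \<gamma>_def)
  have id: "(LINT y|lborel. F y * iexp (- y * x) * of_real (\<gamma> (e n * y)))
     = of_real (sqrt (2 * pi)) * (LINT v|lborel. f (x + e n * v) * of_real (\<gamma> v))" for n
  proof -
    define g where "g = (\<lambda>y u. f u * iexp (y * u) * iexp (- y * x) * of_real (\<gamma> (e n * y)))"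
    have [measurable]: "case_prod g \<in> borel_measurable (lborel \<Otimes>\<^sub>M lborel)" unfolding g_def by simp
    have ng: "norm (g y u) = norm (f u) * \<gamma> (e n * y)" for y u
      by (simp add: g_def norm_mult \<gamma>_def)
    have intg: "integrable (lborel \<Otimes>\<^sub>M lborel) (case_prod g)"
    proof (rule lborel_pair.Fubini_integrable)
      show "integrable lborel (\<lambda>y. LINT u|lborel. norm (case_prod g (y, u)))"
        using int\<gamma>[of n] by (simp add: ng)
      show "AE y in lborel. integrable lborel (\<lambda>u. case_prod g (y, u))"
      proof (rule AE_I2)
        fix y
        have "integrable lborel (\<lambda>u. norm (f u) * \<gamma> (e n * y))" using intf by simp
        then show "integrable lborel (\<lambda>u. case_prod g (y, u))"
        proof (rule Bochner_Integration.integrable_bound)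
          show "(\<lambda>u. case_prod g (y, u)) \<in> borel_measurable lborel" by (simp add: g_def)
          show "AE u in lborel. norm (case_prod g (y, u)) \<le> norm (norm (f u) * \<gamma> (e n * y))"
            unfolding split_conv ng by simp
        qed
      qed
    qed simp
    have "(LINT y|lborel. F y * iexp (- y * x) * of_real (\<gamma> (e n * y))) = (LINT y|lborel. LINT u|lborel. g y u)"
      unfolding F g_def by (simp flip: integral_mult_left_zero)
    also have "\<dots> = (LINT u|lborel. LINT y|lborel. g y u)"
      using lborel_pair.Fubini_integral[OF intg] by simp
    also have "\<dots> = (LINT u|lborel. f u * of_real (sqrt (2 * pi) / e n * \<gamma> ((u - x) / e n)))"
    proof (rule Bochner_Integration.integral_cong[OF refl])
      fix u
      have "(LINT y|lborel. g y u) = (LINT y|lborel. f u * (of_real (\<gamma> (e n * y)) * iexp (y * (u - x))))"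
        unfolding g_def
        by (intro Bochner_Integration.integral_cong refl) (simp add: algebra_simps flip: exp_add)
      then show "(LINT y|lborel. g y u) = f u * of_real (sqrt (2 * pi) / e n * \<gamma> ((u - x) / e n))"
        using Gaussian_Fourier[OF e0[of n], of "u - x"] by (simp add: \<gamma>_def)
    qed
    also have "\<dots> = \<bar>e n\<bar> *\<^sub>R (LINT v|lborel. f (x + e n * v) * of_real (sqrt (2 * pi) / e n * \<gamma> ((x + e n * v - x) / e n)))"
      using e0[of n] by (intro lborel_integral_real_affine) auto
    also have "\<dots> = of_real (sqrt (2 * pi)) * (LINT v|lborel. f (x + e n * v) * of_real (\<gamma> v))"
    proof -
      have "(\<lambda>v. f (x + e n * v) * of_real (sqrt (2 * pi) / e n * \<gamma> ((x + e n * v - x) / e n)))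
        = (\<lambda>v. of_real (sqrt (2 * pi) / e n) * (f (x + e n * v) * of_real (\<gamma> v)))"
        using e0[of n] by (auto simp: fun_eq_iff)
      then show ?thesis using e0[of n] by (simp add: scaleR_conv_of_real)
    qed
    finally show ?thesis .
  qed
  have "(\<lambda>n. LINT y|lborel. F y * iexp (- y * x) * of_real (\<gamma> (e n * y)))
     \<longlonglongrightarrow> (LINT y|lborel. F y * iexp (- y * x) * of_real (\<gamma> (0 * y)))"
  proof (rule integral_dominated_convergence[where w = "\<lambda>y. norm (F y)"])
    show "integrable lborel (\<lambda>y. norm (F y))" using intF by simp
    show "AE y in lborel. (\<lambda>n. F y * iexp (- y * x) * of_real (\<gamma> (e n * y))) \<longlonglongrightarrow> F y * iexp (- y * x) * of_real (\<gamma> (0 * y))"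
    proof (rule AE_I2)
      fix y
      have "(\<lambda>n. \<gamma> (e n * y)) \<longlonglongrightarrow> \<gamma> (0 * y)"
        by (rule continuous_on_tendsto_compose[of UNIV])
           (auto simp: \<gamma>_def intro!: continuous_intros tendsto_mult elim)
      then show "(\<lambda>n. F y * iexp (- y * x) * of_real (\<gamma> (e n * y))) \<longlonglongrightarrow> F y * iexp (- y * x) * of_real (\<gamma> (0 * y))"
        by (intro tendsto_intros)
    qed
    show "AE y in lborel. norm (F y * iexp (- y * x) * of_real (\<gamma> (e n * y))) \<le> norm (F y)" for n
      by (rule AE_I2) (auto simp: norm_mult \<gamma>_def intro!: mult_left_le std_normal_density_bounded)
  qed auto
  moreover have "(\<lambda>n. LINT v|lborel. f (x + e n * v) * of_real (\<gamma> v))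
     \<longlonglongrightarrow> (LINT v|lborel. f x * of_real (\<gamma> v))"
  proof (rule integral_dominated_convergence[where w = "\<lambda>v. B * \<gamma> v"])
    show "integrable lborel (\<lambda>v. B * \<gamma> v)" using integrable_std_normal_moment[of 0] by (simp add: \<gamma>_def)
    show "AE v in lborel. (\<lambda>n. f (x + e n * v) * of_real (\<gamma> v)) \<longlonglongrightarrow> f x * of_real (\<gamma> v)"
    proof (rule AE_I2)
      fix v
      have "(\<lambda>n. x + e n * v) \<longlonglongrightarrow> x + 0 * v" by (intro tendsto_intros elim)
      then have "(\<lambda>n. f (x + e n * v)) \<longlonglongrightarrow> f x"
        using continuous_on_tendsto_compose[OF cont] by simp
      then show "(\<lambda>n. f (x + e n * v) * of_real (\<gamma> v)) \<longlonglongrightarrow> f x * of_real (\<gamma> v)"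
        by (intro tendsto_intros)
    qed
    show "AE v in lborel. norm (f (x + e n * v) * of_real (\<gamma> v)) \<le> B * \<gamma> v" for n
      by (rule AE_I2) (auto simp: norm_mult \<gamma>_def intro!: mult_right_mono bdd)
  qed auto
  then have "(\<lambda>n. LINT y|lborel. F y * iexp (- y * x) * of_real (\<gamma> (e n * y)))
     \<longlonglongrightarrow> of_real (sqrt (2 * pi)) * (LINT v|lborel. f x * of_real (\<gamma> v))"
    unfolding id by (intro tendsto_intros)
  ultimately have "(LINT y|lborel. F y * iexp (- y * x) * of_real (\<gamma> (0 * y)))
      = of_real (sqrt (2 * pi)) * (LINT v|lborel. f x * of_real (\<gamma> v))"
    by (rule LIMSEQ_unique)
  also have "(LINT v|lborel. f x * of_real (\<gamma> v)) = f x"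
    using integral_std_normal_moment_even[of 0] by (simp add: \<gamma>_def)
  \<comment> \<open>The density at 0 is 1/sqrt(2 pi); together with the factor sqrt(2 pi) from the
    Gaussian transform it makes up 2 pi.\<close>
  also have "(\<lambda>y. F y * iexp (- y * x) * of_real (\<gamma> (0 * y))) = (\<lambda>y. F y * iexp (- y * x) * of_real (1 / sqrt (2 * pi)))"
    by (simp add: \<gamma>_def normal_density_def)
  finally have "(LINT y|lborel. F y * iexp (- y * x)) * of_real (1 / sqrt (2 * pi)) = of_real (sqrt (2 * pi)) * f x"
    by (simp only: integral_mult_left_zero)
  moreover have "sqrt (2 * pi) * (1 / sqrt (2 * pi)) = 1" "sqrt (2 * pi) * sqrt (2 * pi) = 2 * pi" by auto
  then have "(of_real (sqrt (2 * pi)) * of_real (1 / sqrt (2 * pi)) :: complex) = 1"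
    "(of_real (sqrt (2 * pi)) * of_real (sqrt (2 * pi)) :: complex) = of_real (2 * pi)"
    by (simp_all only: of_real_mult[symmetric] of_real_1)
  ultimately have "(LINT y|lborel. F y * iexp (- y * x)) = of_real (2 * pi) * f x"
    by algebra
  then show ?thesis by simp
qed

section \<open>Completed Mellin transforms\<close>

lemma exp_mult_of_real: "exp (of_real a * of_real u) = (of_real (exp (a * u)) :: complex)"
  by (metis exp_of_real of_real_mult)

lemma exp_Complex: "exp (Complex c y * of_real u) = of_real (exp (c * u)) * iexp (y * u)"
proof -
  have "Complex c y * of_real u = of_real (c * u) + \<i> * of_real (y * u)" by (simp add: complex_eq_iff)
  then show ?thesis by (simp only: exp_add exp_of_real)
qed

lemma integrable_exp_half_line:
  fixes a :: real
  assumes "a > 0"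
  shows "integrable lborel (\<lambda>u. indicator {0..} u * exp (- a * u))"
proof -
  have "integrable lborel (\<lambda>x::real. exp (- x) * indicator {0..} x)"
    using has_bochner_integral_I0i_power_exp_m'[of 0] by (simp add: has_bochner_integral_iff)
  from lborel_integrable_real_affine[OF this, of a 0]
  have "integrable lborel (\<lambda>x. exp (- (a * x)) * indicator {0..} (a * x))" using assms by simp
  also have "(\<lambda>x. exp (- (a * x)) * indicator {0..} (a * x)) = (\<lambda>u. indicator {0..} u * exp (- a * u))"
    using assms by (auto simp: fun_eq_iff indicator_def zero_le_mult_iff)
  finally show ?thesis .
qed

lemma integrable_exp_abs:
  fixes a :: real
  assumes "a > 0"
  shows "integrable lborel (\<lambda>u. exp (- a * \<bar>u\<bar>))"
proof -
  have 1: "integrable lborel (\<lambda>u. indicator {0..} u * exp (- a * u))" by (rule integrable_exp_half_line) fact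
  have 2: "integrable lborel (\<lambda>u. indicator {0..} (- u) * exp (- a * (- u)))"
    using lborel_integrable_real_affine[OF 1, of "-1" 0] by simp
  show ?thesis
    by (rule Bochner_Integration.integrable_bound[OF Bochner_Integration.integrable_add[OF 1 2]])
       (auto intro!: AE_I2 split: split_indicator)
qed

lemma has_bochner_integral_exp_half_line:
  fixes s :: complex
  assumes "Re s < 0"
  shows "has_bochner_integral lborel (\<lambda>u. indicator {0..} u *\<^sub>R exp (s * of_real u)) (- 1 / s)"
proof -
  have s0: "s \<noteq> 0" using assms by auto
  have int: "integrable lborel (\<lambda>u. indicator {0..} u *\<^sub>R exp (s * of_real u))"
    by (rule Bochner_Integration.integrable_bound[OF integrable_exp_half_line[of "- Re s"]])
       (use assms in \<open>auto intro!: AE_I2 split: split_indicator\<close>)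
  have "(LBINT u=0..\<infinity>. exp (s * of_real u)) = 0 - 1 / s"
  proof (rule interval_integral_FTC_integrable[where F = "\<lambda>u. exp (s * of_real u) / s"])
    show "((\<lambda>u. exp (s * of_real u) / s) has_vector_derivative exp (s * of_real x)) (at x)" for x
      by (rule has_vector_derivative_real_field[where f = "\<lambda>z. exp (s * z) / s"])
         (use s0 in \<open>auto intro!: derivative_eq_intros\<close>)
    show "isCont (\<lambda>u. exp (s * of_real u)) x" for x by (intro continuous_intros)
    have "set_integrable lborel {0..} (\<lambda>u. exp (s * complex_of_real u))" using int by (simp add: set_integrable_def)
    then show "set_integrable lborel (einterval 0 \<infinity>) (\<lambda>u. exp (s * complex_of_real u))"
      by (rule set_integrable_subset) (auto simp: einterval_def)
    have "((\<lambda>u. exp (s * of_real u) / s) \<longlongrightarrow> exp (s * of_real 0) / s) (at_right 0)"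
      using s0 by (intro tendsto_intros)
    then show "(((\<lambda>u. exp (s * of_real u) / s) \<circ> real_of_ereal) \<longlongrightarrow> 1 / s) (at_right 0)"
      by (simp add: ereal_tendsto_simps1 zero_ereal_def)
    have "((\<lambda>u. exp (Re s * u) / norm s) \<longlongrightarrow> 0) at_top"
      using assms s0 by real_asymp
    then have "((\<lambda>u. exp (s * of_real u) / s) \<longlongrightarrow> 0) at_top"
      by (subst tendsto_norm_zero_iff[symmetric]) (simp add: norm_divide)
    then show "(((\<lambda>u. exp (s * of_real u) / s) \<circ> real_of_ereal) \<longlongrightarrow> 0) (at_left \<infinity>)"
      by (simp add: ereal_tendsto_simps1)
  qed simp
  also have "(LBINT u=0..\<infinity>. exp (s * of_real u)) = (LINT u|lborel. indicator {0<..} u *\<^sub>R exp (s * of_real u))"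
    unfolding interval_lebesgue_integral_def set_lebesgue_integral_def by (simp add: einterval_def greaterThan_def)
  also have "\<dots> = (LINT u|lborel. indicator {0..} u *\<^sub>R exp (s * of_real u))"
  proof (rule integral_cong_AE)
    show "AE u in lborel. indicator {0<..} u *\<^sub>R exp (s * complex_of_real u) = indicator {0..} u *\<^sub>R exp (s * complex_of_real u)"
      using AE_lborel_singleton[of "0::real"] by eventually_elim (auto split: split_indicator)
  qed auto
  finally show ?thesis using int by (simp add: has_bochner_integral_iff)
qed

text \<open>For glueing the half lines after the modular relation has rewritten g on u < 0. The
  point u = 0, where X and Y may disagree, is a null set.\<close>

lemma has_bochner_integral_two_sided:
  fixes g X Y :: "real \<Rightarrow> complex"
  assumes [measurable]: "g \<in> borel_measurable borel"
    and X: "has_bochner_integral lborel (\<lambda>u. indicator {0..} u *\<^sub>R X u) x"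
    and Y: "has_bochner_integral lborel (\<lambda>u. indicator {0..} u *\<^sub>R Y u) y"
    and gX: "\<And>u. u > 0 \<Longrightarrow> g u = X u" and gY: "\<And>u. u > 0 \<Longrightarrow> g (- u) = Y u"
  shows "has_bochner_integral lborel g (x + y)"
proof -
  have Y': "has_bochner_integral lborel (\<lambda>u. indicator {0..} (0 + (-1) * u) *\<^sub>R Y (0 + (-1) * u)) y"
    using lborel_has_bochner_integral_real_affine_iff[of "-1" "\<lambda>u. indicator {0..} u *\<^sub>R Y u" y 0] Y by simp
  have sum: "has_bochner_integral lborel (\<lambda>u. indicator {0..} u *\<^sub>R X u + indicator {0..} (0 + (-1) * u) *\<^sub>R Y (0 + (-1) * u)) (x + y)"
    by (rule has_bochner_integral_add[OF X Y'])
  have m: "(\<lambda>u. indicator {0..} u *\<^sub>R X u + indicator {0..} (0 + (-1) * u) *\<^sub>R Y (0 + (-1) * u)) \<in> borel_measurable lborel"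
    using sum by (simp only: has_bochner_integral_iff borel_measurable_integrable)
  have ae: "AE u in lborel. indicator {0..} u *\<^sub>R X u + indicator {0..} (0 + (-1) * u) *\<^sub>R Y (0 + (-1) * u) = g u"
    using AE_lborel_singleton[of "0::real"]
  proof eventually_elim
    case (elim u)
    then show ?case using gX[of u] gY[of "- u"] by (auto split: split_indicator)
  qed
  have gm: "g \<in> borel_measurable lborel" by simp
  show ?thesis using has_bochner_integral_cong_AE[OF m gm ae] sum by blast
qed

text \<open>With x = exp u this is the part x \<ge> 1 of the Mellin integral of h - A, with measure
  dx/x; rapid decay of h - A will make it entire in s.\<close>

definition half_mellin :: "(real \<Rightarrow> complex) \<Rightarrow> complex \<Rightarrow> complex \<Rightarrow> complex" where
  "half_mellin h A s = (LINT u|lborel. indicator {0..} u *\<^sub>R (exp (s * of_real u) * (h u - A)))"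

text \<open>The continued Mellin transform of \<open>h - A\<close>: the half line \<open>u < 0\<close> is folded onto \<open>u > 0\<close> by the
  relation \<open>h (- u) = exp (R * u) * cnj (h u)\<close>.\<close>
definition completed :: "(real \<Rightarrow> complex) \<Rightarrow> real \<Rightarrow> complex \<Rightarrow> complex \<Rightarrow> complex" where
  "completed h R A s = half_mellin h A s + cnj (half_mellin h A (of_real R - cnj s)) - A / s + cnj A / (s - of_real R)"

text \<open>A theta function of weight \<open>R\<close> in the logarithmic variable: with x = exp u,
  \<open>sym\<close> is h(1/x) = x^R cnj(h x). The conjugation reflects that the dual coefficients
  are the conjugate ones. \<open>decay\<close> holds for every \<open>K\<close>, so h approaches its
  constant term faster than any negative power of x.\<close>

locale theta_fun =
  fixes h :: "real \<Rightarrow> complex" and R :: real and A :: complex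
  assumes R_pos: "R > 0"
    and cont: "continuous_on UNIV h"
    and sym: "h (- u) = of_real (exp (R * u)) * cnj (h u)"
    and decay: "\<exists>C. \<forall>u\<ge>0. norm (h u - A) \<le> C * exp (- K * u)"
begin

lemma decay_obtain:
  obtains C where "C > 0" "\<And>u. u \<ge> 0 \<Longrightarrow> norm (h u - A) \<le> C * exp (- K * u)"
proof -
  obtain C where C: "\<And>u. u \<ge> 0 \<Longrightarrow> norm (h u - A) \<le> C * exp (- K * u)" using decay[of K] by blast
  have "norm (h u - A) \<le> max 1 C * exp (- K * u)" if "u \<ge> 0" for u
    by (rule order_trans[OF C[OF that]]) (intro mult_right_mono, auto)
  then show ?thesis by (intro that[of "max 1 C"]) auto
qed

lemma h_measurable [measurable]: "h \<in> borel_measurable borel"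
  using cont by (rule borel_measurable_continuous_onI)

lemma half_mellin_integrable:
  "integrable lborel (\<lambda>u. indicator {0..} u *\<^sub>R (exp (s * of_real u) * (h u - A)))"
proof -
  obtain C where C: "C > 0" "\<And>u. u \<ge> 0 \<Longrightarrow> norm (h u - A) \<le> C * exp (- (Re s + 1) * u)"
    using decay_obtain[of "Re s + 1"] by metis
  show ?thesis
  proof (rule Bochner_Integration.integrable_bound)
    show "integrable lborel (\<lambda>u. C * (indicator {0..} u * exp (- 1 * u)))"
      by (intro integrable_mult_right integrable_exp_half_line) auto
    show "AE u in lborel. norm (indicator {0..} u *\<^sub>R (exp (s * of_real u) * (h u - A)))
       \<le> norm (C * (indicator {0..} u * exp (- 1 * u)))"
    proof (rule AE_I2)
      fix u :: real
      show "norm (indicator {0..} u *\<^sub>R (exp (s * of_real u) * (h u - A)))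
       \<le> norm (C * (indicator {0..} u * exp (- 1 * u)))"
      proof (cases "u \<ge> 0")
        case True
        have "exp (Re s * u) * norm (h u - A) \<le> exp (Re s * u) * (C * exp (- (Re s + 1) * u))"
          using C(2)[OF True] by (intro mult_left_mono) auto
        also have "\<dots> = C * exp (- u)" by (simp add: algebra_simps flip: exp_add)
        finally show ?thesis using True C by (simp add: norm_mult)
      qed auto
    qed
  qed simp
qed

text \<open>For u \<ge> 0 the modulus of the integrand depends on s only through Re s and increases
  with it.\<close>

lemma half_mellin_bounded:
  "\<exists>B. \<forall>s. Re s \<le> L \<longrightarrow> norm (half_mellin h A s) \<le> B"
proof -
  let ?w = "\<lambda>u. indicator {0..} u *\<^sub>R (exp (of_real L * of_real u) * (h u - A))"
  have "norm (half_mellin h A s) \<le> (LINT u|lborel. norm (?w u))" if "Re s \<le> L" for s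
    unfolding half_mellin_def
  proof (rule Bochner_Integration.integral_norm_bound_integral)
    show "integrable lborel (\<lambda>u. norm (?w u))" by (rule integrable_norm[OF half_mellin_integrable])
    show "norm (indicator {0..} u *\<^sub>R (exp (s * of_real u) * (h u - A))) \<le> norm (?w u)" for u
      using that by (auto simp: norm_mult split: split_indicator intro!: mult_right_mono)
  qed (rule half_mellin_integrable)
  then show ?thesis by blast
qed

text \<open>The integrals over [0, n] are holomorphic by differentiation under the integral, and
  they converge locally uniformly.\<close>

lemma half_mellin_holomorphic: "half_mellin h A holomorphic_on UNIV"
proof (rule holomorphic_uniform_sequence)
  define J where "J = (\<lambda>n::nat. \<lambda>s. integral (cbox 0 (real n)) (\<lambda>u. exp (s * of_real u) * (h u - A)))"
  show "J n holomorphic_on UNIV" for n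
    unfolding J_def
  proof (rule leibniz_rule_holomorphic)
    show "((\<lambda>s. exp (s * of_real u) * (h u - A)) has_field_derivative of_real u * exp (s * of_real u) * (h u - A)) (at s within UNIV)" for s u
      by (auto intro!: derivative_eq_intros)
    show "(\<lambda>u. exp (s * of_real u) * (h u - A)) integrable_on cbox 0 (real n)" for s
      by (intro integrable_continuous continuous_intros continuous_on_subset[OF cont]) auto
    show "continuous_on (UNIV \<times> cbox 0 (real n)) (\<lambda>(s, u). of_real u * exp (s * of_real u) * (h u - A))"
      unfolding case_prod_unfold
      by (intro continuous_intros continuous_on_compose2[OF cont]) auto
  qed auto
  fix x :: complex
  define L where "L = Re x + 1"
  \<comment> \<open>Of the two extra powers of exp(-u) one keeps the tail integrable and the other
    gives the rate exp(-n).\<close>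
  obtain C where C: "C > 0" "\<And>u. u \<ge> 0 \<Longrightarrow> norm (h u - A) \<le> C * exp (- (L + 2) * u)"
    using decay_obtain[of "L + 2"] by metis
  define W where "W = (LINT u|lborel. C * (indicator {0..} u * exp (- 1 * u)))"
  have est: "norm (half_mellin h A s - J n s) \<le> W * exp (- real n)" if "Re s \<le> L" for s n
  proof -
    have si: "set_integrable lborel {0..real n} (\<lambda>u. exp (s * of_real u) * (h u - A))"
      by (rule set_integrable_subset[of lborel "{0..}"]) (use half_mellin_integrable in \<open>auto simp: set_integrable_def\<close>)
    have "J n s = (LINT u|lborel. indicator {0..real n} u *\<^sub>R (exp (s * of_real u) * (h u - A)))"
      using set_borel_integral_eq_integral(2)[OF si] by (simp add: J_def set_lebesgue_integral_def)
    then have "half_mellin h A s - J n s = (LINT u|lborel. indicator {0..} u *\<^sub>R (exp (s * of_real u) * (h u - A)) - indicator {0..real n} u *\<^sub>R (exp (s * of_real u) * (h u - A)))"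
      unfolding half_mellin_def using half_mellin_integrable si
      by (subst Bochner_Integration.integral_diff) (auto simp: set_integrable_def)
    also have "norm \<dots> \<le> (LINT u|lborel. exp (- real n) * (C * (indicator {0..} u * exp (- 1 * u))))"
    proof (rule Bochner_Integration.integral_norm_bound_integral)
      show "integrable lborel (\<lambda>u. indicator {0..} u *\<^sub>R (exp (s * of_real u) * (h u - A)) - indicator {0..real n} u *\<^sub>R (exp (s * of_real u) * (h u - A)))"
        using half_mellin_integrable si by (auto simp: set_integrable_def)
      show "integrable lborel (\<lambda>u. exp (- real n) * (C * (indicator {0..} u * exp (- 1 * u))))"
        by (intro integrable_mult_right integrable_exp_half_line) auto
      fix u :: real
      show "norm (indicator {0..} u *\<^sub>R (exp (s * of_real u) * (h u - A)) - indicator {0..real n} u *\<^sub>R (exp (s * of_real u) * (h u - A)))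
        \<le> exp (- real n) * (C * (indicator {0..} u * exp (- 1 * u)))"
      proof (cases "u > real n")
        case True
        then have u: "u \<ge> 0" by linarith
        have "exp (Re s * u) * norm (h u - A) \<le> exp (L * u) * (C * exp (- (L + 2) * u))"
          using C(2)[OF u] that u by (intro mult_mono) (auto intro: mult_right_mono)
        also have "\<dots> = C * (exp (- u) * exp (- u))" by (simp add: algebra_simps flip: exp_add)
        also have "\<dots> \<le> C * (exp (- real n) * exp (- u))"
          using True C by (intro mult_left_mono mult_right_mono) auto
        finally show ?thesis using True u by (simp add: norm_mult mult_ac)
      next
        case False
        then show ?thesis using C by (auto split: split_indicator)
      qed
    qed
    also have "\<dots> = W * exp (- real n)" by (simp add: W_def)
    finally show ?thesis .
  qed
  have "uniform_limit (cball x 1) J (half_mellin h A) sequentially"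
  proof (rule uniform_limitI)
    fix e :: real assume "e > 0"
    have "(\<lambda>n. W * exp (- real n)) \<longlonglongrightarrow> 0" by real_asymp
    from order_tendstoD(2)[OF this \<open>e > 0\<close>]
    show "\<forall>\<^sub>F n in sequentially. \<forall>s\<in>cball x 1. dist (J n s) (half_mellin h A s) < e"
    proof eventually_elim
      case (elim n)
      show ?case
      proof
        fix s assume "s \<in> cball x 1"
        then have "Re s - Re x \<le> 1" using complex_Re_le_cmod[of "s - x"] by (simp add: dist_norm norm_minus_commute)
        then have "norm (half_mellin h A s - J n s) \<le> W * exp (- real n)" by (intro est) (simp add: L_def)
        then show "dist (J n s) (half_mellin h A s) < e" using elim by (simp add: dist_norm norm_minus_commute)
      qed
    qed
  qed
  then show "\<exists>d>0. cball x d \<subseteq> UNIV \<and> uniform_limit (cball x d) J (half_mellin h A) sequentially"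
    by (intro exI[of _ 1]) auto
qed simp

lemma half_mellin_cnj_holomorphic:
  "(\<lambda>s. cnj (half_mellin h A (of_real R - cnj s))) holomorphic_on UNIV"
proof -
  have "(\<lambda>z. half_mellin h A (of_real R - z)) holomorphic_on UNIV"
  proof -
    have "(half_mellin h A \<circ> (\<lambda>z. of_real R - z)) holomorphic_on UNIV"
      by (intro holomorphic_on_compose holomorphic_on_subset[OF half_mellin_holomorphic] holomorphic_intros) auto
    then show ?thesis by (simp add: o_def)
  qed
  then show ?thesis
    using holomorphic_on_compose_cnj_cnj[of "\<lambda>z. half_mellin h A (of_real R - z)" UNIV] surjI[of cnj cnj]
    by (simp add: o_def)
qed

lemma half_mellin_analytic: "half_mellin h A analytic_on S"
  using half_mellin_holomorphic by (auto intro: analytic_on_subset simp: analytic_on_open[symmetric])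

lemma half_mellin_cnj_analytic: "(\<lambda>s. cnj (half_mellin h A (of_real R - cnj s))) analytic_on S"
  using half_mellin_cnj_holomorphic by (auto intro: analytic_on_subset simp: analytic_on_open[symmetric])

lemma completed_analytic: "0 \<notin> S \<Longrightarrow> of_real R \<notin> S \<Longrightarrow> completed h R A analytic_on S"
proof -
  assume S: "0 \<notin> S" "of_real R \<notin> S"
  note half_mellin_analytic[of S] half_mellin_cnj_analytic[of S]
  then show ?thesis unfolding completed_def[abs_def]
    by (intro analytic_intros) (use S in auto)
qed

lemma completed_analytic_zero: "A = 0 \<Longrightarrow> completed h R A analytic_on S"
proof -
  assume S: "A = 0"
  note half_mellin_analytic[of S] half_mellin_cnj_analytic[of S]
  then show ?thesis unfolding completed_def[abs_def] S
    by (auto intro!: analytic_intros)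
qed

lemma completed_meromorphic: "completed h R A meromorphic_on S"
proof -
  note half_mellin_analytic[of S] half_mellin_cnj_analytic[of S]
  then show ?thesis unfolding completed_def[abs_def]
    by (intro meromorphic_intros analytic_on_imp_meromorphic_on) (auto intro!: analytic_intros)
qed

lemma completed_reflect: "completed h R A (of_real R - cnj s) = cnj (completed h R A s)"
proof -
  have e: "A / (cnj s - of_real R) = - (A / (of_real R - cnj s))" "cnj A / (- cnj s) = - (cnj A / cnj s)"
    by (metis minus_diff_eq minus_divide_right) simp
  have "of_real R - cnj (of_real R - cnj s) = s" "of_real R - cnj s - of_real R = - cnj s" by auto
  then show ?thesis unfolding completed_def by (simp add: e)
qed

lemma completed_real: "Re s = R / 2 \<Longrightarrow> completed h R A s \<in> \<real>"
proof -
  assume "Re s = R / 2"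
  then have "of_real R - cnj s = s" by (simp add: complex_eq_iff)
  then show ?thesis using completed_reflect[of s] by (simp add: Reals_cnj_iff)
qed

lemma completed_bounded_strip:
  "\<exists>B. \<forall>s. a \<le> Re s \<longrightarrow> Re s \<le> b \<longrightarrow> 1 \<le> \<bar>Im s\<bar> \<longrightarrow> norm (completed h R A s) \<le> B"
proof -
  obtain B1 where B1: "\<And>s. Re s \<le> b \<Longrightarrow> norm (half_mellin h A s) \<le> B1" using half_mellin_bounded by metis
  obtain B2 where B2: "\<And>s. Re s \<le> R - a \<Longrightarrow> norm (half_mellin h A s) \<le> B2" using half_mellin_bounded by metis
  have "norm (completed h R A s) \<le> B1 + B2 + norm A + norm A" if s: "a \<le> Re s" "Re s \<le> b" "1 \<le> \<bar>Im s\<bar>" for s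
  proof -
    have n: "1 \<le> norm s" "1 \<le> norm (s - of_real R)"
      using abs_Im_le_cmod[of s] abs_Im_le_cmod[of "s - of_real R"] s by auto
    have "norm (A / s) \<le> norm A" "norm (cnj A / (s - of_real R)) \<le> norm A"
      using n frac_le[of "norm A" "norm A" 1 "norm s"] frac_le[of "norm A" "norm A" 1 "norm (s - of_real R)"]
      by (auto simp: norm_divide)
    moreover have "norm (half_mellin h A s) \<le> B1" "norm (cnj (half_mellin h A (of_real R - cnj s))) \<le> B2"
      using B1[of s] B2[of "of_real R - cnj s"] s by auto
    moreover have "norm (completed h R A s) \<le> norm (half_mellin h A s) + norm (cnj (half_mellin h A (of_real R - cnj s))) + norm (A / s) + norm (cnj A / (s - of_real R))"
      unfolding completed_def by (intro order_trans[OF norm_triangle_ineq] order_trans[OF norm_triangle_ineq4] add_mono order_refl)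
    ultimately show ?thesis by linarith
  qed
  then show ?thesis by blast
qed

lemma half_mellin_has_bochner:
  "has_bochner_integral lborel (\<lambda>u. indicator {0..} u *\<^sub>R (exp (s * of_real u) * (h u - A))) (half_mellin h A s)"
  using half_mellin_integrable by (simp add: half_mellin_def has_bochner_integral_iff)

lemma half_mellin_cnj_has_bochner:
  "has_bochner_integral lborel (\<lambda>u. indicator {0..} u *\<^sub>R (exp (s * of_real u) * cnj (h u - A))) (cnj (half_mellin h A (cnj s)))"
  using has_bochner_integral_bounded_linear[OF bounded_linear_cnj half_mellin_has_bochner[of "cnj s"]]
  by (simp add: exp_cnj)

text \<open>Both main terms are removed, \<open>A\<close> for u \<rightarrow> \<infinity> and
  \<open>cnj A * exp (- R * u)\<close> for u \<rightarrow> -\<infinity>. Each is the mirror image of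
  the other under the modular relation, so the relation survives, and exp(s u) times the remainder
  is integrable in the strip between the poles 0 and \<open>R\<close>.\<close>

definition reduced :: "real \<Rightarrow> complex" where
  "reduced u = h u - A - cnj A * of_real (exp (- R * u))"

lemma reduced_reflect: "reduced (- u) = of_real (exp (R * u)) * cnj (reduced u)"
  by (simp add: reduced_def sym exp_minus field_simps)

lemma continuous_reduced: "continuous_on UNIV reduced"
  unfolding reduced_def[abs_def] by (intro continuous_intros cont)

lemma reduced_measurable [measurable]: "reduced \<in> borel_measurable borel"
  using continuous_reduced by (rule borel_measurable_continuous_onI)

text \<open>The pole terms come from the subtracted main terms: on u > 0 the term with
  \<open>cnj A\<close> integrates to cnj A/(s - R), and on u < 0, folded by
  \<open>reduced_reflect\<close>, the remaining one integrates to -A/s.\<close>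

lemma mellin_reduced:
  assumes s: "0 < Re s" "Re s < R"
  shows "has_bochner_integral lborel (\<lambda>u. exp (s * of_real u) * reduced u) (completed h R A s)"
proof -
  define x where "x = half_mellin h A s + (- cnj A) * (- 1 / (s - of_real R))"
  define y where "y = cnj (half_mellin h A (cnj (of_real R - s))) + (- A) * (- 1 / (- s))"
  have "has_bochner_integral lborel (\<lambda>u. exp (s * of_real u) * reduced u) (x + y)"
  proof (rule has_bochner_integral_two_sided)
    have "has_bochner_integral lborel
      (\<lambda>u. indicator {0..} u *\<^sub>R (exp (s * of_real u) * (h u - A)) + (- cnj A) * (indicator {0..} u *\<^sub>R exp ((s - of_real R) * of_real u))) x"
      unfolding x_def
      by (intro has_bochner_integral_add has_bochner_integral_mult_right half_mellin_has_bochner has_bochner_integral_exp_half_line)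
         (use s in auto)
    then show "has_bochner_integral lborel (\<lambda>u. indicator {0..} u *\<^sub>R
        ((exp (s * of_real u) * (h u - A)) + (- cnj A) * exp ((s - of_real R) * of_real u))) x"
      by (simp add: scaleR_right_distrib scaleR_right_diff_distrib)
    have "has_bochner_integral lborel
      (\<lambda>u. indicator {0..} u *\<^sub>R (exp ((of_real R - s) * of_real u) * cnj (h u - A)) + (- A) * (indicator {0..} u *\<^sub>R exp ((- s) * of_real u))) y"
      unfolding y_def
      by (intro has_bochner_integral_add has_bochner_integral_mult_right half_mellin_cnj_has_bochner has_bochner_integral_exp_half_line)
         (use s in auto)
    then show "has_bochner_integral lborel (\<lambda>u. indicator {0..} u *\<^sub>R
        ((exp ((of_real R - s) * of_real u) * cnj (h u - A)) + (- A) * exp ((- s) * of_real u))) y"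
      by (simp add: scaleR_right_distrib scaleR_right_diff_distrib)
    show "exp (s * of_real u) * reduced u = exp (s * of_real u) * (h u - A) + - cnj A * exp ((s - of_real R) * of_real u)" for u
      by (simp add: reduced_def algebra_simps exp_diff exp_minus exp_mult_of_real field_simps)
    show "exp (s * of_real (- u)) * reduced (- u) = exp ((of_real R - s) * of_real u) * cnj (h u - A) + - A * exp ((- s) * of_real u)" for u
      unfolding reduced_reflect
      by (simp add: reduced_def algebra_simps exp_diff exp_minus exp_mult_of_real field_simps)
  qed measurable
  also have "x + y = completed h R A s"
    by (simp add: x_def y_def completed_def)
  finally show ?thesis .
qed

text \<open>On u < 0 the difference h - A still contains cnj A exp(-R u), whose integral against
  exp(s u) converges only for Re s > \<open>R\<close>; if \<open>A\<close> vanishes there is no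
  obstruction.\<close>

lemma mellin_full:
  assumes s: "A = 0 \<or> Re s > R" "0 < Re s"
  shows "has_bochner_integral lborel (\<lambda>u. exp (s * of_real u) * (h u - A)) (completed h R A s)"
proof -
  define y where "y = cnj (half_mellin h A (cnj (of_real R - s))) + (cnj A * (- 1 / (of_real R - s)) + (- A) * (- 1 / (- s)))"
  have E: "has_bochner_integral lborel (\<lambda>u. c * (indicator {0..} u *\<^sub>R exp (z * of_real u))) (c * (- 1 / z))"
    if "c = 0 \<or> Re z < 0" for c z :: complex
    using that has_bochner_integral_mult_right[OF has_bochner_integral_exp_half_line[of z], of c] by (cases "c = 0") auto
  have "has_bochner_integral lborel (\<lambda>u. exp (s * of_real u) * (h u - A)) (half_mellin h A s + y)"
  proof (rule has_bochner_integral_two_sided[OF _ half_mellin_has_bochner])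
    have "has_bochner_integral lborel
      (\<lambda>u. indicator {0..} u *\<^sub>R (exp ((of_real R - s) * of_real u) * cnj (h u - A)) +
        (cnj A * (indicator {0..} u *\<^sub>R exp ((of_real R - s) * of_real u)) + (- A) * (indicator {0..} u *\<^sub>R exp ((- s) * of_real u)))) y"
      unfolding y_def
      by (intro has_bochner_integral_add half_mellin_cnj_has_bochner E)
         (use s in auto)
    then show "has_bochner_integral lborel (\<lambda>u. indicator {0..} u *\<^sub>R
        (exp ((of_real R - s) * of_real u) * cnj (h u - A) + (cnj A * exp ((of_real R - s) * of_real u) + (- A) * exp ((- s) * of_real u)))) y"
      by (simp add: scaleR_right_distrib scaleR_right_diff_distrib)
    show "exp (s * of_real (- u)) * (h (- u) - A) = exp ((of_real R - s) * of_real u) * cnj (h u - A) + (cnj A * exp ((of_real R - s) * of_real u) + (- A) * exp ((- s) * of_real u))" for u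
      unfolding sym
      by (simp add: algebra_simps exp_diff exp_minus exp_mult_of_real field_simps)
  qed auto
  also have "half_mellin h A s + y = completed h R A s"
  proof -
    have "- 1 / (of_real R - s) = 1 / (s - of_real R)"
      by (metis minus_diff_eq minus_divide_left minus_divide_right)
    then show ?thesis by (simp add: y_def completed_def)
  qed
  finally show ?thesis .
qed

text \<open>If \<open>A\<close> \<noteq> 0 and Re s \<le> \<open>R\<close>, the integrand stays
  above |A|/2 in modulus as u \<rightarrow> -\<infinity>. So convergence alone decides which case of
  \<open>mellin_full\<close> applies. This relates the half plane of absolute convergence to the
  pole at a stage where only integrability is known.\<close>

lemma mellin_full_converse:
  assumes int: "integrable lborel (\<lambda>u. exp (s * of_real u) * (h u - A))"
  shows "A = 0 \<or> Re s > R"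
proof (rule ccontr)
  assume "\<not> ?thesis"
  then have A: "A \<noteq> 0" and s: "Re s \<le> R" by auto
  obtain C where C: "C > 0" "\<And>u. u \<ge> 0 \<Longrightarrow> norm (h u - A) \<le> C * exp (- 1 * u)"
    using decay_obtain[of 1] by metis
  have "((\<lambda>u. C * exp (- u) + norm A * exp (- R * u)) \<longlongrightarrow> 0) at_top"
  proof -
    have 1: "((\<lambda>u. C * exp (- u)) \<longlongrightarrow> 0) at_top" by real_asymp
    have "((\<lambda>u. exp (- R * u)) \<longlongrightarrow> 0) at_top" using R_pos by real_asymp
    then have 2: "((\<lambda>u. norm A * exp (- R * u)) \<longlongrightarrow> 0) at_top" by (rule tendsto_mult_right_zero)
    show ?thesis using tendsto_add[OF 1 2] by simp
  qed
  then have "eventually (\<lambda>u. C * exp (- u) + norm A * exp (- R * u) < norm A / 2) at_top"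
    using A by (intro order_tendstoD) auto
  then obtain V where V: "\<And>u. u \<ge> V \<Longrightarrow> C * exp (- u) + norm A * exp (- R * u) < norm A / 2"
    by (auto simp: eventually_at_top_linorder)
  define W where "W = max V 0"
  have lb: "norm A / 2 \<le> norm (exp (s * of_real (- u)) * (h (- u) - A))" if u: "u \<ge> W" for u
  proof -
    have u0: "u \<ge> 0" "u \<ge> V" using u by (auto simp: W_def)
    have eq: "exp (s * of_real (- u)) * (h (- u) - A) = exp ((of_real R - s) * of_real u) * (cnj (h u) - A * of_real (exp (- R * u)))"
      unfolding sym by (simp add: algebra_simps exp_diff exp_minus exp_mult_of_real field_simps)
    have "norm A - C * exp (- u) - norm A * exp (- R * u) \<le> norm (cnj (h u) - A * of_real (exp (- R * u)))"
    proof -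
      have "norm A \<le> norm (h u) + norm (h u - A)"
        using norm_triangle_ineq4[of "h u" "h u - A"] by simp
      moreover have "norm (cnj (h u)) - norm (A * of_real (exp (- R * u))) \<le> norm (cnj (h u) - A * of_real (exp (- R * u)))"
        by (rule norm_triangle_ineq2)
      ultimately show ?thesis using C(2)[OF u0(1)] by (simp add: norm_mult)
    qed
    then have 1: "norm A / 2 \<le> norm (cnj (h u) - A * of_real (exp (- R * u)))" using V[OF u0(2)] by linarith
    have "1 * (norm A / 2) \<le> exp ((R - Re s) * u) * norm (cnj (h u) - A * of_real (exp (- R * u)))"
      using 1 s u0 by (intro mult_mono) auto
    then show ?thesis unfolding eq norm_mult by simp
  qed
  have "integrable lborel (\<lambda>u. exp (s * of_real (0 + (-1) * u)) * (h (0 + (-1) * u) - A))"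
    by (rule lborel_integrable_real_affine[OF int]) auto
  then have i: "integrable lborel (\<lambda>u. norm (exp (s * of_real (- u)) * (h (- u) - A)))" by simp
  have "real n * (norm A / 2) \<le> (LINT u|lborel. norm (exp (s * of_real (- u)) * (h (- u) - A)))" for n
  proof -
    have "(LINT u|lborel. norm A / 2 * indicator {W..W + real n} u) \<le> (LINT u|lborel. norm (exp (s * of_real (- u)) * (h (- u) - A)))"
    proof (rule integral_mono[OF _ i])
      show "norm A / 2 * indicator {W..W + real n} u \<le> norm (exp (s * of_real (- u)) * (h (- u) - A))" for u
        using lb[of u] by (cases "u \<in> {W..W + real n}") (auto simp del: norm_mult)
    qed simp
    moreover have "(LINT u|lborel. norm A / 2 * indicator {W..W + real n} u) = real n * (norm A / 2)" by simp
    ultimately show ?thesis by (simp only:)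
  qed
  moreover obtain n where "real n * (norm A / 2) > (LINT u|lborel. norm (exp (s * of_real (- u)) * (h (- u) - A)))"
    using A reals_Archimedean3[of "norm A / 2"] by fastforce
  ultimately show False by (meson not_le)
qed

lemma mellin_full':
  assumes "integrable lborel (\<lambda>u. exp (s * of_real u) * (h u - A))" "0 < Re s"
  shows "(LINT u|lborel. exp (s * of_real u) * (h u - A)) = completed h R A s"
  by (rule has_bochner_integral_integral_eq[OF mellin_full[OF mellin_full_converse[OF assms(1)] assms(2)]])

text \<open>The weight exp(R u/2) makes the modulus even in u by \<open>reduced_reflect\<close>, so
  the estimate for u \<ge> 0 suffices.\<close>

lemma reduced_bound:
  obtains C where "C > 0" "\<And>u. norm (of_real (exp (R / 2 * u)) * reduced u) \<le> C * exp (- (R / 2) * \<bar>u\<bar>)"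
proof -
  obtain C where C: "C > 0" "\<And>u. u \<ge> 0 \<Longrightarrow> norm (h u - A) \<le> C * exp (- R * u)"
    using decay_obtain[of R] by metis
  have pos: "norm (of_real (exp (R / 2 * u)) * reduced u) \<le> (C + norm A) * exp (- (R / 2) * \<bar>u\<bar>)"
    if u: "u \<ge> 0" for u
  proof -
    have "norm (reduced u) \<le> norm (h u - A) + norm (cnj A * of_real (exp (- R * u)))"
      unfolding reduced_def by (rule norm_triangle_ineq4)
    also have "\<dots> \<le> (C + norm A) * exp (- R * u)"
      using C(2)[OF u] by (simp add: norm_mult algebra_simps)
    finally have "exp (R / 2 * u) * norm (reduced u) \<le> exp (R / 2 * u) * ((C + norm A) * exp (- R * u))"
      by (intro mult_left_mono) auto
    also have "\<dots> = (C + norm A) * (exp (R / 2 * u) * exp (- R * u))" by simp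
    also have "exp (R / 2 * u) * exp (- R * u) = exp (- (R / 2) * u)"
      by (simp add: algebra_simps flip: exp_add)
    finally show ?thesis using u by (simp add: norm_mult)
  qed
  have "norm (of_real (exp (R / 2 * u)) * reduced u) \<le> (C + norm A) * exp (- (R / 2) * \<bar>u\<bar>)" for u
  proof (cases "u \<ge> 0")
    case False
    then have "norm (of_real (exp (R / 2 * u)) * reduced u) = exp (R / 2 * u) * (exp (R * (- u)) * norm (reduced (- u)))"
      using reduced_reflect[of "- u"] by (simp add: norm_mult)
    also have "\<dots> = norm (of_real (exp (R / 2 * (- u))) * reduced (- u))"
      by (simp add: norm_mult mult.assoc[symmetric] algebra_simps flip: exp_add)
    finally show ?thesis using pos[of "- u"] False by simp
  qed (rule pos)
  then show ?thesis using C by (intro that[of "C + norm A"]) (auto intro: add_pos_nonneg)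
qed

lemma reduced_integrable: "integrable lborel (\<lambda>u. of_real (exp (R / 2 * u)) * reduced u)"
proof -
  obtain C where C: "C > 0" "\<And>u. norm (of_real (exp (R / 2 * u)) * reduced u) \<le> C * exp (- (R / 2) * \<bar>u\<bar>)"
    using reduced_bound by metis
  show ?thesis
  proof (rule Bochner_Integration.integrable_bound)
    show "integrable lborel (\<lambda>u. C * exp (- (R / 2) * \<bar>u\<bar>))"
      using R_pos by (intro integrable_mult_right integrable_exp_abs) auto
    show "AE u in lborel. norm (of_real (exp (R / 2 * u)) * reduced u) \<le> norm (C * exp (- (R / 2) * \<bar>u\<bar>))"
      using C by (intro AE_I2) auto
  qed simp
qed

text \<open>On this line \<open>completed\<close> is real, so \<open>Re\<close> discards nothing; as
  a real function it can have a sign.\<close>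

definition crit :: "real \<Rightarrow> real" where "crit y = Re (completed h R A (Complex (R / 2) y))"

lemma crit: "completed h R A (Complex (R / 2) y) = of_real (crit y)"
  using completed_real[of "Complex (R / 2) y"] by (simp add: crit_def)

lemma continuous_crit: "continuous_on UNIV crit"
proof -
  have "completed h R A analytic_on {s. Re s = R / 2}"
    using R_pos by (intro completed_analytic) auto
  then have "continuous_on {s. Re s = R / 2} (completed h R A)"
    by (intro holomorphic_on_imp_continuous_on analytic_imp_holomorphic)
  then have "continuous_on UNIV (\<lambda>y. completed h R A (Complex (R / 2) y))"
    by (rule continuous_on_compose2) (auto simp: Complex_eq intro!: continuous_intros)
  then show ?thesis unfolding crit_def[abs_def] by (intro continuous_intros)
qed

lemma crit_measurable [measurable]: "crit \<in> borel_measurable borel"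
  using continuous_crit by (rule borel_measurable_continuous_onI)

lemma crit_eq: "of_real (crit y) = (LINT u|lborel. of_real (exp (R / 2 * u)) * reduced u * iexp (y * u))"
proof -
  have "has_bochner_integral lborel (\<lambda>u. exp (Complex (R / 2) y * of_real u) * reduced u) (completed h R A (Complex (R / 2) y))"
    using R_pos by (intro mellin_reduced) auto
  then have "completed h R A (Complex (R / 2) y) = (LINT u|lborel. exp (Complex (R / 2) y * of_real u) * reduced u)"
    by (simp add: has_bochner_integral_iff)
  also have "\<dots> = (LINT u|lborel. of_real (exp (R / 2 * u)) * reduced u * iexp (y * u))"
    unfolding exp_Complex by (intro Bochner_Integration.integral_cong) auto
  finally show ?thesis unfolding crit .
qed

lemma reduced_inversion:
  assumes "integrable lborel crit"
  shows "of_real (exp (R / 2 * u)) * reduced u = 1 / (2 * pi) * (LINT y|lborel. of_real (crit y) * iexp (- y * u))"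
proof -
  obtain C where C: "C > 0" "\<And>u. norm (of_real (exp (R / 2 * u)) * reduced u) \<le> C * exp (- (R / 2) * \<bar>u\<bar>)"
    using reduced_bound by metis
  show ?thesis
  proof (rule Fourier_inversion[where F = "\<lambda>y. of_real (crit y)"])
    show "continuous_on UNIV (\<lambda>u. complex_of_real (exp (R / 2 * u)) * reduced u)"
      by (intro continuous_intros continuous_reduced)
    show "norm (complex_of_real (exp (R / 2 * u)) * reduced u) \<le> C * 1" for u
      by (rule order_trans[OF C(2)]) (use C(1) R_pos in \<open>intro mult_left_mono, auto\<close>)
    show "integrable lborel (\<lambda>y. complex_of_real (crit y))" using assms by simp
  qed (rule reduced_integrable crit_eq)+
qed

text \<open>The weight exp(R u) of the critical line of the square splits as exp(R u/2)^2, so this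
  is the Fourier transform of a product. One factor is replaced by its inverse transform, and Fubini
  turns the other into \<open>crit (t - y)\<close>.\<close>

lemma crit_convolution:
  assumes "integrable lborel crit"
  shows "has_bochner_integral lborel (\<lambda>u. exp (Complex R t * of_real u) * (reduced u)\<^sup>2)
           (of_real (1 / (2 * pi) * (LINT y|lborel. crit y * crit (t - y))))"
proof -
  define g where "g = (\<lambda>u. of_real (exp (R / 2 * u)) * reduced u)"
  obtain C where C: "C > 0" "\<And>u. norm (g u) \<le> C * exp (- (R / 2) * \<bar>u\<bar>)"
    using reduced_bound unfolding g_def by metis
  have C1: "norm (g u) \<le> C" for u
    using C(2)[of u] C(1) R_pos by (auto elim!: order_trans)
  have intg: "integrable lborel g" unfolding g_def by (rule reduced_integrable)
  then have [measurable]: "g \<in> borel_measurable borel" by simp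
  have inv: "g u = 1 / (2 * pi) * (LINT y|lborel. of_real (crit y) * iexp (- y * u))" for u
    unfolding g_def by (rule reduced_inversion) fact
  have eq: "exp (Complex R t * of_real u) * (reduced u)\<^sup>2 = g u * g u * iexp (t * u)" for u
  proof -
    have "exp (R * u) = exp (R / 2 * u) * exp (R / 2 * u)" by (simp flip: exp_add)
    then show ?thesis by (simp add: exp_Complex g_def power2_eq_square)
  qed
  have int: "integrable lborel (\<lambda>u. g u * g u * iexp (t * u))"
  proof (rule Bochner_Integration.integrable_bound)
    show "integrable lborel (\<lambda>u. C * norm (g u))" using intg by simp
    show "AE u in lborel. norm (g u * g u * iexp (t * u)) \<le> norm (C * norm (g u))"
      using C1 C(1) by (intro AE_I2) (auto simp: norm_mult intro!: mult_right_mono)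
  qed simp
  define k where "k = (\<lambda>u y. g u * iexp (t * u) * (of_real (crit y) * iexp (- y * u)))"
  have [measurable]: "case_prod k \<in> borel_measurable (lborel \<Otimes>\<^sub>M lborel)" unfolding k_def by simp
  have nk: "norm (k u y) = norm (g u) * \<bar>crit y\<bar>" for u y by (simp add: k_def norm_mult)
  have intk: "integrable (lborel \<Otimes>\<^sub>M lborel) (case_prod k)"
  proof (rule lborel_pair.Fubini_integrable)
    show "integrable lborel (\<lambda>u. LINT y|lborel. norm (case_prod k (u, y)))"
      using intg by (simp add: nk)
    show "AE u in lborel. integrable lborel (\<lambda>y. case_prod k (u, y))"
    proof (rule AE_I2)
      fix u
      have "integrable lborel (\<lambda>y. norm (g u) * \<bar>crit y\<bar>)" using assms by simp
      then show "integrable lborel (\<lambda>y. case_prod k (u, y))"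
      proof (rule Bochner_Integration.integrable_bound)
        show "(\<lambda>y. case_prod k (u, y)) \<in> borel_measurable lborel" by (simp add: k_def)
        show "AE y in lborel. norm (case_prod k (u, y)) \<le> norm (norm (g u) * \<bar>crit y\<bar>)"
          unfolding split_conv nk by simp
      qed
    qed
  qed simp
  have "(LINT u|lborel. g u * g u * iexp (t * u)) = (LINT u|lborel. 1 / (2 * pi) * (LINT y|lborel. k u y))"
  proof (rule Bochner_Integration.integral_cong[OF refl])
    fix u
    have "g u * g u * iexp (t * u) = (g u * iexp (t * u)) * g u" by simp
    also have "\<dots> = (g u * iexp (t * u)) * (1 / (2 * pi) * (LINT y|lborel. of_real (crit y) * iexp (- y * u)))"
      by (subst (2) inv) simp
    also have "\<dots> = 1 / (2 * pi) * (LINT y|lborel. k u y)"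
      unfolding k_def by (subst integral_mult_right_zero) simp
    finally show "g u * g u * iexp (t * u) = 1 / (2 * pi) * (LINT y|lborel. k u y)" .
  qed
  also have "\<dots> = 1 / (2 * pi) * (LINT u|lborel. LINT y|lborel. k u y)"
    by (rule integral_mult_right_zero)
  also have "(LINT u|lborel. LINT y|lborel. k u y) = (LINT y|lborel. LINT u|lborel. k u y)"
    using lborel_pair.Fubini_integral[OF intk] by simp
  also have "\<dots> = (LINT y|lborel. of_real (crit y * crit (t - y)))"
  proof (rule Bochner_Integration.integral_cong[OF refl])
    fix y
    have e: "iexp ((t - y) * u) = iexp (t * u) * iexp (- y * u)" for u
      by (simp add: algebra_simps flip: exp_add)
    have "(LINT u|lborel. k u y) = (LINT u|lborel. of_real (crit y) * (of_real (exp (R / 2 * u)) * reduced u * iexp ((t - y) * u)))"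
      unfolding k_def g_def e
      by (intro Bochner_Integration.integral_cong refl) (simp only: mult_ac)
    also have "\<dots> = of_real (crit y * crit (t - y))"
      by (subst integral_mult_right_zero) (simp only: crit_eq[symmetric], simp)
    finally show "(LINT u|lborel. k u y) = of_real (crit y * crit (t - y))" .
  qed
  also have "\<dots> = complex_of_real (LINT y|lborel. crit y * crit (t - y))"
    by (rule integral_complex_of_real)
  also have "of_real (1 / (2 * pi)) * \<dots> = of_real (1 / (2 * pi) * (LINT y|lborel. crit y * crit (t - y)))"
    by (rule of_real_mult[symmetric])
  finally show ?thesis unfolding eq using int by (simp add: has_bochner_integral_iff)
qed

lemma theta_fun_square: "theta_fun (\<lambda>u. (h u)\<^sup>2) (2 * R) (A\<^sup>2)"
proof
  show "2 * R > 0" using R_pos by simp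
  show "continuous_on UNIV (\<lambda>u. (h u)\<^sup>2)" by (intro continuous_intros cont)
  show "(h (- u))\<^sup>2 = complex_of_real (exp (2 * R * u)) * cnj ((h u)\<^sup>2)" for u
  proof -
    have "exp (2 * R * u) = (exp (R * u))\<^sup>2" by (simp add: power2_eq_square flip: exp_add)
    then show ?thesis by (simp add: sym power_mult_distrib)
  qed
  fix K
  \<comment> \<open>With \<open>max K 0\<close> one constant serves twice: for the decay rate
    \<open>K\<close> and for the boundedness of h on u \<ge> 0.\<close>
  obtain C where C: "C > 0" "\<And>u. u \<ge> 0 \<Longrightarrow> norm (h u - A) \<le> C * exp (- max K 0 * u)"
    using decay_obtain[of "max K 0"] by metis
  have "norm ((h u)\<^sup>2 - A\<^sup>2) \<le> (C * (C + 2 * norm A)) * exp (- K * u)" if u: "u \<ge> 0" for u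
  proof -
    have "norm (h u - A) \<le> C * exp (- K * u)"
    proof -
      have "- max K 0 * u \<le> - K * u" using u by (intro mult_right_mono) auto
      then have "C * exp (- max K 0 * u) \<le> C * exp (- K * u)" using C(1) by (intro mult_left_mono) auto
      then show ?thesis using C(2)[OF u] by linarith
    qed
    moreover have "norm (h u + A) \<le> C + 2 * norm A"
    proof -
      have "C * exp (- max K 0 * u) \<le> C * 1" using C(1) u by (intro mult_left_mono) auto
      then have "norm (h u - A) \<le> C" using C(2)[OF u] by linarith
      moreover have "norm (h u + A) \<le> norm (h u - A) + norm (2 * A)"
      proof -
        have "h u + A = (h u - A) + 2 * A" by simp
        then show ?thesis by (metis norm_triangle_ineq)
      qed
      ultimately show ?thesis by (simp add: norm_mult)
    qed
    moreover have "norm ((h u)\<^sup>2 - A\<^sup>2) = norm (h u - A) * norm (h u + A)"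
      by (simp add: power2_eq_square algebra_simps flip: norm_mult)
    moreover have "norm (h u - A) * norm (h u + A) \<le> (C * exp (- K * u)) * (C + 2 * norm A)"
      using calculation C(1) by (intro mult_mono) auto
    ultimately have "norm ((h u)\<^sup>2 - A\<^sup>2) \<le> (C * exp (- K * u)) * (C + 2 * norm A)" by linarith
    then show ?thesis by (simp add: mult_ac)
  qed
  then show "\<exists>C. \<forall>u\<ge>0. norm ((h u)\<^sup>2 - A\<^sup>2) \<le> C * exp (- K * u)" by blast
qed

text \<open>
  On the critical line of the square, the transform of the square is the self-convolution of the
  critical values, up to a correction caused by the constant term \<open>A\<close>; on that line the reduced
  functions satisfy a reflection identity, which is why only real parts occur.
\<close>
lemma completed_square:
  assumes int: "integrable lborel crit" and t: "t \<noteq> 0"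
  shows "completed (\<lambda>u. (h u)\<^sup>2) (2 * R) (A\<^sup>2) (Complex R t) =
           of_real (1 / (2 * pi) * (LINT y|lborel. crit y * crit (t - y)) + 4 * Re (A * completed h R A (Complex R t)))"
proof -
  interpret sq: theta_fun "\<lambda>u. (h u)\<^sup>2" "2 * R" "A\<^sup>2" by (rule theta_fun_square)
  let ?s = "Complex R t"
  \<comment> \<open>The square of the reduced function is not the reduced function of the square;
    the difference \<open>e\<close> vanishes with \<open>A\<close> and produces the
    correction.\<close>
  define e where "e = (\<lambda>u. sq.reduced u - (reduced u)\<^sup>2)"
  have "has_bochner_integral lborel (\<lambda>u. exp (?s * of_real u) * sq.reduced u - exp (?s * of_real u) * (reduced u)\<^sup>2)
     (completed (\<lambda>u. (h u)\<^sup>2) (2 * R) (A\<^sup>2) ?s - of_real (1 / (2 * pi) * (LINT y|lborel. crit y * crit (t - y))))"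
    using R_pos by (intro has_bochner_integral_diff sq.mellin_reduced crit_convolution int) auto
  then have E1: "has_bochner_integral lborel (\<lambda>u. exp (?s * of_real u) * e u)
     (completed (\<lambda>u. (h u)\<^sup>2) (2 * R) (A\<^sup>2) ?s - of_real (1 / (2 * pi) * (LINT y|lborel. crit y * crit (t - y))))"
    by (simp add: e_def right_diff_distrib)
  \<comment> \<open>\<open>X\<close> is exp(s u) \<open>e u\<close> in expanded form: integrands on
    u \<ge> 0 taken at s, s - R and s - 2 R, so that the integral consists of two values of
    \<open>half_mellin\<close> and one elementary term.\<close>
  define X where "X = (\<lambda>u. 2 * A * (exp (?s * of_real u) * (h u - A)) + (2 * cnj A * (exp ((?s - of_real R) * of_real u) * (h u - A))
        + (- 2 * (cnj A)\<^sup>2) * exp ((?s - of_real (2 * R)) * of_real u)))"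
  define x where "x = 2 * A * half_mellin h A ?s + (2 * cnj A * half_mellin h A (?s - of_real R)
        + (- 2 * (cnj A)\<^sup>2) * (- 1 / (?s - of_real (2 * R))))"
  have "has_bochner_integral lborel (\<lambda>u. 2 * A * (indicator {0..} u *\<^sub>R (exp (?s * of_real u) * (h u - A)))
      + (2 * cnj A * (indicator {0..} u *\<^sub>R (exp ((?s - of_real R) * of_real u) * (h u - A)))
        + (- 2 * (cnj A)\<^sup>2) * (indicator {0..} u *\<^sub>R exp ((?s - of_real (2 * R)) * of_real u)))) x"
    unfolding x_def using R_pos
    by (intro has_bochner_integral_add has_bochner_integral_mult_right half_mellin_has_bochner has_bochner_integral_exp_half_line) auto
  also have "(\<lambda>u. 2 * A * (indicator {0..} u *\<^sub>R (exp (?s * of_real u) * (h u - A)))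
      + (2 * cnj A * (indicator {0..} u *\<^sub>R (exp ((?s - of_real R) * of_real u) * (h u - A)))
        + (- 2 * (cnj A)\<^sup>2) * (indicator {0..} u *\<^sub>R exp ((?s - of_real (2 * R)) * of_real u)))) = (\<lambda>u. indicator {0..} u *\<^sub>R X u)"
    unfolding X_def by (simp add: fun_eq_iff split: split_indicator)
  finally have HX: "has_bochner_integral lborel (\<lambda>u. indicator {0..} u *\<^sub>R X u) x" .
  have HY: "has_bochner_integral lborel (\<lambda>u. indicator {0..} u *\<^sub>R cnj (X u)) (cnj x)"
    using has_bochner_integral_bounded_linear[OF bounded_linear_cnj HX] by simp
  have eX: "exp (?s * of_real u) * e u = X u" for u
  proof -
    define q where "q = complex_of_real (exp (- R * u))"
    have q2: "complex_of_real (exp (- (2 * R) * u)) = q\<^sup>2"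
      by (simp add: q_def power2_eq_square flip: of_real_mult exp_add)
    have s1: "exp ((?s - of_real R) * of_real u) = exp (?s * of_real u) * q"
      by (simp add: q_def left_diff_distrib exp_diff exp_minus exp_mult_of_real divide_inverse)
    have s2: "exp ((?s - of_real (2 * R)) * of_real u) = exp (?s * of_real u) * q\<^sup>2"
      unfolding q2[symmetric] left_diff_distrib exp_diff exp_mult_of_real by (simp add: exp_minus divide_inverse)
    have "e u = (h u)\<^sup>2 - A\<^sup>2 - (cnj A)\<^sup>2 * q\<^sup>2 - (h u - A - cnj A * q)\<^sup>2"
      unfolding e_def sq.reduced_def reduced_def q2 by (simp add: q_def)
    then have "e u = 2 * A * (h u - A) + 2 * cnj A * q * (h u - A) - 2 * (cnj A)\<^sup>2 * q\<^sup>2" by algebra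
    moreover have "X u = exp (?s * of_real u) * (2 * A * (h u - A) + 2 * cnj A * q * (h u - A) - 2 * (cnj A)\<^sup>2 * q\<^sup>2)"
      unfolding X_def s1 s2 by algebra
    ultimately show ?thesis by (simp only:)
  qed
  have eY: "exp (?s * of_real (- u)) * e (- u) = cnj (X u)" for u
  proof -
    have "e (- u) = of_real (exp (2 * R * u)) * cnj (e u)"
    proof -
      have "exp (2 * R * u) = (exp (R * u))\<^sup>2" by (simp add: power2_eq_square flip: exp_add)
      then show ?thesis
        unfolding e_def sq.reduced_reflect reduced_reflect by (simp add: power_mult_distrib algebra_simps)
    qed
    moreover have "exp (?s * of_real (- u)) * of_real (exp (2 * R * u)) = exp (cnj ?s * of_real u)"
    proof -
      have "?s * of_real (- u) + of_real (2 * R * u) = cnj ?s * of_real u" by (simp add: complex_eq_iff)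
      then show ?thesis by (simp only: exp_of_real[symmetric] exp_add[symmetric])
    qed
    ultimately have "exp (?s * of_real (- u)) * e (- u) = exp (cnj ?s * of_real u) * cnj (e u)"
      by (simp only: mult.assoc[symmetric])
    also have "\<dots> = cnj (X u)" unfolding eX[symmetric] by (simp only: complex_cnj_mult exp_cnj complex_cnj_complex_of_real)
    finally show ?thesis .
  qed
  have em: "(\<lambda>u. exp (?s * of_real u) * e u) \<in> borel_measurable borel" unfolding e_def by measurable
  have "has_bochner_integral lborel (\<lambda>u. exp (?s * of_real u) * e u) (x + cnj x)"
    by (rule has_bochner_integral_two_sided[OF em HX HY]) (use eX eY in auto)
  with E1 have "completed (\<lambda>u. (h u)\<^sup>2) (2 * R) (A\<^sup>2) ?s - of_real (1 / (2 * pi) * (LINT y|lborel. crit y * crit (t - y))) = x + cnj x"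
    by (rule has_bochner_integral_eq)
  also have "\<dots> = of_real (2 * Re x)" by (simp add: complex_add_cnj)
  also have "Re x = 2 * Re (A * completed h R A ?s)"
  proof -
    define z where "z = \<i> * of_real t"
    have z: "?s - of_real R = z" "of_real R - cnj ?s = z" "?s - of_real (2 * R) = - cnj ?s"
      by (auto simp: z_def complex_eq_iff)
    have x: "x = 2 * (A * half_mellin h A ?s) + 2 * cnj (A * cnj (half_mellin h A z)) + 2 * cnj (- (A\<^sup>2 / ?s))"
      unfolding x_def z by (simp add: divide_inverse)
    have c: "A * completed h R A ?s = A * half_mellin h A ?s + A * cnj (half_mellin h A z) + - (A\<^sup>2 / ?s) + of_real ((norm A)\<^sup>2) / z"
      unfolding completed_def z complex_norm_square by (simp add: algebra_simps power2_eq_square)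
    \<comment> \<open>The pole of \<open>completed h R A\<close> at \<open>R\<close> contributes
      |A|^2/(i t), which is purely imaginary; it is the one term of the product with
      \<open>A\<close> that has no counterpart in \<open>x\<close>.\<close>
    have "Re (of_real ((norm A)\<^sup>2) / z) = 0"
    proof -
      have "of_real ((norm A)\<^sup>2) / z = - \<i> * of_real ((norm A)\<^sup>2 / t)" using t by (simp add: z_def field_simps)
      then show ?thesis by (simp only:) simp
    qed
    moreover have "Re (2 * p + 2 * cnj q + 2 * cnj r) = 2 * Re (p + q + r + w)" if "Re w = 0" for p q r w :: complex
      using that by simp
    ultimately show ?thesis unfolding x c by blast
  qed
  finally have "completed (\<lambda>u. (h u)\<^sup>2) (2 * R) (A\<^sup>2) ?s = of_real (1 / (2 * pi) * (LINT y|lborel. crit y * crit (t - y)))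
      + of_real (2 * (2 * Re (A * completed h R A ?s)))" by (simp only: diff_eq_eq add.commute)
  then show ?thesis by (simp only: of_real_add[symmetric]) simp
qed

end

section \<open>Growth of completed transforms on vertical lines\<close>

lemma integrable_exp_powr:
  fixes a D :: real
  assumes "a > 0"
  shows "integrable lborel (\<lambda>y. exp (- a * \<bar>y\<bar>) * (1 + \<bar>y\<bar>) powr D)"
proof -
  have "((\<lambda>x. exp (- (a / 2) * x) * (1 + x) powr D) \<longlongrightarrow> 0) at_top"
    using assms by real_asymp
  then have "eventually (\<lambda>x. exp (- (a / 2) * x) * (1 + x) powr D < 1) at_top"
    by (intro order_tendstoD) auto
  then obtain N where N: "\<And>x. x \<ge> N \<Longrightarrow> exp (- (a / 2) * x) * (1 + x) powr D < 1"
    by (auto simp: eventually_at_top_linorder)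
  have "continuous_on {0..max N 0} (\<lambda>x. exp (- (a / 2) * x) * (1 + x) powr D)"
    by (intro continuous_intros) auto
  then have "compact ((\<lambda>x. exp (- (a / 2) * x) * (1 + x) powr D) ` {0..max N 0})"
    by (intro compact_continuous_image) auto
  then obtain B where B: "\<And>x. x \<in> {0..max N 0} \<Longrightarrow> norm (exp (- (a / 2) * x) * (1 + x) powr D) \<le> B"
    by (metis (no_types, lifting) bounded_iff compact_imp_bounded imageI)
  have bound: "exp (- (a / 2) * x) * (1 + x) powr D \<le> max 1 B" if "x \<ge> 0" for x
    using N[of x] B[of x] that by (cases "x \<ge> N") auto
  show ?thesis
  proof (rule Bochner_Integration.integrable_bound)
    show "integrable lborel (\<lambda>y. max 1 B * exp (- (a / 2) * \<bar>y\<bar>))"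
      using assms by (intro integrable_mult_right integrable_exp_abs) auto
    show "AE y in lborel. norm (exp (- a * \<bar>y\<bar>) * (1 + \<bar>y\<bar>) powr D) \<le> norm (max 1 B * exp (- (a / 2) * \<bar>y\<bar>))"
    proof (rule AE_I2)
      fix y :: real
      have "exp (- a * \<bar>y\<bar>) = exp (- (a / 2) * \<bar>y\<bar>) * exp (- (a / 2) * \<bar>y\<bar>)" by (simp flip: exp_add)
      then have "exp (- a * \<bar>y\<bar>) * (1 + \<bar>y\<bar>) powr D = (exp (- (a / 2) * \<bar>y\<bar>) * (1 + \<bar>y\<bar>) powr D) * exp (- (a / 2) * \<bar>y\<bar>)"
        by (simp only: mult_ac)
      also have "\<dots> \<le> max 1 B * exp (- (a / 2) * \<bar>y\<bar>)"
        by (intro mult_right_mono bound) auto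
      finally show "norm (exp (- a * \<bar>y\<bar>) * (1 + \<bar>y\<bar>) powr D) \<le> norm (max 1 B * exp (- (a / 2) * \<bar>y\<bar>))" by simp
    qed
  qed measurable
qed

lemma Gamma_line_upper:
  fixes \<sigma> :: real
  obtains C where "C > 0" "\<And>t. 1 \<le> \<bar>t\<bar> \<Longrightarrow> norm (Gamma (Complex \<sigma> t)) \<le> C * (\<bar>t\<bar> powr (\<sigma> - 1/2) * exp (- pi * \<bar>t\<bar> / 2))"
proof (rule Gamma_vertical_bounds[of \<sigma> \<sigma>])
  fix c C
  assume "C > 0" "\<And>\<sigma>' t. \<sigma> \<le> \<sigma>' \<Longrightarrow> \<sigma>' \<le> \<sigma> \<Longrightarrow> 1 \<le> \<bar>t\<bar> \<Longrightarrow>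
       norm (Gamma (Complex \<sigma>' t)) \<le> C * (\<bar>t\<bar> powr (\<sigma>' - 1/2) * exp (- pi * \<bar>t\<bar> / 2))"
  then show thesis by (intro that[of C]) auto
qed

context theta_fun
begin

lemma theta_fun_cnj: "theta_fun (\<lambda>u. cnj (h u)) R (cnj A)"
proof
  show "R > 0" by (rule R_pos)
  show "continuous_on UNIV (\<lambda>u. cnj (h u))" by (intro continuous_intros cont)
  show "cnj (h (- u)) = complex_of_real (exp (R * u)) * cnj (cnj (h u))" for u by (simp add: sym)
  show "\<exists>C. \<forall>u\<ge>0. norm (cnj (h u) - cnj A) \<le> C * exp (- K * u)" for K
    using decay[of K] by (metis complex_cnj_diff complex_mod_cnj)
qed

lemma half_mellin_cnj: "half_mellin (\<lambda>u. cnj (h u)) (cnj A) s = cnj (half_mellin h A (cnj s))"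
  using half_mellin_cnj_has_bochner[of s]
  by (simp add: half_mellin_def[of "\<lambda>u. cnj (h u)"] has_bochner_integral_iff)

lemma completed_cnj: "completed (\<lambda>u. cnj (h u)) R (cnj A) s = cnj (completed h R A (cnj s))"
  unfolding completed_def half_mellin_cnj by simp

text \<open>On Re s = \<open>B\<close> the transform is at most a multiple of Gamma, and reflection
  gives the same size on Re s = R - \<open>B\<close>. Dividing by s^(B - 1/2) exp(i pi s/2) leaves a
  function bounded on both sides, to which \<open>half_strip_bounded\<close> applies; the exponent
  \<open>B - 1/2\<close> is then uniform over the whole strip.\<close>

lemma completed_upper_bound_pos:
  assumes B: "R / 2 \<le> B" "1 / 2 \<le> B"
    and line: "\<And>t. 1 \<le> \<bar>t\<bar> \<Longrightarrow> norm (completed h R A (Complex B t)) \<le> C * norm (Gamma (Complex B t))"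
  shows "\<exists>C. \<forall>s. R - B \<le> Re s \<longrightarrow> Re s \<le> B \<longrightarrow> 1 \<le> Im s \<longrightarrow>
           norm (completed h R A s) \<le> C * (Im s powr (B - 1/2) * exp (- pi * Im s / 2))"
proof -
  define D where "D = B - 1/2"
  have D: "D \<ge> 0" using B by (simp add: D_def)
  define G where "G = (\<lambda>s. completed h R A s * exp (- \<i> * pi * s / 2) * exp (- of_real D * Ln s))"
  have nG: "norm (G s) = norm (completed h R A s) * exp (pi * Im s / 2) * norm s powr (- D)" if "1 \<le> Im s" for s
  proof -
    have "s \<noteq> 0" using that by auto
    then have "norm (exp (- of_real D * Ln s)) = norm s powr (- D)" by (simp add: powr_def)
    then show ?thesis by (simp add: G_def norm_mult)
  qed
  obtain Bd where Bd: "\<And>s. R - B \<le> Re s \<Longrightarrow> Re s \<le> B \<Longrightarrow> 1 \<le> \<bar>Im s\<bar> \<Longrightarrow> norm (completed h R A s) \<le> Bd"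
    using completed_bounded_strip by metis
  obtain C' where C': "C' > 0"
    "\<And>t. 1 \<le> \<bar>t\<bar> \<Longrightarrow> norm (Gamma (Complex B t)) \<le> C' * (\<bar>t\<bar> powr (B - 1/2) * exp (- pi * \<bar>t\<bar> / 2))"
    using Gamma_line_upper by metis
  have side: "norm (completed h R A s) \<le> (\<bar>C\<bar> * C') * (Im s powr D * exp (- pi * Im s / 2))"
    if s: "Re s = B \<or> Re s = R - B" "1 \<le> Im s" for s
  proof -
    have "norm (completed h R A s) = norm (completed h R A (Complex B (Im s)))"
      using s(1)
    proof
      assume "Re s = B"
      then have "s = Complex B (Im s)" by (simp add: complex_eq_iff)
      then show ?thesis by metis
    next
      assume "Re s = R - B"
      then have "of_real R - cnj s = Complex B (Im s)" by (simp add: complex_eq_iff)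
      then show ?thesis by (metis completed_reflect complex_mod_cnj)
    qed
    also have "\<dots> \<le> C * norm (Gamma (Complex B (Im s)))" using line s by simp
    also have "\<dots> \<le> \<bar>C\<bar> * norm (Gamma (Complex B (Im s)))" by (intro mult_right_mono) auto
    also have "\<dots> \<le> \<bar>C\<bar> * (C' * (\<bar>Im s\<bar> powr (B - 1/2) * exp (- pi * \<bar>Im s\<bar> / 2)))"
      using s by (intro mult_left_mono C') auto
    finally show ?thesis using s by (simp add: D_def mult_ac)
  qed
  have "\<exists>M. \<forall>s. R - B \<le> Re s \<longrightarrow> Re s \<le> B \<longrightarrow> 1 \<le> Im s \<longrightarrow> norm (G s) \<le> M"
  proof (rule half_strip_bounded)
    have "completed h R A analytic_on {s. R - B \<le> Re s \<and> Re s \<le> B \<and> 1 \<le> Im s}"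
      by (intro completed_analytic) auto
    then show "G analytic_on {s. R - B \<le> Re s \<and> Re s \<le> B \<and> 1 \<le> Im s}"
      unfolding G_def by (intro analytic_intros) (auto elim!: nonpos_Reals_cases)
    show "norm (G s) \<le> Bd * exp (pi / 2 * Im s)" if s: "R - B \<le> Re s" "Re s \<le> B" "1 \<le> Im s" for s
    proof -
      have n: "1 \<le> norm s" using abs_Im_le_cmod[of s] s by linarith
      have "norm s powr (- D) \<le> norm s powr 0" using n D by (intro powr_mono) auto
      moreover have "norm s powr 0 = 1" using n by auto
      ultimately have p: "norm s powr (- D) \<le> 1" by simp
      have Bd0: "0 \<le> Bd" by (rule order_trans[OF norm_ge_zero Bd[OF s(1,2)]]) (use s in auto)
      have "norm (G s) \<le> (Bd * exp (pi * Im s / 2)) * 1"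
        unfolding nG[OF s(3)] using Bd[OF s(1,2)] s(3) p Bd0 by (intro mult_mono mult_nonneg_nonneg) auto
      then show ?thesis by simp
    qed
    show "norm (G s) \<le> \<bar>C\<bar> * C'" if s: "Re s = R - B \<or> Re s = B" "1 \<le> Im s" for s
    proof -
      have n: "Im s \<le> norm s" using abs_Im_le_cmod[of s] by linarith
      have p: "norm s powr (- D) \<le> Im s powr (- D)" using n D s(2) by (intro powr_mono2') auto
      have "norm (G s) \<le> ((\<bar>C\<bar> * C') * (Im s powr D * exp (- pi * Im s / 2)) * exp (pi * Im s / 2)) * Im s powr (- D)"
        unfolding nG[OF s(2)] using side[of s] s C' p
        by (intro mult_mono mult_right_mono mult_nonneg_nonneg) auto
      also have "\<dots> = (\<bar>C\<bar> * C') * (Im s powr D * Im s powr (- D)) * (exp (- pi * Im s / 2) * exp (pi * Im s / 2))"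
        by (simp only: mult_ac)
      also have "Im s powr D * Im s powr (- D) = 1" using s by (simp flip: powr_add)
      also have "exp (- pi * Im s / 2) * exp (pi * Im s / 2) = 1" by (simp flip: exp_add)
      finally show ?thesis by simp
    qed
  qed
  then obtain M where M: "\<And>s. R - B \<le> Re s \<Longrightarrow> Re s \<le> B \<Longrightarrow> 1 \<le> Im s \<Longrightarrow> norm (G s) \<le> M" by blast
  define L where "L = max \<bar>R - B\<bar> \<bar>B\<bar>"
  have "norm (completed h R A s) \<le> (M * (1 + L) powr D) * (Im s powr (B - 1/2) * exp (- pi * Im s / 2))"
    if s: "R - B \<le> Re s" "Re s \<le> B" "1 \<le> Im s" for s
  proof -
    have s0: "s \<noteq> 0" using s by auto
    have M0: "0 \<le> M" by (rule order_trans[OF norm_ge_zero M[OF s]])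
    have "norm s \<le> (1 + L) * Im s"
    proof -
      have "norm s \<le> \<bar>Re s\<bar> + \<bar>Im s\<bar>" by (rule cmod_le)
      moreover have "\<bar>Re s\<bar> \<le> L" using s by (auto simp: L_def)
      moreover have "L * 1 \<le> L * Im s" using s by (intro mult_left_mono) (auto simp: L_def)
      moreover have "\<bar>Im s\<bar> = Im s" using s by simp
      ultimately show ?thesis by (simp add: algebra_simps)
    qed
    then have "norm s powr D \<le> ((1 + L) * Im s) powr D" using D by (intro powr_mono2) auto
    also have "\<dots> = (1 + L) powr D * Im s powr D" by (rule powr_mult)
    finally have p: "norm s powr D \<le> (1 + L) powr D * Im s powr D" .
    have "norm (completed h R A s) = norm (completed h R A s) * (exp (pi * Im s / 2) * exp (- pi * Im s / 2)) * (norm s powr (- D) * norm s powr D)"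
      using s0 by (simp flip: exp_add powr_add)
    also have "\<dots> = norm (G s) * norm s powr D * exp (- pi * Im s / 2)"
      unfolding nG[OF s(3)] by (simp only: mult_ac)
    also have "\<dots> \<le> M * ((1 + L) powr D * Im s powr D) * exp (- pi * Im s / 2)"
      using M[OF s] p M0 by (intro mult_right_mono mult_mono) auto
    finally show ?thesis by (simp add: D_def mult_ac)
  qed
  then show ?thesis by blast
qed

text \<open>Negative heights are those of the conjugate theta function, whose transform at s is the
  conjugate of the original one at cnj s.\<close>

lemma completed_upper_bound:
  assumes B: "R / 2 \<le> B" "1 / 2 \<le> B"
    and line: "\<And>t. 1 \<le> \<bar>t\<bar> \<Longrightarrow> norm (completed h R A (Complex B t)) \<le> C * norm (Gamma (Complex B t))"
  shows "\<exists>C. \<forall>s. R - B \<le> Re s \<longrightarrow> Re s \<le> B \<longrightarrow> 1 \<le> \<bar>Im s\<bar> \<longrightarrow>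
           norm (completed h R A s) \<le> C * (\<bar>Im s\<bar> powr (B - 1/2) * exp (- pi * \<bar>Im s\<bar> / 2))"
proof -
  interpret c: theta_fun "\<lambda>u. cnj (h u)" R "cnj A" by (rule theta_fun_cnj)
  obtain C1 where C1: "\<And>s. R - B \<le> Re s \<Longrightarrow> Re s \<le> B \<Longrightarrow> 1 \<le> Im s \<Longrightarrow>
       norm (completed h R A s) \<le> C1 * (Im s powr (B - 1/2) * exp (- pi * Im s / 2))"
    using completed_upper_bound_pos[OF B line] by blast
  have "norm (completed (\<lambda>u. cnj (h u)) R (cnj A) (Complex B t)) \<le> C * norm (Gamma (Complex B t))" if "1 \<le> \<bar>t\<bar>" for t
  proof -
    have "cnj (Complex B t) = Complex B (- t)" by (simp add: complex_cnj)
    then have "norm (Gamma (Complex B (- t))) = norm (Gamma (Complex B t))"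
      by (metis cnj_Gamma complex_mod_cnj)
    then show ?thesis using line[of "- t"] that by (simp add: completed_cnj complex_cnj)
  qed
  from c.completed_upper_bound_pos[OF B this] obtain C2 where C2: "\<And>s. R - B \<le> Re s \<Longrightarrow> Re s \<le> B \<Longrightarrow> 1 \<le> Im s \<Longrightarrow>
       norm (completed (\<lambda>u. cnj (h u)) R (cnj A) s) \<le> C2 * (Im s powr (B - 1/2) * exp (- pi * Im s / 2))"
    by blast
  have "norm (completed h R A s) \<le> max C1 C2 * (\<bar>Im s\<bar> powr (B - 1/2) * exp (- pi * \<bar>Im s\<bar> / 2))"
    if s: "R - B \<le> Re s" "Re s \<le> B" "1 \<le> \<bar>Im s\<bar>" for s
  proof -
    let ?x = "\<bar>Im s\<bar> powr (B - 1/2) * exp (- pi * \<bar>Im s\<bar> / 2)"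
    have "norm (completed h R A s) \<le> C1 * ?x \<or> norm (completed h R A s) \<le> C2 * ?x"
    proof (cases "Im s \<ge> 0")
      case True
      then show ?thesis using C1[of s] s by simp
    next
      case False
      then show ?thesis using C2[of "cnj s"] s by (simp add: completed_cnj)
    qed
    moreover have "C1 * ?x \<le> max C1 C2 * ?x" "C2 * ?x \<le> max C1 C2 * ?x" by (intro mult_right_mono; simp)+
    ultimately show ?thesis by linarith
  qed
  then show ?thesis by blast
qed

text \<open>Used on two lines: Re s = R/2 for the convolution, and the edge Re s = \<open>R\<close>,
  where the correction term of \<open>completed_square\<close> is evaluated.\<close>

definition strip_bounded :: "real \<Rightarrow> bool" where
  "strip_bounded D \<longleftrightarrow> (\<exists>C. \<forall>s. 0 \<le> Re s \<longrightarrow> Re s \<le> R \<longrightarrow> 1 \<le> \<bar>Im s\<bar> \<longrightarrow>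
       norm (completed h R A s) \<le> C * (\<bar>Im s\<bar> powr D * exp (- pi * \<bar>Im s\<bar> / 2)))"

lemma crit_bound:
  assumes D: "D \<ge> 0" and "strip_bounded D"
  obtains C where "C > 0" "\<And>y. \<bar>crit y\<bar> \<le> C * (exp (- (pi / 2) * \<bar>y\<bar>) * (1 + \<bar>y\<bar>) powr D)"
proof -
  obtain C where C: "\<And>s. 0 \<le> Re s \<Longrightarrow> Re s \<le> R \<Longrightarrow> 1 \<le> \<bar>Im s\<bar> \<Longrightarrow>
       norm (completed h R A s) \<le> C * (\<bar>Im s\<bar> powr D * exp (- pi * \<bar>Im s\<bar> / 2))"
    using assms(2) unfolding strip_bounded_def by blast
  have "compact (crit ` {-1..1})"
    by (intro compact_continuous_image continuous_on_subset[OF continuous_crit]) auto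
  then obtain B where B: "\<And>y. y \<in> {-1..1} \<Longrightarrow> norm (crit y) \<le> B"
    by (metis bounded_iff compact_imp_bounded imageI)
  \<comment> \<open>The factor exp(pi/2) makes up for the weight exp(-(pi/2) |y|) on |y| \<le>
    1.\<close>
  define K where "K = max 1 (max \<bar>C\<bar> (B * exp (pi / 2)))"
  have "\<bar>crit y\<bar> \<le> K * (exp (- (pi / 2) * \<bar>y\<bar>) * (1 + \<bar>y\<bar>) powr D)" for y
  proof (cases "1 \<le> \<bar>y\<bar>")
    case True
    have "\<bar>crit y\<bar> = norm (completed h R A (Complex (R / 2) y))" unfolding crit by simp
    also have "\<dots> \<le> C * (\<bar>y\<bar> powr D * exp (- pi * \<bar>y\<bar> / 2))"
      using C[of "Complex (R / 2) y"] R_pos True by simp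
    also have "\<dots> \<le> K * ((1 + \<bar>y\<bar>) powr D * exp (- pi * \<bar>y\<bar> / 2))"
      using D by (intro mult_mono powr_mono2) (auto simp: K_def)
    finally show ?thesis by (simp add: mult_ac)
  next
    case False
    have B0: "0 \<le> B" using B[of 0] by auto
    have "\<bar>crit y\<bar> \<le> B" using B[of y] False by (simp add: not_le abs_less_iff)
    also have "\<dots> = (B * exp (pi / 2)) * exp (- (pi / 2))" by (simp add: mult.assoc flip: exp_add)
    also have "\<dots> \<le> K * (exp (- (pi / 2) * \<bar>y\<bar>) * 1)"
      using False B0 by (intro mult_mono) (auto simp: K_def mult_left_le)
    also have "\<dots> \<le> K * (exp (- (pi / 2) * \<bar>y\<bar>) * (1 + \<bar>y\<bar>) powr D)"
      using D by (intro mult_left_mono ge_one_powr_ge_zero) (auto simp: K_def)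
    finally show ?thesis .
  qed
  then show ?thesis by (intro that[of K]) (auto simp: K_def)
qed

lemma crit_integrable:
  assumes D: "D \<ge> 0" and "strip_bounded D"
  shows "integrable lborel crit"
proof -
  obtain C where C: "C > 0" "\<And>y. \<bar>crit y\<bar> \<le> C * (exp (- (pi / 2) * \<bar>y\<bar>) * (1 + \<bar>y\<bar>) powr D)"
    using crit_bound[OF assms] by metis
  show ?thesis
  proof (rule Bochner_Integration.integrable_bound)
    show "integrable lborel (\<lambda>y. C * (exp (- (pi / 2) * \<bar>y\<bar>) * (1 + \<bar>y\<bar>) powr D))"
      by (intro integrable_mult_right integrable_exp_powr) auto
    show "AE y in lborel. norm (crit y) \<le> norm (C * (exp (- (pi / 2) * \<bar>y\<bar>) * (1 + \<bar>y\<bar>) powr D))"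
    proof (rule AE_I2)
      fix y
      show "norm (crit y) \<le> norm (C * (exp (- (pi / 2) * \<bar>y\<bar>) * (1 + \<bar>y\<bar>) powr D))"
        using C(2)[of y] by simp
    qed
  qed simp
qed

text \<open>Between \<open>Y\<close> and t - \<open>Y\<close> both factors carry the sign
  \<epsilon>, so the product is its absolute value. On the two end ranges only the modulus of
  \<open>crit\<close> is controlled; there the product is at most of order t^D exp(-pi t/2) times a
  fixed integrable function of y or of t - y.\<close>

lemma square_lower:
  assumes D: "D \<ge> 0" and bd: "strip_bounded D" and Y: "Y \<ge> 1"
    and sign: "\<And>y. y \<ge> Y \<Longrightarrow> \<epsilon> * crit y = \<bar>crit y\<bar>"
  shows "\<exists>K. \<forall>t\<ge>1.
    1 / (2 * pi) * (LINT y|lborel. indicator {Y..t - Y} y * (\<bar>crit y\<bar> * \<bar>crit (t - y)\<bar>)) - K * (t powr D * exp (- pi * t / 2))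
      \<le> Re (completed (\<lambda>u. (h u)\<^sup>2) (2 * R) (A\<^sup>2) (Complex R t))"
proof -
  obtain C where C: "C > 0" "\<And>y. \<bar>crit y\<bar> \<le> C * (exp (- (pi / 2) * \<bar>y\<bar>) * (1 + \<bar>y\<bar>) powr D)"
    using crit_bound[OF D bd] by metis
  obtain C1 where C1: "\<And>s. 0 \<le> Re s \<Longrightarrow> Re s \<le> R \<Longrightarrow> 1 \<le> \<bar>Im s\<bar> \<Longrightarrow>
       norm (completed h R A s) \<le> C1 * (\<bar>Im s\<bar> powr D * exp (- pi * \<bar>Im s\<bar> / 2))"
    using bd unfolding strip_bounded_def by blast
  note intc = crit_integrable[OF D bd]
  define w where "w = (\<lambda>y. exp (- pi * \<bar>y\<bar>) * (1 + \<bar>y\<bar>) powr (2 * D))"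
  have intw: "integrable lborel w" unfolding w_def by (rule integrable_exp_powr) simp
  define M where "M = C\<^sup>2 * exp (pi * Y)"
  have M0: "M > 0" using C by (simp add: M_def)
  have tail: "\<bar>crit y * crit (t - y)\<bar> \<le> M * (exp (- pi * t / 2) * (1 + t) powr D) * w y"
    if "y < Y" "t \<ge> 1" for y t
  proof -
    \<comment> \<open>For y \<le> 0 the right-hand side equals t + 2 |y|, so the inequality has room
      2 Y; for 0 < y < Y the term 2 |y| is below 2 Y. The surplus 2 |y| is what makes the tail
      integrable in y uniformly in t.\<close>
    have a: "t + 2 * \<bar>y\<bar> - 2 * Y \<le> \<bar>y\<bar> + \<bar>t - y\<bar>" using that Y by linarith
    have "\<bar>crit y * crit (t - y)\<bar> \<le> (C * (exp (- (pi / 2) * \<bar>y\<bar>) * (1 + \<bar>y\<bar>) powr D)) * (C * (exp (- (pi / 2) * \<bar>t - y\<bar>) * (1 + \<bar>t - y\<bar>) powr D))"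
      unfolding abs_mult using C by (intro mult_mono C(2)) auto
    also have "\<dots> = C\<^sup>2 * (exp (- (pi / 2) * \<bar>y\<bar>) * exp (- (pi / 2) * \<bar>t - y\<bar>)) * ((1 + \<bar>y\<bar>) powr D * (1 + \<bar>t - y\<bar>) powr D)"
      by (simp add: power2_eq_square mult_ac)
    also have "exp (- (pi / 2) * \<bar>y\<bar>) * exp (- (pi / 2) * \<bar>t - y\<bar>) = exp (- (pi / 2) * (\<bar>y\<bar> + \<bar>t - y\<bar>))"
      by (simp add: algebra_simps flip: exp_add)
    also have "(1 + \<bar>y\<bar>) powr D * (1 + \<bar>t - y\<bar>) powr D = ((1 + \<bar>y\<bar>) * (1 + \<bar>t - y\<bar>)) powr D"
      by (rule powr_mult[symmetric])
    also have "C\<^sup>2 * exp (- (pi / 2) * (\<bar>y\<bar> + \<bar>t - y\<bar>)) * ((1 + \<bar>y\<bar>) * (1 + \<bar>t - y\<bar>)) powr D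
       \<le> C\<^sup>2 * exp (- (pi / 2) * (t + 2 * \<bar>y\<bar> - 2 * Y)) * ((1 + t) * ((1 + \<bar>y\<bar>) * (1 + \<bar>y\<bar>))) powr D"
    proof -
      have e: "exp (- (pi / 2) * (\<bar>y\<bar> + \<bar>t - y\<bar>)) \<le> exp (- (pi / 2) * (t + 2 * \<bar>y\<bar> - 2 * Y))" using a by simp
      \<comment> \<open>Separates t from y, so that all polynomial growth in y moves into
        \<open>w\<close>.\<close>
      have "1 + \<bar>t - y\<bar> \<le> (1 + t) * (1 + \<bar>y\<bar>)"
      proof -
        have "0 \<le> t * \<bar>y\<bar>" using that by simp
        moreover have "\<bar>t - y\<bar> \<le> t + \<bar>y\<bar>" using that by linarith
        ultimately show ?thesis by (simp add: algebra_simps)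
      qed
      then have "(1 + \<bar>y\<bar>) * (1 + \<bar>t - y\<bar>) \<le> (1 + \<bar>y\<bar>) * ((1 + t) * (1 + \<bar>y\<bar>))"
        by (intro mult_left_mono) auto
      also have "\<dots> = (1 + t) * ((1 + \<bar>y\<bar>) * (1 + \<bar>y\<bar>))" by (simp only: mult_ac)
      finally have p: "((1 + \<bar>y\<bar>) * (1 + \<bar>t - y\<bar>)) powr D \<le> ((1 + t) * ((1 + \<bar>y\<bar>) * (1 + \<bar>y\<bar>))) powr D"
        by (intro powr_mono2 D) auto
      show ?thesis by (intro mult_mono e p) auto
    qed
    also have "\<dots> = M * (exp (- pi * t / 2) * (1 + t) powr D) * w y"
    proof -
      have "exp (- (pi / 2) * (t + 2 * \<bar>y\<bar> - 2 * Y)) = exp (- pi * t / 2) * exp (- pi * \<bar>y\<bar>) * exp (pi * Y)"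
        by (simp add: algebra_simps flip: exp_add)
      moreover have "((1 + t) * ((1 + \<bar>y\<bar>) * (1 + \<bar>y\<bar>))) powr D = (1 + t) powr D * (1 + \<bar>y\<bar>) powr (2 * D)"
        by (simp add: powr_mult flip: powr_add)
      ultimately show ?thesis by (simp add: M_def w_def mult_ac)
    qed
    finally show ?thesis .
  qed
  \<comment> \<open>The first summand collects both tails, with 1 + t \<le> 2 t; the second bounds
    the correction 4 Re(A completed) on Re s = \<open>R\<close>.\<close>
  define K where "K = 1 / (2 * pi) * (M * 2 powr D * (2 * (LINT y|lborel. w y))) + 4 * norm A * \<bar>C1\<bar>"
  have intw2: "integrable lborel (\<lambda>y. w (t - y))" "(LINT y|lborel. w (t - y)) = (LINT y|lborel. w y)" for t
    using lborel_integrable_real_affine[OF intw, of "-1" t] lborel_integral_real_affine[of "-1" w t] by simp_all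
  have w0: "0 \<le> w y" for y by (simp add: w_def)
  have "1 / (2 * pi) * (LINT y|lborel. indicator {Y..t - Y} y * (\<bar>crit y\<bar> * \<bar>crit (t - y)\<bar>)) - K * (t powr D * exp (- pi * t / 2))
      \<le> Re (completed (\<lambda>u. (h u)\<^sup>2) (2 * R) (A\<^sup>2) (Complex R t))" if t: "t \<ge> 1" for t
  proof -
    define q where "q = M * (exp (- pi * t / 2) * (1 + t) powr D)"
    have q0: "q \<ge> 0" using M0 by (simp add: q_def)
    obtain Bc where Bc: "\<And>y. \<bar>crit y\<bar> \<le> Bc"
    proof -
      have "\<bar>crit y\<bar> \<le> (LINT u|lborel. norm (complex_of_real (exp (R / 2 * u)) * reduced u))" for y
      proof -
        have "norm (complex_of_real (crit y)) \<le> (LINT u|lborel. norm (of_real (exp (R / 2 * u)) * reduced u * iexp (y * u)))"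
          unfolding crit_eq by (rule integral_norm_bound)
        then show ?thesis by (simp add: norm_mult)
      qed
      then show ?thesis using that by blast
    qed
    have Bc0: "Bc \<ge> 0" using Bc[of 0] by linarith
    have int1: "integrable lborel (\<lambda>y. crit y * crit (t - y))"
    proof (rule Bochner_Integration.integrable_bound)
      show "integrable lborel (\<lambda>y. \<bar>crit y\<bar> * Bc)" using intc by (intro integrable_mult_left integrable_abs)
      show "AE y in lborel. norm (crit y * crit (t - y)) \<le> norm (\<bar>crit y\<bar> * Bc)"
        using Bc Bc0 by (intro AE_I2) (auto simp: abs_mult intro!: mult_left_mono)
    qed simp
    have int2: "integrable lborel (\<lambda>y. indicator {Y..t - Y} y * (\<bar>crit y\<bar> * \<bar>crit (t - y)\<bar>))"
    proof (rule Bochner_Integration.integrable_bound[OF int1])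
      show "AE y in lborel. norm (indicator {Y..t - Y} y * (\<bar>crit y\<bar> * \<bar>crit (t - y)\<bar>)) \<le> norm (crit y * crit (t - y))"
        by (intro AE_I2) (simp add: abs_mult split: split_indicator)
    qed simp
    have "(LINT y|lborel. indicator {Y..t - Y} y * (\<bar>crit y\<bar> * \<bar>crit (t - y)\<bar>) - (q * w y + q * w (t - y)))
        \<le> (LINT y|lborel. crit y * crit (t - y))"
    proof (rule integral_mono[OF _ int1])
      show "integrable lborel (\<lambda>y. indicator {Y..t - Y} y * (\<bar>crit y\<bar> * \<bar>crit (t - y)\<bar>) - (q * w y + q * w (t - y)))"
        by (intro Bochner_Integration.integrable_diff Bochner_Integration.integrable_add integrable_mult_right int2 intw intw2)
      fix y
      have q1: "0 \<le> q * w y" "0 \<le> q * w (t - y)" using q0 w0 by auto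
      consider "y < Y" | "t - y < Y" | "Y \<le> y" "Y \<le> t - y" by linarith
      then show "indicator {Y..t - Y} y * (\<bar>crit y\<bar> * \<bar>crit (t - y)\<bar>) - (q * w y + q * w (t - y)) \<le> crit y * crit (t - y)"
      proof cases
        case 1
        then have "\<bar>crit y * crit (t - y)\<bar> \<le> q * w y" using tail[OF 1 t] by (simp add: q_def)
        then show ?thesis using 1 q1 by (simp add: indicator_def)
      next
        case 2
        then have "\<bar>crit (t - y) * crit (t - (t - y))\<bar> \<le> q * w (t - y)" using tail[OF 2 t] by (simp add: q_def)
        then have "\<bar>crit y * crit (t - y)\<bar> \<le> q * w (t - y)" by (simp add: mult.commute)
        then show ?thesis using 2 q1 by (simp add: indicator_def)
      next
        case 3
        have "\<bar>crit y\<bar> * \<bar>crit (t - y)\<bar> = (\<epsilon> * \<epsilon>) * (crit y * crit (t - y))"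
          by (simp only: sign[OF 3(1), symmetric] sign[OF 3(2), symmetric] mult_ac)
        \<comment> \<open>Where \<open>crit y\<close> does not vanish, the sign hypothesis forces
          |\<epsilon>| = 1.\<close>
        moreover have "(\<epsilon> * \<epsilon>) * (crit y * crit (t - y)) \<le> crit y * crit (t - y) \<or> crit y * crit (t - y) = 0"
        proof (cases "crit y = 0")
          case False
          then have "\<bar>\<epsilon>\<bar> * \<bar>crit y\<bar> = 1 * \<bar>crit y\<bar>" using sign[of y] 3 by (metis abs_abs abs_mult mult_1)
          then have "\<bar>\<epsilon>\<bar> = 1" using False by simp
          then have "\<epsilon> * \<epsilon> = 1" by (metis abs_mult_self_eq mult_1)
          then show ?thesis by simp
        qed simp
        ultimately have "\<bar>crit y\<bar> * \<bar>crit (t - y)\<bar> \<le> crit y * crit (t - y)" by auto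
        then show ?thesis using 3 q1 by (simp add: indicator_def)
      qed
    qed
    also have "(LINT y|lborel. indicator {Y..t - Y} y * (\<bar>crit y\<bar> * \<bar>crit (t - y)\<bar>) - (q * w y + q * w (t - y)))
      = (LINT y|lborel. indicator {Y..t - Y} y * (\<bar>crit y\<bar> * \<bar>crit (t - y)\<bar>)) - q * (2 * (LINT y|lborel. w y))"
      using int2 intw intw2 by simp
    finally have conv: "(LINT y|lborel. indicator {Y..t - Y} y * (\<bar>crit y\<bar> * \<bar>crit (t - y)\<bar>)) - q * (2 * (LINT y|lborel. w y))
       \<le> (LINT y|lborel. crit y * crit (t - y))" .
    have qle: "q \<le> M * 2 powr D * (t powr D * exp (- pi * t / 2))"
    proof -
      have "(1 + t) powr D \<le> (2 * t) powr D" using t D by (intro powr_mono2) auto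
      also have "\<dots> = 2 powr D * t powr D" by (rule powr_mult)
      finally have "exp (- pi * t / 2) * (1 + t) powr D \<le> exp (- pi * t / 2) * (2 powr D * t powr D)"
        by (intro mult_left_mono) auto
      then have "q \<le> M * (exp (- pi * t / 2) * (2 powr D * t powr D))"
        unfolding q_def using M0 by (intro mult_left_mono) auto
      then show ?thesis by (simp add: mult_ac)
    qed
    have W0: "0 \<le> (LINT y|lborel. w y)" using w0 by simp
    have "q * (2 * (LINT y|lborel. w y)) \<le> M * 2 powr D * (t powr D * exp (- pi * t / 2)) * (2 * (LINT y|lborel. w y))"
      using qle W0 by (intro mult_right_mono) auto
    with conv have conv2: "(LINT y|lborel. indicator {Y..t - Y} y * (\<bar>crit y\<bar> * \<bar>crit (t - y)\<bar>))
        - M * 2 powr D * (t powr D * exp (- pi * t / 2)) * (2 * (LINT y|lborel. w y)) \<le> (LINT y|lborel. crit y * crit (t - y))"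
      by linarith
    have extra: "- (norm A * \<bar>C1\<bar> * (t powr D * exp (- pi * t / 2))) \<le> Re (A * completed h R A (Complex R t))"
    proof -
      have "norm (completed h R A (Complex R t)) \<le> C1 * (t powr D * exp (- pi * t / 2))"
        using C1[of "Complex R t"] t R_pos by simp
      also have "\<dots> \<le> \<bar>C1\<bar> * (t powr D * exp (- pi * t / 2))" by (intro mult_right_mono) auto
      finally have "norm A * norm (completed h R A (Complex R t)) \<le> norm A * (\<bar>C1\<bar> * (t powr D * exp (- pi * t / 2)))"
        by (intro mult_left_mono) auto
      moreover have "\<bar>Re (A * completed h R A (Complex R t))\<bar> \<le> norm A * norm (completed h R A (Complex R t))"
        using abs_Re_le_cmod[of "A * completed h R A (Complex R t)"] by (simp only: norm_mult)
      ultimately show ?thesis by (simp only: mult.assoc)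
    qed
    have "Re (completed (\<lambda>u. (h u)\<^sup>2) (2 * R) (A\<^sup>2) (Complex R t)) =
       1 / (2 * pi) * (LINT y|lborel. crit y * crit (t - y)) + 4 * Re (A * completed h R A (Complex R t))"
      using completed_square[OF intc, of t] t by simp
    moreover have "1 / (2 * pi) * ((LINT y|lborel. indicator {Y..t - Y} y * (\<bar>crit y\<bar> * \<bar>crit (t - y)\<bar>))
        - M * 2 powr D * (t powr D * exp (- pi * t / 2)) * (2 * (LINT y|lborel. w y))) \<le> 1 / (2 * pi) * (LINT y|lborel. crit y * crit (t - y))"
      using conv2 by (intro mult_left_mono) auto
    ultimately show ?thesis using extra unfolding K_def by (simp add: algebra_simps)
  qed
  then show ?thesis by blast
qed

end

text \<open>Besides the order of growth this carries positivity for large t, so the sign hypothesis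
  of the next squaring is met.\<close>

definition lower_order :: "(real \<Rightarrow> complex) \<Rightarrow> real \<Rightarrow> complex \<Rightarrow> real \<Rightarrow> bool" where
  "lower_order h R A E \<longleftrightarrow> (\<exists>c>0. \<exists>T. \<forall>t\<ge>T.
     c * (t powr E * exp (- pi * t / 2)) \<le> Re (completed h R A (Complex (R / 2) t)))"

section \<open>Lower bounds under squaring\<close>

context theta_fun
begin

lemma square_lower_order:
  assumes D: "D \<ge> 0" and bd: "strip_bounded D" and Y: "Y \<ge> 1"
    and sign: "\<And>y. y \<ge> Y \<Longrightarrow> \<epsilon> * crit y = \<bar>crit y\<bar>"
    and E: "D < E" and c: "c > 0"
    and main: "\<And>t. t \<ge> T \<Longrightarrow> c * (t powr E * exp (- pi * t / 2))
      \<le> (LINT y|lborel. indicator {Y..t - Y} y * (\<bar>crit y\<bar> * \<bar>crit (t - y)\<bar>))"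
  shows "lower_order (\<lambda>u. (h u)\<^sup>2) (2 * R) (A\<^sup>2) E"
proof -
  obtain K where K: "\<And>t. t \<ge> 1 \<Longrightarrow>
    1 / (2 * pi) * (LINT y|lborel. indicator {Y..t - Y} y * (\<bar>crit y\<bar> * \<bar>crit (t - y)\<bar>)) - K * (t powr D * exp (- pi * t / 2))
      \<le> Re (completed (\<lambda>u. (h u)\<^sup>2) (2 * R) (A\<^sup>2) (Complex R t))"
    using square_lower[OF D bd Y sign] by blast
  \<comment> \<open>Half of the main constant c/(2 pi); the other half absorbs the error, which is
    smaller by the factor t^(D - E).\<close>
  define c' where "c' = c / (4 * pi)"
  have c': "c' > 0" using c by (simp add: c'_def)
  have "((\<lambda>t. K * t powr (D - E)) \<longlongrightarrow> 0) at_top" using E by real_asymp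
  from order_tendstoD(2)[OF this c'] obtain N where N: "\<And>t. t \<ge> N \<Longrightarrow> K * t powr (D - E) < c'"
    by (auto simp: eventually_at_top_linorder)
  have "c' * (t powr E * exp (- pi * t / 2)) \<le> Re (completed (\<lambda>u. (h u)\<^sup>2) (2 * R) (A\<^sup>2) (Complex (2 * R / 2) t))"
    if t: "t \<ge> max (max N T) 1" for t
  proof -
    have "K * t powr D = K * t powr (D - E) * t powr E" by (simp add: mult.assoc flip: powr_add)
    also have "\<dots> \<le> c' * t powr E" using N[of t] t by (intro mult_right_mono) auto
    finally have "K * t powr D * exp (- pi * t / 2) \<le> c' * t powr E * exp (- pi * t / 2)"
      by (intro mult_right_mono) auto
    then have "K * (t powr D * exp (- pi * t / 2)) \<le> c' * (t powr E * exp (- pi * t / 2))"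
      by (simp only: mult.assoc)
    moreover have "1 / (2 * pi) * (c * (t powr E * exp (- pi * t / 2))) \<le> 1 / (2 * pi) * (LINT y|lborel. indicator {Y..t - Y} y * (\<bar>crit y\<bar> * \<bar>crit (t - y)\<bar>))"
      using main[of t] t by (intro mult_left_mono) auto
    moreover have "1 / (2 * pi) * (c * (t powr E * exp (- pi * t / 2))) = 2 * (c' * (t powr E * exp (- pi * t / 2)))"
      by (simp add: c'_def)
    moreover have "1 / (2 * pi) * (LINT y|lborel. indicator {Y..t - Y} y * (\<bar>crit y\<bar> * \<bar>crit (t - y)\<bar>)) - K * (t powr D * exp (- pi * t / 2))
      \<le> Re (completed (\<lambda>u. (h u)\<^sup>2) (2 * R) (A\<^sup>2) (Complex R t))"
      using K t by simp
    moreover have "2 * R / 2 = R" by simp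
    ultimately show ?thesis by (simp only:)
  qed
  then show ?thesis unfolding lower_order_def using c' by blast
qed

text \<open>On t/4 \<le> y \<le> 3 t/4 both factors have at least polynomial order t^E, and their
  exponentials multiply to exp(-pi t/2) regardless of y; the length t/2 of the interval accounts for
  the extra power.\<close>

lemma lower_order_square:
  assumes D: "D \<ge> 0" and bd: "strip_bounded D" and low: "lower_order h R A E"
    and E: "E \<ge> 0" "D < 2 * E + 1"
  shows "lower_order (\<lambda>u. (h u)\<^sup>2) (2 * R) (A\<^sup>2) (2 * E + 1)"
proof -
  obtain c T where c: "c > 0" and T: "\<And>t. t \<ge> T \<Longrightarrow> c * (t powr E * exp (- pi * t / 2)) \<le> crit t"
    using low unfolding lower_order_def crit_def by blast
  define Y where "Y = max T 1"
  have pos: "0 \<le> crit y" if "y \<ge> Y" for y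
    by (rule order_trans[OF _ T]) (use c that in \<open>auto simp: Y_def\<close>)
  show ?thesis
  proof (rule square_lower_order[OF D bd _ _ E(2)])
    show "1 \<le> Y" by (simp add: Y_def)
    show "1 * crit y = \<bar>crit y\<bar>" if "Y \<le> y" for y using pos[OF that] by simp
    show "0 < c\<^sup>2 * (1 / 4) powr (2 * E) / 2" using c by simp
    \<comment> \<open>This makes the middle half of [0, t] part of [Y, t - Y].\<close>
    fix t :: real assume t: "t \<ge> 4 * Y"
    have t0: "t > 0" "t \<ge> 4" using t by (auto simp: Y_def)
    define k where "k = c\<^sup>2 * ((1 / 4) powr (2 * E) * t powr (2 * E)) * exp (- pi * t / 2)"
    have "(LINT y|lborel. k * indicator {t/4..3 * t/4} y)
       \<le> (LINT y|lborel. indicator {Y..t - Y} y * (\<bar>crit y\<bar> * \<bar>crit (t - y)\<bar>))"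
    proof (rule integral_mono)
      have "continuous_on {Y..t - Y} (\<lambda>y. \<bar>crit y\<bar> * \<bar>crit (t - y)\<bar>)"
        by (intro continuous_intros continuous_on_compose2[OF continuous_crit]) auto
      then show "integrable lborel (\<lambda>y. indicator {Y..t - Y} y * (\<bar>crit y\<bar> * \<bar>crit (t - y)\<bar>))"
        using borel_integrable_compact[of "{Y..t - Y}" "\<lambda>y. \<bar>crit y\<bar> * \<bar>crit (t - y)\<bar>"]
        by (simp add: set_integrable_def)
      fix y
      show "k * indicator {t/4..3 * t/4} y \<le> indicator {Y..t - Y} y * (\<bar>crit y\<bar> * \<bar>crit (t - y)\<bar>)"
      proof (cases "y \<in> {t/4..3 * t/4}")
        case True
        then have y: "y \<ge> t / 4" "t - y \<ge> t / 4" "y \<ge> Y" "t - y \<ge> Y" using t by auto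
        have "k = (c * ((t / 4) powr E * exp (- pi * y / 2))) * (c * ((t / 4) powr E * exp (- pi * (t - y) / 2)))"
        proof -
          have "exp (- pi * t / 2) = exp (- pi * y / 2) * exp (- pi * (t - y) / 2)"
            by (simp add: algebra_simps flip: exp_add)
          moreover have "(1 / 4) powr (2 * E) * t powr (2 * E) = (t / 4) powr E * (t / 4) powr E"
            using t0 by (simp add: powr_divide flip: powr_add)
          ultimately show ?thesis unfolding k_def by (simp only: power2_eq_square mult_ac)
        qed
        also have "\<dots> \<le> (c * (y powr E * exp (- pi * y / 2))) * (c * ((t - y) powr E * exp (- pi * (t - y) / 2)))"
          using y c t0 E by (intro mult_mono mult_nonneg_nonneg powr_mono2) auto
        also have "\<dots> \<le> crit y * crit (t - y)"
          using T[of y] T[of "t - y"] y c pos[of y] by (intro mult_mono) (auto simp: Y_def)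
        finally show ?thesis using True y pos[of y] pos[of "t - y"] by (simp add: indicator_def)
      qed auto
      show "integrable lborel (\<lambda>y. k * indicator {t/4..3 * t/4} y)"
        by (intro integrable_mult_right integrable_real_indicator) (auto simp: emeasure_lborel_Icc_eq)
    qed
    moreover have "(LINT y|lborel. k * indicator {t/4..3 * t/4} y) = c\<^sup>2 * (1 / 4) powr (2 * E) / 2 * (t powr (2 * E + 1) * exp (- pi * t / 2))"
    proof -
      have "(LINT y|lborel. k * indicator {t/4..3 * t/4} y) = k * (t / 2)" using t0 by simp
      moreover have "t powr (2 * E + 1) = t powr (2 * E) * t" using t0 by (simp add: powr_add)
      ultimately show ?thesis by (simp only: k_def) simp
    qed
    ultimately show "c\<^sup>2 * (1 / 4) powr (2 * E) / 2 * (t powr (2 * E + 1) * exp (- pi * t / 2))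
      \<le> (LINT y|lborel. indicator {Y..t - Y} y * (\<bar>crit y\<bar> * \<bar>crit (t - y)\<bar>))" by (simp only:)
  qed
qed

end

section \<open>Theta functions of generalized Dirichlet series\<close>

lemma Gamma_mellin_exp:
  fixes s :: complex and L :: real
  assumes s: "Re s > 0" and L: "L > 0"
  shows "has_bochner_integral lborel (\<lambda>u. exp (s * of_real u) * of_real (exp (- L * exp u)))
           (Gamma s * of_real L powr (- s))"
proof -
  define f where "f = (\<lambda>t. of_real t powr (s - 1) / of_real (exp t) :: complex)"
  have abs: "f absolutely_integrable_on {0<..}"
    unfolding f_def by (rule absolutely_integrable_Gamma_integral'[OF s])
  have "(f has_integral Gamma s) {0<..}" unfolding f_def by (rule Gamma_integral_complex'[OF s])
  then have int: "integral {0<..} f = Gamma s" by (rule integral_unique)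
  have img: "range (exp :: real \<Rightarrow> real) = {0<..}" by (auto simp: image_def intro: exp_ln[symmetric])
  have "(\<lambda>x. \<bar>exp x\<bar> *\<^sub>R f (exp x)) absolutely_integrable_on UNIV \<and> integral UNIV (\<lambda>x. \<bar>exp x\<bar> *\<^sub>R f (exp x)) = Gamma s"
    by (subst has_absolute_integral_change_of_variables_real)
       (auto simp: img abs int inj_on_def intro!: derivative_eq_intros)
  also have "(\<lambda>x. \<bar>exp x\<bar> *\<^sub>R f (exp x)) = (\<lambda>u. exp (s * of_real u) * of_real (exp (- exp u)))"
  proof
    fix u :: real
    have "complex_of_real (exp u) powr (s - 1) = exp ((s - 1) * of_real u)"
      by (simp add: powr_def Ln_of_real flip: exp_of_real)
    moreover have "complex_of_real (exp u) * exp ((s - 1) * of_real u) = exp (s * of_real u)"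
      by (simp add: left_diff_distrib exp_diff flip: exp_of_real)
    ultimately show "\<bar>exp u\<bar> *\<^sub>R f (exp u) = exp (s * of_real u) * of_real (exp (- exp u))"
      by (simp add: f_def scaleR_conv_of_real exp_minus divide_inverse mult.assoc[symmetric])
  qed
  finally have A: "(\<lambda>u. exp (s * of_real u) * of_real (exp (- exp u))) absolutely_integrable_on UNIV"
    and B: "integral UNIV (\<lambda>u. exp (s * of_real u) * of_real (exp (- exp u))) = Gamma s" by auto
  have i1: "integrable lborel (\<lambda>u. exp (s * of_real u) * of_real (exp (- exp u)))"
    using A unfolding set_integrable_def by (subst (asm) integrable_completion) auto
  have h1: "has_bochner_integral lborel (\<lambda>u. exp (s * of_real u) * of_real (exp (- exp u))) (Gamma s)"
    using i1 integral_lborel[OF i1] B by (simp add: has_bochner_integral_iff)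
  \<comment> \<open>Translation by ln L in the logarithmic variable produces the factor
    L^(-s).\<close>
  have h2: "has_bochner_integral lborel (\<lambda>u. exp (s * of_real (ln L + 1 * u)) * of_real (exp (- exp (ln L + 1 * u)))) (Gamma s /\<^sub>R \<bar>1\<bar>)"
    by (subst lborel_has_bochner_integral_real_affine_iff[symmetric]) (use h1 in auto)
  have "has_bochner_integral lborel (\<lambda>u. exp (- s * of_real (ln L)) * (exp (s * of_real (ln L + 1 * u)) * of_real (exp (- exp (ln L + 1 * u))))) (exp (- s * of_real (ln L)) * (Gamma s /\<^sub>R \<bar>1\<bar>))"
    by (rule has_bochner_integral_mult_right[OF h2])
  also have "(\<lambda>u. exp (- s * of_real (ln L)) * (exp (s * of_real (ln L + 1 * u)) * of_real (exp (- exp (ln L + 1 * u)))))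
    = (\<lambda>u. exp (s * of_real u) * of_real (exp (- L * exp u)))"
    using L by (simp add: fun_eq_iff exp_add distrib_left exp_minus field_simps)
  also have "exp (- s * of_real (ln L)) * (Gamma s /\<^sub>R \<bar>1\<bar>) = Gamma s * of_real L powr (- s)"
    using L by (simp add: powr_def Ln_of_real)
  finally show ?thesis .
qed

text \<open>Fubini for counting measure times \<open>lborel\<close>; \<open>sum\<close> gives
  integrability on the product, and \<open>pt\<close> turns the pointwise infinite sum into an
  integral over the counting measure.\<close>

lemma has_bochner_integral_infsum:
  fixes f :: "'i \<Rightarrow> real \<Rightarrow> complex"
  assumes J: "countable J"
    and int: "\<And>j. j \<in> J \<Longrightarrow> integrable lborel (f j)"
    and sum: "(\<lambda>j. LINT u|lborel. norm (f j u)) summable_on J"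
    and pt: "\<And>u. (\<lambda>j. norm (f j u)) summable_on J"
  shows "has_bochner_integral lborel (\<lambda>u. \<Sum>\<^sub>\<infinity>j\<in>J. f j u) (\<Sum>\<^sub>\<infinity>j\<in>J. LINT u|lborel. f j u)"
proof -
  interpret C: sigma_finite_measure "count_space J" by (rule sigma_finite_measure_count_space_countable[OF J])
  interpret P: pair_sigma_finite "count_space J" lborel ..
  have meas: "case_prod f \<in> borel_measurable (count_space J \<Otimes>\<^sub>M lborel)"
    using J int by (intro measurable_pair_measure_countable1) auto
  have absI: "Infinite_Set_Sum.abs_summable_on g J" if "(\<lambda>j. norm (g j)) summable_on J" for g :: "'i \<Rightarrow> complex"
    using abs_summable_equivalent that by blast
  have "integrable (count_space J) (\<lambda>j. complex_of_real (LINT u|lborel. norm (f j u)))"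
    using absI[of "\<lambda>j. complex_of_real (LINT u|lborel. norm (f j u))"] sum by (simp add: Infinite_Set_Sum.abs_summable_on_def)
  then have s: "integrable (count_space J) (\<lambda>j. LINT u|lborel. norm (f j u))" by (simp add: complex_of_real_integrable_eq)
  have I: "integrable (count_space J \<Otimes>\<^sub>M lborel) (case_prod f)"
    by (rule P.Fubini_integrable[OF meas]) (use s int in \<open>auto simp: AE_count_space\<close>)
  have e1: "(\<Sum>\<^sub>\<infinity>j\<in>J. f j u) = (LINT j|count_space J. f j u)" for u
    using infsetsum_infsum[OF absI[OF pt[of u]]] by (simp add: infsetsum_def)
  have "(\<lambda>j. norm (LINT u|lborel. f j u)) summable_on J"
    by (rule Infinite_Sum.abs_summable_on_comparison_test'[OF sum]) (rule integral_norm_bound)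
  from infsetsum_infsum[OF absI[OF this]]
  have e2: "(\<Sum>\<^sub>\<infinity>j\<in>J. LINT u|lborel. f j u) = (LINT j|count_space J. LINT u|lborel. f j u)"
    by (simp add: infsetsum_def)
  show ?thesis
    unfolding e1 e2 has_bochner_integral_iff using P.integrable_snd[OF I] P.Fubini_integral[OF I] by simp
qed

lemma exp_minus_le_powr:
  fixes K :: real
  assumes K: "K \<ge> 0"
  shows "\<exists>C>0. \<forall>y>0. exp (- y) \<le> C * y powr (- K)"
proof -
  define n where "n = nat \<lceil>K\<rceil>"
  have n: "K \<le> real n" unfolding n_def by linarith
  have "exp (- y) \<le> max 1 (fact n) * y powr (- K)" if y: "y > 0" for y
  proof (cases "y \<ge> 1")
    case True
    have "y ^ n / fact n \<le> exp y"
    proof -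
      have "(\<Sum>k\<in>{n}. y ^ k /\<^sub>R fact k) \<le> (\<Sum>k. y ^ k /\<^sub>R fact k)"
        using y by (intro sum_le_suminf summable_exp_generic) auto
      then show ?thesis by (simp add: exp_def divide_inverse mult.commute)
    qed
    then have "exp (- y) \<le> fact n / y ^ n" using y by (simp add: exp_minus field_simps)
    also have "\<dots> = fact n * y powr (- real n)" using y by (simp add: powr_minus powr_realpow divide_inverse)
    also have "\<dots> \<le> max 1 (fact n) * y powr (- K)" using True n by (intro mult_mono powr_mono) auto
    finally show ?thesis .
  next
    case False
    then have "1 * 1 \<le> max 1 (fact n) * y powr (- K)"
      using y K powr_mono2'[of "- K" y 1] by (intro mult_mono) auto
    moreover have "exp (- y) \<le> 1" using y by simp
    ultimately show ?thesis by linarith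
  qed
  then show ?thesis by (intro exI[of _ "max 1 (fact n)"]) auto
qed

text \<open>Index 0 is included: with \<open>l 0\<close> = 0 it contributes the constant term
  \<open>a 0\<close>. The variable is x = exp u, so the modular relation x \<mapsto> 1/x becomes u
  \<mapsto> -u.\<close>

definition theta :: "(nat \<Rightarrow> complex) \<Rightarrow> (nat \<Rightarrow> real) \<Rightarrow> real \<Rightarrow> complex" where
  "theta a l u = (\<Sum>n. a n * of_real (exp (- l n * exp u)))"

text \<open>\<open>sa\<close> is any nonnegative number to the right of which the series converges
  absolutely, not necessarily the abscissa itself; one interpretation uses 0 in its place.\<close>

locale hecke_series =
  fixes a :: "nat \<Rightarrow> complex" and l :: "nat \<Rightarrow> real" and sa :: real
  assumes exponents: "hecke_exponents l" and l_0 [simp]: "l 0 = 0"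
    and summable_coeff: "\<And>\<sigma>. \<sigma> > sa \<Longrightarrow> summable (\<lambda>n. norm (a (Suc n)) * l (Suc n) powr (- \<sigma>))"
    and sa_nonneg: "sa \<ge> 0"
    and coeff_nonzero: "\<exists>n\<ge>1. a n \<noteq> 0"
begin

lemma l_Suc_pos: "l (Suc n) > 0"
  using exponents by (auto simp: hecke_exponents_def)

lemma l_nonneg: "l n \<ge> 0"
  using l_Suc_pos[of "n - 1"] by (cases n) auto

lemma l_strict: "1 \<le> m \<Longrightarrow> m < n \<Longrightarrow> l m < l n"
  using exponents by (auto simp: hecke_exponents_def strict_mono_on_def)

lemma theta_term_bound:
  assumes "K \<ge> 0"
  shows "\<exists>C>0. \<forall>n u. norm (a (Suc n) * of_real (exp (- l (Suc n) * exp u))) \<le> C * (norm (a (Suc n)) * l (Suc n) powr (- K)) * exp (- K * u)"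
proof -
  obtain C where C: "C > 0" "\<And>y. y > 0 \<Longrightarrow> exp (- y) \<le> C * y powr (- K)"
    using exp_minus_le_powr[OF assms] by blast
  have "norm (a (Suc n) * of_real (exp (- l (Suc n) * exp u))) \<le> C * (norm (a (Suc n)) * l (Suc n) powr (- K)) * exp (- K * u)" for n u
  proof -
    have "exp (- (l (Suc n) * exp u)) \<le> C * (l (Suc n) * exp u) powr (- K)"
      using l_Suc_pos by (intro C(2)) auto
    also have "(l (Suc n) * exp u) powr (- K) = l (Suc n) powr (- K) * exp (- K * u)"
      by (simp add: powr_mult) (simp add: powr_def)
    finally have "norm (a (Suc n)) * exp (- (l (Suc n) * exp u)) \<le> norm (a (Suc n)) * (C * (l (Suc n) powr (- K) * exp (- K * u)))"
      by (intro mult_left_mono) auto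
    then show ?thesis by (simp add: norm_mult mult_ac)
  qed
  then show ?thesis using C(1) by blast
qed

lemma theta_summable_norm: "summable (\<lambda>n. norm (a n * of_real (exp (- l n * exp u))))"
proof -
  define K where "K = sa + 1"
  have "K \<ge> 0" using sa_nonneg by (simp add: K_def)
  then obtain C where C: "\<And>n u. norm (a (Suc n) * of_real (exp (- l (Suc n) * exp u))) \<le> C * (norm (a (Suc n)) * l (Suc n) powr (- K)) * exp (- K * u)"
    using theta_term_bound by blast
  have "summable (\<lambda>n. C * (norm (a (Suc n)) * l (Suc n) powr (- K)) * exp (- K * u))"
    by (intro summable_mult summable_mult2 summable_coeff) (simp add: K_def)
  then have "summable (\<lambda>n. norm (a (Suc n) * of_real (exp (- l (Suc n) * exp u))))"
    by (rule summable_comparison_test'[where N = 0]) (simp only: real_norm_def abs_norm_cancel C)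
  then show ?thesis by (subst summable_Suc_iff[symmetric])
qed

lemma theta_minus: "theta a l u - a 0 = (\<Sum>n. a (Suc n) * of_real (exp (- l (Suc n) * exp u)))"
  unfolding theta_def
  using suminf_split_head[OF summable_norm_cancel[OF theta_summable_norm[of u]]] by simp

text \<open>The bound covers all real u; on u < 0 it limits the growth of theta, which is what
  Mellin inversion on Re s = \<open>K\<close> requires.\<close>

lemma theta_decay:
  assumes K: "K > sa"
  shows "\<exists>C. \<forall>u. norm (theta a l u - a 0) \<le> C * exp (- K * u)"
proof -
  have "K \<ge> 0" using K sa_nonneg by simp
  then obtain C where C: "\<And>n u. norm (a (Suc n) * of_real (exp (- l (Suc n) * exp u))) \<le> C * (norm (a (Suc n)) * l (Suc n) powr (- K)) * exp (- K * u)"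
    using theta_term_bound by blast
  have "norm (theta a l u - a 0) \<le> (C * (\<Sum>n. norm (a (Suc n)) * l (Suc n) powr (- K))) * exp (- K * u)" for u
  proof -
    have s: "summable (\<lambda>n. norm (a (Suc n)) * l (Suc n) powr (- K))" by (rule summable_coeff[OF K])
    have "norm (theta a l u - a 0) \<le> (\<Sum>n. C * (norm (a (Suc n)) * l (Suc n) powr (- K)) * exp (- K * u))"
      unfolding theta_minus
      by (intro norm_suminf_le summable_mult summable_mult2 s C)
    also have "\<dots> = (C * (\<Sum>n. norm (a (Suc n)) * l (Suc n) powr (- K))) * exp (- K * u)"
      using s by (simp add: suminf_mult suminf_mult2[symmetric] summable_mult)
    finally show ?thesis .
  qed
  then show ?thesis by blast
qed

text \<open>Each term decreases in modulus as u grows, so on a ray u > v the values at v are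
  majorants for the Weierstrass test.\<close>

lemma continuous_theta: "continuous_on UNIV (theta a l)"
proof -
  have "continuous_on {v<..} (theta a l)" for v
  proof (rule uniform_limit_theorem)
    show "uniform_limit {v<..} (\<lambda>N u. \<Sum>n<N. a n * of_real (exp (- l n * exp u))) (theta a l) sequentially"
      unfolding theta_def
    proof (rule Weierstrass_m_test[OF _ theta_summable_norm[of v]])
      fix n u assume "u \<in> {v<..}"
      then have "exp (- l n * exp u) \<le> exp (- l n * exp v)" using l_nonneg[of n] by (simp add: mult_left_mono)
      then show "norm (a n * of_real (exp (- l n * exp u))) \<le> norm (a n * of_real (exp (- l n * exp v)))"
        by (simp add: norm_mult mult_left_mono)
    qed
    show "\<forall>\<^sub>F N in sequentially. continuous_on {v<..} (\<lambda>u. \<Sum>n<N. a n * of_real (exp (- l n * exp u)))"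
      by (intro always_eventually allI continuous_intros)
  qed simp
  then have "isCont (theta a l) u" for u
    using continuous_on_eq_continuous_at[of "{u - 1<..}" "theta a l"] by auto
  then show ?thesis by (simp add: continuous_at_imp_continuous_on)
qed

section \<open>Powers of theta and the Epstein series\<close>

definition tuples :: "nat \<Rightarrow> (nat \<Rightarrow> nat) set" where
  "tuples N = {n \<in> {..<N} \<rightarrow>\<^sub>E UNIV. \<exists>i<N. n i \<noteq> 0}"

lemma countable_tuples: "countable (tuples N)"
  by (rule countable_subset[of _ "{..<N} \<rightarrow>\<^sub>E UNIV"]) (auto simp: tuples_def intro!: countable_PiE)

lemma tuple_sum_ge:
  assumes "n \<in> tuples N" "i < N"
  shows "l (n i) \<le> (\<Sum>i<N. l (n i))"
  using assms by (intro member_le_sum) (auto simp: l_nonneg)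

lemma tuple_sum_ge_1:
  assumes "n \<in> tuples N"
  shows "l 1 \<le> (\<Sum>i<N. l (n i))"
proof -
  obtain i where i: "i < N" "n i \<noteq> 0" using assms by (auto simp: tuples_def)
  have "l 1 \<le> l (n i)" using l_strict[of 1 "n i"] i by (cases "n i = 1") auto
  also have "\<dots> \<le> (\<Sum>i<N. l (n i))" using tuple_sum_ge[OF assms i(1)] .
  finally show ?thesis .
qed

lemma tuple_sum_pos: "n \<in> tuples N \<Longrightarrow> (\<Sum>i<N. l (n i)) > 0"
  using tuple_sum_ge_1[of n N] l_Suc_pos[of 0] by simp

lemma summable_on_product:
  fixes f :: "nat \<Rightarrow> real" and N :: nat
  assumes "summable (\<lambda>n. norm (f n))"
  shows "(\<lambda>g. \<bar>\<Prod>i<N. f (g i)\<bar>) summable_on ({..<N} \<rightarrow>\<^sub>E UNIV)"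
proof -
  have f: "Infinite_Set_Sum.abs_summable_on f UNIV" using assms by (simp add: abs_summable_on_nat_iff')
  have "Infinite_Set_Sum.abs_summable_on (\<lambda>g. \<Prod>i<N. f (g i)) ({..<N} \<rightarrow>\<^sub>E UNIV)"
    by (rule abs_summable_on_prod_PiE) (use f in auto)
  then have "(\<lambda>g. norm (\<Prod>i<N. f (g i))) summable_on ({..<N} \<rightarrow>\<^sub>E UNIV)"
    unfolding abs_summable_equivalent[symmetric] .
  then show ?thesis by (simp only: real_norm_def)
qed

text \<open>With \<tau> = \<sigma>/N > \<open>sa\<close> the power of the sum factors into N equal
  powers, and each is at most the power of a single summand; so the multiple series is dominated by
  a product of N convergent series.\<close>

lemma epstein_abs_summable:
  assumes \<sigma>: "\<sigma> > real N * sa" and N: "N \<ge> 1"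
  shows "(\<lambda>n. norm (\<Prod>i<N. a (n i)) * (\<Sum>i<N. l (n i)) powr (- \<sigma>)) summable_on tuples N"
proof -
  define \<tau> where "\<tau> = \<sigma> / real N"
  have \<tau>: "\<tau> > sa" "\<tau> > 0" "\<sigma> = real N * \<tau>"
    using \<sigma> N sa_nonneg by (auto simp: \<tau>_def field_simps intro: le_less_trans[of 0 "real N * sa"])
  \<comment> \<open>An index 0 has exponent \<open>l 0\<close> = 0 and no decay of its own; there
    the whole sum is bounded below by \<open>l 1\<close> instead, since some entry of the tuple is
    nonzero.\<close>
  define w where "w = (\<lambda>n. if n = 0 then l 1 powr (- \<tau>) else l n powr (- \<tau>))"
  have "summable (\<lambda>n. norm (norm (a (Suc n)) * w (Suc n)))"
    using summable_coeff[OF \<tau>(1)] by (simp add: w_def abs_mult)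
  then have s: "summable (\<lambda>n. norm (norm (a n) * w n))" by (subst summable_Suc_iff[symmetric])
  show ?thesis
  proof (rule summable_on_comparison_test)
    show "(\<lambda>g. \<bar>\<Prod>i<N. norm (a (g i)) * w (g i)\<bar>) summable_on tuples N"
      by (rule summable_on_subset_banach[OF summable_on_product[OF s]]) (auto simp: tuples_def)
    fix n assume n: "n \<in> tuples N"
    let ?L = "\<Sum>i<N. l (n i)"
    have L: "?L > 0" by (rule tuple_sum_pos[OF n])
    have "?L powr (- \<sigma>) = (\<Prod>i<N. ?L powr (- \<tau>))"
      using L by (simp add: \<tau>(3) powr_powr mult.commute flip: powr_realpow)
    also have "\<dots> \<le> (\<Prod>i<N. w (n i))"
    proof (intro prod_mono conjI)
      fix i assume "i \<in> {..<N}"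
      then have "l (n i) \<le> ?L" "l 1 \<le> ?L" using tuple_sum_ge[OF n] tuple_sum_ge_1[OF n] by auto
      then show "?L powr (- \<tau>) \<le> w (n i)"
        using \<tau> l_Suc_pos[of 0] l_Suc_pos[of "n i - 1"] unfolding w_def by (auto intro!: powr_mono2')
    qed auto
    finally have "norm (\<Prod>i<N. a (n i)) * ?L powr (- \<sigma>) \<le> norm (\<Prod>i<N. a (n i)) * (\<Prod>i<N. w (n i))"
      by (intro mult_left_mono) auto
    also have "\<dots> = (\<Prod>i<N. norm (a (n i)) * w (n i))" by (simp add: prod_norm prod.distrib)
    also have "\<dots> \<le> \<bar>\<Prod>i<N. norm (a (n i)) * w (n i)\<bar>" by simp
    finally show "norm (\<Prod>i<N. a (n i)) * ?L powr (- \<sigma>) \<le> \<bar>\<Prod>i<N. norm (a (n i)) * w (n i)\<bar>" .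
  qed (auto intro!: mult_nonneg_nonneg)
qed

lemma norm_powr_tuple:
  assumes "n \<in> tuples N"
  shows "norm (complex_of_real (\<Sum>i<N. l (n i)) powr s) = (\<Sum>i<N. l (n i)) powr Re s"
  using tuple_sum_pos[OF assms] by (subst norm_powr_real_powr) auto

lemma norm_epstein_le:
  assumes s: "Re s > real N * sa" and N: "N \<ge> 1"
  shows "norm (epstein_series N a l s) \<le> (\<Sum>\<^sub>\<infinity>n\<in>tuples N. norm (\<Prod>i<N. a (n i)) * (\<Sum>i<N. l (n i)) powr (- Re s))"
proof -
  have e: "norm ((\<Prod>i<N. a (n i)) / complex_of_real (\<Sum>i<N. l (n i)) powr s) = norm (\<Prod>i<N. a (n i)) * (\<Sum>i<N. l (n i)) powr (- Re s)"
    if "n \<in> tuples N" for n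
    unfolding norm_divide norm_powr_tuple[OF that] by (simp add: powr_minus divide_inverse)
  have "(\<lambda>n. norm ((\<Prod>i<N. a (n i)) / complex_of_real (\<Sum>i<N. l (n i)) powr s)) summable_on tuples N"
    using epstein_abs_summable[OF s N] by (subst summable_on_cong[OF e]) auto
  then have "norm (epstein_series N a l s) \<le> (\<Sum>\<^sub>\<infinity>n\<in>tuples N. norm ((\<Prod>i<N. a (n i)) / complex_of_real (\<Sum>i<N. l (n i)) powr s))"
    unfolding epstein_series_def tuples_def by (rule norm_infsum_bound)
  also have "\<dots> = (\<Sum>\<^sub>\<infinity>n\<in>tuples N. norm (\<Prod>i<N. a (n i)) * (\<Sum>i<N. l (n i)) powr (- Re s))"
    by (rule infsum_cong[OF e])
  finally show ?thesis .
qed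

lemma theta_infsum:
  "(\<lambda>n. norm (a n * of_real (exp (- l n * exp u)))) summable_on UNIV"
  "(\<Sum>\<^sub>\<infinity>n. a n * of_real (exp (- l n * exp u))) = theta a l u"
proof -
  show "(\<lambda>n. norm (a n * of_real (exp (- l n * exp u)))) summable_on UNIV"
    using theta_summable_norm[of u] by (simp add: summable_on_UNIV_nonneg_real_iff)
  have "(\<lambda>n. a n * of_real (exp (- l n * exp u))) sums theta a l u"
    unfolding theta_def using summable_norm_cancel[OF theta_summable_norm[of u]] by (rule summable_sums)
  from norm_summable_imp_has_sum[OF theta_summable_norm this]
  show "(\<Sum>\<^sub>\<infinity>n. a n * of_real (exp (- l n * exp u))) = theta a l u" by (rule infsumI)
qed

text \<open>Multiplying out the N-th power of theta gives a sum over all N-tuples; the zero tuple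
  contributes the N-th power of \<open>a 0\<close> and is the one left out of the Epstein
  series.\<close>

lemma theta_power_infsum:
  fixes N :: nat
  defines "F \<equiv> \<lambda>u n. (\<Prod>i<N. a (n i)) * of_real (exp (- (\<Sum>i<N. l (n i)) * exp u))"
  shows "(\<lambda>n. norm (F u n)) summable_on tuples N"
    and "N \<ge> 1 \<Longrightarrow> (\<Sum>\<^sub>\<infinity>n\<in>tuples N. F u n) = theta a l u ^ N - a 0 ^ N"
proof -
  define t where "t = (\<lambda>n. a n * complex_of_real (exp (- l n * exp u)))"
  have F: "F u n = (\<Prod>i<N. t (n i))" for n
  proof -
    have "exp (- (\<Sum>i<N. l (n i)) * exp u) = (\<Prod>i<N. exp (- l (n i) * exp u))"
      by (simp add: sum_distrib_right sum_negf[symmetric] exp_sum)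
    then show ?thesis by (simp add: F_def t_def prod.distrib)
  qed
  have "summable (\<lambda>n. norm (norm (t n)))" using theta_summable_norm[of u] by (simp add: t_def)
  from summable_on_product[OF this, of N]
  have S: "(\<lambda>n. norm (F u n)) summable_on ({..<N} \<rightarrow>\<^sub>E UNIV)"
    by (simp add: F prod_norm[symmetric] abs_prod)
  then show "(\<lambda>n. norm (F u n)) summable_on tuples N"
    by (rule summable_on_subset_banach) (auto simp: tuples_def)
  assume N: "N \<ge> 1"
  define z where "z = (\<lambda>i\<in>{..<N}. 0 :: nat)"
  have tz: "tuples N = ({..<N} \<rightarrow>\<^sub>E UNIV) - {z}"
    unfolding tuples_def z_def by (auto simp: PiE_def extensional_def fun_eq_iff restrict_def)
  have "infsum (F u) ({..<N} \<rightarrow>\<^sub>E UNIV) = (\<Prod>i<N. \<Sum>\<^sub>\<infinity>n. t n)"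
    unfolding F using theta_infsum(1)[of u] by (intro infsum_prod_PiE_abs) (auto simp: t_def)
  also have "\<dots> = theta a l u ^ N" unfolding t_def theta_infsum(2) by simp
  finally have A: "infsum (F u) ({..<N} \<rightarrow>\<^sub>E UNIV) = theta a l u ^ N" .
  have "infsum (F u) (({..<N} \<rightarrow>\<^sub>E UNIV) - {z}) = infsum (F u) ({..<N} \<rightarrow>\<^sub>E UNIV) - infsum (F u) {z}"
    by (rule infsum_Diff) (auto intro: abs_summable_summable[OF S] simp: z_def)
  also have "infsum (F u) {z} = a 0 ^ N"
    by (simp add: F t_def z_def)
  finally show "(\<Sum>\<^sub>\<infinity>n\<in>tuples N. F u n) = theta a l u ^ N - a 0 ^ N" by (simp add: tz A)
qed

lemma Gamma_mellin_exp_norm: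
  fixes L \<sigma> :: real
  assumes "\<sigma> > 0" "L > 0"
  shows "(LINT u|lborel. exp (\<sigma> * u) * exp (- L * exp u)) = Gamma \<sigma> * L powr (- \<sigma>)"
proof -
  have "has_bochner_integral lborel (\<lambda>u. exp (of_real \<sigma> * of_real u) * of_real (exp (- L * exp u)))
           (Gamma (of_real \<sigma>) * of_real L powr (- of_real \<sigma>) :: complex)"
    using assms by (intro Gamma_mellin_exp) auto
  then have "(LINT u|lborel. complex_of_real (exp (\<sigma> * u) * exp (- L * exp u))) = Gamma (of_real \<sigma>) * of_real L powr (- of_real \<sigma>)"
    by (simp add: has_bochner_integral_iff exp_mult_of_real)
  also have "\<dots> = of_real (Gamma \<sigma> * L powr (- \<sigma>))"
    using assms by (simp add: Gamma_complex_of_real powr_of_real[symmetric])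
  finally show ?thesis unfolding integral_complex_of_real by (simp only: of_real_eq_iff)
qed

text \<open>Each tuple gives a Gamma integral with L the sum of its exponents;
  \<open>epstein_abs_summable\<close> at Re s supplies the absolute convergence for the
  exchange.\<close>

lemma mellin_theta_power:
  assumes s: "Re s > real N * sa" and N: "N \<ge> 1"
  shows "has_bochner_integral lborel (\<lambda>u. exp (s * of_real u) * (theta a l u ^ N - a 0 ^ N)) (Gamma s * epstein_series N a l s)"
proof -
  have s0: "Re s > 0" using s sa_nonneg by (auto intro: le_less_trans[of 0 "real N * sa"])
  define c where "c = (\<lambda>n. \<Prod>i<N. a (n i))"
  define L where "L = (\<lambda>n. \<Sum>i<N. l (n i))"
  define f where "f = (\<lambda>n u. c n * (exp (s * of_real u) * of_real (exp (- L n * exp u))))"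
  have L: "L n > 0" if "n \<in> tuples N" for n using tuple_sum_pos[OF that] by (simp add: L_def)
  have hf: "has_bochner_integral lborel (f n) (c n * (Gamma s * of_real (L n) powr (- s)))" if "n \<in> tuples N" for n
    unfolding f_def by (intro has_bochner_integral_mult_right Gamma_mellin_exp s0 L that)
  have nf: "(LINT u|lborel. norm (f n u)) = Gamma (Re s) * (norm (c n) * L n powr (- Re s))" if "n \<in> tuples N" for n
  proof -
    have "norm (f n u) = norm (c n) * (exp (Re s * u) * exp (- L n * exp u))" for u by (simp add: f_def norm_mult)
    then show ?thesis using Gamma_mellin_exp_norm[OF s0 L[OF that]] by simp
  qed
  have F: "f n u = exp (s * of_real u) * (c n * of_real (exp (- L n * exp u)))" for n u by (simp add: f_def)
  have "has_bochner_integral lborel (\<lambda>u. \<Sum>\<^sub>\<infinity>n\<in>tuples N. f n u) (\<Sum>\<^sub>\<infinity>n\<in>tuples N. LINT u|lborel. f n u)"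
  proof (rule has_bochner_integral_infsum[OF countable_tuples])
    show "integrable lborel (f n)" if "n \<in> tuples N" for n using hf[OF that] by (simp add: has_bochner_integral_iff)
    have "(\<lambda>n. Gamma (Re s) * (norm (c n) * L n powr (- Re s))) summable_on tuples N"
      using epstein_abs_summable[OF s N] unfolding c_def L_def by (intro summable_on_cmult_right)
    then show "(\<lambda>n. LINT u|lborel. norm (f n u)) summable_on tuples N"
      by (subst summable_on_cong[OF nf]) auto
    show "(\<lambda>n. norm (f n u)) summable_on tuples N" for u
      unfolding F norm_mult[of "exp (s * of_real u)"] c_def L_def
      by (intro summable_on_cmult_right theta_power_infsum(1))
  qed
  also have "(\<lambda>u. \<Sum>\<^sub>\<infinity>n\<in>tuples N. f n u) = (\<lambda>u. exp (s * of_real u) * (theta a l u ^ N - a 0 ^ N))"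
    unfolding F infsum_cmult_right' c_def L_def theta_power_infsum(2)[OF N] ..
  also have "(\<Sum>\<^sub>\<infinity>n\<in>tuples N. LINT u|lborel. f n u) = (\<Sum>\<^sub>\<infinity>n\<in>tuples N. Gamma s * (c n / of_real (L n) powr s))"
    by (intro infsum_cong) (use hf in \<open>auto simp: has_bochner_integral_iff powr_minus divide_inverse\<close>)
  also have "\<dots> = Gamma s * epstein_series N a l s"
    unfolding infsum_cmult_right' epstein_series_def tuples_def c_def L_def ..
  finally show ?thesis .
qed

end

lemma norm_dirichlet_term:
  "l (Suc n) > 0 \<Longrightarrow> norm (dirichlet_term a l s (Suc n)) = norm (a (Suc n)) * l (Suc n) powr (- Re s)"
  unfolding dirichlet_term_def norm_mult by (subst norm_powr_real_powr) auto

section \<open>The leading term of the Dirichlet series\<close>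

context hecke_series
begin

lemma dirichlet_summable_norm:
  "Re s > sa \<Longrightarrow> summable (\<lambda>n. norm (dirichlet_term a l s (Suc n)))"
  using summable_coeff[of "Re s"] by (simp add: norm_dirichlet_term l_Suc_pos)

lemma epstein_series_1:
  assumes "Re s > sa"
  shows "epstein_series 1 a l s = dirichlet_series a l s"
proof -
  have e: "(\<Prod>i<1. a (n i)) / complex_of_real (\<Sum>i<1. l (n i)) powr s = a (n 0) / complex_of_real (l (n 0)) powr s"
    for n :: "nat \<Rightarrow> nat" by (simp add: lessThan_Suc)
  have "epstein_series 1 a l s = (\<Sum>\<^sub>\<infinity>n\<in>tuples 1. a (n 0) / complex_of_real (l (n 0)) powr s)"
    unfolding epstein_series_def tuples_def e ..
  also have "\<dots> = (\<Sum>\<^sub>\<infinity>n\<in>UNIV. dirichlet_term a l s (Suc n))"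
  proof (rule infsum_reindex_bij_witness[of _ "\<lambda>n. \<lambda>i\<in>{..<1}. Suc n" "\<lambda>n. n 0 - 1"])
    fix n assume n: "n \<in> tuples 1"
    then have n0: "n 0 \<noteq> 0" by (auto simp: tuples_def)
    show "(\<lambda>i\<in>{..<1}. Suc (n 0 - 1)) = n"
      using n n0 by (auto simp: tuples_def PiE_def extensional_def fun_eq_iff)
    show "dirichlet_term a l s (Suc (n 0 - 1)) = a (n 0) / complex_of_real (l (n 0)) powr s"
      using n0 by (simp add: dirichlet_term_def powr_minus divide_inverse)
  qed (auto simp: tuples_def)
  also have "\<dots> = dirichlet_series a l s"
    unfolding dirichlet_series_def
    by (intro infsumI norm_summable_imp_has_sum dirichlet_summable_norm assms summable_sums summable_norm_cancel[OF dirichlet_summable_norm])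
  finally show ?thesis .
qed

definition lead :: nat where "lead = (LEAST n. n \<ge> 1 \<and> a n \<noteq> 0)"

lemma lead: "lead \<ge> 1" "a lead \<noteq> 0" "\<And>n. 1 \<le> n \<Longrightarrow> n < lead \<Longrightarrow> a n = 0"
proof -
  have "lead \<ge> 1 \<and> a lead \<noteq> 0" unfolding lead_def by (rule LeastI_ex) (use coeff_nonzero in auto)
  then show "lead \<ge> 1" "a lead \<noteq> 0" by auto
  show "a n = 0" if "1 \<le> n" "n < lead" for n
    using not_less_Least[of n "\<lambda>n. n \<ge> 1 \<and> a n \<noteq> 0"] that by (auto simp: lead_def)
qed

lemma l_lead_pos: "l lead > 0"
  using l_Suc_pos[of "lead - 1"] lead(1) by simp

text \<open>After multiplication by (l lead)^s the leading term is constant, and at real part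
  \<sigma> + x every later one is at most q^x times its size at \<sigma> = sa + 1, where q < 1 is
  the ratio of \<open>l lead\<close> to the next exponent. The tolerance 1/8 suits products of two
  such series: 2/8 + 1/64 = 17/64 stays below 1/3.\<close>

lemma dirichlet_leading_term:
  fixes b :: real
  obtains c where "c > b" "c > sa"
    "\<And>s. Re s = c \<Longrightarrow> norm (dirichlet_series a l s * of_real (l lead) powr s - a lead) \<le> norm (a lead) / 8"
proof -
  define \<sigma> where "\<sigma> = sa + 1"
  define q where "q = l lead / l (Suc lead)"
  have lpos: "l (Suc n) > 0" for n by (rule l_Suc_pos)
  have q: "0 < q" "q < 1" using l_lead_pos lpos[of lead] l_strict[of lead "Suc lead"] lead(1) by (auto simp: q_def)
  define S where "S = (\<Sum>n. norm (a (Suc n)) * l (Suc n) powr (- \<sigma>)) * l lead powr \<sigma>"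
  have sum\<sigma>: "summable (\<lambda>n. norm (a (Suc n)) * l (Suc n) powr (- \<sigma>))" by (rule summable_coeff) (simp add: \<sigma>_def)
  have "((\<lambda>x. q powr x * S) \<longlongrightarrow> 0) at_top"
  proof -
    have "((\<lambda>x. q powr x) \<longlongrightarrow> 0) at_top" using q by real_asymp
    then show ?thesis by (rule tendsto_mult_left_zero)
  qed
  then have "eventually (\<lambda>x. q powr x * S < norm (a lead) / 8) at_top"
    using lead(2) by (intro order_tendstoD) auto
  then have "eventually (\<lambda>x. q powr x * S < norm (a lead) / 8 \<and> x > 0 \<and> x > b - \<sigma>) at_top"
    by (intro eventually_conj eventually_gt_at_top)
  then obtain x where x: "q powr x * S < norm (a lead) / 8" "x > 0" "x > b - \<sigma>"
    by (auto dest!: eventually_happens)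
  define c where "c = \<sigma> + x"
  have "norm (dirichlet_series a l s * of_real (l lead) powr s - a lead) \<le> norm (a lead) / 8" if s: "Re s = c" for s
  proof -
    define g where "g = (\<lambda>n. dirichlet_term a l s (Suc n) * of_real (l lead) powr s)"
    define e where "e = (\<lambda>n. if n = lead - 1 then a lead else 0)"
    have sc: "Re s > sa" using s x by (simp add: c_def \<sigma>_def)
    have gs: "g sums (dirichlet_series a l s * of_real (l lead) powr s)"
      unfolding g_def dirichlet_series_def
      by (intro sums_mult2 summable_sums summable_norm_cancel[OF dirichlet_summable_norm[OF sc]])
    have es: "e sums a lead" unfolding e_def using sums_single[of "lead - 1" "\<lambda>_. a lead"] by simp
    have ps: "(of_real y :: complex) powr (- s) * of_real y powr s = 1" if "y > 0" for y
      using that by (simp flip: powr_add)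
    have bound: "norm (g n - e n) \<le> q powr x * (norm (a (Suc n)) * l (Suc n) powr (- \<sigma>) * l lead powr \<sigma>)" for n
    proof -
      consider "Suc n < lead" | "Suc n = lead" | "lead < Suc n" by linarith
      then show ?thesis
      proof cases
        case 1
        then have "a (Suc n) = 0" using lead(3)[of "Suc n"] by simp
        moreover have "n \<noteq> lead - 1" using 1 lead(1) by linarith
        ultimately show ?thesis by (simp add: g_def e_def dirichlet_term_def)
      next
        case 2
        have "g n = a lead * (of_real (l lead) powr (- s) * of_real (l lead) powr s)"
          unfolding g_def dirichlet_term_def 2 by (rule mult.assoc)
        also have "\<dots> = a lead" unfolding ps[OF l_lead_pos] by simp
        finally have "g n = a lead" .
        moreover have "e n = a lead" unfolding e_def 2[symmetric] by simp
        ultimately show ?thesis using q by (simp add: mult_nonneg_nonneg)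
      next
        case 3
        have "n \<noteq> lead - 1" using 3 lead(1) by linarith
        then have "e n = 0" by (simp add: e_def)
        moreover have "norm (g n) = norm (a (Suc n)) * l (Suc n) powr (- c) * l lead powr c"
          using lpos[of n] l_lead_pos s unfolding g_def dirichlet_term_def norm_mult
          by (subst (1 2) norm_powr_real_powr) auto
        moreover have "l (Suc n) powr (- c) * l lead powr c \<le> q powr x * (l (Suc n) powr (- \<sigma>) * l lead powr \<sigma>)"
        proof -
          have "l (Suc lead) \<le> l (Suc n)"
            using 3 l_strict[of "Suc lead" "Suc n"] by (cases "lead = n") auto
          then have "l lead / l (Suc n) \<le> q" unfolding q_def using l_lead_pos lpos by (intro divide_left_mono) auto
          then have "(l lead / l (Suc n)) powr x \<le> q powr x" using x l_lead_pos lpos[of n] by (intro powr_mono2) auto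
          then have "l (Suc n) powr (- x) * l lead powr x \<le> q powr x"
          proof -
            have "(l lead / l (Suc n)) powr x = l lead powr x / l (Suc n) powr x"
              using l_lead_pos lpos[of n] by (simp add: powr_divide)
            then show ?thesis using \<open>(l lead / l (Suc n)) powr x \<le> q powr x\<close> by (simp add: powr_minus field_simps)
          qed
          then have "(l (Suc n) powr (- x) * l lead powr x) * (l (Suc n) powr (- \<sigma>) * l lead powr \<sigma>) \<le> q powr x * (l (Suc n) powr (- \<sigma>) * l lead powr \<sigma>)"
            by (intro mult_right_mono) auto
          also have "(l (Suc n) powr (- x) * l lead powr x) * (l (Suc n) powr (- \<sigma>) * l lead powr \<sigma>)
            = (l (Suc n) powr (- \<sigma>) * l (Suc n) powr (- x)) * (l lead powr \<sigma> * l lead powr x)" by (simp only: mult_ac)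
          also have "\<dots> = l (Suc n) powr (- c) * l lead powr c" by (simp add: c_def flip: powr_add)
          finally show ?thesis .
        qed
        then have "norm (a (Suc n)) * (l (Suc n) powr (- c) * l lead powr c) \<le> norm (a (Suc n)) * (q powr x * (l (Suc n) powr (- \<sigma>) * l lead powr \<sigma>))"
          by (intro mult_left_mono) auto
        ultimately show ?thesis by (simp add: mult_ac)
      qed
    qed
    have sb: "summable (\<lambda>n. q powr x * (norm (a (Suc n)) * l (Suc n) powr (- \<sigma>) * l lead powr \<sigma>))"
      by (intro summable_mult summable_mult2 sum\<sigma>)
    have "dirichlet_series a l s * of_real (l lead) powr s - a lead = (\<Sum>n. g n - e n)"
      using sums_diff[OF gs es] by (simp add: sums_iff)
    also have "norm \<dots> \<le> (\<Sum>n. q powr x * (norm (a (Suc n)) * l (Suc n) powr (- \<sigma>) * l lead powr \<sigma>))"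
      by (rule norm_suminf_le[OF bound sb])
    also have "\<dots> = q powr x * S"
      unfolding S_def using sum\<sigma> by (simp add: suminf_mult suminf_mult2 summable_mult2)
    finally show ?thesis using x(1) by linarith
  qed
  then show ?thesis using x by (intro that[of c]) (auto simp: c_def \<sigma>_def)
qed

end

section \<open>Self-dual theta functions\<close>

text \<open>A primitive on a convex domain replaces the contour integral over a rectangle.\<close>
lemma vertical_shift:
  fixes W :: "complex \<Rightarrow> complex" and a b y0 y1 M :: real
  assumes hol: "W holomorphic_on S" and S: "convex S" "open S"
    and rect: "\<And>s. a \<le> Re s \<Longrightarrow> Re s \<le> b \<Longrightarrow> y0 \<le> Im s \<Longrightarrow> Im s \<le> y1 \<Longrightarrow> s \<in> S"
    and ab: "a \<le> b" and y: "y0 \<le> y1"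
    and hor: "\<And>s. a \<le> Re s \<Longrightarrow> Re s \<le> b \<Longrightarrow> Im s = y0 \<or> Im s = y1 \<Longrightarrow> norm (W s) \<le> M"
  shows "norm (integral {y0..y1} (\<lambda>y. W (Complex a y)) - integral {y0..y1} (\<lambda>y. W (Complex b y))) \<le> 2 * M * (b - a)"
proof -
  obtain F where F: "\<And>z. z \<in> S \<Longrightarrow> (F has_field_derivative W z) (at z)"
    using holomorphic_convex_primitive'[OF S hol] S(2) by (metis at_within_open)
  \<comment> \<open>Along a vertical line the primitive has derivative i W, so the two integrals
    differ by values of \<open>F\<close> at the four corners, which the estimates on the horizontal
    edges control.\<close>
  have vert: "((\<lambda>y. W (Complex x y)) has_integral (F (Complex x y1) - F (Complex x y0)) / \<i>) {y0..y1}"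
    if x: "a \<le> x" "x \<le> b" for x
  proof -
    have "((\<lambda>y. F (Complex x y)) has_vector_derivative \<i> * W (Complex x y)) (at y within {y0..y1})"
      if "y \<in> {y0..y1}" for y
    proof -
      have "(F has_field_derivative W (Complex x y)) (at (Complex x y))" using that x by (intro F rect) auto
      moreover have "((\<lambda>y. Complex x y) has_vector_derivative \<i>) (at y within {y0..y1})"
        unfolding Complex_eq by (auto intro!: derivative_eq_intros)
      ultimately have "((F \<circ> (\<lambda>y. Complex x y)) has_vector_derivative \<i> * W (Complex x y)) (at y within {y0..y1})"
        by (intro field_vector_diff_chain_within) (auto intro: has_field_derivative_at_within)
      then show ?thesis by (simp add: o_def)
    qed
    then have "((\<lambda>y. \<i> * W (Complex x y)) has_integral F (Complex x y1) - F (Complex x y0)) {y0..y1}"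
      by (intro fundamental_theorem_of_calculus y)
    from has_integral_divide[OF this, of \<i>] show ?thesis by simp
  qed
  have horiz: "norm (F (Complex b y) - F (Complex a y)) \<le> M * (b - a)" if "y = y0 \<or> y = y1" for y
  proof -
    have "norm (F (Complex b y) - F (Complex a y)) \<le> M * norm (Complex b y - Complex a y)"
    proof (rule field_differentiable_bound[of "closed_segment (Complex a y) (Complex b y)" F W M])
      fix z assume z: "z \<in> closed_segment (Complex a y) (Complex b y)"
      have "closed_segment (Complex a y) (Complex b y) \<subseteq> cbox (Complex a y) (Complex b y)"
        using ab by (intro closed_segment_subset convex_box) (auto simp: in_cbox_complex_iff)
      with z have zz: "a \<le> Re z" "Re z \<le> b" "Im z = y" by (auto simp: in_cbox_complex_iff)
      show "(F has_field_derivative W z) (at z within closed_segment (Complex a y) (Complex b y))"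
        by (rule has_field_derivative_at_within[OF F[OF rect]]) (use zz that y in auto)
      show "norm (W z) \<le> M" using zz that by (intro hor) auto
    qed auto
    then show ?thesis using ab by (simp add: cmod_def)
  qed
  have "integral {y0..y1} (\<lambda>y. W (Complex a y)) - integral {y0..y1} (\<lambda>y. W (Complex b y))
      = ((F (Complex b y0) - F (Complex a y0)) - (F (Complex b y1) - F (Complex a y1))) / \<i>"
    using integral_unique[OF vert[of a]] integral_unique[OF vert[of b]] ab by (simp add: field_simps)
  also have "norm \<dots> \<le> norm (F (Complex b y0) - F (Complex a y0)) + norm (F (Complex b y1) - F (Complex a y1))"
    unfolding norm_divide norm_ii div_by_1 by (rule norm_triangle_ineq4)
  also have "\<dots> \<le> M * (b - a) + M * (b - a)" by (intro add_mono horiz) auto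
  finally show ?thesis by simp
qed

text \<open>The modular relation is assumed here in place of the functional equation, because it
  passes to powers of theta at once. \<open>class_A_imp_hecke_theta\<close> derives it for class
  A.\<close>

locale hecke_theta = hecke_series a l sa for a :: "nat \<Rightarrow> complex" and l sa +
  fixes r :: real and \<Phi> :: "complex \<Rightarrow> complex"
  assumes r_pos: "r > 0"
    and modular: "theta a l (- u) = of_real (exp (r * u)) * cnj (theta a l u)"
    and sa_lt: "sa < r + 1 / 2"
    and \<Phi>_analytic: "\<Phi> analytic_on - {of_real r}"
    and \<Phi>_series: "\<And>s. Re s > sa \<Longrightarrow> \<Phi> s = dirichlet_series a l s"
begin

sublocale base: theta_fun "theta a l" r "a 0"
proof
  show "\<exists>C. \<forall>u\<ge>0. norm (theta a l u - a 0) \<le> C * exp (- K * u)" for K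
  proof -
    \<comment> \<open>\<open>theta_decay\<close> asks for an exponent above \<open>sa\<close>; on u
      \<ge> 0 a larger one is stronger.\<close>
    define K' where "K' = max K (sa + 1)"
    obtain C where C: "\<And>u. norm (theta a l u - a 0) \<le> C * exp (- K' * u)"
    proof -
      have "K' > sa" by (simp add: K'_def)
      from theta_decay[OF this] that show ?thesis by blast
    qed
    have C0: "0 \<le> C" using order_trans[OF norm_ge_zero C[of 0]] by simp
    have "norm (theta a l u - a 0) \<le> C * exp (- K * u)" if "u \<ge> 0" for u
    proof -
      have "- K' * u \<le> - K * u" using that by (intro mult_right_mono) (auto simp: K'_def)
      then have "C * exp (- K' * u) \<le> C * exp (- K * u)" using C0 by (intro mult_left_mono) auto
      then show ?thesis using C[of u] by linarith
    qed
    then show ?thesis by blast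
  qed
qed (rule r_pos continuous_theta modular)+

lemma theta_fun_power:
  "theta_fun (\<lambda>u. theta a l u ^ (2 ^ k)) (2 ^ k * r) (a 0 ^ (2 ^ k))"
proof (induction k)
  case 0
  show ?case using base.theta_fun_axioms by simp
next
  case (Suc k)
  interpret t: theta_fun "\<lambda>u. theta a l u ^ (2 ^ k)" "2 ^ k * r" "a 0 ^ (2 ^ k)" by (rule Suc)
  have e: "x ^ (2 ^ Suc k) = (x ^ (2 ^ k))\<^sup>2" for x :: complex
    by (simp add: power_mult[symmetric] mult.commute)
  show ?case unfolding e using t.theta_fun_square by (simp add: mult.assoc)
qed

text \<open>Both sides are the same Mellin integral; its convergence is what
  \<open>mellin_full'\<close> asks for.\<close>

lemma completed_eq_epstein:
  assumes s: "Re s > 2 ^ k * sa"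
  shows "completed (\<lambda>u. theta a l u ^ (2 ^ k)) (2 ^ k * r) (a 0 ^ (2 ^ k)) s = Gamma s * epstein_series (2 ^ k) a l s"
proof -
  interpret t: theta_fun "\<lambda>u. theta a l u ^ (2 ^ k)" "2 ^ k * r" "a 0 ^ (2 ^ k)" by (rule theta_fun_power)
  have N: "(2::nat) ^ k \<ge> 1" by simp
  have s': "Re s > real (2 ^ k) * sa" using s by simp
  have s0: "Re s > 0" using s sa_nonneg by (auto intro: le_less_trans[of 0 "2 ^ k * sa"])
  show ?thesis
    using mellin_theta_power[OF s' N] t.mellin_full'[OF _ s0] by (simp add: has_bochner_integral_iff)
qed

text \<open>The hypothesis \<open>sa < r + 1 / 2\<close> only enters through the choice of this abscissa: the exponent
  \<open>2 ^ k * cc - 1/2\<close> of the error terms stays below that of the main terms.\<close>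
definition cc :: real where "cc = (max (max sa r) (1/2) + (r + 1/2)) / 2"

lemma cc: "cc > sa" "cc > r" "cc > 1/2" "cc < r + 1/2"
  using r_pos sa_lt by (auto simp: cc_def)

lemma line_bound:
  assumes c: "c > sa"
  shows "\<exists>C. \<forall>t. norm (completed (\<lambda>u. theta a l u ^ (2 ^ k)) (2 ^ k * r) (a 0 ^ (2 ^ k)) (Complex (2 ^ k * c) t))
            \<le> C * norm (Gamma (Complex (2 ^ k * c) t))"
proof -
  define S where "S = (\<Sum>\<^sub>\<infinity>n\<in>tuples (2 ^ k). norm (\<Prod>i<2 ^ k. a (n i)) * (\<Sum>i<2 ^ k. l (n i)) powr (- (2 ^ k * c)))"
  have "norm (completed (\<lambda>u. theta a l u ^ (2 ^ k)) (2 ^ k * r) (a 0 ^ (2 ^ k)) (Complex (2 ^ k * c) t))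
            \<le> S * norm (Gamma (Complex (2 ^ k * c) t))" for t
  proof -
    have g: "Re (Complex (2 ^ k * c) t) > 2 ^ k * sa" using c by simp
    then have "norm (epstein_series (2 ^ k) a l (Complex (2 ^ k * c) t)) \<le> S"
      using norm_epstein_le[of "2 ^ k" "Complex (2 ^ k * c) t"] by (simp add: S_def)
    then show ?thesis
      unfolding completed_eq_epstein[OF g] norm_mult by (subst mult.commute) (rule mult_right_mono, auto)
  qed
  then show ?thesis by blast
qed

lemma upper_bound:
  assumes c: "c > sa" "c \<ge> r" "c \<ge> 1/2"
  shows "\<exists>C. \<forall>s. 2 ^ k * (r - c) \<le> Re s \<longrightarrow> Re s \<le> 2 ^ k * c \<longrightarrow> 1 \<le> \<bar>Im s\<bar> \<longrightarrow>
    norm (completed (\<lambda>u. theta a l u ^ (2 ^ k)) (2 ^ k * r) (a 0 ^ (2 ^ k)) s)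
     \<le> C * (\<bar>Im s\<bar> powr (2 ^ k * c - 1/2) * exp (- pi * \<bar>Im s\<bar> / 2))"
proof -
  interpret t: theta_fun "\<lambda>u. theta a l u ^ (2 ^ k)" "2 ^ k * r" "a 0 ^ (2 ^ k)" by (rule theta_fun_power)
  obtain C where C: "\<And>t. norm (completed (\<lambda>u. theta a l u ^ (2 ^ k)) (2 ^ k * r) (a 0 ^ (2 ^ k)) (Complex (2 ^ k * c) t))
            \<le> C * norm (Gamma (Complex (2 ^ k * c) t))" using line_bound[OF c(1)] by blast
  have k: "(1::real) \<le> 2 ^ k" by simp
  have 1: "2 ^ k * r / 2 \<le> 2 ^ k * c"
    using mult_left_mono[of "r / 2" c "2 ^ k"] c(2) r_pos by simp
  have 2: "1/2 \<le> 2 ^ k * c"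
    using mult_mono[of 1 "2 ^ k" "1/2" c] k c(3) by simp
  have eq: "2 ^ k * r - 2 ^ k * c = 2 ^ k * (r - c)" by (simp add: algebra_simps)
  show ?thesis using t.completed_upper_bound[OF 1 2 C] unfolding eq .
qed

text \<open>Since \<open>cc\<close> > r, the strip from 0 to 2^k r lies between the two lines that
  delimit \<open>upper_bound\<close>.\<close>

lemma strip_bounded_power:
  "theta_fun.strip_bounded (\<lambda>u. theta a l u ^ (2 ^ k)) (2 ^ k * r) (a 0 ^ (2 ^ k)) (2 ^ k * cc - 1/2)"
proof -
  interpret t: theta_fun "\<lambda>u. theta a l u ^ (2 ^ k)" "2 ^ k * r" "a 0 ^ (2 ^ k)" by (rule theta_fun_power)
  obtain C where C: "\<And>s. 2 ^ k * (r - cc) \<le> Re s \<Longrightarrow> Re s \<le> 2 ^ k * cc \<Longrightarrow> 1 \<le> \<bar>Im s\<bar> \<Longrightarrow>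
    norm (completed (\<lambda>u. theta a l u ^ (2 ^ k)) (2 ^ k * r) (a 0 ^ (2 ^ k)) s)
     \<le> C * (\<bar>Im s\<bar> powr (2 ^ k * cc - 1/2) * exp (- pi * \<bar>Im s\<bar> / 2))"
    using upper_bound[of cc k] cc by auto
  have "2 ^ k * (r - cc) \<le> 0" "2 ^ k * r \<le> 2 ^ k * cc" using cc by (auto simp: mult_nonneg_nonpos)
  then show ?thesis unfolding t.strip_bounded_def by (intro exI[of _ C] allI impI C) linarith+
qed

text \<open>Both sides are analytic on the right half plane without r, which is still connected, and
  agree far to the right, where the series converges.\<close>

lemma completed_base:
  assumes s: "Re s > 0" "s \<noteq> of_real r"
  shows "completed (theta a l) r (a 0) s = Gamma s * \<Phi> s"
proof -
  define S where "S = {s. Re s > 0} - {complex_of_real r}"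
  define b where "b = max sa r + 1"
  have opn: "open {s. Re s > 0}" by (rule open_halfspace_Re_gt)
  have con: "connected {s. Re s > 0}" by (intro convex_connected convex_halfspace_Re_gt)
  have "completed (theta a l) r (a 0) s - Gamma s * \<Phi> s = 0"
  proof (rule analytic_continuation[of "\<lambda>s. completed (theta a l) r (a 0) s - Gamma s * \<Phi> s" S "{s. Re s > b}" "of_real (b + 1)"])
    have "completed (theta a l) r (a 0) analytic_on S"
      by (rule base.completed_analytic) (auto simp: S_def)
    moreover have "\<Phi> analytic_on S" using \<Phi>_analytic by (rule analytic_on_subset) (auto simp: S_def)
    moreover have "Gamma analytic_on S" by (rule analytic_Gamma) (auto simp: S_def elim!: nonpos_Ints_cases)
    ultimately show "(\<lambda>s. completed (theta a l) r (a 0) s - Gamma s * \<Phi> s) holomorphic_on S"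
      by (intro analytic_imp_holomorphic analytic_on_diff analytic_on_mult)
    show "open S" unfolding S_def by (intro open_Diff opn) auto
    show "connected S" unfolding S_def by (rule connected_open_delete[OF opn con]) simp
    show sub: "{s. Re s > b} \<subseteq> S" using r_pos by (auto simp: S_def b_def)
    show "of_real (b + 1) \<in> S" using r_pos by (auto simp: S_def b_def complex_eq_iff)
    have "complex_of_real (b + 1) islimpt {s. Re s > b}"
      by (intro interior_limit_point) (auto simp: interior_open open_halfspace_Re_gt)
    then show "complex_of_real (b + 1) islimpt {s. Re s > b}" .
    show "s \<in> S" using s by (simp add: S_def)
    fix z assume z: "z \<in> {s. Re s > b}"
    then have "Re z > sa" by (simp add: b_def)
    then show "completed (theta a l) r (a 0) z - Gamma z * \<Phi> z = 0"
      using completed_eq_epstein[of 0 z] by (simp add: epstein_series_1[simplified] \<Phi>_series)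
  qed
  then show ?thesis by simp
qed

lemma crit_base: "of_real (base.crit y) = Gamma (Complex (r / 2) y) * \<Phi> (Complex (r / 2) y)"
proof -
  have "Complex (r / 2) y \<noteq> of_real r" using r_pos by (simp add: complex_eq_iff)
  then show ?thesis using completed_base[of "Complex (r / 2) y"] base.crit[of y] r_pos by simp
qed

end

lemma Gamma_lower_interval:
  fixes \<alpha> \<beta> :: real
  obtains c where "c > 0" "\<And>\<sigma> t. \<alpha> \<le> \<sigma> \<Longrightarrow> \<sigma> \<le> \<beta> \<Longrightarrow> 1 \<le> \<bar>t\<bar> \<Longrightarrow>
    c * (\<bar>t\<bar> powr (\<sigma> - 1/2) * exp (- pi * \<bar>t\<bar> / 2)) \<le> norm (Gamma (Complex \<sigma> t))"
proof (rule Gamma_vertical_bounds[of \<alpha> \<beta>])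
  fix c C
  assume "c > 0" "\<And>\<sigma> t. \<alpha> \<le> \<sigma> \<Longrightarrow> \<sigma> \<le> \<beta> \<Longrightarrow> 1 \<le> \<bar>t\<bar> \<Longrightarrow>
       c * (\<bar>t\<bar> powr (\<sigma> - 1/2) * exp (- pi * \<bar>t\<bar> / 2)) \<le> norm (Gamma (Complex \<sigma> t))"
  then show thesis by (rule that)
qed

section \<open>A mean value lower bound for \<Phi> on the critical line\<close>

context hecke_theta
begin

text \<open>Dividing the bound for the completed function by the lower bound for Gamma cancels the
  exponentials and leaves the exponent c - \<sigma>, largest at \<sigma> = r/2.\<close>

lemma \<Phi>_bound:
  assumes c: "c > sa" "c \<ge> r" "c \<ge> 1/2"
  shows "\<exists>C>0. \<forall>\<sigma> t. r / 2 \<le> \<sigma> \<longrightarrow> \<sigma> \<le> c \<longrightarrow> 1 \<le> \<bar>t\<bar> \<longrightarrow> norm (\<Phi> (Complex \<sigma> t)) \<le> C * \<bar>t\<bar> powr (c - r / 2)"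
proof -
  obtain C where C: "\<And>s. r - c \<le> Re s \<Longrightarrow> Re s \<le> c \<Longrightarrow> 1 \<le> \<bar>Im s\<bar> \<Longrightarrow>
    norm (completed (theta a l) r (a 0) s) \<le> C * (\<bar>Im s\<bar> powr (c - 1/2) * exp (- pi * \<bar>Im s\<bar> / 2))"
    using upper_bound[OF c, of 0] by auto
  obtain g where g: "g > 0"
    and lower: "\<And>\<sigma> t. r / 2 \<le> \<sigma> \<Longrightarrow> \<sigma> \<le> c \<Longrightarrow> 1 \<le> \<bar>t\<bar> \<Longrightarrow>
       g * (\<bar>t\<bar> powr (\<sigma> - 1/2) * exp (- pi * \<bar>t\<bar> / 2)) \<le> norm (Gamma (Complex \<sigma> t))"
    using Gamma_lower_interval[of "r / 2" c] by metis
  have "norm (\<Phi> (Complex \<sigma> t)) \<le> max 1 (C / g) * \<bar>t\<bar> powr (c - r / 2)"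
    if st: "r / 2 \<le> \<sigma>" "\<sigma> \<le> c" "1 \<le> \<bar>t\<bar>" for \<sigma> t
  proof -
    let ?e = "exp (- pi * \<bar>t\<bar> / 2)"
    have ne: "Complex \<sigma> t \<noteq> of_real r" using st by (auto simp: complex_eq_iff)
    have "g * (\<bar>t\<bar> powr (\<sigma> - 1/2) * ?e) * norm (\<Phi> (Complex \<sigma> t)) \<le> norm (Gamma (Complex \<sigma> t)) * norm (\<Phi> (Complex \<sigma> t))"
      by (intro mult_right_mono lower st) auto
    also have "\<dots> = norm (completed (theta a l) r (a 0) (Complex \<sigma> t))"
      using completed_base[OF _ ne] st r_pos by (simp add: norm_mult)
    also have "\<dots> \<le> C * (\<bar>t\<bar> powr (c - 1/2) * ?e)"
      using C[of "Complex \<sigma> t"] st r_pos by simp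
    finally have "(g * norm (\<Phi> (Complex \<sigma> t)) * \<bar>t\<bar> powr (\<sigma> - 1/2)) * ?e \<le> (C * \<bar>t\<bar> powr (c - 1/2)) * ?e"
      by (simp add: mult_ac)
    then have 1: "g * norm (\<Phi> (Complex \<sigma> t)) * \<bar>t\<bar> powr (\<sigma> - 1/2) \<le> C * \<bar>t\<bar> powr (c - 1/2)"
      by (subst (asm) mult_le_cancel_right_pos) auto
    have "g * norm (\<Phi> (Complex \<sigma> t)) = (g * norm (\<Phi> (Complex \<sigma> t)) * \<bar>t\<bar> powr (\<sigma> - 1/2)) * \<bar>t\<bar> powr (1/2 - \<sigma>)"
      using st by (simp add: mult.assoc flip: powr_add)
    also have "\<dots> \<le> (C * \<bar>t\<bar> powr (c - 1/2)) * \<bar>t\<bar> powr (1/2 - \<sigma>)" by (intro mult_right_mono 1) auto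
    also have "\<dots> = C * \<bar>t\<bar> powr (c - \<sigma>)" by (simp add: mult.assoc flip: powr_add)
    finally have "norm (\<Phi> (Complex \<sigma> t)) \<le> C / g * \<bar>t\<bar> powr (c - \<sigma>)" using g by (simp add: field_simps)
    also have "\<dots> \<le> max 1 (C / g) * \<bar>t\<bar> powr (c - r / 2)"
      using st by (intro mult_mono powr_mono) auto
    finally show ?thesis .
  qed
  then show ?thesis by (intro exI[of _ "max 1 (C / g)"]) auto
qed

text \<open>Normalised so that the leading term of the series becomes the constant
  \<open>a lead\<close>.\<close>

definition D :: "complex \<Rightarrow> complex" where "D s = \<Phi> s * of_real (l lead) powr s"

lemma norm_D: "norm (D s) = norm (\<Phi> s) * l lead powr Re s"
  using l_lead_pos unfolding D_def norm_mult by (subst norm_powr_real_powr) auto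

text \<open>The integral of \<open>\<Phi> s * cnj (\<Phi> (cnj (s - \<i> * t)))\<close>, weighted by \<open>((- \<i> * s) * (t + \<i> * s) / t\<^sup>2) ^ K\<close>
  and normalised by the leading term, is shifted from \<open>Re s = r / 2\<close> to a line on which the leading
  term dominates. The weight is small near both ends of the range, where it absorbs the polynomial growth of \<open>\<Phi>\<close>.\<close>
lemma base_convolution_lower:
  assumes Y: "Y \<ge> 1"
  shows "\<exists>\<kappa>>0. \<exists>T. \<forall>t\<ge>T. \<kappa> * (t powr r * exp (- pi * t / 2))
      \<le> (LINT y|lborel. indicator {Y..t - Y} y * (\<bar>base.crit y\<bar> * \<bar>base.crit (t - y)\<bar>))"
proof -
  obtain c where c: "c > max (max sa r) (1/2)" "c > sa"
    and lead_term: "\<And>s. Re s = c \<Longrightarrow> norm (dirichlet_series a l s * of_real (l lead) powr s - a lead) \<le> norm (a lead) / 8"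
    using dirichlet_leading_term[of "max (max sa r) (1/2)"] by metis
  have c': "c \<ge> r" "c \<ge> 1/2" "c \<ge> r / 2" "c > 0" using c r_pos by auto
  define \<alpha> where "\<alpha> = a lead"
  have \<alpha>: "\<alpha> \<noteq> 0" using lead(2) by (simp add: \<alpha>_def)
  define lam where "lam = l lead"
  have lam: "lam > 0" using l_lead_pos by (simp add: lam_def)
  define A where "A = c - r / 2"
  have A0: "A \<ge> 0" using c' by (simp add: A_def)
  obtain CF where CF: "CF > 0" "\<And>\<sigma> t. r / 2 \<le> \<sigma> \<Longrightarrow> \<sigma> \<le> c \<Longrightarrow> 1 \<le> \<bar>t\<bar> \<Longrightarrow> norm (\<Phi> (Complex \<sigma> t)) \<le> CF * \<bar>t\<bar> powr A"
    using \<Phi>_bound[OF c(2) c'(1,2)] unfolding A_def by blast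
  define CL where "CL = max (lam powr (r / 2)) (lam powr c)"
  have CL: "lam powr \<sigma> \<le> CL" if "r / 2 \<le> \<sigma>" "\<sigma> \<le> c" for \<sigma>
  proof (cases "lam \<ge> 1")
    case True
    then have "lam powr \<sigma> \<le> lam powr c" using that by (intro powr_mono) auto
    then show ?thesis by (simp add: CL_def)
  next
    case False
    then have "lam powr \<sigma> \<le> lam powr (r / 2)" using that lam by (intro powr_mono') auto
    then show ?thesis by (simp add: CL_def)
  qed
  have CL0: "CL > 0" using lam by (simp add: CL_def less_max_iff_disj)
  define CD where "CD = CF * CL"
  have CD0: "CD > 0" using CF CL0 by (simp add: CD_def)
  have D_bound: "norm (D (Complex \<sigma> t)) \<le> CD * \<bar>t\<bar> powr A" if "r / 2 \<le> \<sigma>" "\<sigma> \<le> c" "1 \<le> \<bar>t\<bar>" for \<sigma> t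
  proof -
    have "norm (\<Phi> (Complex \<sigma> t)) * lam powr \<sigma> \<le> (CF * \<bar>t\<bar> powr A) * CL"
      using CF that by (intro mult_mono CL) auto
    then show ?thesis by (simp add: norm_D lam_def CD_def mult_ac)
  qed
  \<comment> \<open>Two requirements: the weight absorbs t^A on the horizontal edges, and on the
    left edge it is below the power (y (t - y)/t^2)^((r - 1)/2) coming from the Gamma
    factors.\<close>
  define K where "K = nat \<lceil>max (A + 1) r\<rceil>"
  have K: "A \<le> real K" "(r - 1) / 2 \<le> real K"
  proof -
    have "max (A + 1) r \<le> real K" unfolding K_def by linarith
    then show "A \<le> real K" "(r - 1) / 2 \<le> real K" using r_pos by auto
  qed
  \<comment> \<open>At s = \<sigma> + i y the factors are y - i \<sigma> and (t - y) + i \<sigma>,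
    so \<open>P t s\<close> is a holomorphic stand-in for (y (t - y)/t^2)^K.\<close>
  define P where "P = (\<lambda>t s. ((- \<i> * s) * (of_real t + \<i> * s) / of_real (t\<^sup>2)) ^ K)"
  \<comment> \<open>The double conjugation keeps \<open>W\<close> holomorphic in s, while at s =
    \<sigma> + i y the last factor is cnj(D(\<sigma> + i (t - y))): heights y and t - y meet, as in
    the convolution.\<close>
  define W where "W = (\<lambda>t s. P t s * D s * cnj (D (cnj (s - \<i> * of_real t))))"
  define Rc where "Rc = c + Y"
  have Rc: "Rc \<ge> 1" "Rc > 0" using Y c' by (auto simp: Rc_def)
  \<comment> \<open>On each horizontal edge one factor of the weight is bounded and the other at
    most 2 t, so \<open>P\<close> is O(t^(-K)) against growth t^A of the two factors
    \<open>D\<close>, and the resulting bound does not depend on t.\<close>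
  have hor: "norm (W t s) \<le> (2 * Rc) ^ K * (CD * Y powr A) * CD"
    if s: "r / 2 \<le> Re s" "Re s \<le> c" "Im s = Y \<or> Im s = t - Y" and t: "t \<ge> Rc + 2 * Y" for s t
  proof -
    have tp: "t \<ge> 1" "t > 0" using t Rc Y by auto
    have Ds: "norm (D s) \<le> CD * \<bar>Im s\<bar> powr A" if "1 \<le> \<bar>Im s\<bar>"
      using D_bound[of "Re s" "Im s"] s(1,2) that by simp
    have s2: "cnj (s - \<i> * of_real t) = Complex (Re s) (t - Im s)" by (simp add: complex_eq_iff)
    have s3: "of_real t + \<i> * s = Complex (t - Im s) (Re s)" by (simp add: complex_eq_iff)
    have DD: "norm (D s) * norm (D (cnj (s - \<i> * of_real t))) \<le> (CD * Y powr A) * (CD * t powr A)"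
      using s(3)
    proof
      assume Im: "Im s = Y"
      have "norm (D s) \<le> CD * \<bar>Im s\<bar> powr A" using Ds Im Y by simp
      moreover have "norm (D (cnj (s - \<i> * of_real t))) \<le> CD * \<bar>t - Im s\<bar> powr A"
        unfolding s2 using s Im t Y Rc by (intro D_bound) auto
      moreover have "CD * \<bar>t - Im s\<bar> powr A \<le> CD * t powr A"
        using Im t Y Rc A0 CD0 by (intro mult_left_mono powr_mono2) auto
      ultimately have "norm (D (cnj (s - \<i> * of_real t))) \<le> CD * t powr A" "norm (D s) \<le> CD * Y powr A"
        using Im Y by (linarith, simp)
      then show ?thesis using CD0 by (intro mult_mono) auto
    next
      assume Im: "Im s = t - Y"
      have "norm (D s) \<le> CD * \<bar>Im s\<bar> powr A" using Ds Im Y Rc t by simp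
      moreover have "CD * \<bar>Im s\<bar> powr A \<le> CD * t powr A"
        using Im t Y Rc A0 CD0 by (intro mult_left_mono powr_mono2) auto
      moreover have "norm (D (cnj (s - \<i> * of_real t))) \<le> CD * \<bar>t - Im s\<bar> powr A"
        unfolding s2 using s Im t Y Rc by (intro D_bound) auto
      ultimately have "norm (D (cnj (s - \<i> * of_real t))) \<le> CD * Y powr A" "norm (D s) \<le> CD * t powr A"
        using Im Y by (simp, linarith)
      then have "norm (D (cnj (s - \<i> * of_real t))) * norm (D s) \<le> (CD * Y powr A) * (CD * t powr A)"
        using CD0 by (intro mult_mono) auto
      then show ?thesis by (simp add: mult.commute)
    qed
    have PP: "norm (P t s) \<le> (2 * Rc / t) ^ K"
    proof -
      have "norm (- \<i> * s) * norm (of_real t + \<i> * s) \<le> Rc * (2 * t)"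
        using s(3)
      proof
        assume Im: "Im s = Y"
        have "norm (- \<i> * s) \<le> Rc" using cmod_le[of s] s Im Y r_pos by (simp add: norm_mult Rc_def)
        moreover have "norm (of_real t + \<i> * s) \<le> 2 * t"
          unfolding s3 using cmod_le[of "Complex (t - Im s) (Re s)"] s Im Y r_pos t by (simp add: Rc_def)
        ultimately show ?thesis using Rc by (intro mult_mono) auto
      next
        assume Im: "Im s = t - Y"
        have "norm (- \<i> * s) \<le> 2 * t" using cmod_le[of s] s Im Y r_pos t by (simp add: norm_mult Rc_def)
        moreover have "norm (of_real t + \<i> * s) \<le> Rc"
          unfolding s3 using cmod_le[of "Complex (t - Im s) (Re s)"] s Im Y r_pos t by (simp add: Rc_def)
        ultimately have "norm (- \<i> * s) * norm (of_real t + \<i> * s) \<le> (2 * t) * Rc" using Rc tp by (intro mult_mono) auto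
        then show ?thesis by (simp add: mult_ac)
      qed
      then have "norm (- \<i> * s) * norm (of_real t + \<i> * s) / t\<^sup>2 \<le> 2 * Rc / t"
        using tp by (simp add: field_simps power2_eq_square)
      then have "(norm (- \<i> * s) * norm (of_real t + \<i> * s) / t\<^sup>2) ^ K \<le> (2 * Rc / t) ^ K"
        by (intro power_mono) auto
      then show ?thesis unfolding P_def norm_power norm_divide norm_mult norm_of_real by simp
    qed
    have tA: "t powr A \<le> t ^ K"
      using tp K powr_mono[of A "real K" t] by (simp add: powr_realpow)
    have "norm (W t s) = norm (P t s) * (norm (D s) * norm (D (cnj (s - \<i> * of_real t))))"
      by (simp add: W_def norm_mult)
    also have "\<dots> \<le> (2 * Rc / t) ^ K * ((CD * Y powr A) * (CD * t ^ K))"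
    proof (rule mult_mono[OF PP])
      have "(CD * Y powr A) * (CD * t powr A) \<le> (CD * Y powr A) * (CD * t ^ K)"
        using tA CD0 by (intro mult_left_mono) auto
      then show "norm (D s) * norm (D (cnj (s - \<i> * of_real t))) \<le> (CD * Y powr A) * (CD * t ^ K)"
        using DD by linarith
    qed (use Rc tp in auto)
    also have "\<dots> = (2 * Rc) ^ K * (CD * Y powr A) * CD"
      using tp by (simp add: power_divide)
    finally show ?thesis .
  qed
  define M where "M = (2 * Rc) ^ K * (CD * Y powr A) * CD"
  \<comment> \<open>In 0 < Im s < t neither the possible pole s = r nor its translate r + i t is
    met.\<close>
  have W_hol: "W t holomorphic_on {s. 0 < Im s \<and> Im s < t}" for t
  proof -
    have hD: "D holomorphic_on {s. 0 < Im s \<and> Im s < t}"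
      unfolding D_def using l_lead_pos \<Phi>_analytic
      by (intro analytic_imp_holomorphic analytic_on_mult analytic_on_powr)
         (auto intro: analytic_on_subset elim!: nonpos_Reals_cases)
    have op: "open {s. 0 < Im s \<and> Im s < t}"
      using open_Collect_conj[OF open_halfspace_Im_gt[of 0] open_halfspace_Im_lt[of t]] by simp
    have "(\<lambda>w. D (w + \<i> * of_real t)) holomorphic_on {s. - t < Im s \<and> Im s < 0}"
    proof -
      have "(D \<circ> (\<lambda>w. w + \<i> * of_real t)) holomorphic_on {s. - t < Im s \<and> Im s < 0}"
        by (rule holomorphic_on_compose_gen[OF _ hD]) (auto intro!: holomorphic_intros)
      then show ?thesis by (simp add: o_def)
    qed
    moreover have "cnj ` {s. 0 < Im s \<and> Im s < t} = {s. - t < Im s \<and> Im s < 0}"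
      by (auto simp: image_iff intro!: exI[of _ "cnj _"])
    ultimately have "(\<lambda>s. cnj (D (cnj s + \<i> * of_real t))) holomorphic_on {s. 0 < Im s \<and> Im s < t}"
      using holomorphic_on_compose_cnj_cnj[of "\<lambda>w. D (w + \<i> * of_real t)" "{s. 0 < Im s \<and> Im s < t}"] op by (simp add: o_def)
    then show ?thesis unfolding W_def P_def using hD by (cases "t = 0") (auto intro!: holomorphic_intros)
  qed
  have shift: "norm (integral {Y..t - Y} (\<lambda>y. W t (Complex (r / 2) y)) - integral {Y..t - Y} (\<lambda>y. W t (Complex c y))) \<le> 2 * M * (c - r / 2)"
    if t: "t \<ge> Rc + 2 * Y" for t
  proof (rule vertical_shift[OF W_hol[of t]])
    have e: "{s. 0 < Im s \<and> Im s < t} = {s. Im s > 0} \<inter> {s. Im s < t}" by auto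
    show "convex {s. 0 < Im s \<and> Im s < t}" unfolding e by (intro convex_Int convex_halfspace_Im_gt convex_halfspace_Im_lt)
    show "open {s. 0 < Im s \<and> Im s < t}" unfolding e by (intro open_Int open_halfspace_Im_gt open_halfspace_Im_lt)
    show "norm (W t s) \<le> M" if "r / 2 \<le> Re s" "Re s \<le> c" "Im s = Y \<or> Im s = t - Y" for s
      unfolding M_def by (rule hor[OF that t])
  qed (use Y t Rc c' in auto)
  have W_cont: "continuous_on {Y..t - Y} (\<lambda>y. W t (Complex x y))" for t x
  proof -
    have "continuous_on {s. 0 < Im s \<and> Im s < t} (W t)" by (rule holomorphic_on_imp_continuous_on[OF W_hol])
    then show ?thesis
      by (rule continuous_on_compose2) (use Y in \<open>auto simp: Complex_eq intro!: continuous_intros\<close>)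
  qed
  define p where "p = (\<lambda>t y::real. (y * (t - y) / t\<^sup>2) ^ K)"
  \<comment> \<open>Two errors are separated: replacing the weight by its real value
    \<open>p\<close> costs at most 2 K c/t, and replacing the product of the two \<open>D\<close> by
    |\<alpha>|^2 costs a proportion of at most 17/64 \<le> 1/3. The factor 4/3 bounds that product
    relative to |\<alpha>|^2.\<close>
  have right: "norm (W t (Complex c y) - of_real ((norm \<alpha>)\<^sup>2 * p t y)) \<le> (norm \<alpha>)\<^sup>2 * (p t y / 3 + 4 / 3 * (2 * real K * c / t))"
    if y: "Y \<le> y" "y \<le> t - Y" and t: "t \<ge> 8 * c" "t \<ge> Rc + 2 * Y" for t y
  proof -
    have tp: "t \<ge> 1" "t > 0" "t \<ge> c" using t Rc Y c' by auto
    define z1 where "z1 = (- \<i> * Complex c y) * (of_real t + \<i> * Complex c y) / of_real (t\<^sup>2)"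
    define x where "x = y * (t - y) / t\<^sup>2"
    have x0: "0 \<le> x" using y Y tp by (simp add: x_def)
    have x1: "x \<le> 1 / 4"
    proof -
      have "0 \<le> (t - 2 * y)\<^sup>2" by simp
      then have "4 * (y * (t - y)) \<le> t\<^sup>2" by (simp add: power2_eq_square algebra_simps)
      then show ?thesis using tp by (simp add: x_def field_simps)
    qed
    have z1: "z1 - of_real x = Complex (c\<^sup>2) (c * (2 * y - t)) / of_real (t\<^sup>2)"
    proof -
      have "(- \<i> * Complex c y) * (of_real t + \<i> * Complex c y) - of_real (y * (t - y)) = Complex (c\<^sup>2) (c * (2 * y - t))"
        by (simp add: complex_eq_iff power2_eq_square algebra_simps)
      then show ?thesis unfolding z1_def x_def of_real_divide diff_divide_distrib[symmetric] by simp
    qed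
    have d: "norm (z1 - of_real x) \<le> 2 * c / t"
    proof -
      have "norm (Complex (c\<^sup>2) (c * (2 * y - t))) \<le> \<bar>c\<^sup>2\<bar> + \<bar>c * (2 * y - t)\<bar>" using cmod_le[of "Complex (c\<^sup>2) (c * (2 * y - t))"] by simp
      also have "\<bar>c\<^sup>2\<bar> \<le> c * t" using tp c' by (simp add: power2_eq_square)
      also have "\<bar>c * (2 * y - t)\<bar> \<le> c * t" using y Y c' unfolding abs_mult by (intro mult_mono) auto
      finally have "norm (Complex (c\<^sup>2) (c * (2 * y - t))) \<le> 2 * c * t" by simp
      then have "norm (z1 - of_real x) \<le> 2 * c * t / t\<^sup>2"
        unfolding z1 norm_divide norm_of_real by (simp add: divide_right_mono)
      also have "\<dots> = 2 * c / t" using tp by (simp add: power2_eq_square)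
      finally show ?thesis .
    qed
    have "2 * c / t \<le> 1 / 4" using t tp by (simp add: field_simps)
    moreover have "norm z1 \<le> norm (z1 - of_real x) + norm (complex_of_real x)"
      using norm_triangle_ineq[of "z1 - of_real x" "of_real x"] by simp
    ultimately have nz: "norm z1 \<le> 1" "norm (complex_of_real x) \<le> 1" using d x0 x1 by auto
    have dK: "norm (z1 ^ K - of_real x ^ K) \<le> 2 * real K * c / t"
    proof -
      have "norm (z1 ^ K - of_real x ^ K) \<le> real K * norm (z1 - of_real x)" by (rule norm_power_diff[OF nz])
      also have "\<dots> \<le> real K * (2 * c / t)" by (intro mult_left_mono d) auto
      finally show ?thesis by (simp add: algebra_simps)
    qed
    define e1 where "e1 = D (Complex c y) - \<alpha>"
    define e2 where "e2 = D (Complex c (t - y)) - \<alpha>"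
    have De: "norm (D (Complex c v) - \<alpha>) \<le> norm \<alpha> / 8" for v
      using lead_term[of "Complex c v"] \<Phi>_series[of "Complex c v"] c by (simp add: D_def \<alpha>_def)
    have e: "norm e1 \<le> norm \<alpha> / 8" "norm e2 \<le> norm \<alpha> / 8" unfolding e1_def e2_def by (rule De)+
    define Q where "Q = D (Complex c y) * cnj (D (Complex c (t - y)))"
    have Qd: "norm (Q - of_real ((norm \<alpha>)\<^sup>2)) \<le> (norm \<alpha>)\<^sup>2 / 3"
    proof -
      have "Q = (\<alpha> + e1) * cnj (\<alpha> + e2)" by (simp add: Q_def e1_def e2_def)
      then have "Q - of_real ((norm \<alpha>)\<^sup>2) = e1 * cnj \<alpha> + \<alpha> * cnj e2 + e1 * cnj e2"
        unfolding complex_norm_square by (simp add: algebra_simps)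
      also have "norm \<dots> \<le> norm (e1 * cnj \<alpha>) + norm (\<alpha> * cnj e2) + norm (e1 * cnj e2)"
        by (intro order_trans[OF norm_triangle_ineq] add_mono norm_triangle_ineq order_refl)
      also have "\<dots> \<le> (norm \<alpha> / 8) * norm \<alpha> + norm \<alpha> * (norm \<alpha> / 8) + (norm \<alpha> / 8) * (norm \<alpha> / 8)"
        unfolding norm_mult complex_mod_cnj using e by (intro add_mono mult_mono) auto
      also have "\<dots> = 17 / 64 * (norm \<alpha>)\<^sup>2" by (simp add: power2_eq_square)
      also have "\<dots> \<le> (norm \<alpha>)\<^sup>2 / 3" by simp
      finally show ?thesis .
    qed
    have nQ: "norm Q \<le> 4 / 3 * (norm \<alpha>)\<^sup>2"
    proof -
      have "norm Q \<le> norm (Q - of_real ((norm \<alpha>)\<^sup>2)) + norm (complex_of_real ((norm \<alpha>)\<^sup>2))"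
        using norm_triangle_ineq[of "Q - of_real ((norm \<alpha>)\<^sup>2)" "of_real ((norm \<alpha>)\<^sup>2)"] by simp
      moreover have "norm (complex_of_real ((norm \<alpha>)\<^sup>2)) = (norm \<alpha>)\<^sup>2" by (simp add: norm_power)
      ultimately show ?thesis using Qd by linarith
    qed
    have pe: "p t y = x ^ K" by (simp add: p_def x_def)
    have arg: "cnj (Complex c y - \<i> * of_real t) = Complex c (t - y)" by (simp add: complex_eq_iff)
    have "W t (Complex c y) = z1 ^ K * Q" unfolding W_def P_def z1_def Q_def arg by (simp add: mult.assoc)
    then have "W t (Complex c y) - of_real ((norm \<alpha>)\<^sup>2 * p t y) = (z1 ^ K - of_real x ^ K) * Q + of_real x ^ K * (Q - of_real ((norm \<alpha>)\<^sup>2))"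
      by (simp add: pe algebra_simps)
    also have "norm \<dots> \<le> norm (z1 ^ K - of_real x ^ K) * norm Q + norm (complex_of_real x ^ K) * norm (Q - of_real ((norm \<alpha>)\<^sup>2))"
      unfolding norm_mult[symmetric] by (rule norm_triangle_ineq)
    also have "\<dots> \<le> (2 * real K * c / t) * (4 / 3 * (norm \<alpha>)\<^sup>2) + x ^ K * ((norm \<alpha>)\<^sup>2 / 3)"
      using dK nQ Qd x0 c' tp by (intro add_mono mult_mono) (auto simp: norm_power)
    also have "\<dots> = (norm \<alpha>)\<^sup>2 * (p t y / 3 + 4 / 3 * (2 * real K * c / t))"
      by (simp add: pe algebra_simps)
    finally show ?thesis .
  qed
  have p_cont: "continuous_on X (p t)" for t X unfolding p_def by (cases "t = 0") (auto intro!: continuous_intros)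
  \<comment> \<open>Within t/4 \<le> y \<le> 3 t/4 one has y (t - y) \<ge> 3/16 t^2, since |y - t/2|
    \<le> t/4.\<close>
  have p_int: "t / 2 * (3 / 16) ^ K \<le> integral {Y..t - Y} (p t)" if t: "t \<ge> 4 * Y" for t
  proof -
    have tp: "t > 0" using t Y by linarith
    have "t / 2 * (3 / 16) ^ K = integral {t/4..3 * t/4} (\<lambda>y. (3 / 16) ^ K)" using tp by simp
    also have "\<dots> \<le> integral {t/4..3 * t/4} (p t)"
    proof (rule integral_le)
      fix y assume y: "y \<in> {t/4..3 * t/4}"
      have "\<bar>y - t / 2\<bar> \<le> t / 4" using y by (intro abs_leI) auto
      then have "(y - t / 2)\<^sup>2 \<le> (t / 4)\<^sup>2" using abs_le_square_iff[of "y - t/2" "t/4"] tp by simp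
      then have "3 / 16 * t\<^sup>2 \<le> y * (t - y)" by (simp add: power2_eq_square algebra_simps)
      then have "3 / 16 \<le> y * (t - y) / t\<^sup>2" using tp by (simp add: field_simps)
      then show "(3 / 16) ^ K \<le> p t y" unfolding p_def by (intro power_mono) auto
    qed (auto intro: integrable_continuous_real p_cont)
    also have "\<dots> \<le> integral {Y..t - Y} (p t)"
    proof (rule integral_subset_le)
      show "\<forall>y\<in>{Y..t - Y}. 0 \<le> p t y"
        using Y unfolding p_def by (intro ballI zero_le_power divide_nonneg_nonneg mult_nonneg_nonneg) auto
    qed (use t Y in \<open>auto intro: integrable_continuous_real p_cont\<close>)
    finally show ?thesis .
  qed
  \<comment> \<open>Two thirds of the main integral survive, which is at least linear in t, whereas
    the other error integrates to a constant.\<close>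
  have right_int: "(norm \<alpha>)\<^sup>2 * ((1 / 3) * (3 / 16) ^ K * t - 8 / 3 * (real K * c)) \<le> norm (integral {Y..t - Y} (\<lambda>y. W t (Complex c y)))"
    if t: "t \<ge> 8 * c" "t \<ge> Rc + 2 * Y" "t \<ge> 4 * Y" for t
  proof -
    have tp: "t > 0" "Y \<le> t - Y" using t Y by linarith+
    let ?p = "\<lambda>y. of_real ((norm \<alpha>)\<^sup>2 * p t y) :: complex"
    let ?I = "integral {Y..t - Y} (p t)"
    have iW: "(\<lambda>y. W t (Complex c y)) integrable_on {Y..t - Y}" by (intro integrable_continuous_real W_cont)
    have ip: "?p integrable_on {Y..t - Y}" by (intro integrable_continuous_real continuous_intros p_cont)
    have "norm (integral {Y..t - Y} (\<lambda>y. W t (Complex c y)) - integral {Y..t - Y} ?p)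
       = norm (integral {Y..t - Y} (\<lambda>y. W t (Complex c y) - ?p y))"
      using iW ip by (simp add: Henstock_Kurzweil_Integration.integral_diff)
    also have "\<dots> \<le> integral {Y..t - Y} (\<lambda>y. (norm \<alpha>)\<^sup>2 * (p t y / 3 + 4 / 3 * (2 * real K * c / t)))"
    proof (rule integral_norm_bound_integral)
      show "(\<lambda>y. W t (Complex c y) - ?p y) integrable_on {Y..t - Y}" by (intro integrable_diff iW ip)
      show "(\<lambda>y. (norm \<alpha>)\<^sup>2 * (p t y / 3 + 4 / 3 * (2 * real K * c / t))) integrable_on {Y..t - Y}"
        by (intro integrable_continuous_real continuous_intros p_cont) auto
    qed (use right t in auto)
    also have "\<dots> = (norm \<alpha>)\<^sup>2 * (?I / 3 + 4 / 3 * (2 * real K * c / t) * (t - 2 * Y))"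
    proof -
      have "integral {Y..t - Y} (\<lambda>y. p t y / 3 + 4 / 3 * (2 * real K * c / t)) = integral {Y..t - Y} (\<lambda>y. p t y / 3) + integral {Y..t - Y} (\<lambda>y. 4 / 3 * (2 * real K * c / t))"
        by (intro Henstock_Kurzweil_Integration.integral_add integrable_continuous_real continuous_intros p_cont) auto
      also have "integral {Y..t - Y} (\<lambda>y. 4 / 3 * (2 * real K * c / t)) = 4 / 3 * (2 * real K * c / t) * (t - 2 * Y)"
        using tp by (simp add: algebra_simps)
      finally show ?thesis by simp
    qed
    also have "\<dots> \<le> (norm \<alpha>)\<^sup>2 * (?I / 3 + 4 / 3 * (2 * real K * c))"
    proof -
      have "2 * real K * c / t * (t - 2 * Y) \<le> 2 * real K * c / t * t" using c' tp Y by (intro mult_left_mono) auto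
      also have "2 * real K * c / t * t = 2 * real K * c" using tp by simp
      finally have "4 / 3 * (2 * real K * c / t * (t - 2 * Y)) \<le> 4 / 3 * (2 * real K * c)" by (rule mult_left_mono) simp
      then have "4 / 3 * (2 * real K * c / t) * (t - 2 * Y) \<le> 4 / 3 * (2 * real K * c)" by (simp only: mult.assoc)
      then show ?thesis by (intro mult_left_mono add_left_mono) auto
    qed
    finally have d: "norm (integral {Y..t - Y} (\<lambda>y. W t (Complex c y)) - integral {Y..t - Y} ?p) \<le> (norm \<alpha>)\<^sup>2 * (?I / 3 + 4 / 3 * (2 * real K * c))" .
    have I0: "0 \<le> ?I" using p_int[OF t(3)] tp by (intro order_trans[OF _ p_int[OF t(3)]]) auto
    have "integral {Y..t - Y} ?p = of_real ((norm \<alpha>)\<^sup>2 * ?I)"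
    proof (rule integral_unique)
      have "(p t has_integral ?I) {Y..t - Y}" by (intro integrable_integral integrable_continuous_real p_cont)
      from has_integral_linear[OF has_integral_mult_right[OF this, of "(norm \<alpha>)\<^sup>2"] bounded_linear_of_real]
      show "(?p has_integral of_real ((norm \<alpha>)\<^sup>2 * ?I)) {Y..t - Y}" by (simp only: o_def)
    qed
    then have "norm (integral {Y..t - Y} ?p) = (norm \<alpha>)\<^sup>2 * ?I" using I0 by (simp only: norm_of_real) simp
    moreover have "norm (integral {Y..t - Y} ?p) \<le> norm (integral {Y..t - Y} (\<lambda>y. W t (Complex c y))) + norm (integral {Y..t - Y} (\<lambda>y. W t (Complex c y)) - integral {Y..t - Y} ?p)"
      by (metis norm_minus_commute norm_triangle_sub)
    ultimately have "(norm \<alpha>)\<^sup>2 * ?I - (norm \<alpha>)\<^sup>2 * (?I / 3 + 4 / 3 * (2 * real K * c)) \<le> norm (integral {Y..t - Y} (\<lambda>y. W t (Complex c y)))"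
      using d by linarith
    moreover have "(norm \<alpha>)\<^sup>2 * ((1 / 3) * (3 / 16) ^ K * t - 8 / 3 * (real K * c)) \<le> (norm \<alpha>)\<^sup>2 * (2 / 3 * ?I - 8 / 3 * (real K * c))"
      using p_int[OF t(3)] by (intro mult_left_mono) (auto simp: algebra_simps)
    ultimately show ?thesis by (simp add: algebra_simps)
  qed
  obtain g where g: "g > 0" "\<And>\<sigma> t. r / 2 \<le> \<sigma> \<Longrightarrow> \<sigma> \<le> r / 2 \<Longrightarrow> 1 \<le> \<bar>t\<bar> \<Longrightarrow>
    g * (\<bar>t\<bar> powr (\<sigma> - 1/2) * exp (- pi * \<bar>t\<bar> / 2)) \<le> norm (Gamma (Complex \<sigma> t))"
    using Gamma_lower_interval[of "r / 2" "r / 2"] by metis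
  have crit_lower: "g * (y powr (r / 2 - 1/2) * exp (- pi * y / 2)) * norm (\<Phi> (Complex (r / 2) y)) \<le> \<bar>base.crit y\<bar>"
    if "y \<ge> 1" for y
  proof -
    have "\<bar>base.crit y\<bar> = norm (Gamma (Complex (r / 2) y)) * norm (\<Phi> (Complex (r / 2) y))"
      unfolding norm_mult[symmetric] crit_base[symmetric] by simp
    then show ?thesis using g(2)[of "r / 2" y] that by (auto intro!: mult_right_mono)
  qed
  define q where "q = 1 + r / 2"
  define CW where "CW = (q\<^sup>2) ^ K * (lam powr (r / 2))\<^sup>2 / g\<^sup>2"
  have CW: "CW > 0" using r_pos lam g by (auto simp: CW_def q_def)
  \<comment> \<open>By the lower Stirling bound each critical value carries its height to the power
    (r - 1)/2, and together with t^(1 - r) these combine to x^((r - 1)/2), where x = y (t - y)/t^2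
    \<le> 1. The weight x^K is no larger, so |W| is dominated by the product of critical
    values.\<close>
  have left: "norm (W t (Complex (r / 2) y)) \<le> CW * (t powr (1 - r) * exp (pi * t / 2)) * (\<bar>base.crit y\<bar> * \<bar>base.crit (t - y)\<bar>)"
    if y: "Y \<le> y" "y \<le> t - Y" for t y
  proof -
    have tp: "t > 0" "y \<ge> 1" "t - y \<ge> 1" using y Y by linarith+
    define x where "x = y * (t - y) / t\<^sup>2"
    have x0: "0 < x" using tp by (simp add: x_def)
    have x1: "x \<le> 1"
    proof -
      have "y * (t - y) \<le> t * t" using tp by (intro mult_mono) auto
      then show ?thesis using tp by (simp add: x_def power2_eq_square)
    qed
    let ?F = "norm (\<Phi> (Complex (r / 2) y)) * norm (\<Phi> (Complex (r / 2) (t - y)))"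
    have arg: "cnj (Complex (r / 2) y - \<i> * of_real t) = Complex (r / 2) (t - y)" by (simp add: complex_eq_iff)
    have nP: "norm (P t (Complex (r / 2) y)) \<le> (q\<^sup>2 * x) ^ K"
    proof -
      have "norm (- \<i> * Complex (r / 2) y) \<le> q * y"
      proof -
        have "norm (- \<i> * Complex (r / 2) y) \<le> r / 2 + y"
          using cmod_le[of "Complex (r / 2) y"] r_pos tp by (simp add: norm_mult)
        moreover have "r / 2 * 1 \<le> r / 2 * y" using tp r_pos by (intro mult_left_mono) auto
        ultimately show ?thesis by (simp add: q_def field_simps)
      qed
      moreover have "norm (of_real t + \<i> * Complex (r / 2) y) \<le> q * (t - y)"
      proof -
        have "of_real t + \<i> * Complex (r / 2) y = Complex (t - y) (r / 2)" by (simp add: complex_eq_iff)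
        then have "norm (of_real t + \<i> * Complex (r / 2) y) \<le> r / 2 + (t - y)"
          using cmod_le[of "Complex (t - y) (r / 2)"] r_pos tp by simp
        moreover have "r / 2 * 1 \<le> r / 2 * (t - y)" using tp r_pos by (intro mult_left_mono) auto
        ultimately show ?thesis by (simp add: q_def field_simps)
      qed
      ultimately have "norm (- \<i> * Complex (r / 2) y) * norm (of_real t + \<i> * Complex (r / 2) y) \<le> (q * y) * (q * (t - y))"
        using r_pos tp by (intro mult_mono) (auto simp: q_def)
      then have "norm (- \<i> * Complex (r / 2) y) * norm (of_real t + \<i> * Complex (r / 2) y) / t\<^sup>2 \<le> (q * y) * (q * (t - y)) / t\<^sup>2"
        by (rule divide_right_mono) simp
      also have "\<dots> = q\<^sup>2 * x" by (simp add: x_def power2_eq_square mult_ac)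
      finally have "(norm (- \<i> * Complex (r / 2) y) * norm (of_real t + \<i> * Complex (r / 2) y) / t\<^sup>2) ^ K \<le> (q\<^sup>2 * x) ^ K"
        by (intro power_mono) auto
      then show ?thesis unfolding P_def norm_power norm_divide norm_mult norm_of_real by simp
    qed
    have "norm (W t (Complex (r / 2) y)) = norm (P t (Complex (r / 2) y)) * ((lam powr (r / 2))\<^sup>2 * ?F)"
      unfolding W_def arg by (simp add: norm_mult norm_D lam_def power2_eq_square mult_ac)
    also have "\<dots> \<le> (q\<^sup>2 * x) ^ K * ((lam powr (r / 2))\<^sup>2 * ?F)"
      by (intro mult_right_mono nP) auto
    also have "\<dots> = CW * (g\<^sup>2 * x ^ K * ?F)"
      using g(1) by (simp add: CW_def power_mult_distrib)
    also have "\<dots> \<le> CW * ((t powr (1 - r) * exp (pi * t / 2)) * (\<bar>base.crit y\<bar> * \<bar>base.crit (t - y)\<bar>))"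
    proof (rule mult_left_mono)
      have xK: "x ^ K \<le> x powr ((r - 1) / 2)"
        using x0 x1 K(2) powr_mono'[of "(r - 1) / 2" "real K" x] by (simp add: powr_realpow)
      have e1: "t powr (1 - r) * (y powr (r / 2 - 1/2) * (t - y) powr (r / 2 - 1/2)) = x powr ((r - 1) / 2)"
      proof -
        have "x powr ((r - 1) / 2) = (y * (t - y)) powr ((r - 1) / 2) / (t\<^sup>2) powr ((r - 1) / 2)"
          unfolding x_def by (rule powr_divide)
        also have "(t\<^sup>2) powr ((r - 1) / 2) = t powr (r - 1)"
        proof -
          have "t\<^sup>2 = t powr 2" using tp by simp
          then have "(t\<^sup>2) powr ((r - 1) / 2) = t powr (2 * ((r - 1) / 2))" by (simp only: powr_powr)
          moreover have "2 * ((r - 1) / 2) = r - 1" by (simp add: field_simps)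
          ultimately show ?thesis by (simp only:)
        qed
        also have "(y * (t - y)) powr ((r - 1) / 2) = y powr ((r - 1) / 2) * (t - y) powr ((r - 1) / 2)"
          using tp by (intro powr_mult)
        also have "y powr ((r - 1) / 2) * (t - y) powr ((r - 1) / 2) / t powr (r - 1)
            = inverse (t powr (r - 1)) * (y powr ((r - 1) / 2) * (t - y) powr ((r - 1) / 2))"
          by (simp only: divide_inverse mult.commute)
        also have "inverse (t powr (r - 1)) = t powr (1 - r)" using powr_minus[of t "r - 1"] by simp
        finally have "x powr ((r - 1) / 2) = t powr (1 - r) * (y powr ((r - 1) / 2) * (t - y) powr ((r - 1) / 2))" .
        moreover have "(r - 1) / 2 = r / 2 - 1/2" by (simp add: diff_divide_distrib)
        ultimately show ?thesis by (simp only:)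
      qed
      have e2: "exp (pi * t / 2) * (exp (- pi * y / 2) * exp (- pi * (t - y) / 2)) = 1"
        by (simp add: algebra_simps add_divide_distrib diff_divide_distrib flip: exp_add)
      have "g\<^sup>2 * x ^ K * ?F \<le> g\<^sup>2 * x powr ((r - 1) / 2) * ?F"
        using xK by (intro mult_right_mono mult_left_mono) auto
      also have "\<dots> = g\<^sup>2 * (x powr ((r - 1) / 2)) * (exp (pi * t / 2) * (exp (- pi * y / 2) * exp (- pi * (t - y) / 2))) * ?F"
        unfolding e2 by simp
      also have "\<dots> = (t powr (1 - r) * exp (pi * t / 2)) *
          ((g * (y powr (r / 2 - 1/2) * exp (- pi * y / 2)) * norm (\<Phi> (Complex (r / 2) y))) *
           (g * ((t - y) powr (r / 2 - 1/2) * exp (- pi * (t - y) / 2)) * norm (\<Phi> (Complex (r / 2) (t - y)))))"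
        unfolding e1[symmetric] power2_eq_square by (simp only: mult_ac)
      also have "\<dots> \<le> (t powr (1 - r) * exp (pi * t / 2)) * (\<bar>base.crit y\<bar> * \<bar>base.crit (t - y)\<bar>)"
        using g(1) tp by (intro mult_left_mono mult_mono crit_lower) auto
      finally show "g\<^sup>2 * x ^ K * ?F \<le> (t powr (1 - r) * exp (pi * t / 2)) * (\<bar>base.crit y\<bar> * \<bar>base.crit (t - y)\<bar>)" .
    qed (use CW in auto)
    finally show ?thesis by (simp add: mult_ac)
  qed
  \<comment> \<open>The right line gives 2 \<kappa> t up to the constant \<open>N\<close>; for t
    \<ge> N/\<kappa> half of it is left.\<close>
  define \<kappa> where "\<kappa> = (norm \<alpha>)\<^sup>2 * (3 / 16) ^ K / 6"
  have \<kappa>: "\<kappa> > 0" using \<alpha> by (simp add: \<kappa>_def)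
  define N where "N = (norm \<alpha>)\<^sup>2 * (8 / 3 * (real K * c)) + 2 * M * (c - r / 2)"
  have main: "(\<kappa> / CW) * (t powr r * exp (- pi * t / 2)) \<le> (LINT y|lborel. indicator {Y..t - Y} y * (\<bar>base.crit y\<bar> * \<bar>base.crit (t - y)\<bar>))"
    if t: "t \<ge> max (max (8 * c) (Rc + 2 * Y)) (max (4 * Y) (N / \<kappa>))" for t
  proof -
    have t': "t \<ge> 8 * c" "t \<ge> Rc + 2 * Y" "t \<ge> 4 * Y" "N \<le> \<kappa> * t" "t > 0"
      using t \<kappa> Y by (auto simp: field_simps)
    let ?cc = "\<lambda>y. \<bar>base.crit y\<bar> * \<bar>base.crit (t - y)\<bar>"
    have cont: "continuous_on {Y..t - Y} ?cc"
      by (intro continuous_intros continuous_on_compose2[OF base.continuous_crit]) auto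
    have si: "set_integrable lborel {Y..t - Y} ?cc"
      using borel_integrable_compact[OF _ cont] by (simp add: set_integrable_def)
    have I: "(LINT y|lborel. indicator {Y..t - Y} y * ?cc y) = integral {Y..t - Y} ?cc"
      using set_borel_integral_eq_integral(2)[OF si] by (simp add: set_lebesgue_integral_def)
    have "(norm \<alpha>)\<^sup>2 * ((1 / 3) * (3 / 16) ^ K * t - 8 / 3 * (real K * c)) - 2 * M * (c - r / 2) \<le> norm (integral {Y..t - Y} (\<lambda>y. W t (Complex (r / 2) y)))"
    proof -
      have "norm (integral {Y..t - Y} (\<lambda>y. W t (Complex c y))) \<le> norm (integral {Y..t - Y} (\<lambda>y. W t (Complex (r / 2) y))) +
         norm (integral {Y..t - Y} (\<lambda>y. W t (Complex (r / 2) y)) - integral {Y..t - Y} (\<lambda>y. W t (Complex c y)))"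
        by (metis norm_minus_commute norm_triangle_sub)
      then show ?thesis using shift[OF t'(2)] right_int[OF t'(1-3)] by linarith
    qed
    moreover have "(norm \<alpha>)\<^sup>2 * ((1 / 3) * (3 / 16) ^ K * t - 8 / 3 * (real K * c)) - 2 * M * (c - r / 2) = 2 * \<kappa> * t - N"
      by (simp add: \<kappa>_def N_def algebra_simps)
    ultimately have "\<kappa> * t \<le> norm (integral {Y..t - Y} (\<lambda>y. W t (Complex (r / 2) y)))" using t'(4) by linarith
    also have "\<dots> \<le> integral {Y..t - Y} (\<lambda>y. CW * (t powr (1 - r) * exp (pi * t / 2)) * ?cc y)"
      by (rule integral_norm_bound_integral)
         (auto intro!: integrable_continuous_real W_cont continuous_on_mult_left cont left)
    also have "\<dots> = CW * (t powr (1 - r) * exp (pi * t / 2)) * integral {Y..t - Y} ?cc" by (rule integral_mult_right)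
    \<comment> \<open>Multiplication by t^(r - 1) exp(-pi t/2) undoes the factor that
      \<open>left\<close> introduced.\<close>
    finally have "\<kappa> * t * (t powr (r - 1) * exp (- pi * t / 2)) \<le> CW * (t powr (1 - r) * exp (pi * t / 2)) * integral {Y..t - Y} ?cc * (t powr (r - 1) * exp (- pi * t / 2))"
      by (intro mult_right_mono) auto
    also have "\<dots> = CW * integral {Y..t - Y} ?cc * ((t powr (1 - r) * t powr (r - 1)) * (exp (pi * t / 2) * exp (- pi * t / 2)))"
      by (simp only: mult_ac)
    also have "t powr (1 - r) * t powr (r - 1) = 1" using t' by (simp flip: powr_add)
    also have "exp (pi * t / 2) * exp (- pi * t / 2) = 1" by (simp flip: exp_add)
    also have "\<kappa> * t * (t powr (r - 1) * exp (- pi * t / 2)) = \<kappa> * (t powr r * exp (- pi * t / 2))"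
    proof -
      have "t * t powr (r - 1) = t powr 1 * t powr (r - 1)" using t' by simp
      also have "\<dots> = t powr r" unfolding powr_add[symmetric] by simp
      finally show ?thesis by (simp add: mult.assoc[symmetric])
    qed
    finally show ?thesis unfolding I using CW by (simp add: field_simps)
  qed
  show ?thesis
    by (intro exI[of _ "\<kappa> / CW"] conjI exI[of _ "max (max (8 * c) (Rc + 2 * Y)) (max (4 * Y) (N / \<kappa>))"] allI impI main)
       (use \<kappa> CW in auto)
qed

end

section \<open>Lower bounds for the Epstein zeta function\<close>

text \<open>The difference vanishes on an open set, hence off a sparse set. Nice meromorphy fixes
  the remaining values: the limit, or 0 at a pole.\<close>

lemma nicely_meromorphic_eqI:
  fixes f g :: "complex \<Rightarrow> complex"
  assumes f: "f nicely_meromorphic_on UNIV" and g: "g nicely_meromorphic_on UNIV"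
    and U: "open U" "w0 \<in> U" and eq: "\<And>s. s \<in> U \<Longrightarrow> f s = g s"
  shows "f = g"
proof
  fix w
  have mero: "(\<lambda>z. f z - g z) meromorphic_on UNIV"
    using f g by (intro meromorphic_intros) (auto simp: nicely_meromorphic_on_def)
  have "\<not> eventually (\<lambda>z. f z - g z \<noteq> 0) (cosparse UNIV)"
  proof
    assume "eventually (\<lambda>z. f z - g z \<noteq> 0) (cosparse UNIV)"
    then have "eventually (\<lambda>z. f z - g z \<noteq> 0) (at w0)"
      by (simp add: eventually_cosparse_open_eq)
    moreover have "eventually (\<lambda>z. z \<in> U) (at w0)"
      using U by (intro eventually_at_in_open')
    ultimately have "eventually (\<lambda>z. False) (at w0)"
      by eventually_elim (use eq in auto)
    then show False by simp
  qed
  with meromorphic_imp_constant_or_avoid[OF mero, of 0]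
  have "eventually (\<lambda>z. f z - g z = 0) (cosparse UNIV)" by auto
  then have ev: "eventually (\<lambda>z. f z = g z) (at w)"
    by (auto simp: eventually_cosparse_open_eq elim!: eventually_mono)
  have fw: "(is_pole f w \<and> f w = 0) \<or> f \<midarrow>w\<rightarrow> f w" and gw: "(is_pole g w \<and> g w = 0) \<or> g \<midarrow>w\<rightarrow> g w"
    using f g by (auto simp: nicely_meromorphic_on_def)
  have pole: "is_pole f w \<longleftrightarrow> is_pole g w" using ev by (rule is_pole_cong) simp
  show "f w = g w"
  proof (cases "is_pole f w")
    case True
    have "\<not> f \<midarrow>w\<rightarrow> f w" "\<not> g \<midarrow>w\<rightarrow> g w"
      using True pole not_tendsto_and_filterlim_at_infinity[of "at w"] by (auto simp: is_pole_def)
    then show ?thesis using fw gw by auto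
  next
    case False
    then have "f \<midarrow>w\<rightarrow> f w" "g \<midarrow>w\<rightarrow> g w" using fw gw pole by auto
    moreover have "f \<midarrow>w\<rightarrow> g w" using tendsto_cong[OF ev] \<open>g \<midarrow>w\<rightarrow> g w\<close> by blast
    ultimately show ?thesis by (metis LIM_unique)
  qed
qed

section \<open>Iterated squaring and division by Gamma\<close>

context hecke_theta
begin

abbreviation chi :: "nat \<Rightarrow> complex \<Rightarrow> complex" where
  "chi k \<equiv> completed (\<lambda>u. theta a l u ^ (2 ^ k)) (2 ^ k * r) (a 0 ^ (2 ^ k))"

text \<open>Constant sign of \<open>crit\<close> is combined with
  \<open>base_convolution_lower\<close>, which in this first squaring takes the place of a pointwise
  lower bound.\<close>

lemma lower_order_1:
  assumes fin: "finite {s. Re s = r / 2 \<and> \<Phi> s = 0}"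
  shows "lower_order (\<lambda>u. theta a l u ^ (2 ^ 1)) (2 ^ 1 * r) (a 0 ^ (2 ^ 1)) r"
proof -
  have "finite (Im ` {s. Re s = r / 2 \<and> \<Phi> s = 0})" using fin by simp
  then have "bdd_above (Im ` {s. Re s = r / 2 \<and> \<Phi> s = 0})" by (rule bdd_above_finite)
  then obtain B where B: "\<And>s. Re s = r / 2 \<Longrightarrow> \<Phi> s = 0 \<Longrightarrow> Im s \<le> B"
    unfolding bdd_above_def by blast
  \<comment> \<open>Above the highest zero on the critical line.\<close>
  define Y where "Y = max 1 (B + 1)"
  have nz: "base.crit y \<noteq> 0" if "y \<ge> Y" for y
  proof -
    have "\<Phi> (Complex (r / 2) y) \<noteq> 0" using B[of "Complex (r / 2) y"] that by (auto simp: Y_def)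
    moreover have "Gamma (Complex (r / 2) y) \<noteq> 0"
    proof -
      have "Complex (r / 2) y \<notin> \<int>\<^sub>\<le>\<^sub>0" using r_pos by (auto simp: complex_eq_iff elim!: nonpos_Ints_cases)
      then show ?thesis by (simp add: Gamma_eq_zero_iff)
    qed
    ultimately have "complex_of_real (base.crit y) \<noteq> 0" unfolding crit_base by simp
    then show ?thesis by simp
  qed
  \<comment> \<open>A continuous real function without zeros from \<open>Y\<close> on keeps the sign
    it has at \<open>Y\<close>.\<close>
  have sign: "sgn (base.crit Y) * base.crit y = \<bar>base.crit y\<bar>" if y: "y \<ge> Y" for y
  proof -
    have cont: "continuous_on {Y..y} base.crit" by (rule continuous_on_subset[OF base.continuous_crit]) simp
    have "\<not> (base.crit Y \<le> 0 \<and> 0 \<le> base.crit y)" using IVT'[of base.crit Y 0 y] cont y nz by auto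
    moreover have "\<not> (base.crit y \<le> 0 \<and> 0 \<le> base.crit Y)" using IVT2'[of base.crit y 0 Y] cont y nz by auto
    ultimately show ?thesis using nz[of Y] nz[OF y] by (auto simp: sgn_if not_le)
  qed
  obtain \<kappa> T where \<kappa>: "\<kappa> > 0" "\<And>t. t \<ge> T \<Longrightarrow> \<kappa> * (t powr r * exp (- pi * t / 2))
      \<le> (LINT y|lborel. indicator {Y..t - Y} y * (\<bar>base.crit y\<bar> * \<bar>base.crit (t - y)\<bar>))"
    using base_convolution_lower[of Y] by (auto simp: Y_def)
  have "lower_order (\<lambda>u. (theta a l u)\<^sup>2) (2 * r) ((a 0)\<^sup>2) r"
  proof (rule base.square_lower_order[OF _ _ _ sign _ \<kappa>])
    \<comment> \<open>The tightest comparison of the iteration: error exponent cc - 1/2 against main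
      exponent r. Later squarings leave more room.\<close>
    show "0 \<le> cc - 1/2" "cc - 1/2 < r" using cc by auto
    show "base.strip_bounded (cc - 1/2)" using strip_bounded_power[of 0] by simp
  qed (auto simp: Y_def)
  then show ?thesis by simp
qed

text \<open>Each squaring maps the exponent E to 2 E + 1, that is, it doubles E + 1; the start is E
  = r for the square of theta.\<close>

lemma lower_order_power:
  assumes fin: "finite {s. Re s = r / 2 \<and> \<Phi> s = 0}"
  shows "lower_order (\<lambda>u. theta a l u ^ (2 ^ Suc k)) (2 ^ Suc k * r) (a 0 ^ (2 ^ Suc k)) (2 ^ k * r + 2 ^ k - 1)"
proof (induction k)
  case 0
  then show ?case using lower_order_1[OF fin] by simp
next
  case (Suc k)
  define m where "m = Suc k"
  interpret t: theta_fun "\<lambda>u. theta a l u ^ (2 ^ m)" "2 ^ m * r" "a 0 ^ (2 ^ m)" by (rule theta_fun_power)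
  have k1: "(1::real) \<le> 2 ^ k" by simp
  have "lower_order (\<lambda>u. (theta a l u ^ (2 ^ m))\<^sup>2) (2 * (2 ^ m * r)) ((a 0 ^ (2 ^ m))\<^sup>2) (2 * (2 ^ k * r + 2 ^ k - 1) + 1)"
  proof (rule t.lower_order_square)
    show "t.strip_bounded (2 ^ m * cc - 1/2)" by (rule strip_bounded_power)
    show "lower_order (\<lambda>u. theta a l u ^ (2 ^ m)) (2 ^ m * r) (a 0 ^ (2 ^ m)) (2 ^ k * r + 2 ^ k - 1)"
      using Suc by (simp add: m_def)
    show "0 \<le> 2 ^ k * r + 2 ^ k - 1" using k1 mult_nonneg_nonneg[of "2 ^ k" r] r_pos by linarith
    have "(1::real) * (1/2) \<le> 2 ^ m * cc" using cc by (intro mult_mono) auto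
    then show "0 \<le> 2 ^ m * cc - 1/2" by simp
    have "2 ^ m * cc \<le> 2 ^ m * (r + 1/2)" using cc by (intro mult_left_mono) auto
    also have "\<dots> = 2 * (2 ^ k * r) + 2 ^ k" by (simp add: m_def algebra_simps)
    finally have "2 ^ m * cc \<le> 2 * (2 ^ k * r) + 2 ^ k" .
    moreover have "u - 1/2 < 2 * (x + p - 1) + 1" if "u \<le> 2 * x + p" "1 \<le> p" for u x p :: real
      using that by argo
    ultimately show "2 ^ m * cc - 1/2 < 2 * (2 ^ k * r + 2 ^ k - 1) + 1" using k1 by blast
  qed
  moreover have "(x ^ (2 ^ m))\<^sup>2 = x ^ (2 ^ Suc (Suc k))" for x :: complex
    by (simp add: m_def power_mult[symmetric] mult.commute)
  moreover have "2 * (2 ^ k * r + 2 ^ k - 1) + 1 = 2 ^ Suc k * r + 2 ^ Suc k - 1" by (simp add: algebra_simps)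
  moreover have "2 * (2 ^ m * r) = 2 ^ Suc (Suc k) * r" by (simp add: m_def)
  ultimately show ?case by (simp only:)
qed

lemma chi_analytic: "0 \<notin> S \<Longrightarrow> of_real (2 ^ k * r) \<notin> S \<Longrightarrow> chi k analytic_on S"
  by (rule theta_fun.completed_analytic[OF theta_fun_power])

text \<open>The description by \<open>THE\<close> needs a witness on the whole plane: rGamma times
  \<open>chi k\<close> represents the series to the right, and \<open>remove_sings\<close> replaces
  the values that division by 0 gives \<open>completed\<close> at the points 0 and 2^k r.\<close>

lemma epstein_zeta_eq_remove_sings:
  assumes absc: "abs_conv_abscissa a l = ereal sa"
  shows "epstein_zeta (2 ^ k) a l = remove_sings (\<lambda>s. rGamma s * chi k s)"
proof -
  interpret t: theta_fun "\<lambda>u. theta a l u ^ (2 ^ k)" "2 ^ k * r" "a 0 ^ (2 ^ k)" by (rule theta_fun_power)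
  define Z where "Z = remove_sings (\<lambda>s. rGamma s * chi k s)"
  have Zn: "Z nicely_meromorphic_on UNIV"
    unfolding Z_def
    by (intro remove_sings_nicely_meromorphic meromorphic_on_mult t.completed_meromorphic analytic_on_imp_meromorphic_on analytic_rGamma)
  have cond: "ereal (Re s) > ereal (real (2 ^ k)) * abs_conv_abscissa a l \<longleftrightarrow> Re s > 2 ^ k * sa" for s
    by (simp add: absc)
  have Zs: "Z s = epstein_series (2 ^ k) a l s" if s: "Re s > 2 ^ k * sa" for s
  proof -
    have s0: "Re s > 0" using s sa_nonneg by (auto intro: le_less_trans[of 0 "2 ^ k * sa"])
    have N: "(2::nat) ^ k \<ge> 1" and s': "Re s > real (2 ^ k) * sa" using s by auto
    have "integrable lborel (\<lambda>u. exp (s * of_real u) * (theta a l u ^ (2 ^ k) - a 0 ^ (2 ^ k)))"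
      using mellin_theta_power[OF s' N] by (simp add: has_bochner_integral_iff)
    \<comment> \<open>Absolute convergence at s itself shows that Re s exceeds 2^k r or that the
      pole there is absent.\<close>
    then have c: "a 0 ^ (2 ^ k) = 0 \<or> Re s > 2 ^ k * r" by (rule t.mellin_full_converse)
    have "chi k analytic_on {s}"
    proof (cases "a 0 ^ (2 ^ k) = 0")
      case True
      then show ?thesis by (rule t.completed_analytic_zero)
    next
      case False
      then show ?thesis using c s0 by (intro chi_analytic) auto
    qed
    then have "(\<lambda>s. rGamma s * chi k s) analytic_on {s}" by (intro analytic_on_mult analytic_rGamma)
    then have "Z s = rGamma s * chi k s" unfolding Z_def by (rule remove_sings_at_analytic)
    also have "\<dots> = (rGamma s * Gamma s) * epstein_series (2 ^ k) a l s"
      using completed_eq_epstein[OF s] by simp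
    also have "rGamma s * Gamma s = 1"
    proof -
      have "s \<notin> \<int>\<^sub>\<le>\<^sub>0" using s0 by (auto elim!: nonpos_Ints_cases)
      then show ?thesis by (simp add: rGamma_inverse_Gamma Gamma_eq_zero_iff)
    qed
    finally show ?thesis by simp
  qed
  show ?thesis
    unfolding epstein_zeta_def Z_def[symmetric] cond
  proof (rule the_equality)
    show "Z nicely_meromorphic_on UNIV \<and> (\<forall>s. Re s > 2 ^ k * sa \<longrightarrow> Z s = epstein_series (2 ^ k) a l s)"
      using Zn Zs by blast
    fix Z' assume Z': "Z' nicely_meromorphic_on UNIV \<and> (\<forall>s. Re s > 2 ^ k * sa \<longrightarrow> Z' s = epstein_series (2 ^ k) a l s)"
    show "Z' = Z"
      by (rule nicely_meromorphic_eqI[of _ _ "{s. Re s > 2 ^ k * sa}" "of_real (2 ^ k * sa + 1)"])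
        (use Z' Zn Zs in \<open>auto simp: open_halfspace_Re_gt\<close>)
  qed
qed

lemma epstein_zeta_eq:
  assumes absc: "abs_conv_abscissa a l = ereal sa" and s: "s \<noteq> 0" "s \<noteq> of_real (2 ^ k * r)"
  shows "epstein_zeta (2 ^ k) a l s = rGamma s * chi k s"
proof -
  have "(\<lambda>s. rGamma s * chi k s) analytic_on {s}"
    using s by (intro analytic_on_mult analytic_rGamma chi_analytic) auto
  then show ?thesis unfolding epstein_zeta_eq_remove_sings[OF absc] by (rule remove_sings_at_analytic)
qed

text \<open>The exponents subtract to 2^k r + 2^k - 1 - (2^k r - 1/2) = 2^k - 1/2, where 2^k r - 1/2
  is that of Gamma on Re s = 2^k r.\<close>

lemma epstein_zeta_lower:
  assumes absc: "abs_conv_abscissa a l = ereal sa"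
    and fin: "finite {s. Re s = r / 2 \<and> \<Phi> s = 0}"
  shows "\<exists>c>0. \<exists>T. \<forall>t\<ge>T. c * t powr (2 ^ k - 1/2) \<le> norm (epstein_zeta (2 ^ (k + 1)) a l (Complex (2 ^ k * r) t))"
proof -
  define E where "E = 2 ^ k * r + 2 ^ k - 1"
  define R where "R = 2 ^ k * r"
  have R: "R > 0" using r_pos by (simp add: R_def)
  obtain c T where c: "c > 0" and T: "\<And>t. t \<ge> T \<Longrightarrow> c * (t powr E * exp (- pi * t / 2)) \<le> Re (chi (Suc k) (Complex R t))"
    using lower_order_power[OF fin, of k] unfolding lower_order_def E_def R_def by auto
  obtain C where C: "C > 0" "\<And>t. 1 \<le> \<bar>t\<bar> \<Longrightarrow> norm (Gamma (Complex R t)) \<le> C * (\<bar>t\<bar> powr (R - 1/2) * exp (- pi * \<bar>t\<bar> / 2))"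
    using Gamma_line_upper by metis
  have "(c / C) * t powr (2 ^ k - 1/2) \<le> norm (epstein_zeta (2 ^ (k + 1)) a l (Complex (2 ^ k * r) t))"
    if t: "t \<ge> max T 1" for t
  proof -
    let ?s = "Complex R t"
    let ?e = "exp (- pi * t / 2)"
    have "?s \<noteq> 0" "?s \<noteq> of_real (2 ^ Suc k * r)" using t by (auto simp: complex_eq_iff)
    then have Z: "epstein_zeta (2 ^ Suc k) a l ?s = rGamma ?s * chi (Suc k) ?s" by (rule epstein_zeta_eq[OF absc])
    have "?s \<notin> \<int>\<^sub>\<le>\<^sub>0" using t by (auto simp: complex_eq_iff elim!: nonpos_Ints_cases)
    then have G0: "Gamma ?s \<noteq> 0" by (simp add: Gamma_eq_zero_iff)
    have "c * (t powr E * ?e) \<le> norm (chi (Suc k) ?s)"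
      using T[of t] t complex_Re_le_cmod[of "chi (Suc k) ?s"] by linarith
    also have "\<dots> = norm (epstein_zeta (2 ^ Suc k) a l ?s) * norm (Gamma ?s)"
      unfolding Z using G0 by (simp add: norm_mult rGamma_inverse_Gamma norm_inverse)
    also have "\<dots> \<le> norm (epstein_zeta (2 ^ Suc k) a l ?s) * (C * (t powr (R - 1/2) * ?e))"
      using C(2)[of t] t by (intro mult_left_mono) auto
    finally have "(c * t powr E) * ?e \<le> (norm (epstein_zeta (2 ^ Suc k) a l ?s) * C * t powr (R - 1/2)) * ?e"
      by (simp add: mult_ac)
    then have 1: "c * t powr E \<le> norm (epstein_zeta (2 ^ Suc k) a l ?s) * C * t powr (R - 1/2)"
      by (subst (asm) mult_le_cancel_right_pos) auto
    have "E = (2 ^ k - 1/2) + (R - 1/2)" by (simp add: E_def R_def)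
    then have "t powr E = t powr (2 ^ k - 1/2) * t powr (R - 1/2)" by (simp only: powr_add)
    with 1 have "(c * t powr (2 ^ k - 1/2)) * t powr (R - 1/2) \<le> (norm (epstein_zeta (2 ^ Suc k) a l ?s) * C) * t powr (R - 1/2)"
      by (simp only: mult.assoc)
    then have "c * t powr (2 ^ k - 1/2) \<le> norm (epstein_zeta (2 ^ Suc k) a l ?s) * C"
      using t by (subst (asm) mult_le_cancel_right_pos) auto
    then show ?thesis using C(1) by (simp add: R_def field_simps)
  qed
  then show ?thesis using c C(1) by (intro exI[of _ "c / C"] conjI exI[of _ "max T 1"]) auto
qed

end

section \<open>From the functional equation to the modular relation\<close>

lemma tendsto_integral_symmetric:
  fixes g :: "real \<Rightarrow> complex"
  assumes g: "integrable lborel g"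
  shows "(\<lambda>n. integral {- real n..real n} g) \<longlonglongrightarrow> (LINT y|lborel. g y)"
proof -
  have [measurable]: "g \<in> borel_measurable lborel" using g by auto
  have eq: "integral {- real n..real n} g = (LINT y|lborel. indicator {- real n..real n} y *\<^sub>R g y)" for n
  proof -
    have "set_integrable lborel {- real n..real n} g"
      unfolding set_integrable_def using g by (intro integrable_mult_indicator) auto
    then show ?thesis using set_borel_integral_eq_integral(2) unfolding set_lebesgue_integral_def by metis
  qed
  show ?thesis
    unfolding eq
  proof (rule integral_dominated_convergence[where w = "\<lambda>y. norm (g y)"])
    show "AE y in lborel. (\<lambda>n. indicator {- real n..real n} y *\<^sub>R g y) \<longlonglongrightarrow> g y"
    proof (rule AE_I2)
      fix y :: real
      obtain N where N: "\<bar>y\<bar> \<le> real N" using real_arch_simple by blast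
      have "eventually (\<lambda>n. indicator {- real n..real n} y *\<^sub>R g y = g y) sequentially"
        using eventually_ge_at_top[of N] by eventually_elim (use N in \<open>auto simp: indicator_def\<close>)
      then show "(\<lambda>n. indicator {- real n..real n} y *\<^sub>R g y) \<longlonglongrightarrow> g y" by (rule tendsto_eventually)
    qed
  qed (use g in \<open>auto simp: indicator_def\<close>)
qed

lemma integral_inverse_vertical:
  fixes x T :: real
  assumes x: "x \<noteq> 0" and T: "T \<ge> 0"
  shows "((\<lambda>y. 1 / Complex x y) has_integral of_real (2 * arctan (T / x))) {-T..T}"
proof -
  \<comment> \<open>A primitive of 1/(x + i y) in y is -i Ln(x + i y); the arctangent form has no
    branch cut for x < 0, and the logarithm of the modulus, even in y, cancels between -T and
    T.\<close>
  define F where "F = (\<lambda>y. complex_of_real (arctan (y / x)) - \<i> * complex_of_real (ln (x\<^sup>2 + y\<^sup>2) / 2))"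
  have pos: "x\<^sup>2 + y\<^sup>2 > 0" for y using x by (simp add: sum_power2_gt_zero_iff)
  have "(F has_vector_derivative 1 / Complex x y) (at y within {-T..T})" for y
  proof -
    have "((\<lambda>y. arctan (y / x)) has_field_derivative x / (x\<^sup>2 + y\<^sup>2)) (at y)"
      using x pos[of y] by (auto intro!: derivative_eq_intros simp: divide_simps power2_eq_square)
    moreover have "((\<lambda>y. ln (x\<^sup>2 + y\<^sup>2) / 2) has_field_derivative y / (x\<^sup>2 + y\<^sup>2)) (at y)"
      using pos[of y] by (auto intro!: derivative_eq_intros simp: divide_simps)
    ultimately have "(F has_vector_derivative of_real (x / (x\<^sup>2 + y\<^sup>2)) - \<i> * of_real (y / (x\<^sup>2 + y\<^sup>2))) (at y)"
      unfolding F_def by (intro derivative_intros has_vector_derivative_of_real) (simp_all add: has_real_derivative_iff_has_vector_derivative)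
    also have "of_real (x / (x\<^sup>2 + y\<^sup>2)) - \<i> * of_real (y / (x\<^sup>2 + y\<^sup>2)) = 1 / Complex x y"
    proof -
      have "v * d / d\<^sup>2 = v / d" for v d :: real by (simp add: power2_eq_square)
      then show ?thesis by (simp add: complex_eq_iff Re_divide Im_divide)
    qed
    finally show ?thesis by (rule has_vector_derivative_at_within)
  qed
  then have "((\<lambda>y. 1 / Complex x y) has_integral F T - F (-T)) {-T..T}"
    using T by (intro fundamental_theorem_of_calculus) auto
  also have "F T - F (-T) = of_real (2 * arctan (T / x))"
    by (simp add: F_def arctan_minus)
  finally show ?thesis .
qed

lemma arctan_difference_tendsto:
  fixes x y :: real
  assumes "x > 0" "y < 0"
  shows "((\<lambda>T. 2 * arctan (T / x) - 2 * arctan (T / y)) \<longlongrightarrow> 2 * pi) at_top"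
proof -
  have "((\<lambda>T. arctan (T / z)) \<longlongrightarrow> pi / 2) at_top" if "z > 0" for z :: real using that by real_asymp
  from this[OF assms(1)] this[of "- y"] assms(2)
  have "((\<lambda>T. 2 * arctan (T / x) + 2 * arctan (T / - y)) \<longlongrightarrow> 2 * (pi / 2) + 2 * (pi / 2)) at_top"
    by (intro tendsto_intros) auto
  then show ?thesis by (simp add: arctan_minus)
qed

text \<open>Subtracting the principal parts leaves an entire function, so that only the
  elementary integrals of \<open>1 / (x + \<i>y)\<close> contribute.\<close>
lemma vertical_line_difference_tendsto:
  fixes f :: "complex \<Rightarrow> complex" and p q \<alpha> \<beta> :: real and A B :: complex
  assumes hol: "f holomorphic_on - {of_real p, of_real q}" and pq: "p < q" "\<alpha> < p" "q < \<beta>"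
    and A: "((\<lambda>s. (s - of_real p) * f s) \<longlongrightarrow> A) (at (of_real p))"
    and B: "((\<lambda>s. (s - of_real q) * f s) \<longlongrightarrow> B) (at (of_real q))"
    and hor: "\<And>e. e > 0 \<Longrightarrow> \<exists>T0. \<forall>s. \<alpha> \<le> Re s \<longrightarrow> Re s \<le> \<beta> \<longrightarrow> T0 \<le> \<bar>Im s\<bar> \<longrightarrow> norm (f s) \<le> e"
  shows "((\<lambda>T. integral {-T..T} (\<lambda>y. f (Complex \<beta> y)) - integral {-T..T} (\<lambda>y. f (Complex \<alpha> y)))
    \<longlongrightarrow> 2 * pi * (A + B)) at_top"
proof -
  define P where "P = (\<lambda>s :: complex. A / (s - of_real p) + B / (s - of_real q))"
  define h where "h = (\<lambda>s. f s - P s)"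
  have pq': "complex_of_real p \<noteq> of_real q" using pq by simp
  have holh: "h holomorphic_on - {of_real p, of_real q}"
    unfolding h_def P_def by (intro holomorphic_intros hol) auto
  have "((\<lambda>s. (s - of_real p) * h s) \<longlongrightarrow> A - (A + 0 * (B / (of_real p - of_real q)))) (at (of_real p))"
  proof (rule Lim_transform_eventually)
    show "((\<lambda>s. (s - of_real p) * f s - (A + (s - of_real p) * (B / (s - of_real q)))) \<longlongrightarrow> A - (A + 0 * (B / (of_real p - of_real q)))) (at (of_real p))"
    proof -
      have "((\<lambda>s. s - of_real p) \<longlongrightarrow> 0) (at (complex_of_real p))" by (auto intro!: tendsto_eq_intros)
      moreover have "((\<lambda>s. B / (s - of_real q)) \<longlongrightarrow> B / (of_real p - of_real q)) (at (of_real p))"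
        using pq' by (intro tendsto_intros) auto
      ultimately show ?thesis by (intro tendsto_diff[OF A] tendsto_add tendsto_const tendsto_mult)
    qed
    show "\<forall>\<^sub>F s in at (complex_of_real p). (s - of_real p) * f s - (A + (s - of_real p) * (B / (s - of_real q))) = (s - of_real p) * h s"
      unfolding eventually_at_filter by (rule always_eventually) (simp add: h_def P_def distrib_left right_diff_distrib)
  qed
  then have limp: "((\<lambda>s. (s - of_real p) * h s) \<longlongrightarrow> 0) (at (of_real p))" by simp
  have "((\<lambda>s. (s - of_real q) * h s) \<longlongrightarrow> B - (0 * (A / (of_real q - of_real p)) + B)) (at (of_real q))"
  proof (rule Lim_transform_eventually)
    show "((\<lambda>s. (s - of_real q) * f s - ((s - of_real q) * (A / (s - of_real p)) + B)) \<longlongrightarrow> B - (0 * (A / (of_real q - of_real p)) + B)) (at (of_real q))"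
    proof -
      have "((\<lambda>s. s - of_real q) \<longlongrightarrow> 0) (at (complex_of_real q))" by (auto intro!: tendsto_eq_intros)
      moreover have "((\<lambda>s. A / (s - of_real p)) \<longlongrightarrow> A / (of_real q - of_real p)) (at (of_real q))"
        using pq' by (intro tendsto_intros) auto
      ultimately show ?thesis by (intro tendsto_diff[OF B] tendsto_add tendsto_const tendsto_mult)
    qed
    show "\<forall>\<^sub>F s in at (complex_of_real q). (s - of_real q) * f s - ((s - of_real q) * (A / (s - of_real p)) + B) = (s - of_real q) * h s"
      unfolding eventually_at_filter by (rule always_eventually) (simp add: h_def P_def distrib_left right_diff_distrib)
  qed
  then have limq: "((\<lambda>s. (s - of_real q) * h s) \<longlongrightarrow> 0) (at (of_real q))" by simp
  have h1: "h holomorphic_on (- {of_real q}) - {of_real p}" using holh by (rule holomorphic_on_subset) auto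
  have i1: "complex_of_real p \<in> interior (- {of_real q})" using pq' by (subst interior_open) auto
  \<comment> \<open>The singularities are removed one at a time: first at p, still leaving out q,
    then at q.\<close>
  obtain g where g: "g holomorphic_on - {of_real q}" "\<And>z. z \<in> - {of_real q} - {of_real p} \<Longrightarrow> g z = h z"
    using holomorphic_on_extend_lim[OF h1 i1] limp by blast
  have "((\<lambda>s. (s - of_real q) * g s) \<longlongrightarrow> 0) (at (of_real q))"
  proof (rule Lim_transform_eventually[OF limq])
    have "\<forall>\<^sub>F s in at (complex_of_real q). s \<in> - {of_real p}"
      using pq' by (intro eventually_at_in_open') auto
    moreover have "\<forall>\<^sub>F s in at (complex_of_real q). s \<noteq> of_real q" by (simp add: eventually_at_filter)
    ultimately show "\<forall>\<^sub>F s in at (complex_of_real q). (s - of_real q) * h s = (s - of_real q) * g s"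
      by eventually_elim (use g(2) in auto)
  qed
  then obtain E where E: "E holomorphic_on UNIV" "\<And>z. z \<in> UNIV - {of_real q} \<Longrightarrow> E z = g z"
    using holomorphic_on_extend_lim[of g UNIV "of_real q"] g(1) by (auto simp: Compl_eq_Diff_UNIV)
  have Eh: "E z = f z - P z" if "z \<noteq> of_real p" "z \<noteq> of_real q" for z
    using E(2)[of z] g(2)[of z] that by (simp add: h_def)
  \<comment> \<open>The principal parts decay like 1/|Im s|, so the entire function inherits the
    decay of f.\<close>
  have small: "\<exists>T0. \<forall>s. \<alpha> \<le> Re s \<longrightarrow> Re s \<le> \<beta> \<longrightarrow> T0 \<le> \<bar>Im s\<bar> \<longrightarrow> norm (E s) \<le> e" if e: "e > 0" for e
  proof -
    obtain T0 where T0: "\<And>s. \<alpha> \<le> Re s \<Longrightarrow> Re s \<le> \<beta> \<Longrightarrow> T0 \<le> \<bar>Im s\<bar> \<Longrightarrow> norm (f s) \<le> e / 2"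
      using hor[of "e / 2"] e by auto
    define T1 where "T1 = max (max T0 1) (2 * (norm A + norm B) / e)"
    have "norm (E s) \<le> e" if s: "\<alpha> \<le> Re s" "Re s \<le> \<beta>" "T1 \<le> \<bar>Im s\<bar>" for s
    proof -
      have "1 \<le> \<bar>Im s\<bar>" using s by (simp add: T1_def)
      then have pos: "\<bar>Im s\<bar> > 0" by linarith
      have d: "norm (C / (s - of_real x)) \<le> norm C / \<bar>Im s\<bar>" for C :: complex and x :: real
        using abs_Im_le_cmod[of "s - of_real x"] pos unfolding norm_divide by (intro divide_left_mono mult_pos_pos) auto
      have "norm (P s) \<le> norm A / \<bar>Im s\<bar> + norm B / \<bar>Im s\<bar>"
        unfolding P_def by (intro norm_triangle_le add_mono d)
      also have "\<dots> = (norm A + norm B) / \<bar>Im s\<bar>" by (simp add: add_divide_distrib)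
      also have "\<dots> \<le> e / 2"
      proof -
        have "2 * (norm A + norm B) / e \<le> \<bar>Im s\<bar>" using s by (simp add: T1_def)
        then show ?thesis using e pos by (simp add: field_simps)
      qed
      finally have "norm (P s) \<le> e / 2" .
      moreover have "E s = f s - P s" using pos by (intro Eh) auto
      moreover have "norm (f s) \<le> e / 2" using s by (intro T0) (auto simp: T1_def)
      ultimately show ?thesis using norm_triangle_ineq4[of "f s" "P s"] by simp
    qed
    then show ?thesis by blast
  qed
  have contE: "continuous_on UNIV E" using E(1) by (rule holomorphic_on_imp_continuous_on)
  have intE: "((\<lambda>y. E (Complex x y)) has_integral integral {-T..T} (\<lambda>y. E (Complex x y))) {-T..T}" for x T
  proof (rule integrable_integral)
    have "continuous_on {-T..T} (\<lambda>y. E (Complex x y))"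
      unfolding Complex_eq by (intro continuous_on_compose2[OF contE] continuous_intros) auto
    then show "(\<lambda>y. E (Complex x y)) integrable_on {-T..T}" by (rule integrable_continuous_real)
  qed
  have line: "integral {-T..T} (\<lambda>y. f (Complex x y)) = integral {-T..T} (\<lambda>y. E (Complex x y))
      + (A * of_real (2 * arctan (T / (x - p))) + B * of_real (2 * arctan (T / (x - q))))"
    if x: "x \<noteq> p" "x \<noteq> q" and T: "T \<ge> 0" for x T
  proof (rule integral_unique)
    have e: "f (Complex x y) = E (Complex x y) + (A * (1 / Complex (x - p) y) + B * (1 / Complex (x - q) y))" for y
    proof -
      have "Complex x y - of_real p = Complex (x - p) y" "Complex x y - of_real q = Complex (x - q) y"
        by (auto simp: complex_eq_iff)
      moreover have "Complex x y \<noteq> of_real p" "Complex x y \<noteq> of_real q" using x by (auto simp: complex_eq_iff)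
      ultimately show ?thesis by (simp add: Eh P_def)
    qed
    show "((\<lambda>y. f (Complex x y)) has_integral integral {-T..T} (\<lambda>y. E (Complex x y))
      + (A * of_real (2 * arctan (T / (x - p))) + B * of_real (2 * arctan (T / (x - q))))) {-T..T}"
      unfolding e using x T
      by (intro has_integral_add intE has_integral_mult_right integral_inverse_vertical) auto
  qed
  have Elim: "((\<lambda>T. integral {-T..T} (\<lambda>y. E (Complex \<beta> y)) - integral {-T..T} (\<lambda>y. E (Complex \<alpha> y))) \<longlongrightarrow> 0) at_top"
  proof (rule tendstoI)
    fix e :: real assume e: "e > 0"
    define e' where "e' = e / (4 * (\<beta> - \<alpha>))"
    have ab: "\<alpha> < \<beta>" using pq by linarith
    have e': "e' > 0" using e ab by (simp add: e'_def)
    obtain T0 where T0: "\<And>s. \<alpha> \<le> Re s \<Longrightarrow> Re s \<le> \<beta> \<Longrightarrow> T0 \<le> \<bar>Im s\<bar> \<Longrightarrow> norm (E s) \<le> e'"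
      using small[OF e'] by auto
    have "norm (integral {-T..T} (\<lambda>y. E (Complex \<beta> y)) - integral {-T..T} (\<lambda>y. E (Complex \<alpha> y))) < e"
      if T: "T \<ge> max T0 0" for T
    proof -
      have "norm (integral {-T..T} (\<lambda>y. E (Complex \<alpha> y)) - integral {-T..T} (\<lambda>y. E (Complex \<beta> y))) \<le> 2 * e' * (\<beta> - \<alpha>)"
        by (rule vertical_shift[OF E(1)]) (use T ab in \<open>auto intro!: T0\<close>)
      also have "\<dots> = e / 2" using ab by (simp add: e'_def field_simps)
      also have "\<dots> < e" using e by simp
      finally show ?thesis by (subst norm_minus_commute)
    qed
    then show "\<forall>\<^sub>F T in at_top. dist (integral {-T..T} (\<lambda>y. E (Complex \<beta> y)) - integral {-T..T} (\<lambda>y. E (Complex \<alpha> y))) 0 < e"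
      unfolding eventually_at_top_linorder dist_norm diff_0_right by blast
  qed
  \<comment> \<open>Since x lies between the two lines, the arctangents tend to pi/2 and -pi/2;
    twice their difference is the residue factor 2 pi.\<close>
  have at: "((\<lambda>T. complex_of_real (2 * arctan (T / (\<beta> - x)) - 2 * arctan (T / (\<alpha> - x)))) \<longlongrightarrow> of_real (2 * pi)) at_top"
    if "\<alpha> < x" "x < \<beta>" for x
    using that by (intro tendsto_of_real arctan_difference_tendsto) auto
  have "((\<lambda>T. (integral {-T..T} (\<lambda>y. E (Complex \<beta> y)) - integral {-T..T} (\<lambda>y. E (Complex \<alpha> y)))
     + (A * of_real (2 * arctan (T / (\<beta> - p)) - 2 * arctan (T / (\<alpha> - p)))
      + B * of_real (2 * arctan (T / (\<beta> - q)) - 2 * arctan (T / (\<alpha> - q)))))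
     \<longlongrightarrow> 0 + (A * of_real (2 * pi) + B * of_real (2 * pi))) at_top"
    using pq by (intro tendsto_add Elim tendsto_mult tendsto_const at) auto
  then have "((\<lambda>T. integral {-T..T} (\<lambda>y. f (Complex \<beta> y)) - integral {-T..T} (\<lambda>y. f (Complex \<alpha> y)))
     \<longlongrightarrow> 0 + (A * of_real (2 * pi) + B * of_real (2 * pi))) at_top"
  proof (rule Lim_transform_eventually)
    show "\<forall>\<^sub>F T in at_top. (integral {-T..T} (\<lambda>y. E (Complex \<beta> y)) - integral {-T..T} (\<lambda>y. E (Complex \<alpha> y)))
     + (A * of_real (2 * arctan (T / (\<beta> - p)) - 2 * arctan (T / (\<alpha> - p)))
      + B * of_real (2 * arctan (T / (\<beta> - q)) - 2 * arctan (T / (\<alpha> - q))))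
     = integral {-T..T} (\<lambda>y. f (Complex \<beta> y)) - integral {-T..T} (\<lambda>y. f (Complex \<alpha> y))"
      using eventually_ge_at_top[of 0]
    proof eventually_elim
      case (elim T)
      have "integral {-T..T} (\<lambda>y. f (Complex \<beta> y)) = integral {-T..T} (\<lambda>y. E (Complex \<beta> y))
      + (A * of_real (2 * arctan (T / (\<beta> - p))) + B * of_real (2 * arctan (T / (\<beta> - q))))"
        by (rule line) (use pq elim in auto)
      moreover have "integral {-T..T} (\<lambda>y. f (Complex \<alpha> y)) = integral {-T..T} (\<lambda>y. E (Complex \<alpha> y))
      + (A * of_real (2 * arctan (T / (\<alpha> - p))) + B * of_real (2 * arctan (T / (\<alpha> - q))))"
        by (rule line) (use pq elim in auto)
      ultimately show ?case by (simp only: of_real_diff right_diff_distrib) simp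
    qed
  qed
  then show ?thesis by (simp add: algebra_simps)
qed

lemma integrable_Gamma_line:
  assumes c: "c > 0"
  shows "integrable lborel (\<lambda>y. Gamma (Complex c y))"
proof -
  obtain C where C: "C > 0" "\<And>t. 1 \<le> \<bar>t\<bar> \<Longrightarrow> norm (Gamma (Complex c t)) \<le> C * (\<bar>t\<bar> powr (c - 1/2) * exp (- pi * \<bar>t\<bar> / 2))"
    using Gamma_line_upper[of c] by metis
  have "Complex c y \<notin> \<int>\<^sub>\<le>\<^sub>0" for y using c by (auto simp: complex_eq_iff elim!: nonpos_Ints_cases)
  then have cont: "continuous_on UNIV (\<lambda>y. Gamma (Complex c y))"
    unfolding Complex_eq by (intro continuous_on_compose2[OF continuous_on_Gamma[of "{s. s \<notin> \<int>\<^sub>\<le>\<^sub>0}"]] continuous_intros) auto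
  have "bounded ((\<lambda>y. Gamma (Complex c y)) ` {-1..1})"
    by (intro compact_imp_bounded compact_continuous_image continuous_on_subset[OF cont]) auto
  then obtain B where B: "\<And>y. y \<in> {-1..1} \<Longrightarrow> norm (Gamma (Complex c y)) \<le> B"
    unfolding bounded_iff ball_simps by blast
  define M where "M = max C (B * exp (pi / 2))"
  have bound: "norm (Gamma (Complex c y)) \<le> M * (exp (- (pi / 2) * \<bar>y\<bar>) * (1 + \<bar>y\<bar>) powr \<bar>c - 1/2\<bar>)" for y
  proof (cases "1 \<le> \<bar>y\<bar>")
    case True
    have "\<bar>y\<bar> powr (c - 1/2) \<le> \<bar>y\<bar> powr \<bar>c - 1/2\<bar>" using True by (intro powr_mono) auto
    also have "\<dots> \<le> (1 + \<bar>y\<bar>) powr \<bar>c - 1/2\<bar>" by (intro powr_mono2) auto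
    finally have "C * (\<bar>y\<bar> powr (c - 1/2) * exp (- pi * \<bar>y\<bar> / 2)) \<le> M * ((1 + \<bar>y\<bar>) powr \<bar>c - 1/2\<bar> * exp (- pi * \<bar>y\<bar> / 2))"
      using C(1) by (intro mult_mono) (auto simp: M_def)
    then have "norm (Gamma (Complex c y)) \<le> M * ((1 + \<bar>y\<bar>) powr \<bar>c - 1/2\<bar> * exp (- pi * \<bar>y\<bar> / 2))"
      using C(2)[OF True] by linarith
    also have "- pi * \<bar>y\<bar> / 2 = - (pi / 2) * \<bar>y\<bar>" by simp
    finally show ?thesis by (simp only: mult_ac)
  next
    case False
    have "norm (Gamma (Complex c y)) \<le> B" using False by (intro B) auto
    also have "B = (B * exp (pi / 2)) * exp (- (pi / 2))" by (simp add: exp_minus)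
    also have "\<dots> \<le> M * exp (- (pi / 2))" by (intro mult_right_mono) (auto simp: M_def)
    also have "\<dots> \<le> M * (exp (- (pi / 2) * \<bar>y\<bar>) * (1 + \<bar>y\<bar>) powr \<bar>c - 1/2\<bar>)"
    proof (intro mult_left_mono)
      have "exp (- (pi / 2)) * 1 \<le> exp (- (pi / 2) * \<bar>y\<bar>) * (1 + \<bar>y\<bar>) powr \<bar>c - 1/2\<bar>"
        using False by (intro mult_mono) (auto intro!: ge_one_powr_ge_zero)
      then show "exp (- (pi / 2)) \<le> exp (- (pi / 2) * \<bar>y\<bar>) * (1 + \<bar>y\<bar>) powr \<bar>c - 1/2\<bar>" by simp
    qed (use C in \<open>auto simp: M_def\<close>)
    finally show ?thesis .
  qed
  have "integrable lborel (\<lambda>y. M * (exp (- (pi / 2) * \<bar>y\<bar>) * (1 + \<bar>y\<bar>) powr \<bar>c - 1/2\<bar>))"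
    by (intro integrable_mult_right integrable_exp_powr) simp
  then show ?thesis
  proof (rule Bochner_Integration.integrable_bound)
    show "(\<lambda>y. Gamma (Complex c y)) \<in> borel_measurable lborel"
      using borel_measurable_continuous_onI[OF cont] by simp
    show "AE y in lborel. norm (Gamma (Complex c y)) \<le> norm (M * (exp (- (pi / 2) * \<bar>y\<bar>) * (1 + \<bar>y\<bar>) powr \<bar>c - 1/2\<bar>))"
      using bound by (intro AE_I2) (auto intro: order_trans abs_ge_self)
  qed
qed

lemma norm_dirichlet_series_le:
  assumes l: "\<And>n. l (Suc n) > 0" and sum: "summable (\<lambda>n. norm (a (Suc n)) * l (Suc n) powr (- Re s))"
  shows "norm (dirichlet_series a l s) \<le> (\<Sum>n. norm (a (Suc n)) * l (Suc n) powr (- Re s))"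
proof -
  have "norm (dirichlet_term a l s (Suc n)) = norm (a (Suc n)) * l (Suc n) powr (- Re s)" for n
    by (simp add: norm_dirichlet_term l)
  then show ?thesis unfolding dirichlet_series_def
    using summable_norm[of "\<lambda>n. dirichlet_term a l s (Suc n)"] sum by simp
qed

section \<open>Mellin inversion and the shift of the line\<close>

context hecke_series
begin

text \<open>Fourier inversion for exp(c u) (theta - a 0), which is bounded by
  \<open>theta_decay\<close> and integrable because its Mellin integral converges at c. The
  transform is integrable because Gamma is and the series is bounded on the line.\<close>

lemma theta_inversion:
  assumes c: "c > sa" "c > 0"
  shows "integrable lborel (\<lambda>y. Gamma (Complex c y) * dirichlet_series a l (Complex c y) * exp (- (Complex c y * of_real u)))"
    and "theta a l u - a 0 = 1 / (2 * pi) *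
      (LINT y|lborel. Gamma (Complex c y) * dirichlet_series a l (Complex c y) * exp (- (Complex c y * of_real u)))"
proof -
  define f where "f = (\<lambda>u. of_real (exp (c * u)) * (theta a l u - a 0))"
  define F where "F = (\<lambda>y. Gamma (Complex c y) * dirichlet_series a l (Complex c y))"
  have mel: "has_bochner_integral lborel (\<lambda>u. exp (s * of_real u) * (theta a l u - a 0)) (Gamma s * dirichlet_series a l s)"
    if "Re s = c" for s
    using mellin_theta_power[of 1 s] epstein_series_1[of s] c that by simp
  have cont: "continuous_on UNIV f" unfolding f_def by (intro continuous_intros continuous_theta)
  have intf: "integrable lborel f"
    using mel[of "of_real c"] unfolding has_bochner_integral_iff exp_mult_of_real f_def by simp
  obtain C where C: "\<And>u. norm (theta a l u - a 0) \<le> C * exp (- c * u)"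
    using theta_decay[OF c(1)] by blast
  have bdd: "norm (f u) \<le> C" for u
  proof -
    have "norm (f u) = exp (c * u) * norm (theta a l u - a 0)" by (simp add: f_def norm_mult)
    also have "\<dots> \<le> exp (c * u) * (C * exp (- c * u))" by (intro mult_left_mono C) auto
    also have "\<dots> = C" by (simp add: exp_minus)
    finally show ?thesis .
  qed
  have F: "F y = (LINT u|lborel. f u * iexp (y * u))" for y
  proof -
    have "(LINT u|lborel. exp (Complex c y * of_real u) * (theta a l u - a 0)) = F y"
      unfolding F_def using mel[of "Complex c y"] by (simp add: has_bochner_integral_iff)
    then show ?thesis unfolding exp_Complex f_def by (simp only: mult_ac)
  qed
  have Fm: "F \<in> borel_measurable lborel"
  proof -
    have [measurable]: "f \<in> borel_measurable borel" by (rule borel_measurable_continuous_onI[OF cont])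
    show ?thesis unfolding F[abs_def] by measurable
  qed
  have intF: "integrable lborel F"
  proof (rule Bochner_Integration.integrable_bound[OF integrable_mult_left[OF integrable_Gamma_line[OF c(2)]] Fm])
    let ?S = "\<Sum>n. norm (a (Suc n)) * l (Suc n) powr (- c)"
    have "norm (F y) \<le> norm (Gamma (Complex c y)) * ?S" for y
      using norm_dirichlet_series_le[where l = l and a = a and s = "Complex c y", OF l_Suc_pos] summable_coeff[OF c(1)] unfolding F_def norm_mult by (intro mult_left_mono) auto
    then have "norm (F y) \<le> norm (Gamma (Complex c y) * complex_of_real ?S)" for y
      unfolding norm_mult norm_of_real by (rule order_trans) (intro mult_left_mono, auto)
    then show "AE y in lborel. norm (F y) \<le> norm (Gamma (Complex c y) * complex_of_real ?S)" by simp
  qed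
  have ex: "F y * exp (- (Complex c y * of_real u)) = of_real (exp (- c * u)) * (F y * iexp (- y * u))" for y
    using exp_Complex[of c y "- u"] by (simp add: mult_ac)
  have i2: "integrable lborel (\<lambda>y. F y * iexp (- y * u))"
    by (rule Bochner_Integration.integrable_bound[OF intF]) (use Fm in \<open>auto simp: norm_mult\<close>)
  show "integrable lborel (\<lambda>y. Gamma (Complex c y) * dirichlet_series a l (Complex c y) * exp (- (Complex c y * of_real u)))"
    using integrable_mult_right[OF i2, of "of_real (exp (- c * u))"] unfolding ex[symmetric] unfolding F_def .
  have "f u = 1 / (2 * pi) * (LINT y|lborel. F y * iexp (- y * u))"
    by (rule Fourier_inversion[OF cont intf bdd F intF])
  then have "of_real (exp (- c * u)) * f u = 1 / (2 * pi) * (of_real (exp (- c * u)) * (LINT y|lborel. F y * iexp (- y * u)))"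
    by (simp add: mult_ac)
  also have "of_real (exp (- c * u)) * f u = theta a l u - a 0"
    by (simp add: f_def exp_minus flip: of_real_mult)
  also have "of_real (exp (- c * u)) * (LINT y|lborel. F y * iexp (- y * u)) = (LINT y|lborel. F y * exp (- (Complex c y * of_real u)))"
    unfolding ex by simp
  finally show "theta a l u - a 0 = 1 / (2 * pi) *
      (LINT y|lborel. Gamma (Complex c y) * dirichlet_series a l (Complex c y) * exp (- (Complex c y * of_real u)))"
    unfolding F_def .
qed

text \<open>Hecke's argument: theta - a 0 is the inverse Mellin integral of X on Re s = c, and on Re
  s = r - c the functional equation turns the same integrand into the conjugate integral at -u, up
  to exp(-r u). The two lines differ by the residues at 0 and r.\<close>

lemma theta_modular:
  fixes X :: "complex \<Rightarrow> complex" and r :: real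
  assumes r: "r > 0" and hol: "X holomorphic_on - {0, of_real r}"
    and lim0: "((\<lambda>s. s * X s) \<longlongrightarrow> - a 0) (at 0)"
    and limr: "((\<lambda>s. (s - of_real r) * X s) \<longlongrightarrow> cnj (a 0)) (at (of_real r))"
    and right: "\<And>s. Re s > max sa r \<Longrightarrow> X s = Gamma s * dirichlet_series a l s"
    and left: "\<And>s. Re s > max sa r \<Longrightarrow> X (of_real r - cnj s) = cnj (Gamma s * dirichlet_series a l s)"
    and hor: "\<And>\<sigma>1 \<sigma>2. uniform_limit {\<sigma>1..\<sigma>2} (\<lambda>t \<sigma>. X (Complex \<sigma> t)) (\<lambda>_. 0) at_infinity"
  shows "theta a l (- u) = of_real (exp (r * u)) * cnj (theta a l u)"
proof -
  define c where "c = max sa r + 1"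
  have c: "c > sa" "c > 0" "c > r" using r by (auto simp: c_def)
  define G where "G = (\<lambda>y. Gamma (Complex c y) * dirichlet_series a l (Complex c y))"
  define f where "f = (\<lambda>s. X s * exp (- (s * of_real u)))"
  define A where "A = - a 0"
  define B where "B = cnj (a 0) * of_real (exp (- r * u))"
  have fol: "f holomorphic_on - {of_real 0, of_real r}" unfolding f_def using hol by (intro holomorphic_intros) simp
  have "((\<lambda>s. (s * X s) * exp (- (s * of_real u))) \<longlongrightarrow> - a 0 * exp (- (0 * of_real u))) (at 0)"
    by (intro tendsto_intros lim0)
  then have fA: "((\<lambda>s. (s - of_real 0) * f s) \<longlongrightarrow> A) (at (of_real 0))" by (simp add: f_def A_def mult.assoc)
  have "((\<lambda>s. ((s - of_real r) * X s) * exp (- (s * of_real u))) \<longlongrightarrow> cnj (a 0) * exp (- (of_real r * of_real u))) (at (of_real r))"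
    by (intro tendsto_intros limr)
  moreover have "exp (- (of_real r * of_real u)) = complex_of_real (exp (- r * u))" by (simp flip: exp_of_real)
  ultimately have fB: "((\<lambda>s. (s - of_real r) * f s) \<longlongrightarrow> B) (at (of_real r))" by (simp add: f_def B_def mult.assoc)
  \<comment> \<open>On the strip the exponential factor has modulus at most exp K, so the uniform
    decay of X survives.\<close>
  have fhor: "\<exists>T0. \<forall>s. r - c \<le> Re s \<longrightarrow> Re s \<le> c \<longrightarrow> T0 \<le> \<bar>Im s\<bar> \<longrightarrow> norm (f s) \<le> e" if e: "e > 0" for e
  proof -
    define K where "K = (c + \<bar>r - c\<bar>) * \<bar>u\<bar>"
    have "\<forall>\<^sub>F t in at_infinity. \<forall>\<sigma>\<in>{r - c..c}. dist (X (Complex \<sigma> t)) 0 < e * exp (- K)"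
      using hor[of "r - c" c] e by (auto simp: uniform_limit_iff)
    then obtain T0 where "\<forall>t. T0 \<le> norm t \<longrightarrow> (\<forall>\<sigma>\<in>{r - c..c}. dist (X (Complex \<sigma> t)) 0 < e * exp (- K))"
      unfolding eventually_at_infinity by blast
    then have T0: "norm (X (Complex \<sigma> t)) < e * exp (- K)" if "T0 \<le> \<bar>t\<bar>" "r - c \<le> \<sigma>" "\<sigma> \<le> c" for t \<sigma>
      using that by simp
    have "norm (f s) \<le> e" if s: "r - c \<le> Re s" "Re s \<le> c" "T0 \<le> \<bar>Im s\<bar>" for s
    proof -
      have "- (Re s * u) \<le> \<bar>Re s\<bar> * \<bar>u\<bar>" by (metis abs_ge_minus_self abs_mult)
      also have "\<dots> \<le> K" unfolding K_def using s c by (intro mult_right_mono) linarith+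
      finally have "norm (exp (- (s * of_real u))) \<le> exp K" by simp
      moreover have "norm (X s) \<le> e * exp (- K)" using T0[of "Im s" "Re s"] s by simp
      ultimately have "norm (f s) \<le> (e * exp (- K)) * exp K" unfolding f_def norm_mult by (intro mult_mono) (use e in auto)
      also have "\<dots> = e" by (simp add: mult.assoc flip: exp_add)
      finally show ?thesis .
    qed
    then show ?thesis by blast
  qed
  have lim: "((\<lambda>T. integral {-T..T} (\<lambda>y. f (Complex c y)) - integral {-T..T} (\<lambda>y. f (Complex (r - c) y)))
    \<longlongrightarrow> 2 * pi * (A + B)) at_top"
    by (rule vertical_line_difference_tendsto[OF fol _ _ _ fA fB fhor]) (use c r in auto)
  have fc: "f (Complex c y) = G y * exp (- (Complex c y * of_real u))" for y
    using right[of "Complex c y"] c by (simp add: f_def G_def)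
  have frc: "f (Complex (r - c) y) = of_real (exp (- r * u)) * cnj (G y * exp (- (Complex c y * of_real (- u))))" for y
  proof -
    have "of_real r - cnj (Complex c y) = Complex (r - c) y" by (simp add: complex_eq_iff)
    then have "X (Complex (r - c) y) = cnj (G y)" using left[of "Complex c y"] c by (simp add: G_def)
    moreover have "exp (- (Complex (r - c) y * of_real u)) = of_real (exp (- r * u)) * cnj (exp (- (Complex c y * of_real (- u))))"
    proof -
      have "- (Complex (r - c) y * of_real u) = of_real (- r * u) + cnj (- (Complex c y * of_real (- u)))"
        by (simp add: complex_eq_iff algebra_simps)
      then show ?thesis by (simp only: exp_add exp_of_real exp_cnj)
    qed
    ultimately show ?thesis by (simp add: f_def mult_ac)
  qed
  define J where "J = (\<lambda>u. LINT y|lborel. G y * exp (- (Complex c y * of_real u)))"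
  have i: "integrable lborel (\<lambda>y. G y * exp (- (Complex c y * of_real u)))" for u
    unfolding G_def by (rule theta_inversion[OF c(1,2)])
  have J: "J v = 2 * pi * (theta a l v - a 0)" for v
    using theta_inversion(2)[OF c(1,2), of v] by (simp add: J_def G_def)
  have "(\<lambda>n. integral {- real n..real n} (\<lambda>y. f (Complex c y))) \<longlonglongrightarrow> J u"
    unfolding fc J_def by (intro tendsto_integral_symmetric i)
  moreover have "(\<lambda>n. integral {- real n..real n} (\<lambda>y. f (Complex (r - c) y))) \<longlonglongrightarrow> of_real (exp (- r * u)) * cnj (J (- u))"
  proof -
    have 1: "integrable lborel (\<lambda>y. of_real (exp (- r * u)) * cnj (G y * exp (- (Complex c y * of_real (- u)))))"
      by (intro integrable_mult_right integrable_cnj i)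
    have "(LINT y|lborel. of_real (exp (- r * u)) * cnj (G y * exp (- (Complex c y * of_real (- u))))) = of_real (exp (- r * u)) * cnj (J (- u))"
      unfolding J_def by (simp only: integral_mult_right_zero Bochner_Integration.integral_cnj)
    then show ?thesis unfolding frc using tendsto_integral_symmetric[OF 1] by simp
  qed
  ultimately have "(\<lambda>n. integral {- real n..real n} (\<lambda>y. f (Complex c y)) - integral {- real n..real n} (\<lambda>y. f (Complex (r - c) y)))
    \<longlonglongrightarrow> J u - of_real (exp (- r * u)) * cnj (J (- u))" by (rule tendsto_diff)
  moreover have "(\<lambda>n. integral {- real n..real n} (\<lambda>y. f (Complex c y)) - integral {- real n..real n} (\<lambda>y. f (Complex (r - c) y)))
    \<longlonglongrightarrow> 2 * pi * (A + B)" by (rule filterlim_compose[OF lim filterlim_real_sequentially])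
  ultimately have "J u - of_real (exp (- r * u)) * cnj (J (- u)) = 2 * pi * (A + B)" by (rule LIMSEQ_unique)
  then have "2 * pi * (theta a l u - a 0 - of_real (exp (- r * u)) * cnj (theta a l (- u) - a 0)) = 2 * pi * (A + B)"
    unfolding J by (simp add: algebra_simps)
  \<comment> \<open>The residues -a 0 and cnj(a 0) exp(-r u) are exactly the two constant terms on
    the left, so they cancel.\<close>
  then have "theta a l u - a 0 - of_real (exp (- r * u)) * cnj (theta a l (- u) - a 0) = A + B" by simp
  then have "theta a l u = of_real (exp (- r * u)) * cnj (theta a l (- u))"
    by (simp add: A_def B_def algebra_simps)
  then have "of_real (exp (r * u)) * cnj (theta a l u) = (of_real (exp (r * u)) * of_real (exp (- r * u))) * theta a l (- u)"
    by simp
  also have "of_real (exp (r * u)) * of_real (exp (- r * u)) = (1 :: complex)" by (simp add: exp_minus flip: of_real_mult)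
  finally show ?thesis by simp
qed

end

section \<open>Conjugate Hecke pairs: poles of X and the modular relation\<close>

lemma not_nonpos_Int_if_Re_pos: "Re s > 0 \<Longrightarrow> s \<notin> \<int>\<^sub>\<le>\<^sub>0"
  by (auto elim!: nonpos_Ints_cases)

lemma not_nonpos_Int_if_Im_nonzero: "Im s \<noteq> 0 \<Longrightarrow> s \<notin> \<int>\<^sub>\<le>\<^sub>0"
  by (auto elim!: nonpos_Ints_cases)

lemma meromorphic_Gamma: "Gamma meromorphic_on S"
proof -
  have "(\<lambda>s. inverse (rGamma s)) meromorphic_on S"
    by (intro meromorphic_on_inverse analytic_on_imp_meromorphic_on analytic_rGamma)
  then show ?thesis by (simp add: Gamma_def[abs_def] o_def)
qed

text \<open>A Hecke pair with conjugate coefficients and equal exponents. The sign of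
  \<open>sa\<close> is left open; it is settled inside the locale, before the theory of
  \<open>hecke_series\<close> becomes available for \<open>sa\<close>.\<close>

locale conjugate_hecke_pair =
  fixes a :: "nat \<Rightarrow> complex" and l :: "nat \<Rightarrow> real" and sa r :: real and \<Phi> \<Psi> X :: "complex \<Rightarrow> complex"
  assumes exponents: "hecke_exponents l" and l_0: "l 0 = 0"
    and summable_coeff: "\<And>\<sigma>. \<sigma> > sa \<Longrightarrow> summable (\<lambda>n. norm (a (Suc n)) * l (Suc n) powr (- \<sigma>))"
    and coeff_nonzero: "\<exists>n\<ge>1. a n \<noteq> 0"
    and r_pos: "r > 0"
    and \<Phi>_meromorphic: "\<Phi> meromorphic_on UNIV" and \<Phi>_analytic: "\<Phi> analytic_on - {of_real r}"
    and \<Phi>_series: "\<And>s. Re s > sa \<Longrightarrow> \<Phi> s = dirichlet_series a l s"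
    and \<Psi>_meromorphic: "\<Psi> meromorphic_on UNIV" and \<Psi>_analytic: "\<Psi> analytic_on - {of_real r}"
    and \<Psi>_series: "\<And>s. Re s > sa \<Longrightarrow> \<Psi> s = cnj (dirichlet_series a l (cnj s))"
    and a_0: "a 0 = - \<Phi> 0"
    and X_nice: "X nicely_meromorphic_on UNIV"
    and X_right: "\<And>s. Re s > sa \<Longrightarrow> s \<notin> \<int>\<^sub>\<le>\<^sub>0 \<Longrightarrow> X s = Gamma s * dirichlet_series a l s"
    and X_left: "\<And>s. Re s < r - sa \<Longrightarrow> of_real r - s \<notin> \<int>\<^sub>\<le>\<^sub>0 \<Longrightarrow> X s = Gamma (of_real r - s) * \<Psi> (of_real r - s)"
    and X_decay: "\<And>\<sigma>1 \<sigma>2. uniform_limit {\<sigma>1..\<sigma>2} (\<lambda>t \<sigma>. X (Complex \<sigma> t)) (\<lambda>_. 0) at_infinity"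
begin

lemma l_pos: "l (Suc n) > 0"
  using exponents by (simp add: hecke_exponents_def)

text \<open>The two sides have the same series far to the right, and the punctured plane is
  connected.\<close>

lemma \<Psi>_eq: "s \<noteq> of_real r \<Longrightarrow> \<Psi> s = cnj (\<Phi> (cnj s))"
proof -
  assume s: "s \<noteq> of_real r"
  have opn: "open (- {complex_of_real r})" by auto
  have con: "connected (- {complex_of_real r})" using connected_punctured_universe[of "complex_of_real r"] by simp
  have im: "cnj ` (- {complex_of_real r}) = - {complex_of_real r}"
  proof (intro equalityI subsetI)
    fix z assume "z \<in> - {complex_of_real r}"
    then have "cnj z \<in> - {complex_of_real r}" by (metis ComplD ComplI complex_cnj_cnj complex_cnj_complex_of_real singletonD singletonI)
    then show "z \<in> cnj ` (- {complex_of_real r})" by (rule rev_image_eqI) simp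
  qed (auto simp: complex_eq_iff)
  have "(cnj \<circ> \<Phi> \<circ> cnj) holomorphic_on - {of_real r}"
    using \<Phi>_analytic opn by (intro holomorphic_on_compose_cnj_cnj) (simp_all add: im analytic_imp_holomorphic)
  then have hol: "(\<lambda>s. \<Psi> s - cnj (\<Phi> (cnj s))) holomorphic_on - {of_real r}"
    using \<Psi>_analytic by (intro holomorphic_on_diff) (simp_all add: o_def analytic_imp_holomorphic)
  define b where "b = max sa r"
  have "\<Psi> s - cnj (\<Phi> (cnj s)) = 0"
  proof (rule analytic_continuation[OF hol opn con, of "{s. Re s > b}" "of_real (b + 1)"])
    show "complex_of_real (b + 1) islimpt {s. Re s > b}"
      by (intro interior_limit_point) (auto simp: interior_open open_halfspace_Re_gt)
    show "{s. Re s > b} \<subseteq> - {complex_of_real r}" by (auto simp: b_def)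
    show "complex_of_real (b + 1) \<in> - {of_real r}" by (auto simp: b_def complex_eq_iff)
    show "s \<in> - {complex_of_real r}" using s by simp
    fix z assume "z \<in> {s. Re s > b}"
    then have "Re z > sa" by (simp add: b_def)
    then show "\<Psi> z - cnj (\<Phi> (cnj z)) = 0" by (simp add: \<Psi>_series \<Phi>_series)
  qed
  then show ?thesis by simp
qed

lemma right_analytic: "s \<notin> \<int>\<^sub>\<le>\<^sub>0 \<Longrightarrow> s \<noteq> of_real r \<Longrightarrow> (\<lambda>s. Gamma s * \<Phi> s) analytic_on {s}"
  by (intro analytic_on_mult analytic_Gamma analytic_on_subset[OF \<Phi>_analytic]) auto

lemma left_analytic:
  assumes "of_real r - s \<notin> \<int>\<^sub>\<le>\<^sub>0" "s \<noteq> 0"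
  shows "(\<lambda>s. Gamma (of_real r - s) * \<Psi> (of_real r - s)) analytic_on {s}"
proof -
  have "(\<lambda>s. Gamma s * \<Psi> s) analytic_on {of_real r - s}"
    using assms by (intro analytic_on_mult analytic_Gamma analytic_on_subset[OF \<Psi>_analytic]) auto
  then show ?thesis
    using analytic_on_compose[of "\<lambda>s. of_real r - s" "{s}" "\<lambda>s. Gamma s * \<Psi> s"]
    by (simp add: o_def analytic_on_diff)
qed

text \<open>X is nicely meromorphic, so agreement with Gamma \<Phi> far to the right determines it;
  wherever that product is analytic, X may then be computed from it. \<open>X_eq_left\<close> does
  the same from the other side.\<close>

lemma X_eq_right: "X = remove_sings (\<lambda>s. Gamma s * \<Phi> s)"
proof -
  define b where "b = max (max sa 0) r"
  show ?thesis
  proof (rule nicely_meromorphic_eqI[OF X_nice _ _ _ , of _ "{s. Re s > b}" "of_real (b + 1)"])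
    show "remove_sings (\<lambda>s. Gamma s * \<Phi> s) nicely_meromorphic_on UNIV"
      by (intro remove_sings_nicely_meromorphic meromorphic_on_mult \<Phi>_meromorphic meromorphic_Gamma)
    fix s assume "s \<in> {s. Re s > b}"
    then have s: "Re s > sa" "Re s > 0" "Re s > r" by (auto simp: b_def)
    then have s': "s \<notin> \<int>\<^sub>\<le>\<^sub>0" by (intro not_nonpos_Int_if_Re_pos) simp
    have "remove_sings (\<lambda>s. Gamma s * \<Phi> s) s = Gamma s * \<Phi> s"
      using s s' by (intro remove_sings_at_analytic right_analytic) auto
    then show "X s = remove_sings (\<lambda>s. Gamma s * \<Phi> s) s" using X_right[OF s(1) s'] by (simp add: \<Phi>_series s)
  qed (auto simp: open_halfspace_Re_gt)
qed

lemma X_eq_left: "X = remove_sings (\<lambda>s. Gamma (of_real r - s) * \<Psi> (of_real r - s))"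
proof -
  define b where "b = min (min (r - sa) 0) r"
  show ?thesis
  proof (rule nicely_meromorphic_eqI[OF X_nice _ _ _ , of _ "{s. Re s < b}" "of_real (b - 1)"])
    have "(\<lambda>s. Gamma s * \<Psi> s) meromorphic_on UNIV" by (intro meromorphic_on_mult \<Psi>_meromorphic meromorphic_Gamma)
    then have "(\<lambda>s. Gamma (of_real r - s) * \<Psi> (of_real r - s)) meromorphic_on UNIV"
      by (rule meromorphic_on_compose) (auto intro!: analytic_intros)
    then show "remove_sings (\<lambda>s. Gamma (of_real r - s) * \<Psi> (of_real r - s)) nicely_meromorphic_on UNIV"
      by (rule remove_sings_nicely_meromorphic)
    fix s assume "s \<in> {s. Re s < b}"
    then have s: "Re s < r - sa" "Re s < 0" "Re s < r" by (auto simp: b_def)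
    then have "Re (of_real r - s) > 0" by simp
    then have s': "of_real r - s \<notin> \<int>\<^sub>\<le>\<^sub>0" by (rule not_nonpos_Int_if_Re_pos)
    have "remove_sings (\<lambda>s. Gamma (of_real r - s) * \<Psi> (of_real r - s)) s = Gamma (of_real r - s) * \<Psi> (of_real r - s)"
      using s s' by (intro remove_sings_at_analytic left_analytic) auto
    then show "X s = remove_sings (\<lambda>s. Gamma (of_real r - s) * \<Psi> (of_real r - s)) s" using X_left[OF s(1) s'] by simp
  qed (auto simp: open_halfspace_Re_lt)
qed

text \<open>Gamma \<Phi> is analytic away from r and the poles of Gamma. At a pole of Gamma the
  other representation applies, because there Re(r - s) > 0; it leaves out only s = 0.\<close>

lemma X_analytic: "X analytic_on - {0, of_real r}"
proof (rule analytic_on_analytic_at[THEN iffD2], intro ballI)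
  fix s assume s: "s \<in> - {0, complex_of_real r}"
  show "X analytic_on {s}"
  proof (cases "s \<in> \<int>\<^sub>\<le>\<^sub>0")
    case False
    then show ?thesis unfolding X_eq_right using s by (intro remove_sings_analytic_on right_analytic) auto
  next
    case True
    then have "Re (of_real r - s) > 0" using r_pos by (auto elim!: nonpos_Ints_cases)
    then have "of_real r - s \<notin> \<int>\<^sub>\<le>\<^sub>0" by (rule not_nonpos_Int_if_Re_pos)
    then show ?thesis unfolding X_eq_left using s by (intro remove_sings_analytic_on left_analytic) auto
  qed
qed

text \<open>Near 0 one has s Gamma(s) = Gamma(s + 1), which leaves \<Phi> 0 in the limit; this is
  why the coefficients are extended by a 0 = -\<Phi> 0.\<close>

lemma X_residue_0: "((\<lambda>s. s * X s) \<longlongrightarrow> - a 0) (at 0)"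
proof -
  have "isCont (\<lambda>s. Gamma (s + 1) * \<Phi> s) 0"
  proof -
    have "\<Phi> analytic_on {0}" using r_pos by (intro analytic_on_subset[OF \<Phi>_analytic]) auto
    then have "isCont \<Phi> 0" by (rule analytic_at_imp_isCont)
    moreover have "isCont (\<lambda>s. Gamma (s + 1 :: complex)) 0" by (intro isCont_Gamma continuous_intros) auto
    ultimately show ?thesis by (intro continuous_mult)
  qed
  then have "((\<lambda>s. Gamma (s + 1) * \<Phi> s) \<longlongrightarrow> - a 0) (at 0)" by (simp add: isCont_def a_0)
  moreover have "\<forall>\<^sub>F s in at 0. Gamma (s + 1) * \<Phi> s = s * X s"
  proof -
    \<comment> \<open>The punctured ball avoids the point r and, being of radius at most 1, the
      other poles of Gamma.\<close>
    define d where "d = min r 1"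
    have "\<forall>\<^sub>F s in at (0 :: complex). s \<in> ball 0 d - {0}"
      by (intro eventually_at_in_open) (use r_pos in \<open>auto simp: d_def\<close>)
    then show ?thesis
    proof eventually_elim
      case (elim s)
      have s: "s \<noteq> 0" "s \<noteq> of_real r" using elim r_pos by (auto simp: d_def)
      have s': "s \<notin> \<int>\<^sub>\<le>\<^sub>0" using elim by (auto simp: d_def elim!: nonpos_Ints_cases)
      have "X s = Gamma s * \<Phi> s" unfolding X_eq_right using s s' by (intro remove_sings_at_analytic right_analytic)
      then show ?case using Gamma_plus1[OF s'] by simp
    qed
  qed
  ultimately show ?thesis by (rule Lim_transform_eventually)
qed

lemma X_residue_r: "((\<lambda>s. (s - of_real r) * X s) \<longlongrightarrow> cnj (a 0)) (at (of_real r))"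
proof -
  have P0: "\<Psi> 0 = - cnj (a 0)" using \<Psi>_eq[of 0] r_pos by (simp add: a_0)
  have "isCont (\<lambda>s. - (Gamma (of_real r - s + 1) * \<Psi> (of_real r - s))) (of_real r)"
  proof -
    have "\<Psi> analytic_on {0}" using r_pos by (intro analytic_on_subset[OF \<Psi>_analytic]) auto
    then have "isCont \<Psi> 0" by (rule analytic_at_imp_isCont)
    then have "isCont (\<lambda>s. \<Psi> (of_real r - s)) (of_real r)"
      using isCont_o2[where f = "\<lambda>s. of_real r - s" and g = \<Psi> and a = "of_real r"] by simp
    moreover have "isCont (\<lambda>s. Gamma (of_real r - s + 1 :: complex)) (of_real r)"
      by (rule isCont_Gamma) (simp_all add: not_nonpos_Int_if_Re_pos)
    ultimately show ?thesis by (intro continuous_minus continuous_mult)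
  qed
  then have "((\<lambda>s. - (Gamma (of_real r - s + 1) * \<Psi> (of_real r - s))) \<longlongrightarrow> cnj (a 0)) (at (of_real r))"
    by (simp add: isCont_def P0)
  moreover have "\<forall>\<^sub>F s in at (of_real r). - (Gamma (of_real r - s + 1) * \<Psi> (of_real r - s)) = (s - of_real r) * X s"
  proof -
    define d where "d = min r 1"
    have "\<forall>\<^sub>F s in at (complex_of_real r). s \<in> ball (of_real r) d - {of_real r}"
      by (intro eventually_at_in_open) (use r_pos in \<open>auto simp: d_def\<close>)
    then show ?thesis
    proof eventually_elim
      case (elim s)
      have s: "s \<noteq> 0" using elim r_pos by (auto simp: d_def)
      have n: "norm (of_real r - s) < 1" "of_real r - s \<noteq> 0" using elim by (auto simp: d_def dist_norm)
      have s': "of_real r - s \<notin> \<int>\<^sub>\<le>\<^sub>0"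
      proof
        assume "of_real r - s \<in> \<int>\<^sub>\<le>\<^sub>0"
        then obtain i where "of_real r - s = of_int i" "i \<le> 0" by (elim nonpos_Ints_cases)
        then show False using n by simp
      qed
      have Xs: "X s = Gamma (of_real r - s) * \<Psi> (of_real r - s)"
        unfolding X_eq_left using s s' by (intro remove_sings_at_analytic left_analytic)
      show ?case unfolding Xs Gamma_plus1[OF s'] by (simp add: algebra_simps)
    qed
  qed
  ultimately show ?thesis by (rule Lim_transform_eventually)
qed

text \<open>For \<open>sa\<close> < 0 the point i t belongs to both half planes of the functional
  equation, so Gamma(i t) \<phi>(i t) = Gamma(r - i t) cnj(\<phi>(r + i t)) for the Dirichlet series
  \<phi>. The series is bounded on Re s = 0, and the Gamma quotient has size t^(-1/2)/t^(r - 1/2) =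
  t^(-r).\<close>

lemma dirichlet_decay_of_negative_abscissa:
  assumes neg: "sa < 0"
  shows "\<exists>K. \<forall>t\<ge>1. norm (dirichlet_series a l (Complex r t)) \<le> K * t powr (- r)"
proof -
  define S0 where "S0 = (\<Sum>n. norm (a (Suc n)) * l (Suc n) powr (- 0))"
  obtain C where C: "C > 0" "\<And>t. 1 \<le> \<bar>t\<bar> \<Longrightarrow> norm (Gamma (Complex 0 t)) \<le> C * (\<bar>t\<bar> powr (0 - 1/2) * exp (- pi * \<bar>t\<bar> / 2))"
    using Gamma_line_upper[of 0] by metis
  obtain c where c: "c > 0" "\<And>\<sigma> t. r \<le> \<sigma> \<Longrightarrow> \<sigma> \<le> r \<Longrightarrow> 1 \<le> \<bar>t\<bar> \<Longrightarrow>
    c * (\<bar>t\<bar> powr (\<sigma> - 1/2) * exp (- pi * \<bar>t\<bar> / 2)) \<le> norm (Gamma (Complex \<sigma> t))"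
    using Gamma_lower_interval[of r r] by metis
  have "norm (dirichlet_series a l (Complex r t)) \<le> C * S0 / c * t powr (- r)" if t: "t \<ge> 1" for t
  proof -
    let ?e = "exp (- pi * t / 2)"
    let ?s = "Complex 0 t"
    have n: "of_real r - ?s = Complex r (- t)" by (simp add: complex_eq_iff)
    have i: "?s \<notin> \<int>\<^sub>\<le>\<^sub>0" "Complex r (- t) \<notin> \<int>\<^sub>\<le>\<^sub>0" using t by (intro not_nonpos_Int_if_Im_nonzero; simp)+
    have "X ?s = Gamma ?s * dirichlet_series a l ?s" using neg i by (intro X_right) auto
    moreover have "X ?s = Gamma (Complex r (- t)) * \<Psi> (Complex r (- t))"
      unfolding n[symmetric] using neg i r_pos by (intro X_left) (auto simp: n)
    moreover have "\<Psi> (Complex r (- t)) = cnj (dirichlet_series a l (Complex r t))"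
      using neg r_pos by (subst \<Psi>_series) (auto simp: complex_cnj)
    ultimately have eq: "norm (Gamma (Complex r (- t))) * norm (dirichlet_series a l (Complex r t)) = norm (Gamma ?s) * norm (dirichlet_series a l ?s)"
      by (metis norm_mult complex_mod_cnj)
    have "c * (t powr (r - 1/2) * ?e) * norm (dirichlet_series a l (Complex r t)) \<le> norm (Gamma (Complex r (- t))) * norm (dirichlet_series a l (Complex r t))"
      using c(2)[of r "- t"] t by (intro mult_right_mono) auto
    also have "\<dots> \<le> (C * (t powr (0 - 1/2) * ?e)) * S0"
      unfolding eq
    proof (intro mult_mono)
      show "norm (dirichlet_series a l ?s) \<le> S0"
        using norm_dirichlet_series_le[where l = l and a = a and s = ?s, OF l_pos] summable_coeff[OF neg] by (simp add: S0_def)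
    qed (use C(1) C(2)[of t] t in auto)
    finally have "(c * norm (dirichlet_series a l (Complex r t)) * t powr (r - 1/2)) * ?e \<le> (C * S0 * t powr (- 1/2)) * ?e"
      by (simp add: mult_ac)
    then have "c * norm (dirichlet_series a l (Complex r t)) * t powr (r - 1/2) \<le> C * S0 * t powr (- 1/2)"
      by (subst (asm) mult_le_cancel_right_pos) auto
    then have "c * norm (dirichlet_series a l (Complex r t)) * t powr (r - 1/2) * t powr (1/2 - r) \<le> C * S0 * t powr (- 1/2) * t powr (1/2 - r)"
      by (rule mult_right_mono) simp
    moreover have "t powr (r - 1/2) * t powr (1/2 - r) = 1" "t powr (- 1/2) * t powr (1/2 - r) = t powr (- r)"
      using t by (simp_all flip: powr_add)
    ultimately have "c * norm (dirichlet_series a l (Complex r t)) \<le> C * S0 * t powr (- r)"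
      by (simp only: mult.assoc mult_1_right)
    then show ?thesis using c(1) by (simp add: field_simps)
  qed
  then show ?thesis by blast
qed

text \<open>If \<open>sa < 0\<close>, the functional equation forces \<open>\<Phi>\<close> to decay along \<open>Re s = r\<close>, whereas the mean
  value of \<open>\<Phi> s * \<lambda> powr s\<close>, with \<open>\<lambda>\<close> the exponent of the leading term, is the leading coefficient.\<close>
lemma abscissa_nonneg: "sa \<ge> 0"
proof (rule ccontr)
  assume "\<not> sa \<ge> 0"
  then have neg: "sa < 0" by simp
  \<comment> \<open>\<open>hecke_series\<close> requires a nonnegative bound; 0 is admissible in
    place of the negative \<open>sa\<close>.\<close>
  interpret h: hecke_series a l 0
    by unfold_locales (use exponents l_0 coeff_nonzero neg in \<open>auto intro: summable_coeff\<close>)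
  define L where "L = l h.lead"
  define \<alpha> where "\<alpha> = a h.lead"
  have L: "L > 0" and \<alpha>: "\<alpha> \<noteq> 0" using h.l_lead_pos h.lead by (auto simp: L_def \<alpha>_def)
  obtain K where K: "\<And>t. t \<ge> 1 \<Longrightarrow> norm (dirichlet_series a l (Complex r t)) \<le> K * t powr (- r)"
    using dirichlet_decay_of_negative_abscissa[OF neg] by blast
  obtain c where c: "c > r" "\<And>s. Re s = c \<Longrightarrow> norm (dirichlet_series a l s * of_real L powr s - \<alpha>) \<le> norm \<alpha> / 8"
    using h.dirichlet_leading_term[of r] unfolding L_def \<alpha>_def by metis
  define W where "W = (\<lambda>s. \<Phi> s * of_real L powr s)"
  define S where "S = {s. Im s > 0}"
  define S1 where "S1 = (\<Sum>n. norm (a (Suc n)) * l (Suc n) powr (- r)) + (\<Sum>n. norm (a (Suc n)) * l (Suc n) powr (- c))"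
  define M where "M = S1 * (L powr r + L powr c)"
  have nW: "norm (W s) = norm (\<Phi> s) * L powr Re s" for s
    using L unfolding W_def norm_mult by (subst norm_powr_real_powr) auto
  \<comment> \<open>The direction in which y^\<sigma> is monotone in \<sigma> depends on whether y
    \<ge> 1, hence the sum of both end values.\<close>
  have two: "y powr \<sigma> \<le> y powr \<sigma>1 + y powr \<sigma>2" if "\<sigma>1 \<le> \<sigma>" "\<sigma> \<le> \<sigma>2" "y > 0" for y \<sigma> \<sigma>1 \<sigma>2 :: real
  proof (cases "y \<ge> 1")
    case True
    then have "y powr \<sigma> \<le> y powr \<sigma>2" using that by (intro powr_mono) auto
    then show ?thesis using powr_ge_zero[of y \<sigma>1] by linarith
  next
    case False
    then have "y powr \<sigma> \<le> y powr \<sigma>1" using that by (intro powr_mono') auto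
    then show ?thesis using powr_ge_zero[of y \<sigma>2] by linarith
  qed
  have WM: "norm (W s) \<le> M" if s: "r \<le> Re s" "Re s \<le> c" for s
  proof -
    have sm: "summable (\<lambda>n. norm (a (Suc n)) * l (Suc n) powr (- \<sigma>))" if "r \<le> \<sigma>" for \<sigma>
      using that neg r_pos by (intro summable_coeff) auto
    have "norm (dirichlet_series a l s) \<le> (\<Sum>n. norm (a (Suc n)) * l (Suc n) powr (- Re s))"
      by (rule norm_dirichlet_series_le[where l = l and a = a, OF l_pos sm[OF s(1)]])
    also have "\<dots> \<le> (\<Sum>n. norm (a (Suc n)) * l (Suc n) powr (- r) + norm (a (Suc n)) * l (Suc n) powr (- c))"
    proof (intro suminf_le sm s(1) summable_add)
      fix n
      have "l (Suc n) powr (- Re s) \<le> l (Suc n) powr (- c) + l (Suc n) powr (- r)"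
        using s l_pos[of n] by (intro two) auto
      then have "norm (a (Suc n)) * l (Suc n) powr (- Re s) \<le> norm (a (Suc n)) * (l (Suc n) powr (- c) + l (Suc n) powr (- r))"
        by (rule mult_left_mono) simp
      then show "norm (a (Suc n)) * l (Suc n) powr (- Re s) \<le> norm (a (Suc n)) * l (Suc n) powr (- r) + norm (a (Suc n)) * l (Suc n) powr (- c)"
        by (simp add: algebra_simps)
    qed (use c in auto)
    also have "\<dots> = S1" unfolding S1_def using c by (intro suminf_add[symmetric] sm) auto
    finally have "norm (\<Phi> s) \<le> S1" using s neg r_pos by (simp add: \<Phi>_series)
    moreover have "L powr Re s \<le> L powr r + L powr c" using s L by (intro two) auto
    ultimately show ?thesis unfolding nW M_def by (intro mult_mono) (auto intro: order_trans[OF norm_ge_zero])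
  qed
  have hol: "W holomorphic_on S"
  proof -
    have "\<Phi> holomorphic_on S"
      by (intro analytic_imp_holomorphic analytic_on_subset[OF \<Phi>_analytic]) (auto simp: S_def)
    then show ?thesis unfolding W_def using L by (intro holomorphic_intros) auto
  qed
  have contW: "continuous_on {T..2 * T} (\<lambda>y. W (Complex x y))" if "T \<ge> 1" for x T
    unfolding Complex_eq using that
    by (intro continuous_on_compose2[OF holomorphic_on_imp_continuous_on[OF hol]] continuous_intros) (auto simp: S_def)
  \<comment> \<open>Integration over [T, 2 T]: the mean on Re s = c is within |\<alpha>|/8 of
    \<alpha>, the shift to Re s = r costs a constant, and the result is divided by T.\<close>
  have ineq: "7 / 8 * norm \<alpha> \<le> K * L powr r * T powr (- r) + 2 * M * (c - r) / T" if T: "T \<ge> 1" for T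
  proof -
    have shift: "norm (integral {T..2 * T} (\<lambda>y. W (Complex r y)) - integral {T..2 * T} (\<lambda>y. W (Complex c y))) \<le> 2 * M * (c - r)"
      by (rule vertical_shift[OF hol]) (use T c in \<open>auto simp: S_def convex_halfspace_Im_gt open_halfspace_Im_gt intro!: WM\<close>)
    have left: "norm (integral {T..2 * T} (\<lambda>y. W (Complex r y))) \<le> K * T powr (- r) * L powr r * (2 * T - T)"
    proof (rule integral_bound)
      fix y assume y: "y \<in> {T..2 * T}"
      have "0 \<le> K * 1 powr (- r)" using order_trans[OF norm_ge_zero K[of 1]] by simp
      then have K0: "K \<ge> 0" by simp
      have "norm (dirichlet_series a l (Complex r y)) \<le> K * y powr (- r)" using y T by (intro K) auto
      also have "\<dots> \<le> K * T powr (- r)" using y T r_pos K0 by (intro mult_left_mono powr_mono2') auto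
      finally show "norm (W (Complex r y)) \<le> K * T powr (- r) * L powr r"
        unfolding nW using neg r_pos by (simp add: \<Phi>_series mult_right_mono)
    qed (use T contW in auto)
    have right: "norm (integral {T..2 * T} (\<lambda>y. W (Complex c y) - \<alpha>)) \<le> norm \<alpha> / 8 * (2 * T - T)"
    proof (rule integral_bound)
      show "norm (W (Complex c y) - \<alpha>) \<le> norm \<alpha> / 8" for y
        using c neg r_pos by (simp add: W_def \<Phi>_series)
    qed (use T in \<open>auto intro!: continuous_intros contW\<close>)
    have "integral {T..2 * T} (\<lambda>y. W (Complex c y) - \<alpha>) = integral {T..2 * T} (\<lambda>y. W (Complex c y)) - of_real T * \<alpha>"
      using T by (subst integral_diff) (auto intro!: integrable_continuous_real contW simp: scaleR_conv_of_real)
    then have "of_real T * \<alpha> = integral {T..2 * T} (\<lambda>y. W (Complex c y)) - integral {T..2 * T} (\<lambda>y. W (Complex c y) - \<alpha>)"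
      by simp
    also have "norm \<dots> \<le> norm (integral {T..2 * T} (\<lambda>y. W (Complex c y))) + norm (integral {T..2 * T} (\<lambda>y. W (Complex c y) - \<alpha>))"
      by (rule norm_triangle_ineq4)
    also have "norm (integral {T..2 * T} (\<lambda>y. W (Complex c y) - \<alpha>)) \<le> T * (norm \<alpha> / 8)" using right by (simp add: mult.commute)
    finally have "norm (of_real T * \<alpha>) \<le> norm (integral {T..2 * T} (\<lambda>y. W (Complex c y))) + T * (norm \<alpha> / 8)" by simp
    also have "norm (of_real T * \<alpha>) = T * norm \<alpha>" using T by (simp add: norm_mult)
    also have "norm (integral {T..2 * T} (\<lambda>y. W (Complex c y))) \<le> norm (integral {T..2 * T} (\<lambda>y. W (Complex r y))) + 2 * M * (c - r)"
      using shift norm_triangle_sub[of "integral {T..2 * T} (\<lambda>y. W (Complex c y))" "integral {T..2 * T} (\<lambda>y. W (Complex r y))"]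
      by (simp add: norm_minus_commute)
    finally have "T * (7 / 8 * norm \<alpha>) \<le> K * T powr (- r) * L powr r * T + 2 * M * (c - r)" using left by simp
    then show ?thesis using T by (simp add: field_simps)
  qed
  have "((\<lambda>T. K * L powr r * T powr (- r) + 2 * M * (c - r) / T) \<longlongrightarrow> K * L powr r * 0 + 0) at_top"
  proof (intro tendsto_add tendsto_mult tendsto_const)
    show "((\<lambda>T. T powr (- r)) \<longlongrightarrow> 0) at_top" using r_pos by real_asymp
    show "((\<lambda>T. 2 * M * (c - r) / T) \<longlongrightarrow> 0) at_top" by real_asymp
  qed
  then have "7 / 8 * norm \<alpha> \<le> K * L powr r * 0 + 0"
    by (rule tendsto_lowerbound) (use ineq in \<open>auto intro: eventually_mono[OF eventually_ge_at_top[of 1]]\<close>)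
  then show False using \<alpha> by simp
qed

sublocale hecke_series a l sa
  by unfold_locales (use exponents l_0 summable_coeff abscissa_nonneg coeff_nonzero in auto)

lemma modular: "theta a l (- u) = of_real (exp (r * u)) * cnj (theta a l u)"
proof (rule theta_modular[OF r_pos analytic_imp_holomorphic[OF X_analytic] X_residue_0 X_residue_r _ _ X_decay])
  fix s assume s: "Re s > max sa r"
  then have s': "s \<notin> \<int>\<^sub>\<le>\<^sub>0" and c': "cnj s \<notin> \<int>\<^sub>\<le>\<^sub>0"
    using r_pos by (intro not_nonpos_Int_if_Re_pos; simp)+
  show "X s = Gamma s * dirichlet_series a l s" using s s' by (intro X_right) auto
  have "X (of_real r - cnj s) = Gamma (of_real r - (of_real r - cnj s)) * \<Psi> (of_real r - (of_real r - cnj s))"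
    using s c' by (intro X_left) auto
  then show "X (of_real r - cnj s) = cnj (Gamma s * dirichlet_series a l s)"
    using s by (simp add: \<Psi>_series cnj_Gamma)
qed

lemma hecke_theta:
  assumes "sa < r + 1 / 2"
  shows "hecke_theta a l sa r \<Phi>"
  by unfold_locales (rule r_pos modular assms \<Phi>_analytic \<Phi>_series; assumption?)+

end

section \<open>Zeros on the critical lines\<close>

lemma dirichlet_series_cnj:
  assumes l: "\<And>n. l (Suc n) > 0" and sum: "summable (\<lambda>n. norm (dirichlet_term a l (cnj s) (Suc n)))"
  shows "dirichlet_series (\<lambda>n. cnj (a n)) l s = cnj (dirichlet_series a l (cnj s))"
proof -
  have "dirichlet_term (\<lambda>n. cnj (a n)) l s (Suc n) = cnj (dirichlet_term a l (cnj s) (Suc n))" for n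
  proof -
    have "cnj (complex_of_real (l (Suc n)) powr - cnj s) = complex_of_real (l (Suc n)) powr - s"
      using l[of n] by (subst cnj_powr) auto
    then show ?thesis by (simp add: dirichlet_term_def)
  qed
  moreover have "(\<lambda>n. cnj (dirichlet_term a l (cnj s) (Suc n))) sums cnj (dirichlet_series a l (cnj s))"
    unfolding sums_cnj dirichlet_series_def by (rule summable_sums[OF summable_norm_cancel[OF sum]])
  ultimately show ?thesis unfolding dirichlet_series_def by (simp add: sums_iff)
qed

lemma abs_conv_abscissa_cong_norm:
  assumes "\<And>n. norm (a (Suc n)) = norm (b (Suc n))" "\<And>n. l (Suc n) = m (Suc n)"
  shows "abs_conv_abscissa a l = abs_conv_abscissa b m"
  unfolding abs_conv_abscissa_def dirichlet_term_def norm_mult assms ..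

text \<open>The infimum provides a smaller exponent with convergence; the comparison is only
  eventual, since the first few \<open>l n\<close> may be below 1.\<close>

lemma summable_above_abscissa:
  assumes l: "hecke_exponents l" and \<sigma>: "abs_conv_abscissa a l < ereal \<sigma>"
  shows "summable (\<lambda>n. norm (a (Suc n)) * l (Suc n) powr (- \<sigma>))"
proof -
  have lpos: "l (Suc n) > 0" for n using l by (simp add: hecke_exponents_def)
  obtain \<sigma>' where \<sigma>': "\<sigma>' < \<sigma>" "summable (\<lambda>n. norm (dirichlet_term a l (of_real \<sigma>') (Suc n)))"
    using \<sigma> unfolding abs_conv_abscissa_def Inf_less_iff by auto
  have sum: "summable (\<lambda>n. norm (a (Suc n)) * l (Suc n) powr (- \<sigma>'))"
    using \<sigma>'(2) by (simp add: norm_dirichlet_term lpos)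
  have "filterlim (\<lambda>n. l (Suc n)) at_top sequentially"
    using l by (simp add: hecke_exponents_def filterlim_sequentially_Suc)
  then have "\<forall>\<^sub>F n in sequentially. 1 \<le> l (Suc n)" by (simp add: filterlim_at_top)
  then have "\<forall>\<^sub>F n in sequentially. norm (norm (a (Suc n)) * l (Suc n) powr (- \<sigma>)) \<le> norm (a (Suc n)) * l (Suc n) powr (- \<sigma>')"
    by eventually_elim (use \<sigma>'(1) in \<open>auto intro!: mult_left_mono powr_mono\<close>)
  then show ?thesis using sum by (rule summable_comparison_test_ev)
qed

section \<open>Negative heights and the conjugate coefficients\<close>

lemma (in hecke_series) theta_cnj: "theta (\<lambda>n. cnj (a n)) l u = cnj (theta a l u)"
proof -
  have "(\<lambda>n. cnj (a n * of_real (exp (- l n * exp u)))) sums cnj (theta a l u)"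
    unfolding sums_cnj theta_def by (rule summable_sums[OF summable_norm_cancel[OF theta_summable_norm]])
  then show ?thesis unfolding theta_def[of "\<lambda>n. cnj (a n)"] by (simp add: sums_iff)
qed

context hecke_theta
begin

text \<open>The Epstein zeta function of the conjugate coefficients at height t is the conjugate of
  the original one at height -t; so with this symmetry of the hypotheses, bounds for t \<rightarrow>
  \<infinity> cover t \<rightarrow> -\<infinity> too.\<close>

lemma hecke_theta_cnj: "hecke_theta (\<lambda>n. cnj (a n)) l sa r (\<lambda>s. cnj (\<Phi> (cnj s)))"
proof unfold_locales
  show "hecke_exponents l" by (rule exponents)
  show "l 0 = 0" by (rule l_0)
  show "summable (\<lambda>n. norm (cnj (a (Suc n))) * l (Suc n) powr (- \<sigma>))" if "\<sigma> > sa" for \<sigma>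
    using summable_coeff[OF that] by simp
  show "sa \<ge> 0" by (rule sa_nonneg)
  show "\<exists>n\<ge>1. cnj (a n) \<noteq> 0" using coeff_nonzero by simp
  show "r > 0" by (rule r_pos)
  show "sa < r + 1 / 2" by (rule sa_lt)
  show "theta (\<lambda>n. cnj (a n)) l (- u) = of_real (exp (r * u)) * cnj (theta (\<lambda>n. cnj (a n)) l u)" for u
    unfolding theta_cnj modular[of u] by simp
  have opn: "open (- {complex_of_real r})" by auto
  have "cnj ` (- {complex_of_real r}) \<subseteq> - {complex_of_real r}" by (auto simp: complex_eq_iff)
  then have "\<Phi> holomorphic_on cnj ` (- {complex_of_real r})"
    using \<Phi>_analytic by (blast intro: analytic_imp_holomorphic analytic_on_subset)
  then have "(cnj \<circ> \<Phi> \<circ> cnj) holomorphic_on - {of_real r}"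
    using opn by (rule holomorphic_on_compose_cnj_cnj)
  then show "(\<lambda>s. cnj (\<Phi> (cnj s))) analytic_on - {of_real r}"
    using opn by (simp add: analytic_on_open o_def)
  show "cnj (\<Phi> (cnj s)) = dirichlet_series (\<lambda>n. cnj (a n)) l s" if "Re s > sa" for s
    using that dirichlet_series_cnj[OF l_Suc_pos dirichlet_summable_norm, of s] by (simp add: \<Phi>_series)
qed

lemma epstein_zeta_cnj:
  assumes absc: "abs_conv_abscissa a l = ereal sa" and s: "s \<noteq> 0" "s \<noteq> of_real (2 ^ k * r)"
  shows "epstein_zeta (2 ^ k) (\<lambda>n. cnj (a n)) l s = cnj (epstein_zeta (2 ^ k) a l (cnj s))"
proof -
  interpret c: hecke_theta "\<lambda>n. cnj (a n)" l sa r "\<lambda>s. cnj (\<Phi> (cnj s))" by (rule hecke_theta_cnj)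
  interpret t: theta_fun "\<lambda>u. theta a l u ^ (2 ^ k)" "2 ^ k * r" "a 0 ^ (2 ^ k)" by (rule theta_fun_power)
  have absc': "abs_conv_abscissa (\<lambda>n. cnj (a n)) l = ereal sa"
    unfolding absc[symmetric] by (rule abs_conv_abscissa_cong_norm) simp_all
  have cs: "cnj s \<noteq> 0" "cnj s \<noteq> of_real (2 ^ k * r)"
    using s by (auto simp: complex_eq_iff)
  have "c.chi k s = cnj (chi k (cnj s))"
    using t.completed_cnj[of s] by (simp add: theta_cnj)
  then show ?thesis
    unfolding c.epstein_zeta_eq[OF absc' s] epstein_zeta_eq[OF absc cs] by (simp add: cnj_rGamma)
qed

lemma epstein_zeta_lower_two_sided:
  assumes absc: "abs_conv_abscissa a l = ereal sa"
    and fin: "finite {s. Re s = r / 2 \<and> \<Phi> s = 0}"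
  shows "\<exists>c>0. \<exists>T. \<forall>t. T \<le> \<bar>t\<bar> \<longrightarrow> c * \<bar>t\<bar> powr (2 ^ k - 1/2) \<le> norm (epstein_zeta (2 ^ (k + 1)) a l (Complex (2 ^ k * r) t))"
proof -
  let ?Z = "\<lambda>t. epstein_zeta (2 ^ (k + 1)) a l (Complex (2 ^ k * r) t)"
  interpret c: hecke_theta "\<lambda>n. cnj (a n)" l sa r "\<lambda>s. cnj (\<Phi> (cnj s))" by (rule hecke_theta_cnj)
  have absc': "abs_conv_abscissa (\<lambda>n. cnj (a n)) l = ereal sa"
    unfolding absc[symmetric] by (rule abs_conv_abscissa_cong_norm) simp_all
  have "{s. Re s = r / 2 \<and> cnj (\<Phi> (cnj s)) = 0} \<subseteq> cnj ` {s. Re s = r / 2 \<and> \<Phi> s = 0}"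
  proof
    fix s assume "s \<in> {s. Re s = r / 2 \<and> cnj (\<Phi> (cnj s)) = 0}"
    then have "cnj s \<in> {s. Re s = r / 2 \<and> \<Phi> s = 0}" by simp
    then show "s \<in> cnj ` {s. Re s = r / 2 \<and> \<Phi> s = 0}" by (rule rev_image_eqI) simp
  qed
  then have fin': "finite {s. Re s = r / 2 \<and> cnj (\<Phi> (cnj s)) = 0}"
    by (rule finite_subset) (use fin in simp)
  obtain c1 T1 where 1: "c1 > 0" "\<And>t. t \<ge> T1 \<Longrightarrow> c1 * t powr (2 ^ k - 1/2) \<le> norm (?Z t)"
    using epstein_zeta_lower[OF absc fin, of k] by blast
  obtain c2 T2 where 2: "c2 > 0" "\<And>t. t \<ge> T2 \<Longrightarrow> c2 * t powr (2 ^ k - 1/2)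
      \<le> norm (epstein_zeta (2 ^ (k + 1)) (\<lambda>n. cnj (a n)) l (Complex (2 ^ k * r) t))"
    using c.epstein_zeta_lower[OF absc' fin', of k] by blast
  have "min c1 c2 * \<bar>t\<bar> powr (2 ^ k - 1/2) \<le> norm (?Z t)" if t: "max (max T1 T2) 1 \<le> \<bar>t\<bar>" for t
  proof (cases "t \<ge> 0")
    case True
    have "min c1 c2 * \<bar>t\<bar> powr (2 ^ k - 1/2) \<le> c1 * \<bar>t\<bar> powr (2 ^ k - 1/2)" by (intro mult_right_mono) auto
    also have "\<dots> \<le> norm (?Z t)" using 1(2)[of t] t True by simp
    finally show ?thesis .
  next
    case False
    have ne: "Complex (2 ^ k * r) (- t) \<noteq> 0" "Complex (2 ^ k * r) (- t) \<noteq> of_real (2 ^ (k + 1) * r)"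
      using False by (auto simp: complex_eq_iff)
    have "min c1 c2 * \<bar>t\<bar> powr (2 ^ k - 1/2) \<le> c2 * \<bar>t\<bar> powr (2 ^ k - 1/2)" by (intro mult_right_mono) auto
    also have "\<dots> \<le> norm (epstein_zeta (2 ^ (k + 1)) (\<lambda>n. cnj (a n)) l (Complex (2 ^ k * r) (- t)))"
      using 2(2)[of "- t"] t False by simp
    also have "\<dots> = norm (?Z t)" unfolding epstein_zeta_cnj[OF absc ne] by (simp add: complex_cnj)
    finally show ?thesis .
  qed
  then show ?thesis using 1(1) 2(1) by (intro exI[of _ "min c1 c2"] conjI exI[of _ "max (max T1 T2) 1"]) auto
qed

text \<open>The lower bound confines the zeros to a bounded segment of the line. Infinitely many
  would accumulate there, and the identity theorem off the possible poles would make the function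
  vanish at a height where it cannot.\<close>

lemma finite_zeros_epstein_zeta:
  assumes absc: "abs_conv_abscissa a l = ereal sa"
    and fin: "finite {s. Re s = r / 2 \<and> \<Phi> s = 0}"
  shows "finite {s. Re s = 2 ^ k * r \<and> epstein_zeta (2 ^ (k + 1)) a l s = 0}" (is "finite ?Zs")
proof (rule ccontr)
  assume inf: "infinite ?Zs"
  obtain c T where c: "c > 0" "\<And>t. T \<le> \<bar>t\<bar> \<Longrightarrow> c * \<bar>t\<bar> powr (2 ^ k - 1/2) \<le> norm (epstein_zeta (2 ^ (k + 1)) a l (Complex (2 ^ k * r) t))"
    using epstein_zeta_lower_two_sided[OF absc fin, of k] by blast
  define T' where "T' = max T 1"
  have nz: "epstein_zeta (2 ^ (k + 1)) a l (Complex (2 ^ k * r) t) \<noteq> 0" if "T' \<le> \<bar>t\<bar>" for t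
  proof -
    have "0 < c * \<bar>t\<bar> powr (2 ^ k - 1/2)" using c(1) that by (auto simp: T'_def)
    also have "\<dots> \<le> norm (epstein_zeta (2 ^ (k + 1)) a l (Complex (2 ^ k * r) t))" using that by (intro c) (simp add: T'_def)
    finally show ?thesis by auto
  qed
  have R: "2 ^ k * r > 0" using r_pos by simp
  have sub: "?Zs \<subseteq> cbox (Complex (2 ^ k * r) (- T')) (Complex (2 ^ k * r) T')"
  proof
    fix s assume "s \<in> ?Zs"
    then have s: "Re s = 2 ^ k * r" "epstein_zeta (2 ^ (k + 1)) a l s = 0" by auto
    have "Complex (2 ^ k * r) (Im s) = s" using s(1) by (simp add: complex_eq_iff)
    then have "\<not> T' \<le> \<bar>Im s\<bar>" using nz[of "Im s"] s(2) by auto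
    then show "s \<in> cbox (Complex (2 ^ k * r) (- T')) (Complex (2 ^ k * r) T')"
      using s(1) by (auto simp: in_cbox_complex_iff)
  qed
  obtain \<xi> where \<xi>: "\<xi> \<in> cbox (Complex (2 ^ k * r) (- T')) (Complex (2 ^ k * r) T')" "\<xi> islimpt ?Zs"
    using compact_cbox inf sub unfolding compact_eq_Bolzano_Weierstrass by blast
  \<comment> \<open>Only 0 and 2^(k+1) r are left out; the line Re s = 2^k r runs strictly between
    them, so the zeros and their accumulation point stay in \<open>S\<close>.\<close>
  define S where "S = - {0, complex_of_real (2 ^ (k + 1) * r)}"
  have Re_S: "s \<in> S" if "Re s = 2 ^ k * r" for s using that R r_pos by (auto simp: S_def)
  have "(\<lambda>s. rGamma s * chi (Suc k) s) analytic_on S"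
    by (intro analytic_on_mult analytic_rGamma chi_analytic) (auto simp: S_def)
  then have hol: "(\<lambda>s. rGamma s * chi (Suc k) s) holomorphic_on S" by (rule analytic_imp_holomorphic)
  have opn: "open S" unfolding S_def by (intro open_Compl finite_imp_closed) auto
  have con: "connected S" unfolding S_def Compl_eq_Diff_UNIV by (intro connected_open_diff_countable) auto
  have Z: "epstein_zeta (2 ^ (k + 1)) a l s = rGamma s * chi (Suc k) s" if "s \<in> S" for s
    using epstein_zeta_eq[OF absc, of s "Suc k"] that by (simp add: S_def)
  define w where "w = Complex (2 ^ k * r) T'"
  have "w \<in> S" by (rule Re_S) (simp add: w_def)
  have "rGamma w * chi (Suc k) w = 0"
  proof (rule analytic_continuation[OF hol opn con _ _ \<xi>(2) _ \<open>w \<in> S\<close>])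
    show "?Zs \<subseteq> S" using Re_S by auto
    show "\<xi> \<in> S" using \<xi>(1) by (intro Re_S) (auto simp: in_cbox_complex_iff)
    show "rGamma s * chi (Suc k) s = 0" if "s \<in> ?Zs" for s using that Z[OF Re_S] by auto
  qed
  then have "epstein_zeta (2 ^ (k + 1)) a l w = 0" using Z[OF \<open>w \<in> S\<close>] by simp
  then show False using nz[of T'] by (simp add: w_def T'_def)
qed

lemma epstein_zeta_not_smallo:
  assumes absc: "abs_conv_abscissa a l = ereal sa"
    and fin: "finite {s. Re s = r / 2 \<and> \<Phi> s = 0}"
  shows "(\<lambda>t::real. epstein_zeta (2 ^ (k + 1)) a l (Complex (2 ^ k * r) t))
    \<notin> o[at_infinity](\<lambda>t. complex_of_real (\<bar>t\<bar> powr (2 ^ k - 1 / 2)))"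
proof
  assume o: "(\<lambda>t::real. epstein_zeta (2 ^ (k + 1)) a l (Complex (2 ^ k * r) t))
    \<in> o[at_infinity](\<lambda>t. complex_of_real (\<bar>t\<bar> powr (2 ^ k - 1 / 2)))"
  obtain c T where c: "c > 0" "\<And>t. T \<le> \<bar>t\<bar> \<Longrightarrow> c * \<bar>t\<bar> powr (2 ^ k - 1/2) \<le> norm (epstein_zeta (2 ^ (k + 1)) a l (Complex (2 ^ k * r) t))"
    using epstein_zeta_lower_two_sided[OF absc fin, of k] by blast
  have "\<forall>\<^sub>F t::real in at_infinity. norm (epstein_zeta (2 ^ (k + 1)) a l (Complex (2 ^ k * r) t))
    \<le> c / 2 * norm (complex_of_real (\<bar>t\<bar> powr (2 ^ k - 1 / 2)))"
    using landau_o.smallD[OF o, of "c / 2"] c(1) by simp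
  then obtain B where B: "\<And>t::real. B \<le> norm t \<Longrightarrow> norm (epstein_zeta (2 ^ (k + 1)) a l (Complex (2 ^ k * r) t))
    \<le> c / 2 * norm (complex_of_real (\<bar>t\<bar> powr (2 ^ k - 1 / 2)))"
    unfolding eventually_at_infinity by blast
  define t where "t = max (max T B) 1"
  have t: "t \<ge> 1" "T \<le> \<bar>t\<bar>" "B \<le> norm t" by (auto simp: t_def)
  have pos: "\<bar>t\<bar> powr (2 ^ k - 1/2) > 0" using t by simp
  have "c * \<bar>t\<bar> powr (2 ^ k - 1/2) \<le> c / 2 * \<bar>t\<bar> powr (2 ^ k - 1/2)"
    using c(2)[OF t(2)] B[OF t(3)] by simp
  then show False using pos c(1) by simp
qed

end

lemma class_A_imp_hecke_theta:
  assumes A: "class_A r a l b m \<Phi> \<Psi>"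
    and b: "\<And>n. n \<ge> 1 \<Longrightarrow> b n = cnj (a n)" and m: "\<And>n. n \<ge> 1 \<Longrightarrow> l n = m n"
    and sa: "abs_conv_abscissa a l = ereal sa" "sa < r + 1 / 2"
  shows "hecke_theta a l sa r \<Phi>"
proof -
  have hp: "hecke_pair r a l b m"
    and \<Phi>: "continuation_simple_pole r a l \<Phi>" and \<Psi>: "continuation_simple_pole r b m \<Psi>"
    and a0: "a 0 = - \<Phi> 0" and l0: "l 0 = 0"
    using A by (auto simp: class_A_def)
  have l: "hecke_exponents l" and r: "r > 0" and nz: "\<exists>n\<ge>1. a n \<noteq> 0"
    using hp by (auto simp: hecke_pair_def)
  have lpos: "l (Suc n) > 0" for n using l by (simp add: hecke_exponents_def)
  have sb: "abs_conv_abscissa b m = ereal sa"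
    unfolding sa(1)[symmetric] by (rule abs_conv_abscissa_cong_norm) (simp_all add: b m)
  have ds: "dirichlet_series b m s = dirichlet_series (\<lambda>n. cnj (a n)) l s" for s
    unfolding dirichlet_series_def dirichlet_term_def by (simp add: b m)
  have sum: "summable (\<lambda>n. norm (a (Suc n)) * l (Suc n) powr (- \<sigma>))" if "\<sigma> > sa" for \<sigma>
    using that by (intro summable_above_abscissa l) (simp add: sa)
  have dc: "dirichlet_series b m s = cnj (dirichlet_series a l (cnj s))" if "Re s > sa" for s
    unfolding ds using sum[OF that] by (intro dirichlet_series_cnj lpos) (simp add: norm_dirichlet_term lpos)
  obtain X where X: "X nicely_meromorphic_on UNIV"
      "\<And>s. ereal (Re s) > abs_conv_abscissa a l \<Longrightarrow> s \<notin> \<int>\<^sub>\<le>\<^sub>0 \<Longrightarrow> X s = Gamma s * dirichlet_series a l s"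
      "\<And>s. ereal (Re s) < ereal r - abs_conv_abscissa b m \<Longrightarrow> of_real r - s \<notin> \<int>\<^sub>\<le>\<^sub>0 \<Longrightarrow>
         X s = Gamma (of_real r - s) * dirichlet_series b m (of_real r - s)"
      "\<And>\<sigma>1 \<sigma>2. uniform_limit {\<sigma>1..\<sigma>2} (\<lambda>t \<sigma>. X (Complex \<sigma> t)) (\<lambda>_. 0) at_infinity"
    using hp unfolding hecke_pair_def by blast
  interpret conjugate_hecke_pair a l sa r \<Phi> \<Psi> X
  proof unfold_locales
    show "\<Phi> meromorphic_on UNIV" "\<Psi> meromorphic_on UNIV"
      using \<Phi> \<Psi> by (auto simp: continuation_simple_pole_def nicely_meromorphic_on_def)
    show "\<Phi> analytic_on - {of_real r}" "\<Psi> analytic_on - {of_real r}"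
      using \<Phi> \<Psi> by (auto simp: continuation_simple_pole_def)
    show "\<Phi> s = dirichlet_series a l s" if "Re s > sa" for s
      using \<Phi> that by (auto simp: continuation_simple_pole_def sa)
    have \<Psi>': "\<Psi> s = dirichlet_series b m s" if "Re s > sa" for s
      using \<Psi> that by (auto simp: continuation_simple_pole_def sb)
    then show "\<Psi> s = cnj (dirichlet_series a l (cnj s))" if "Re s > sa" for s
      using dc that by simp
    show "X s = Gamma s * dirichlet_series a l s" if "Re s > sa" "s \<notin> \<int>\<^sub>\<le>\<^sub>0" for s
      using that by (intro X(2)) (simp_all add: sa)
    show "X s = Gamma (of_real r - s) * \<Psi> (of_real r - s)" if "Re s < r - sa" "of_real r - s \<notin> \<int>\<^sub>\<le>\<^sub>0" for s
      using that by (subst X(3)) (simp_all add: sb \<Psi>')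
  qed (use l l0 nz r a0 X sum in auto)
  show ?thesis by (rule hecke_theta[OF sa(2)])
qed

theorem theorem4p1:
  fixes r :: real
    and a b :: "nat \<Rightarrow> complex"
    and l m :: "nat \<Rightarrow> real"
    and \<Phi> \<Psi> :: "complex \<Rightarrow> complex"
  assumes "class_A r a l b m \<Phi> \<Psi>"
    and "\<And>n. n \<ge> 1 \<Longrightarrow> b n = cnj (a n)"
    and "\<And>n. n \<ge> 1 \<Longrightarrow> l n = m n"
    and "(abs_conv_abscissa a l < ereal (min 1 r + max 1 r / 2) \<and>
          (\<exists>k::nat. infinite {s. Re s = 2 ^ k * r \<and> epstein_zeta (2 ^ (k + 1)) a l s = 0})) \<or>
         (abs_conv_abscissa a l < ereal (min 1 r + max 1 r / 2) \<and>
          (\<exists>k::nat. (\<lambda>t::real. epstein_zeta (2 ^ (k + 1)) a l (Complex (2 ^ k * r) t))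
             \<in> o[at_infinity](\<lambda>t. complex_of_real (\<bar>t\<bar> powr (2 ^ k - 1 / 2)))))"
  shows "infinite {s. Re s = r / 2 \<and> \<Phi> s = 0}"
proof
  assume fin: "finite {s. Re s = r / 2 \<and> \<Phi> s = 0}"
  have "\<bar>abs_conv_abscissa a l\<bar> \<noteq> \<infinity>" using assms(1) by (simp add: class_A_def hecke_pair_def)
  then obtain sa where sa: "abs_conv_abscissa a l = ereal sa" by (cases "abs_conv_abscissa a l") auto
  have "sa < min 1 r + max 1 r / 2" using assms(4) by (auto simp: sa)
  \<comment> \<open>The left side equals r + 1/2 for r \<le> 1, and it is 1 + r/2 \<le> r + 1/2 for
    r \<ge> 1.\<close>
  also have "\<dots> \<le> r + 1 / 2" by (auto simp: min_def max_def)
  finally have lt: "sa < r + 1 / 2" .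
  interpret hecke_theta a l sa r \<Phi>
    using assms(2,3) by (intro class_A_imp_hecke_theta[OF assms(1) _ _ sa lt]) auto
  show False using assms(4) finite_zeros_epstein_zeta[OF sa fin] epstein_zeta_not_smallo[OF sa fin] by blast
qed

end
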